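(* Let $T_k$ be the $k$-regular tree with $k\geq 3$ and let $G$ be a connected, locally finite, quasi-transitive graph. Then $p_c(T_k\times G)<p_u(T_k\times G)$.
   Context: $T_k\times G$ denotes the Cartesian (box) product of graphs. A graph is quasi-transitive if its automorphism group acts on its vertex set with only finitely many orbits. For a connected, locally finite, infinite graph $H$ and $p\in[0,1]$, $H[p]$ denotes the random subgraph obtained by Bernoulli bond percolation: each edge is independently retained with probability $p$ and deleted otherwise. Clusters are the connected components of $H[p]$. $p_c(H)=\inf\{p: H[p]$ contains an infinite cluster almost surely$\}$ and $p_u(H)=\inf\{p: H[p]$ contains a unique infinite cluster almost surely$\}$. *)

theory Defs
  imports "HOL-Probability.Probability"
begin

section \<open>Simple undirected graphs\<close>

record 'a graph =
  verts :: "'a set"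
  edges :: "'a set set"

definition simple_graph :: "'a graph \<Rightarrow> bool" where
  "simple_graph G \<longleftrightarrow>
     (\<forall>e\<in>edges G. \<exists>u\<in>verts G. \<exists>v\<in>verts G. u \<noteq> v \<and> e = {u, v})"

definition adj :: "'a graph \<Rightarrow> 'a \<Rightarrow> 'a \<Rightarrow> bool" where
  "adj G u v \<longleftrightarrow> {u, v} \<in> edges G"

definition neighbours :: "'a graph \<Rightarrow> 'a \<Rightarrow> 'a set" where
  "neighbours G v = {u. adj G v u}"

definition locally_finite :: "'a graph \<Rightarrow> bool" where
  "locally_finite G \<longleftrightarrow> (\<forall>v\<in>verts G. finite (neighbours G v))"

definition regular :: "nat \<Rightarrow> 'a graph \<Rightarrow> bool" where
  "regular k G \<longleftrightarrow>
     (\<forall>v\<in>verts G. finite (neighbours G v) \<and> card (neighbours G v) = k)"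

definition component_of :: "'a graph \<Rightarrow> 'a \<Rightarrow> 'a set" where
  "component_of G v = {u. (adj G)\<^sup>*\<^sup>* v u}"

definition graph_components :: "'a graph \<Rightarrow> 'a set set" where
  "graph_components G = component_of G ` verts G"

text \<open>The graph without vertices does not count as connected.\<close>

definition connected_graph :: "'a graph \<Rightarrow> bool" where
  "connected_graph G \<longleftrightarrow>
     verts G \<noteq> {} \<and> (\<forall>u\<in>verts G. \<forall>v\<in>verts G. (adj G)\<^sup>*\<^sup>* u v)"

definition is_cycle :: "'a graph \<Rightarrow> 'a list \<Rightarrow> bool" where
  "is_cycle G vs \<longleftrightarrow> 3 \<le> length vs \<and> distinct vs \<and>
     (\<forall>i<length vs. adj G (vs ! i) (vs ! (Suc i mod length vs)))"

definition is_tree :: "'a graph \<Rightarrow> bool" where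
  "is_tree G \<longleftrightarrow> simple_graph G \<and> connected_graph G \<and> (\<nexists>vs. is_cycle G vs)"

text \<open>The \<open>k\<close>-regular tree is determined only up to isomorphism; this predicate
  holds of each of its copies.\<close>

definition is_regular_tree :: "nat \<Rightarrow> 'a graph \<Rightarrow> bool" where
  "is_regular_tree k T \<longleftrightarrow> is_tree T \<and> regular k T"

text \<open>An automorphism is represented by any function on the whole type that restricts
  to one on the vertex set; its values elsewhere do not affect orbits of vertices.\<close>

definition is_automorphism :: "'a graph \<Rightarrow> ('a \<Rightarrow> 'a) \<Rightarrow> bool" where
  "is_automorphism G \<phi> \<longleftrightarrow> bij_betw \<phi> (verts G) (verts G) \<and>
     (\<forall>u\<in>verts G. \<forall>v\<in>verts G. adj G (\<phi> u) (\<phi> v) \<longleftrightarrow> adj G u v)"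

definition vertex_orbit :: "'a graph \<Rightarrow> 'a \<Rightarrow> 'a set" where
  "vertex_orbit G v = {\<phi> v | \<phi>. is_automorphism G \<phi>}"

definition quasi_transitive :: "'a graph \<Rightarrow> bool" where
  "quasi_transitive G \<longleftrightarrow> finite (vertex_orbit G ` verts G)"

definition box_product :: "'a graph \<Rightarrow> 'b graph \<Rightarrow> ('a \<times> 'b) graph" where
  "box_product G H =
     \<lparr>verts = verts G \<times> verts H,
      edges = {{(u, x), (v, x)} | u v x. adj G u v \<and> x \<in> verts H} \<union>
              {{(u, x), (u, y)} | u x y. u \<in> verts G \<and> adj H x y}\<rparr>"


section \<open>Bernoulli bond percolation\<close>

text \<open>A configuration maps each edge to \<open>True\<close> (retained) or \<open>False\<close> (deleted).
  \<^const>\<open>bernoulli_pmf\<close> has success probability \<open>p\<close> only for \<open>p\<close> in the unit interval.\<close>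

definition percolation :: "'a graph \<Rightarrow> real \<Rightarrow> ('a set \<Rightarrow> bool) measure" where
  "percolation H p = (\<Pi>\<^sub>M e\<in>edges H. measure_pmf (bernoulli_pmf p))"

definition retained_subgraph :: "'a graph \<Rightarrow> ('a set \<Rightarrow> bool) \<Rightarrow> 'a graph" where
  "retained_subgraph H \<omega> = \<lparr>verts = verts H, edges = {e \<in> edges H. \<omega> e}\<rparr>"

definition infinite_clusters :: "'a graph \<Rightarrow> ('a set \<Rightarrow> bool) \<Rightarrow> 'a set set" where
  "infinite_clusters H \<omega> = {C \<in> graph_components (retained_subgraph H \<omega>). infinite C}"

text \<open>For connected infinite \<open>H\<close> both sets below contain \<open>p = 1\<close>, so that the infima
  are taken over nonempty bounded sets.\<close>

definition p_c :: "'a graph \<Rightarrow> real" where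
  "p_c H = Inf {p \<in> {0..1}. AE \<omega> in percolation H p. \<exists>C. C \<in> infinite_clusters H \<omega>}"

definition p_u :: "'a graph \<Rightarrow> real" where
  "p_u H = Inf {p \<in> {0..1}. AE \<omega> in percolation H p. \<exists>!C. C \<in> infinite_clusters H \<omega>}"

end

theory Submission
  imports Defs
begin

text \<open>Write \<open>H\<close> for the product and \<open>d = k - 1\<close>. The argument of Duminil-Copin and Tassion gives a
  threshold \<open>p_chi\<close> below which the susceptibility of \<open>H\<close> is finite and above which, by the
  zero-one law, there are infinite clusters, so that \<open>p_c H \<le> p_chi\<close>. Below \<open>p_chi\<close>, homogeneity of
  the tree forces the expected number of points of the fibre over a vertex at distance \<open>n\<close> that are
  joined to a given point to be at most a constant times \<open>d ^ - n\<close>; the heart of the proof is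
  that the constant \<open>DD p\<close> stays bounded as \<open>p\<close> increases to \<open>p_chi\<close>. A cluster that meets a fibre in
  a large set keeps a comparable size for many further steps along a line (coasting), hence hitting
  probabilities control the moments of order \<open>a < 1\<close> uniformly in \<open>p\<close>; interpolation with the second
  moment, which is at most a power of \<open>DD p\<close> times \<open>d ^ - m\<close>, followed by a decomposition of
  paths along a ray yields a self-improving inequality for \<open>DD p\<close>.

  The bound therefore persists at \<open>p_chi\<close>. With vertices weighted by \<open>d powr (- dist / 2)\<close>, Simon's
  inequality turns it into a condition on finite balls, which by continuity survives at some
  \<open>p1 > p_chi\<close> and makes the two-point function along a fibre decay exponentially in the tree distance.
  If the infinite cluster were unique at some \<open>p \<le> p1\<close>, Harris' inequality and the transitivity of
  the tree would bound this two-point function from below, so \<open>p1 \<le> p_u H\<close>.\<close>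

section \<open>Harris and van den Berg--Kesten inequalities\<close>

text \<open>All estimates are made for finite edge sets and hold uniformly in them, so that
  expectations are polynomials in \<open>p\<close>; the infinite percolation measure enters only in
  the last section. The obstacle is uniformity in \<open>p\<close>: below the threshold, finite
  susceptibility gives some constant in front of \<open>d ^ - n\<close>, but a priori it explodes at
  \<open>p_chi\<close>. The remedy is a quantity that does not depend on \<open>p\<close>: the best
  exponential rate \<beta> that all subcritical \<open>p\<close> share. Supermultiplicativity bounds
  hitting probabilities by \<open>\<beta> ^ n\<close> with no prefactor but a power of
  \<open>1 / p\<close>, whereas means are almost as large as \<open>\<beta> ^ n\<close> at suitable
  \<open>p\<close>. Coasting over \<open>n\<close> steps therefore loses a factor only slightly
  worse than \<open>\<beta> ^ n\<close>, just enough to sum the moments of any order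
  \<open>a < 1\<close>. The order is then taken so close to 1 that the self-improving inequality
  becomes \<open>DD p \<le> const * sqrt (DD p)\<close>. There is room above \<open>p_chi\<close>
  because fibre sums of order \<open>d ^ - n\<close> are tested against the much larger weights
  \<open>d powr (- n / 2)\<close>; the gap leaves convergent geometric series in every direction of
  the tree.\<close>

definition Exp :: "real \<Rightarrow> 'e set \<Rightarrow> ('e set \<Rightarrow> real) \<Rightarrow> real" where
  "Exp p F f = (\<Sum>U\<in>Pow F. p ^ card U * (1 - p) ^ card (F - U) * f U)"

definition Pr :: "real \<Rightarrow> 'e set \<Rightarrow> ('e set \<Rightarrow> bool) \<Rightarrow> real" where
  "Pr p F A = Exp p F (\<lambda>U. of_bool (A U))"

lemma Exp_empty [simp]: "Exp p {} f = f {}"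
  by (simp add: Exp_def)

text \<open>Conditioning on the state of \<open>e\<close>. Most inductions over edge sets below run
  through this identity and so reduce to a one-edge computation.\<close>

lemma Exp_insert:
  assumes "finite F" "e \<notin> F"
  shows "Exp p (insert e F) f = (1 - p) * Exp p F f + p * Exp p F (\<lambda>U. f (insert e U))"
proof -
  have d: "Pow F \<inter> insert e ` Pow F = {}" using assms by auto
  have inj: "inj_on (insert e) (Pow F)" using assms by (auto simp: inj_on_def)
  have 1: "p ^ card U * (1 - p) ^ card (insert e F - U) * f U
      = (1 - p) * (p ^ card U * (1 - p) ^ card (F - U) * f U)" if "U \<in> Pow F" for U
  proof -
    have "insert e F - U = insert e (F - U)" using that assms by auto
    then show ?thesis using assms by simp
  qed
  have 2: "p ^ card (insert e U) * (1 - p) ^ card (insert e F - insert e U) * f (insert e U)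
      = p * (p ^ card U * (1 - p) ^ card (F - U) * f (insert e U))" if "U \<in> Pow F" for U
  proof -
    have "insert e F - insert e U = F - U" using that assms by auto
    moreover have "finite U" "e \<notin> U" using that assms finite_subset by auto
    ultimately show ?thesis by simp
  qed
  have "Exp p (insert e F) f = (\<Sum>U\<in>Pow F. p ^ card U * (1 - p) ^ card (insert e F - U) * f U)
     + (\<Sum>U\<in>insert e ` Pow F. p ^ card U * (1 - p) ^ card (insert e F - U) * f U)"
    unfolding Exp_def Pow_insert using d assms by (subst sum.union_disjoint) auto
  also have "(\<Sum>U\<in>insert e ` Pow F. p ^ card U * (1 - p) ^ card (insert e F - U) * f U)
     = (\<Sum>U\<in>Pow F. p ^ card (insert e U) * (1 - p) ^ card (insert e F - insert e U) * f (insert e U))"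
    using inj by (subst sum.reindex) auto
  finally have "Exp p (insert e F) f
     = (\<Sum>U\<in>Pow F. (1 - p) * (p ^ card U * (1 - p) ^ card (F - U) * f U))
     + (\<Sum>U\<in>Pow F. p * (p ^ card U * (1 - p) ^ card (F - U) * f (insert e U)))"
    by (simp only: sum.cong[OF refl 1] sum.cong[OF refl 2])
  then show ?thesis unfolding Exp_def sum_distrib_left .
qed

lemma Exp_cong: "(\<And>U. U \<subseteq> F \<Longrightarrow> f U = g U) \<Longrightarrow> Exp p F f = Exp p F g"
  unfolding Exp_def by (rule sum.cong) auto

lemma Exp_add: "Exp p F (\<lambda>U. f U + g U) = Exp p F f + Exp p F g"
  unfolding Exp_def by (simp add: algebra_simps sum.distrib)

lemma Exp_diff: "Exp p F (\<lambda>U. f U - g U) = Exp p F f - Exp p F g"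
  unfolding Exp_def by (simp add: algebra_simps sum_subtractf)

lemma Exp_cmult: "Exp p F (\<lambda>U. c * f U) = c * Exp p F f"
  unfolding Exp_def sum_distrib_left by (rule sum.cong) auto

lemma Exp_multc: "Exp p F (\<lambda>U. f U * c) = Exp p F f * c"
  using Exp_cmult[of p F c f] by (simp add: mult.commute)

lemma Exp_sum: "Exp p F (\<lambda>U. \<Sum>i\<in>I. f i U) = (\<Sum>i\<in>I. Exp p F (f i))"
  unfolding Exp_def sum_distrib_left by (rule sum.swap)

lemma Exp_const [simp]: "finite F \<Longrightarrow> Exp p F (\<lambda>U. c) = c"
  by (induction F rule: finite_induct) (auto simp: Exp_insert algebra_simps)

lemma Exp_mono:
  assumes "0 \<le> p" "p \<le> 1" "\<And>U. U \<subseteq> F \<Longrightarrow> f U \<le> g U"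
  shows "Exp p F f \<le> Exp p F g"
  unfolding Exp_def using assms by (intro sum_mono mult_left_mono) auto

lemma Exp_nonneg:
  assumes "0 \<le> p" "p \<le> 1" "\<And>U. U \<subseteq> F \<Longrightarrow> 0 \<le> f U"
  shows "0 \<le> Exp p F f"
  unfolding Exp_def using assms by (intro sum_nonneg mult_nonneg_nonneg) auto

lemma Exp_Un:
  assumes "finite A" "finite B" "A \<inter> B = {}"
  shows "Exp p (A \<union> B) f = Exp p A (\<lambda>U. Exp p B (\<lambda>V. f (U \<union> V)))"
  using assms
  by (induction A arbitrary: f rule: finite_induct) (auto simp: Exp_insert)

lemma Exp_restrict:
  assumes "finite F" "A \<subseteq> F"
  shows "Exp p F (\<lambda>U. f (U \<inter> A)) = Exp p A f"
proof -
  have A: "finite A" using assms finite_subset by auto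
  have "F = A \<union> (F - A)" using assms by auto
  then have "Exp p F (\<lambda>U. f (U \<inter> A)) = Exp p (A \<union> (F - A)) (\<lambda>U. f (U \<inter> A))" by simp
  also have "\<dots> = Exp p A (\<lambda>U. Exp p (F - A) (\<lambda>V. f ((U \<union> V) \<inter> A)))"
    using assms A by (subst Exp_Un) auto
  also have "\<dots> = Exp p A f"
  proof (rule Exp_cong)
    fix U assume U: "U \<subseteq> A"
    have "Exp p (F - A) (\<lambda>V. f ((U \<union> V) \<inter> A)) = Exp p (F - A) (\<lambda>V. f U)"
      by (rule Exp_cong) (use U in \<open>auto intro: arg_cong[where f = f]\<close>)
    then show "Exp p (F - A) (\<lambda>V. f ((U \<union> V) \<inter> A)) = f U" using assms by simp
  qed
  finally show ?thesis .
qed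

lemma Exp_image:
  assumes "finite F" "inj_on h F"
  shows "Exp p (h ` F) f = Exp p F (\<lambda>U. f (h ` U))"
  using assms
proof (induction F arbitrary: f rule: finite_induct)
  case (insert e F)
  have "h e \<notin> h ` F" using insert by auto
  then show ?case using insert by (simp add: Exp_insert)
qed simp

lemma mono_insert: "mono f \<Longrightarrow> mono (\<lambda>U. f (insert e U))"
  by (intro monoI) (rule monoD, assumption, auto)

lemma mono_predD: "mono Q \<Longrightarrow> Q U \<Longrightarrow> U \<subseteq> V \<Longrightarrow> Q V"
  by (meson le_boolD monoD)

lemma mono_le_insert: "mono f \<Longrightarrow> f U \<le> f (insert e U)"
  by (rule monoD) auto

lemma Exp_mono_p:
  assumes "finite F" "mono f" "0 \<le> p" "p \<le> q" "q \<le> 1"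
  shows "Exp p F f \<le> Exp q F f"
  using assms(1,2)
proof (induction F arbitrary: f rule: finite_induct)
  case (insert e F)
  let ?g = "\<lambda>U. f (insert e U)"
  have 1: "Exp p F f \<le> Exp q F f" "Exp p F ?g \<le> Exp q F ?g"
    using insert by (auto intro: insert.IH mono_insert)
  have 2: "Exp q F f \<le> Exp q F ?g"
    using assms insert.prems by (intro Exp_mono mono_le_insert) auto
  have "(1 - p) * Exp p F f + p * Exp p F ?g \<le> (1 - p) * Exp q F f + p * Exp q F ?g"
    using 1 assms by (intro add_mono mult_left_mono) auto
  also have "\<dots> \<le> (1 - q) * Exp q F f + q * Exp q F ?g"
    using mult_nonneg_nonneg[of "q - p" "Exp q F ?g - Exp q F f"] 2 assms
    by (simp add: algebra_simps)
  finally show ?case using insert by (simp add: Exp_insert)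
qed simp

text \<open>Each edge contributes \<open>q - p\<close> times the difference of two averages in
  \<open>[0, 1]\<close>. Since the constant is the mere number of edges, the estimate is later
  uniform over all balls of a given radius.\<close>

lemma Exp_Lipschitz:
  fixes p q :: real
  assumes "finite F" "\<And>U. 0 \<le> f U \<and> f U \<le> 1" "0 \<le> p" "p \<le> q" "q \<le> 1"
  shows "\<bar>Exp q F f - Exp p F f\<bar> \<le> card F * (q - p)"
  using assms(1,2)
proof (induction F arbitrary: f rule: finite_induct)
  case (insert e F)
  let ?g = "\<lambda>U. f (insert e U)"
  have 1: "\<bar>Exp q F f - Exp p F f\<bar> \<le> card F * (q - p)"
      "\<bar>Exp q F ?g - Exp p F ?g\<bar> \<le> card F * (q - p)"
    using insert by (auto intro!: insert.IH)
  have rng: "0 \<le> Exp p F h" "Exp p F h \<le> 1" if "\<And>U. 0 \<le> h U \<and> h U \<le> 1" for h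
  proof -
    show "0 \<le> Exp p F h" using that assms by (intro Exp_nonneg) auto
    have "Exp p F h \<le> Exp p F (\<lambda>_. 1)" using that assms by (intro Exp_mono) auto
    then show "Exp p F h \<le> 1" using insert by simp
  qed
  have r: "0 \<le> Exp p F f" "Exp p F f \<le> 1" "0 \<le> Exp p F ?g" "Exp p F ?g \<le> 1"
    using rng[of f] rng[of ?g] insert.prems by auto
  have "Exp q (insert e F) f - Exp p (insert e F) f
     = (1 - q) * (Exp q F f - Exp p F f) + q * (Exp q F ?g - Exp p F ?g)
       + (q - p) * (Exp p F ?g - Exp p F f)"
    using insert by (simp add: Exp_insert algebra_simps)
  also have "\<bar>\<dots>\<bar> \<le> (1 - q) * \<bar>Exp q F f - Exp p F f\<bar> + q * \<bar>Exp q F ?g - Exp p F ?g\<bar>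
       + (q - p) * \<bar>Exp p F ?g - Exp p F f\<bar>"
    using assms by (intro order_trans[OF abs_triangle_ineq] add_mono) (auto simp: abs_mult)
  also have "\<dots> \<le> (1 - q) * (card F * (q - p)) + q * (card F * (q - p)) + (q - p) * 1"
    using assms 1 r by (intro add_mono mult_left_mono) auto
  also have "\<dots> = card (insert e F) * (q - p)" using insert by (simp add: algebra_simps)
  finally show ?case .
qed simp

text \<open>Russo's formula, for arbitrary functions. For an increasing event the summand of
  \<open>e\<close> is the probability that \<open>e\<close> is pivotal.\<close>

lemma Exp_derivative:
  assumes "finite F"
  shows "((\<lambda>p. Exp p F f) has_real_derivative
     (\<Sum>e\<in>F. Exp p (F - {e}) (\<lambda>U. f (insert e U) - f U))) (at p)"
  using assms
proof (induction F arbitrary: f rule: finite_induct)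
  case (insert e F)
  let ?g = "\<lambda>U. f (insert e U)"
  let ?D = "\<lambda>f. \<Sum>e\<in>F. Exp p (F - {e}) (\<lambda>U. f (insert e U) - f U)"
  have eq: "(\<Sum>e'\<in>insert e F. Exp p (insert e F - {e'}) (\<lambda>U. f (insert e' U) - f U))
      = (Exp p F ?g - Exp p F f) + (1 - p) * ?D f + p * ?D ?g"
  proof -
    have "Exp p (insert e F - {e'}) (\<lambda>U. f (insert e' U) - f U)
       = (1 - p) * Exp p (F - {e'}) (\<lambda>U. f (insert e' U) - f U)
         + p * Exp p (F - {e'}) (\<lambda>U. ?g (insert e' U) - ?g U)" if "e' \<in> F" for e'
    proof -
      have "insert e F - {e'} = insert e (F - {e'})" using that insert by auto
      then show ?thesis using that insert by (simp add: Exp_insert insert_commute)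
    qed
    moreover have "insert e F - {e} = F" using insert by auto
    ultimately show ?thesis using insert
      by (simp add: Exp_diff sum.distrib sum_distrib_left)
  qed
  have "((\<lambda>p. (1 - p) * Exp p F f + p * Exp p F ?g) has_real_derivative
     ((1 - p) * ?D f + (0 - 1) * Exp p F f) + (p * ?D ?g + 1 * Exp p F ?g)) (at p)"
    by (intro DERIV_add DERIV_mult' DERIV_diff DERIV_const DERIV_ident insert.IH)
  then show ?case
    unfolding eq using insert by (simp add: Exp_insert algebra_simps)
qed simp

text \<open>When one edge is split off, the product of the averages equals the average of the
  products minus \<open>p * (1 - p)\<close> times the product of the two increments, and both
  increments are nonnegative.\<close>

lemma Exp_Harris:
  assumes "finite F" "mono f" "mono g" "0 \<le> p" "p \<le> 1"
  shows "Exp p F f * Exp p F g \<le> Exp p F (\<lambda>U. f U * g U)"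
  using assms(1-3)
proof (induction F arbitrary: f g rule: finite_induct)
  case (insert e F)
  let ?f = "\<lambda>U. f (insert e U)" and ?g = "\<lambda>U. g (insert e U)"
  have 0: "Exp p F f \<le> Exp p F ?f" "Exp p F g \<le> Exp p F ?g"
    using insert.prems assms by (auto intro!: Exp_mono mono_le_insert)
  have 1: "Exp p F f * Exp p F g \<le> Exp p F (\<lambda>U. f U * g U)"
    "Exp p F ?f * Exp p F ?g \<le> Exp p F (\<lambda>U. ?f U * ?g U)"
    using insert by (auto intro!: insert.IH mono_insert)
  have "((1 - p) * Exp p F f + p * Exp p F ?f) * ((1 - p) * Exp p F g + p * Exp p F ?g)
    = (1 - p) * (Exp p F f * Exp p F g) + p * (Exp p F ?f * Exp p F ?g)
      - p * (1 - p) * ((Exp p F ?f - Exp p F f) * (Exp p F ?g - Exp p F g))"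
    by (simp add: algebra_simps)
  also have "\<dots> \<le> (1 - p) * (Exp p F f * Exp p F g) + p * (Exp p F ?f * Exp p F ?g)"
    using 0 assms by (simp add: mult_nonneg_nonneg)
  also have "\<dots> \<le> (1 - p) * Exp p F (\<lambda>U. f U * g U) + p * Exp p F (\<lambda>U. ?f U * ?g U)"
    using 1 assms by (intro add_mono mult_left_mono) auto
  finally show ?case using insert by (simp add: Exp_insert)
qed simp

lemma Pr_nonneg [simp]: "0 \<le> p \<Longrightarrow> p \<le> 1 \<Longrightarrow> 0 \<le> Pr p F A"
  unfolding Pr_def by (rule Exp_nonneg) auto

lemma Pr_mono:
  "0 \<le> p \<Longrightarrow> p \<le> 1 \<Longrightarrow> (\<And>U. U \<subseteq> F \<Longrightarrow> A U \<Longrightarrow> B U) \<Longrightarrow> Pr p F A \<le> Pr p F B"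
  unfolding Pr_def by (rule Exp_mono) auto

lemma Pr_cong: "(\<And>U. U \<subseteq> F \<Longrightarrow> A U = B U) \<Longrightarrow> Pr p F A = Pr p F B"
  unfolding Pr_def by (rule Exp_cong) auto

lemma Pr_le_1: "0 \<le> p \<Longrightarrow> p \<le> 1 \<Longrightarrow> finite F \<Longrightarrow> Pr p F A \<le> 1"
  using Exp_mono[of p F "\<lambda>U. of_bool (A U)" "\<lambda>_. 1"] unfolding Pr_def by auto

lemma Pr_True [simp]: "finite F \<Longrightarrow> Pr p F (\<lambda>_. True) = 1"
  unfolding Pr_def by simp

lemma Pr_compl: "finite F \<Longrightarrow> Pr p F (\<lambda>U. \<not> A U) = 1 - Pr p F A"
proof -
  assume "finite F"
  then have "Exp p F (\<lambda>U. 1 - of_bool (A U)) = 1 - Pr p F A"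
    unfolding Pr_def by (subst Exp_diff) auto
  moreover have "(\<lambda>U. of_bool (\<not> A U)) = (\<lambda>U. 1 - of_bool (A U) :: real)" by auto
  ultimately show ?thesis unfolding Pr_def by simp
qed

lemma Pr_union_bound:
  assumes "0 \<le> p" "p \<le> 1" "finite I" "\<And>U. U \<subseteq> F \<Longrightarrow> A U \<Longrightarrow> \<exists>i\<in>I. B i U"
  shows "Pr p F A \<le> (\<Sum>i\<in>I. Pr p F (B i))"
proof -
  have "Pr p F A \<le> Exp p F (\<lambda>U. \<Sum>i\<in>I. of_bool (B i U))"
    unfolding Pr_def
  proof (rule Exp_mono)
    fix U assume U: "U \<subseteq> F"
    show "of_bool (A U) \<le> (\<Sum>i\<in>I. of_bool (B i U) :: real)"
    proof (cases "A U")
      case True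
      then obtain i where i: "i \<in> I" "B i U" using assms(4) U by auto
      have "of_bool (B i U) \<le> (\<Sum>i\<in>I. of_bool (B i U) :: real)"
        using i assms by (intro member_le_sum) auto
      then show ?thesis using i True by simp
    qed (auto intro: sum_nonneg)
  qed (use assms in auto)
  then show ?thesis by (simp add: Exp_sum Pr_def)
qed

lemma mono_of_bool: "mono A \<Longrightarrow> mono (\<lambda>U. of_bool (A U) :: real)"
  unfolding mono_def by auto

lemma Pr_mono_p:
  "finite F \<Longrightarrow> mono A \<Longrightarrow> 0 \<le> p \<Longrightarrow> p \<le> q \<Longrightarrow> q \<le> 1 \<Longrightarrow> Pr p F A \<le> Pr q F A"
  unfolding Pr_def by (intro Exp_mono_p mono_of_bool)

lemma Pr_restrict:
  "finite F \<Longrightarrow> A \<subseteq> F \<Longrightarrow> Pr p F (\<lambda>U. Q (U \<inter> A)) = Pr p A Q"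
  unfolding Pr_def by (rule Exp_restrict)

lemma Pr_mono_set:
  assumes "finite F" "A \<subseteq> F" "mono Q" "0 \<le> p" "p \<le> 1"
  shows "Pr p A Q \<le> Pr p F Q"
proof -
  have "Pr p A Q = Pr p F (\<lambda>U. Q (U \<inter> A))" using assms by (simp add: Pr_restrict)
  also have "\<dots> \<le> Pr p F Q"
    using assms by (intro Pr_mono) (auto elim: mono_predD)
  finally show ?thesis .
qed

lemma Pr_Harris:
  assumes "finite F" "mono A" "mono B" "0 \<le> p" "p \<le> 1"
  shows "Pr p F A * Pr p F B \<le> Pr p F (\<lambda>U. A U \<and> B U)"
  using Exp_Harris[OF assms(1) mono_of_bool[OF assms(2)] mono_of_bool[OF assms(3)] assms(4,5)]
  unfolding Pr_def by (simp add: of_bool_conj)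

lemma Pr_subset:
  assumes "finite F" "W \<subseteq> F"
  shows "Pr p F (\<lambda>U. W \<subseteq> U) = p ^ card W"
proof -
  have *: "finite W \<Longrightarrow> Pr p W (\<lambda>U. W \<subseteq> U) = p ^ card W"
  proof -
    assume W: "finite W"
    have "Pr p W (\<lambda>U. W \<subseteq> U) = (\<Sum>U\<in>Pow W. if U = W then p ^ card W else 0)"
      unfolding Pr_def Exp_def by (rule sum.cong) auto
    then show ?thesis using W by simp
  qed
  have "Pr p F (\<lambda>U. W \<subseteq> U) = Pr p F (\<lambda>U. W \<subseteq> U \<inter> W)" by (rule Pr_cong) auto
  also have "\<dots> = Pr p W (\<lambda>U. W \<subseteq> U)" using assms by (rule Pr_restrict)
  finally show ?thesis using * assms finite_subset by auto
qed

lemma Pr_image: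
  assumes "finite F" "inj_on h F"
  shows "Pr p (h ` F) A = Pr p F (\<lambda>U. A (h ` U))"
  unfolding Pr_def using Exp_image[OF assms] .

text \<open>Disjoint occurrence is generalised from a pair of events to a binary relation \<open>Q\<close>, so that the BK
  inequality can be proved by duplicating one edge at a time.\<close>

definition dis :: "('e set \<Rightarrow> 'e set \<Rightarrow> bool) \<Rightarrow> 'e set \<Rightarrow> bool" where
  "dis Q U \<longleftrightarrow> (\<exists>V W. V \<subseteq> U \<and> W \<subseteq> U \<and> V \<inter> W = {} \<and> Q V W)"

lemma BK_relation:
  assumes "finite F" "0 \<le> p" "p \<le> 1"
    "\<And>V W V' W'. Q V W \<Longrightarrow> V \<subseteq> V' \<Longrightarrow> W \<subseteq> W' \<Longrightarrow> Q V' W'"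
  shows "Pr p F (dis Q) \<le> Exp p F (\<lambda>U. Exp p F (\<lambda>V. of_bool (Q U V)))"
  using assms(1,4)
proof (induction F arbitrary: Q rule: finite_induct)
  case empty
  then show ?case by (auto simp: Pr_def dis_def)
next
  case (insert e F)
  note mono = insert.prems
  let ?Q1 = "\<lambda>V W. Q (insert e V) W" and ?Q2 = "\<lambda>V W. Q V (insert e W)"
  \<comment> \<open>With one copy of \<open>e\<close> available, at most one of the two disjoint
    witnesses can use it; \<open>?R\<close> allows it to either of them.\<close>
  let ?R = "\<lambda>V W. ?Q1 V W \<or> ?Q2 V W"
  have A: "Pr p F (dis Q) \<le> Exp p F (\<lambda>U. Exp p F (\<lambda>V. of_bool (Q U V)))"
    using insert.IH mono by blast
  have "Pr p F (dis ?R) \<le> Exp p F (\<lambda>U. Exp p F (\<lambda>V. of_bool (?R U V)))"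
    
  proof (rule insert.IH)
    fix V W V' W' assume "?R V W" "V \<subseteq> V'" "W \<subseteq> W'"
    then show "?R V' W'"
      using mono[of "insert e V" W "insert e V'" W'] mono[of V "insert e W" V' "insert e W'"]
      by (auto simp: insert_mono)
  qed
  moreover have "Pr p F (\<lambda>U. dis Q (insert e U)) \<le> Pr p F (dis ?R)"
  proof (rule Pr_mono)
    fix U assume "U \<subseteq> F" "dis Q (insert e U)"
    then obtain V W where VW: "V \<subseteq> insert e U" "W \<subseteq> insert e U" "V \<inter> W = {}" "Q V W"
      unfolding dis_def by auto
    show "dis ?R U"
    proof (cases "e \<in> V")
      case True
      then have "W \<subseteq> U" "V - {e} \<subseteq> U" "(V - {e}) \<inter> W = {}" "?R (V - {e}) W"
        using VW by (auto simp: insert_absorb)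
      then show ?thesis unfolding dis_def by blast
    next
      case False
      then have "V \<subseteq> U" "W - {e} \<subseteq> U" "V \<inter> (W - {e}) = {}" "?R V (W - {e})"
        using VW by (auto intro: mono)
      then show ?thesis unfolding dis_def by blast
    qed
  qed (use assms in auto)
  ultimately have B: "Pr p F (\<lambda>U. dis Q (insert e U))
      \<le> Exp p F (\<lambda>U. Exp p F (\<lambda>V. of_bool (?R U V)))" by linarith
  \<comment> \<open>Pointwise comparison of one shared copy of \<open>e\<close> with two independent
    copies. Equality holds when \<open>Q U V\<close> fails and exactly one of \<open>?Q1\<close>,
    \<open>?Q2\<close> holds.\<close>
  have pw: "(1 - p) * of_bool (Q U V) + p * of_bool (?R U V)
     \<le> (1 - p) * ((1 - p) * of_bool (Q U V) + p * of_bool (?Q2 U V))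
      + p * ((1 - p) * of_bool (?Q1 U V) + p * of_bool (Q (insert e U) (insert e V)))" for U V
  proof -
    have a: "Q U V \<Longrightarrow> ?Q1 U V" "Q U V \<Longrightarrow> ?Q2 U V"
      "?Q1 U V \<Longrightarrow> Q (insert e U) (insert e V)" "?Q2 U V \<Longrightarrow> Q (insert e U) (insert e V)"
      using mono by (blast+)
    have "p * p \<le> p * 1" using assms by (intro mult_left_mono) auto
    then show ?thesis
      using a assms by (cases "Q U V"; cases "?Q1 U V"; cases "?Q2 U V";
          cases "Q (insert e U) (insert e V)") (auto simp: algebra_simps)
  qed
  have "Pr p (insert e F) (dis Q) = (1 - p) * Pr p F (dis Q) + p * Pr p F (\<lambda>U. dis Q (insert e U))"
    unfolding Pr_def using insert by (simp add: Exp_insert)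
  also have "\<dots> \<le> (1 - p) * Exp p F (\<lambda>U. Exp p F (\<lambda>V. of_bool (Q U V)))
      + p * Exp p F (\<lambda>U. Exp p F (\<lambda>V. of_bool (?R U V)))"
    using A B assms by (intro add_mono mult_left_mono) auto
  also have "\<dots> = Exp p F (\<lambda>U. Exp p F (\<lambda>V. (1 - p) * of_bool (Q U V) + p * of_bool (?R U V)))"
    by (simp only: Exp_add Exp_cmult)
  also have "\<dots> \<le> Exp p F (\<lambda>U. Exp p F (\<lambda>V.
      (1 - p) * ((1 - p) * of_bool (Q U V) + p * of_bool (?Q2 U V))
      + p * ((1 - p) * of_bool (?Q1 U V) + p * of_bool (Q (insert e U) (insert e V)))))"
    using assms pw by (intro Exp_mono) auto
  also have "\<dots> = Exp p (insert e F) (\<lambda>U. Exp p (insert e F) (\<lambda>V. of_bool (Q U V)))"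
    by (simp only: Exp_insert[OF insert.hyps(1,2)] Exp_add Exp_cmult) (simp add: algebra_simps)
  finally show ?case .
qed

lemma BK:
  assumes "finite F" "0 \<le> p" "p \<le> 1" "mono A" "mono B"
  shows "Pr p F (dis (\<lambda>V W. A V \<and> B W)) \<le> Pr p F A * Pr p F B"
proof -
  have "Pr p F (dis (\<lambda>V W. A V \<and> B W))
      \<le> Exp p F (\<lambda>U. Exp p F (\<lambda>V. of_bool (A U \<and> B V)))"
    using assms by (intro BK_relation) (auto simp: mono_def le_bool_def)
  also have "\<dots> = Pr p F A * Pr p F B"
    unfolding Pr_def by (simp only: of_bool_conj Exp_cmult Exp_multc)
  finally show ?thesis .
qed

lemma mono_dis: "mono (dis Q)"
  unfolding mono_def le_bool_def dis_def by (meson order_trans)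

lemma BK3:
  assumes "finite F" "0 \<le> p" "p \<le> 1" "mono A" "mono B" "mono C"
  shows "Pr p F (\<lambda>U. \<exists>V1 V2 V3. V1 \<subseteq> U \<and> V2 \<subseteq> U \<and> V3 \<subseteq> U \<and> V1 \<inter> V2 = {} \<and> V1 \<inter> V3 = {}
     \<and> V2 \<inter> V3 = {} \<and> A V1 \<and> B V2 \<and> C V3) \<le> Pr p F A * Pr p F B * Pr p F C"
    (is "Pr p F ?E \<le> _")
proof -
  have "Pr p F ?E \<le> Pr p F (dis (\<lambda>V W. dis (\<lambda>V W. A V \<and> B W) V \<and> C W))"
  proof (rule Pr_mono)
    fix U assume "?E U"
    then obtain V1 V2 V3 where v: "V1 \<subseteq> U" "V2 \<subseteq> U" "V3 \<subseteq> U" "V1 \<inter> V2 = {}" "V1 \<inter> V3 = {}"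
     "V2 \<inter> V3 = {}" "A V1" "B V2" "C V3" by auto
    show "dis (\<lambda>V W. dis (\<lambda>V W. A V \<and> B W) V \<and> C W) U"
      unfolding dis_def by (rule exI[of _ "V1 \<union> V2"], rule exI[of _ V3]) (use v in auto)
  qed (use assms in auto)
  also have "\<dots> \<le> Pr p F (dis (\<lambda>V W. A V \<and> B W)) * Pr p F C"
    using assms by (intro BK mono_dis)
  also have "\<dots> \<le> Pr p F A * Pr p F B * Pr p F C"
    using assms by (intro mult_right_mono BK) auto
  finally show ?thesis .
qed

section \<open>The two-point function\<close>

definition conn :: "'v set set \<Rightarrow> 'v \<Rightarrow> 'v \<Rightarrow> bool" where
  "conn U = (\<lambda>a b. {a, b} \<in> U)\<^sup>*\<^sup>*"

lemma conn_refl [simp]: "conn U x x"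
  by (simp add: conn_def)

lemma conn_edge: "{x, y} \<in> U \<Longrightarrow> conn U x y"
  by (auto simp: conn_def)

lemma conn_trans [trans]: "conn U x y \<Longrightarrow> conn U y z \<Longrightarrow> conn U x z"
  unfolding conn_def by (rule rtranclp_trans)

lemma conn_mono: "conn U x y \<Longrightarrow> U \<subseteq> V \<Longrightarrow> conn V x y"
  using rtranclp_mono[of "\<lambda>a b. {a, b} \<in> U" "\<lambda>a b. {a, b} \<in> V"]
  by (auto simp: conn_def le_fun_def)

lemma mono_conn: "mono (\<lambda>U. conn U x y)"
  by (intro monoI le_boolI) (rule conn_mono)

lemma mono_conn_Int: "mono (\<lambda>U. conn (U \<inter> E) x y)"
  by (intro monoI le_boolI) (erule conn_mono, auto)

lemma conn_sym: "conn U x y \<longleftrightarrow> conn U y x"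
proof -
  have "conn U x y \<Longrightarrow> conn U y x" for x y
    unfolding conn_def
  proof (induction rule: rtranclp_induct)
    case (step y z)
    have "{z, y} \<in> U" using step(2) by (simp add: insert_commute)
    then show ?case using step(3) by (rule converse_rtranclp_into_rtranclp)
  qed simp
  then show ?thesis by blast
qed

lemma conn_image: "conn U x y \<Longrightarrow> conn ((`) h ` U) (h x) (h y)"
proof -
  assume "conn U x y"
  then have "(\<lambda>a b. {a, b} \<in> U)\<^sup>*\<^sup>* x y" by (simp add: conn_def)
  then show ?thesis
  proof (induction rule: rtranclp_induct)
    case (step y z)
    have "h ` {y, z} \<in> (`) h ` U" using step(2) by (rule imageI)
    then have "{h y, h z} \<in> (`) h ` U" by simp
    then show ?case using step conn_trans conn_edge by metis
  qed simp
qed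

lemma conn_verts: "conn U x y \<Longrightarrow> x = y \<or> y \<in> \<Union>U"
  unfolding conn_def by (induction rule: rtranclp_induct) auto

lemma conn_empty [simp]: "conn {} x y \<longleftrightarrow> x = y"
  using conn_verts[of "{}" x y] by auto

lemma conn_inj:
  assumes "inj_on h W" "\<Union>U \<subseteq> W" "x \<in> W" "y \<in> W"
  shows "conn ((`) h ` U) (h x) (h y) \<longleftrightarrow> conn U x y"
proof
  assume "conn ((`) h ` U) (h x) (h y)"
  from conn_image[OF this, of "inv_into W h"]
  have "conn ((`) (inv_into W h) ` (`) h ` U) x y"
    using assms by simp
  moreover have "(`) (inv_into W h) ` (`) h ` U = U"
  proof -
    have "inv_into W h ` h ` e = e" if "e \<in> U" for e
      using that assms by (intro inv_into_image_cancel) auto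
    then show ?thesis by (simp add: image_image cong: image_cong)
  qed
  ultimately show "conn U x y" by simp
qed (rule conn_image)

section \<open>Simple paths and their edge sets\<close>

fun pedges :: "'v list \<Rightarrow> 'v set set" where
  "pedges (a # b # r) = insert {a, b} (pedges (b # r))"
| "pedges _ = {}"

lemma pedges_append: "pedges (xs @ z # ys) = pedges (xs @ [z]) \<union> pedges (z # ys)"
proof (induction xs)
  case (Cons a xs)
  then show ?case by (cases xs) auto
qed simp

lemma Union_pedges: "\<Union>(pedges xs) \<subseteq> set xs"
  by (induction xs rule: pedges.induct) auto

lemma pedges_subset: "e \<in> pedges xs \<Longrightarrow> e \<subseteq> set xs"
  using Union_pedges[of xs] by auto

lemma pedges_rev: "pedges (rev xs) = pedges xs"
proof (induction xs rule: pedges.induct)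
  case (1 a b r)
  have "pedges (rev r @ [b, a]) = pedges (rev r @ [b]) \<union> pedges [b, a]"
    using pedges_append[of "rev r" b "[a]"] by simp
  then show ?case using 1 by (auto simp: insert_commute)
qed auto

lemma conn_pedges: "xs \<noteq> [] \<Longrightarrow> conn (pedges xs) (hd xs) (last xs)"
proof (induction xs rule: pedges.induct)
  case (1 a b r)
  then have "conn (pedges (a # b # r)) b (last (b # r))"
    by (auto elim: conn_mono)
  moreover have "conn (pedges (a # b # r)) a b" by (auto intro: conn_edge)
  ultimately show ?case using conn_trans by (metis last_ConsR list.discI list.sel(1))
qed auto

lemma conn_in_pedges:
  assumes "z \<in> set xs"
  shows "conn (pedges xs) (hd xs) z" "conn (pedges xs) z (last xs)"
proof -
  obtain ys zs where xs: "xs = ys @ z # zs" using assms by (meson split_list)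
  have "conn (pedges (ys @ [z])) (hd (ys @ [z])) (last (ys @ [z]))" by (rule conn_pedges) simp
  then show "conn (pedges xs) (hd xs) z"
    unfolding xs by (subst pedges_append) (cases ys, auto elim: conn_mono)
  have "conn (pedges (z # zs)) (hd (z # zs)) (last (z # zs))" by (rule conn_pedges) simp
  then show "conn (pedges xs) z (last xs)"
    unfolding xs by (subst pedges_append) (auto elim: conn_mono)
qed

definition spath :: "'v set set \<Rightarrow> 'v \<Rightarrow> 'v list \<Rightarrow> 'v \<Rightarrow> bool" where
  "spath U x xs y \<longleftrightarrow> xs \<noteq> [] \<and> distinct xs \<and> hd xs = x \<and> last xs = y \<and> pedges xs \<subseteq> U"

text \<open>Loop erasure: if the new first vertex already occurs on the path, the path is cut back
  to that occurrence.\<close>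

lemma conn_spath: "conn U x y \<Longrightarrow> \<exists>xs. spath U x xs y"
proof -
  assume "conn U x y"
  then have "(\<lambda>a b. {a, b} \<in> U)\<^sup>*\<^sup>* x y" by (simp add: conn_def)
  then show ?thesis
  proof (induction rule: converse_rtranclp_induct)
    case base
    then show ?case by (intro exI[of _ "[y]"]) (simp add: spath_def)
  next
    case (step x z)
    then obtain xs where xs: "spath U z xs y" by auto
    show ?case
    proof (cases "x \<in> set xs")
      case True
      then obtain as bs where s: "xs = as @ x # bs" by (meson split_list)
      have "pedges (x # bs) \<subseteq> U" using xs unfolding spath_def s by (subst (asm) pedges_append) auto
      then have "spath U x (x # bs) y" using xs s by (auto simp: spath_def)
      then show ?thesis by blast
    next
      case False
      then have "spath U x (x # xs) y"
        using xs step(1) by (cases xs) (auto simp: spath_def)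
      then show ?thesis by blast
    qed
  qed
qed

text \<open>Every edge before \<open>z\<close> contains a vertex of \<open>xs\<close>, and on a
  simple path such a vertex does not occur from \<open>z\<close> on.\<close>

lemma pedges_disjoint:
  assumes "distinct (xs @ z # ys)"
  shows "pedges (xs @ [z]) \<inter> pedges (z # ys) = {}"
proof -
  have *: "distinct (xs @ [z]) \<Longrightarrow> e \<in> pedges (xs @ [z]) \<Longrightarrow> e \<inter> set xs \<noteq> {}" for e
  proof (induction xs)
    case (Cons a xs)
    then show ?case by (cases xs) auto
  qed simp
  show ?thesis
  proof (rule equals0I)
    fix e assume e: "e \<in> pedges (xs @ [z]) \<inter> pedges (z # ys)"
    then have "e \<inter> set xs \<noteq> {}" using * assms by auto
    moreover have "e \<subseteq> set (z # ys)" using e pedges_subset by blast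
    ultimately show False using assms by auto
  qed
qed

lemma pedges_meets:
  assumes "distinct (xs @ [z])" "e \<in> pedges (xs @ [z])"
  shows "e \<inter> set xs \<noteq> {}"
  using assms
proof (induction xs)
  case (Cons a xs)
  then show ?case by (cases xs) auto
qed simp

text \<open>A path from \<open>z\<close> towards \<open>x\<close> is stopped at its first vertex
  \<open>w\<close> on a simple path from \<open>x\<close> to \<open>y\<close>. Up to there it shares
  no edge with the latter, which \<open>w\<close> cuts into two disjoint pieces.\<close>

lemma conn_tree_graph:
  assumes "conn U x y" "conn U x z"
  shows "\<exists>w V1 V2 V3. V1 \<subseteq> U \<and> V2 \<subseteq> U \<and> V3 \<subseteq> U \<and> V1 \<inter> V2 = {} \<and> V1 \<inter> V3 = {}
     \<and> V2 \<inter> V3 = {} \<and> conn V1 x w \<and> conn V2 w y \<and> conn V3 w z"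
proof -
  obtain P where P: "spath U x P y" using conn_spath[OF assms(1)] by blast
  obtain Q where Q: "spath U z Q x" using conn_spath[OF conn_sym[THEN iffD1, OF assms(2)]] by blast
  have "x \<in> set P" "x \<in> set Q" using P Q unfolding spath_def by (metis hd_in_set, metis last_in_set)
  then have "\<exists>v\<in>set Q. v \<in> set P" by auto
  then obtain Q1 w Q2 where q: "Q = Q1 @ w # Q2" "w \<in> set P" "\<forall>v\<in>set Q1. v \<notin> set P"
    using split_list_first_prop[of Q "\<lambda>v. v \<in> set P"] by blast
  obtain P1 P2 where p: "P = P1 @ w # P2" using q(2) by (meson split_list)
  define V1 where "V1 = pedges (P1 @ [w])"
  define V2 where "V2 = pedges (w # P2)"
  define V3 where "V3 = pedges (Q1 @ [w])"
  have P12: "pedges P = V1 \<union> V2" unfolding V1_def V2_def p by (rule pedges_append)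
  have "pedges Q = V3 \<union> pedges (w # Q2)" unfolding V3_def q by (rule pedges_append)
  then have sub: "V1 \<subseteq> U" "V2 \<subseteq> U" "V3 \<subseteq> U" using P12 P Q by (auto simp: spath_def)
  have d: "V1 \<inter> V2 = {}" unfolding V1_def V2_def using P p by (intro pedges_disjoint) (auto simp: spath_def)
  have "V3 \<inter> pedges P = {}"
  proof (rule equals0I)
    fix e assume e: "e \<in> V3 \<inter> pedges P"
    then have "e \<subseteq> set P" using pedges_subset by blast
    moreover have "e \<inter> set Q1 \<noteq> {}"
      using e Q q unfolding V3_def by (intro pedges_meets[of _ w]) (auto simp: spath_def)
    ultimately show False using q by auto
  qed
  then have d': "V1 \<inter> V3 = {}" "V2 \<inter> V3 = {}" using P12 by auto
  have c1: "conn V1 x w"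
    using conn_pedges[of "P1 @ [w]"] P p unfolding V1_def spath_def by (cases P1) auto
  have c2: "conn V2 w y"
    using conn_pedges[of "w # P2"] P p unfolding V2_def spath_def by auto
  have "conn V3 z w"
    using conn_pedges[of "Q1 @ [w]"] Q q unfolding V3_def spath_def by (cases Q1) auto
  then have "conn V3 w z" by (simp add: conn_sym)
  then show ?thesis using c1 c2 d d' sub by blast
qed

definition tau :: "real \<Rightarrow> 'v set set \<Rightarrow> 'v \<Rightarrow> 'v \<Rightarrow> real" where
  "tau p F x y = Pr p F (\<lambda>U. conn U x y)"

definition inner :: "'v set \<Rightarrow> 'v set set" where
  "inner S = {e. e \<subseteq> S}"

lemma tau_nonneg [simp]: "0 \<le> p \<Longrightarrow> p \<le> 1 \<Longrightarrow> 0 \<le> tau p F x y"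
  by (simp add: tau_def)

lemma tau_le_1: "0 \<le> p \<Longrightarrow> p \<le> 1 \<Longrightarrow> finite F \<Longrightarrow> tau p F x y \<le> 1"
  by (simp add: tau_def Pr_le_1)

lemma tau_refl [simp]: "finite F \<Longrightarrow> tau p F x x = 1"
  by (simp add: tau_def)

lemma tau_mono: "finite F \<Longrightarrow> A \<subseteq> F \<Longrightarrow> 0 \<le> p \<Longrightarrow> p \<le> 1 \<Longrightarrow> tau p A x y \<le> tau p F x y"
  unfolding tau_def by (intro Pr_mono_set mono_conn)

lemma tau_mono_p: "finite F \<Longrightarrow> 0 \<le> p \<Longrightarrow> p \<le> q \<Longrightarrow> q \<le> 1 \<Longrightarrow> tau p F x y \<le> tau q F x y"
  unfolding tau_def by (intro Pr_mono_p mono_conn)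

lemma tau_eq_0: "finite F \<Longrightarrow> y \<noteq> x \<Longrightarrow> y \<notin> \<Union>F \<Longrightarrow> tau p F x y = 0"
proof -
  assume a: "finite F" "y \<noteq> x" "y \<notin> \<Union>F"
  have "tau p F x y = Pr p F (\<lambda>U. False)"
    unfolding tau_def
  proof (rule Pr_cong)
    fix U assume "U \<subseteq> F"
    then have "y \<notin> \<Union>U" using a by blast
    then show "conn U x y = False" using conn_verts[of U x y] a by auto
  qed
  then show ?thesis by (simp add: Pr_def a)
qed

lemma Pr_conn_Int:
  assumes "finite F"
  shows "Pr p F (\<lambda>U. conn (U \<inter> E) x y) = tau p (F \<inter> E) x y"
proof -
  have "Pr p F (\<lambda>U. conn (U \<inter> E) x y) = Pr p F (\<lambda>U. conn (U \<inter> (F \<inter> E)) x y)"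
  proof (rule Pr_cong)
    fix U assume "U \<subseteq> F"
    then have "U \<inter> E = U \<inter> (F \<inter> E)" by auto
    then show "conn (U \<inter> E) x y = conn (U \<inter> (F \<inter> E)) x y" by simp
  qed
  then show ?thesis unfolding tau_def using assms Pr_restrict[of F "F \<inter> E"] by auto
qed

lemma tau_image:
  assumes "finite F" "inj_on h W" "\<Union>F \<subseteq> W" "x \<in> W" "y \<in> W"
  shows "tau p ((`) h ` F) (h x) (h y) = tau p F x y"
proof -
  have "inj_on ((`) h) F"
    using assms(2,3) by (meson Union_least Union_upper inj_on_image inj_on_subset)
  then have "tau p ((`) h ` F) (h x) (h y) = Pr p F (\<lambda>U. conn ((`) h ` U) (h x) (h y))"
    unfolding tau_def using assms by (intro Pr_image) auto
  also have "\<dots> = tau p F x y"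
    unfolding tau_def
  proof (rule Pr_cong)
    fix U assume "U \<subseteq> F"
    then have "\<Union>U \<subseteq> W" using assms(3) by blast
    then show "conn ((`) h ` U) (h x) (h y) = conn U x y" using assms by (intro conn_inj)
  qed
  finally show ?thesis .
qed

lemma BK_sum:
  assumes "finite F" "0 \<le> p" "p \<le> 1" "finite W"
    "\<And>z. mono (B z)" "\<And>z. mono (C z)"
    "\<And>U. U \<subseteq> F \<Longrightarrow> A U \<Longrightarrow> \<exists>z\<in>W. \<exists>V V'. V \<subseteq> U \<and> V' \<subseteq> U \<and> V \<inter> V' = {} \<and> B z V \<and> C z V'"
  shows "Pr p F A \<le> (\<Sum>z\<in>W. Pr p F (B z) * Pr p F (C z))"
proof -
  have "Pr p F A \<le> (\<Sum>z\<in>W. Pr p F (dis (\<lambda>V W. B z V \<and> C z W)))"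
    using assms(2,3,4) by (rule Pr_union_bound) (use assms(7) in \<open>simp add: dis_def\<close>)
  also have "\<dots> \<le> (\<Sum>z\<in>W. Pr p F (B z) * Pr p F (C z))"
    using assms by (intro sum_mono BK) auto
  finally show ?thesis .
qed

lemma BK3_sum:
  assumes "finite F" "0 \<le> p" "p \<le> 1" "finite W"
    "\<And>z. mono (B z)" "\<And>z. mono (C z)" "\<And>z. mono (D z)"
    "\<And>U. U \<subseteq> F \<Longrightarrow> A U \<Longrightarrow> \<exists>z\<in>W. \<exists>V1 V2 V3. V1 \<subseteq> U \<and> V2 \<subseteq> U \<and> V3 \<subseteq> U
       \<and> V1 \<inter> V2 = {} \<and> V1 \<inter> V3 = {} \<and> V2 \<inter> V3 = {} \<and> B z V1 \<and> C z V2 \<and> D z V3"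
  shows "Pr p F A \<le> (\<Sum>z\<in>W. Pr p F (B z) * Pr p F (C z) * Pr p F (D z))"
proof -
  have "Pr p F A \<le> (\<Sum>z\<in>W. Pr p F (\<lambda>U. \<exists>V1 V2 V3. V1 \<subseteq> U \<and> V2 \<subseteq> U \<and> V3 \<subseteq> U
       \<and> V1 \<inter> V2 = {} \<and> V1 \<inter> V3 = {} \<and> V2 \<inter> V3 = {} \<and> B z V1 \<and> C z V2 \<and> D z V3))"
    by (intro Pr_union_bound assms(2,3,4,8))
  also have "\<dots> \<le> (\<Sum>z\<in>W. Pr p F (B z) * Pr p F (C z) * Pr p F (D z))"
    using assms by (intro sum_mono BK3) auto
  finally show ?thesis .
qed

lemma tau_triangle_Harris:
  assumes "finite F" "0 \<le> p" "p \<le> 1"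
  shows "tau p F x y * tau p F y z \<le> tau p F x z"
proof -
  have "tau p F x y * tau p F y z \<le> Pr p F (\<lambda>U. conn U x y \<and> conn U y z)"
    unfolding tau_def using assms by (intro Pr_Harris mono_conn)
  also have "\<dots> \<le> tau p F x z"
    unfolding tau_def using assms by (intro Pr_mono) (auto intro: conn_trans)
  finally show ?thesis .
qed

lemma tau_path:
  assumes "finite F" "0 \<le> p" "p \<le> 1" "W \<subseteq> F" "conn W x y" "card W \<le> n"
  shows "p ^ n \<le> tau p F x y"
proof -
  have "p ^ n \<le> p ^ card W" using assms by (intro power_decreasing) auto
  also have "\<dots> = Pr p F (\<lambda>U. W \<subseteq> U)" using assms by (simp add: Pr_subset)
  also have "\<dots> \<le> tau p F x y"
    unfolding tau_def using assms by (intro Pr_mono) (auto elim: conn_mono)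
  finally show ?thesis .
qed

lemma path_exit:
  assumes "spath U x xs y" "x \<in> S" "y \<notin> S"
  shows "\<exists>as a b bs. xs = as @ a # b # bs \<and> set (as @ [a]) \<subseteq> S \<and> b \<notin> S"
proof -
  have xs: "xs \<noteq> []" "hd xs = x" "last xs = y" using assms by (auto simp: spath_def)
  have "\<exists>v\<in>set xs. v \<notin> S" using xs assms last_in_set by blast
  then obtain as b bs where s: "xs = as @ b # bs" "b \<notin> S" "\<forall>v\<in>set as. v \<in> S"
    using split_list_first_prop[of xs "\<lambda>v. v \<notin> S"] by blast
  then have "as \<noteq> []" using xs assms by auto
  then obtain as' a where "as = as' @ [a]" by (metis rev_exhaust)
  then show ?thesis using s by auto
qed

lemma spath_parts:
  assumes "spath U x (as @ a # b # bs) y"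
  shows "conn (pedges (as @ [a])) x a" "conn (pedges (b # bs)) b y" "{a, b} \<in> U"
    "pedges (as @ [a]) \<subseteq> U" "pedges (b # bs) \<subseteq> U"
    "pedges (as @ [a]) \<inter> {{a, b}} = {}" "{{a, b}} \<inter> pedges (b # bs) = {}"
    "pedges (as @ [a]) \<inter> pedges (b # bs) = {}"
proof -
  have e: "pedges (as @ a # b # bs) = pedges (as @ [a]) \<union> (insert {a, b} (pedges (b # bs)))"
    by (subst pedges_append) simp
  have d: "distinct (as @ a # b # bs)" using assms by (simp add: spath_def)
  show "{a, b} \<in> U" "pedges (as @ [a]) \<subseteq> U" "pedges (b # bs) \<subseteq> U"
    using assms e by (auto simp: spath_def)
  show "conn (pedges (as @ [a])) x a"
    using conn_pedges[of "as @ [a]"] assms by (cases as) (auto simp: spath_def)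
  show "conn (pedges (b # bs)) b y"
    using conn_pedges[of "b # bs"] assms by (auto simp: spath_def)
  have dd: "pedges (as @ [a]) \<inter> pedges (a # b # bs) = {}" using d by (rule pedges_disjoint)
  then show "pedges (as @ [a]) \<inter> {{a, b}} = {}" "pedges (as @ [a]) \<inter> pedges (b # bs) = {}" by auto
  show "{{a, b}} \<inter> pedges (b # bs) = {}" using d pedges_subset[of "{a, b}" "b # bs"] by auto
qed

lemma finite_edge_pairs:
  assumes "finite (F :: 'v set set)"
  shows "finite {(a, b). {a, b} \<in> F}"
proof -
  have "{(a, b). {a, b} \<in> F} \<subseteq> (\<Union>e\<in>{e \<in> F. finite e}. e \<times> e)"
  proof clarify
    fix a b assume "{a, b} \<in> F"
    then show "(a, b) \<in> (\<Union>e\<in>{e \<in> F. finite e}. e \<times> e)" by (intro UN_I[of "{a, b}"]) auto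
  qed
  moreover have "finite \<dots>" using assms by auto
  ultimately show ?thesis by (rule finite_subset)
qed

section \<open>Simon's inequality and restricted susceptibilities\<close>

definition exits :: "'v set set \<Rightarrow> 'v set \<Rightarrow> ('v \<times> 'v) set" where
  "exits F S = {(a, b). {a, b} \<in> F \<and> a \<in> S \<and> b \<notin> S}"

lemma finite_exits: "finite F \<Longrightarrow> finite (exits F S)"
  unfolding exits_def by (rule finite_subset[OF _ finite_edge_pairs[of F]]) auto

lemma Pr_edge: "finite F \<Longrightarrow> e \<in> F \<Longrightarrow> Pr p F (\<lambda>U. e \<in> U) = p"
  using Pr_subset[of F "{e}" p] by simp

text \<open>BK for three disjoint pieces of a simple path: the part up to its first exit from
  \<open>S\<close>, which uses only edges inside \<open>S\<close>, the exit edge, and the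
  remainder.\<close>

lemma Simon:
  assumes F: "finite F" and p: "0 \<le> p" "p \<le> 1" and xy: "x \<in> S" "y \<notin> S"
  shows "tau p F x y \<le> (\<Sum>(a, b)\<in>exits F S. tau p (F \<inter> inner S) x a * p * tau p F b y)"
proof -
  have "tau p F x y \<le> (\<Sum>z\<in>exits F S. Pr p F (\<lambda>U. conn (U \<inter> inner S) x (fst z))
      * Pr p F (\<lambda>U. {fst z, snd z} \<in> U) * Pr p F (\<lambda>U. conn U (snd z) y))"
    unfolding tau_def
  proof (rule BK3_sum[OF F p finite_exits[OF F]])
    fix U assume U: "U \<subseteq> F" "conn U x y"
    obtain xs where xs: "spath U x xs y" using conn_spath[OF U(2)] by blast
    then obtain as a b bs where s: "xs = as @ a # b # bs" "set (as @ [a]) \<subseteq> S" "b \<notin> S"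
      using path_exit xy by metis
    note parts = spath_parts[OF xs[unfolded s]]
    have "pedges (as @ [a]) \<inter> inner S = pedges (as @ [a])"
      using pedges_subset s(2) unfolding inner_def by blast
    then have "conn (pedges (as @ [a]) \<inter> inner S) x a" using parts by simp
    moreover have "(a, b) \<in> exits F S" using s parts U by (auto simp: exits_def)
    ultimately show "\<exists>z\<in>exits F S. \<exists>V1 V2 V3. V1 \<subseteq> U \<and> V2 \<subseteq> U \<and> V3 \<subseteq> U
       \<and> V1 \<inter> V2 = {} \<and> V1 \<inter> V3 = {} \<and> V2 \<inter> V3 = {} \<and> conn (V1 \<inter> inner S) x (fst z)
       \<and> {fst z, snd z} \<in> V2 \<and> conn V3 (snd z) y"
      using parts by (intro bexI[of _ "(a, b)"] exI[of _ "pedges (as @ [a])"] exI[of _ "{{a, b}}"]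
        exI[of _ "pedges (b # bs)"]) auto
  qed (rule mono_conn mono_conn_Int | force simp: mono_def le_bool_def)+
  also have "\<dots> = (\<Sum>(a, b)\<in>exits F S. tau p (F \<inter> inner S) x a * p * tau p F b y)"
    using F by (intro sum.cong) (auto simp: Pr_conn_Int Pr_edge exits_def tau_def)
  finally show ?thesis .
qed

text \<open>Restricting the sum to the finitely many vertices that are incident to \<open>F\<close> loses nothing,
  because \<open>tau\<close> vanishes elsewhere.\<close>

definition rs :: "real \<Rightarrow> 'v set set \<Rightarrow> 'v \<Rightarrow> 'v set \<Rightarrow> real" where
  "rs p F x A = (\<Sum>y\<in>A \<inter> insert x (\<Union>F). tau p F x y)"

text \<open>Members of \<open>F\<close> are arbitrary sets at this level of generality, so the
  finiteness of the set of incident vertices has to be demanded separately.\<close>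

definition fin_edges :: "'v set set \<Rightarrow> bool" where
  "fin_edges F \<longleftrightarrow> finite F \<and> finite (\<Union>F)"

lemma fin_edges_subset: "fin_edges F \<Longrightarrow> A \<subseteq> F \<Longrightarrow> fin_edges A"
  unfolding fin_edges_def by (meson Union_mono finite_subset)

lemma fin_edges_Int: "fin_edges F \<Longrightarrow> fin_edges (F \<inter> A)"
  by (rule fin_edges_subset) auto

lemma rs_superset:
  assumes "fin_edges F" "finite Z" "A \<inter> insert x (\<Union>F) \<subseteq> Z" "Z \<subseteq> A"
  shows "rs p F x A = (\<Sum>y\<in>Z. tau p F x y)"
  unfolding rs_def
proof (rule sum.mono_neutral_left)
  show "\<forall>i\<in>Z - A \<inter> insert x (\<Union> F). tau p F x i = 0"
    using assms by (auto intro!: tau_eq_0 simp: fin_edges_def)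
qed (use assms in auto)

lemma rs_nonneg: "0 \<le> p \<Longrightarrow> p \<le> 1 \<Longrightarrow> 0 \<le> rs p F x A"
  unfolding rs_def by (intro sum_nonneg) auto

lemma rs_mono:
  assumes "fin_edges F" "F' \<subseteq> F" "A' \<subseteq> A" "0 \<le> p" "p \<le> 1"
  shows "rs p F' x A' \<le> rs p F x A"
proof -
  have "rs p F' x A' = (\<Sum>y\<in>A' \<inter> insert x (\<Union>F). tau p F' x y)"
    using assms by (intro rs_superset fin_edges_subset[OF assms(1,2)])
      (auto simp: fin_edges_def)
  also have "\<dots> \<le> (\<Sum>y\<in>A' \<inter> insert x (\<Union>F). tau p F x y)"
    using assms by (intro sum_mono tau_mono) (auto simp: fin_edges_def)
  also have "\<dots> \<le> rs p F x A"
    unfolding rs_def using assms by (intro sum_mono2) (auto simp: fin_edges_def)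
  finally show ?thesis .
qed

lemma rs_mono_p:
  assumes "fin_edges F" "0 \<le> p" "p \<le> q" "q \<le> 1"
  shows "rs p F x A \<le> rs q F x A"
  unfolding rs_def using assms by (intro sum_mono tau_mono_p) (auto simp: fin_edges_def)

lemma sum_tau_le_rs:
  assumes "fin_edges F" "finite Z" "Z \<subseteq> A" "0 \<le> p" "p \<le> 1"
  shows "(\<Sum>y\<in>Z. tau p F x y) \<le> rs p F x A"
proof -
  have "(\<Sum>y\<in>Z. tau p F x y) = rs p F x Z"
    using assms by (intro rs_superset[symmetric]) auto
  also have "\<dots> \<le> rs p F x A" using assms by (intro rs_mono) auto
  finally show ?thesis .
qed

lemma sum_UN_le:
  fixes f :: "'b \<Rightarrow> real"
  assumes "finite I" "\<And>i. i \<in> I \<Longrightarrow> finite (B i)" "\<And>x. 0 \<le> f x"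
  shows "sum f (\<Union>i\<in>I. B i) \<le> (\<Sum>i\<in>I. sum f (B i))"
  using assms(1,2)
proof (induction I rule: finite_induct)
  case (insert i I)
  have "sum f (B i \<union> (\<Union>i\<in>I. B i)) \<le> sum f (B i) + sum f (\<Union>i\<in>I. B i)"
    using insert sum.union_inter[of "B i" "\<Union>i\<in>I. B i" f]
      sum_nonneg[of "B i \<inter> (\<Union>i\<in>I. B i)" f] assms(3) by simp
  then show ?case using insert by simp
qed simp

section \<open>Graph distance and regular trees\<close>

definition gd :: "'a graph \<Rightarrow> 'a \<Rightarrow> 'a \<Rightarrow> nat" where
  "gd G x y = (LEAST n. (adj G ^^ n) x y)"

lemma adj_sym: "adj G x y \<longleftrightarrow> adj G y x"
  by (simp add: adj_def insert_commute)

locale cgraph =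
  fixes G :: "'a graph"
  assumes simple: "simple_graph G" and connected: "connected_graph G"
begin

lemma adjD: "adj G x y \<Longrightarrow> x \<in> verts G \<and> y \<in> verts G \<and> x \<noteq> y"
  using simple unfolding simple_graph_def adj_def by (fastforce simp: doubleton_eq_iff)

lemma edgeE:
  assumes "e \<in> edges G"
  obtains x y where "e = {x, y}" "adj G x y"
  using assms simple unfolding simple_graph_def adj_def by metis

lemma gd_relpow: "x \<in> verts G \<Longrightarrow> y \<in> verts G \<Longrightarrow> (adj G ^^ gd G x y) x y"
  unfolding gd_def
  by (rule LeastI_ex) (use connected in \<open>auto simp: connected_graph_def rtranclp_power\<close>)

lemma gd_le: "(adj G ^^ n) x y \<Longrightarrow> gd G x y \<le> n"
  unfolding gd_def by (rule Least_le)

lemma gd_refl [simp]: "gd G x x = 0"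
  using gd_le[of 0 x x] by simp

lemma gd_eq_0: "x \<in> verts G \<Longrightarrow> y \<in> verts G \<Longrightarrow> gd G x y = 0 \<longleftrightarrow> x = y"
  using gd_relpow[of x y] by (cases "gd G x y = 0") auto

lemma relpow_adj_sym: "(adj G ^^ n) x y \<Longrightarrow> (adj G ^^ n) y x"
proof (induction n arbitrary: y)
  case (Suc n)
  then obtain z where "(adj G ^^ n) x z" "adj G z y" by auto
  then show ?case using Suc.IH adj_sym relpowp_Suc_I2 by metis
qed auto

lemma gd_sym: "gd G x y = gd G y x"
  unfolding gd_def using relpow_adj_sym by (metis (no_types, lifting))

lemma gd_triangle:
  assumes "x \<in> verts G" "y \<in> verts G" "z \<in> verts G"
  shows "gd G x z \<le> gd G x y + gd G y z"
  using gd_relpow[of x y] gd_relpow[of y z] assms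
  by (intro gd_le) (auto simp: relpowp_add)

lemma gd_adj: "adj G x y \<Longrightarrow> gd G x y = 1"
  using gd_le[of 1 x y] gd_eq_0[of x y] adjD[of x y] by (auto simp: le_Suc_eq)

lemma gd_adj_le: "adj G x y \<Longrightarrow> z \<in> verts G \<Longrightarrow> gd G x z \<le> Suc (gd G y z)"
  using gd_triangle[of x y z] gd_adj[of x y] adjD[of x y] by auto

lemma gd_closer:
  assumes "x \<in> verts G" "y \<in> verts G" "gd G x y = Suc n"
  obtains z where "adj G x z" "gd G z y = n"
proof -
  have "(adj G ^^ Suc n) x y" using gd_relpow[of x y] assms by simp
  then obtain z where z: "adj G x z" "(adj G ^^ n) z y" by (meson relpowp_Suc_D2)
  have "gd G z y \<le> n" using z gd_le by auto
  moreover have "Suc n \<le> Suc (gd G z y)" using gd_adj_le[OF z(1) assms(2)] assms by simp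
  ultimately show thesis using that z by auto
qed

lemma conn_edges: "conn (edges G) = (adj G)\<^sup>*\<^sup>*"
  unfolding conn_def adj_def by simp

lemma gd_walk:
  "x \<in> verts G \<Longrightarrow> y \<in> verts G \<Longrightarrow> gd G x y = n \<Longrightarrow>
   \<exists>W\<subseteq>edges G. finite W \<and> card W \<le> n \<and> conn W x y"
proof (induction n arbitrary: x)
  case 0
  then show ?case using gd_eq_0 by (intro exI[of _ "{}"]) auto
next
  case (Suc n)
  obtain z where z: "adj G x z" "gd G z y = n" by (rule gd_closer[OF Suc.prems])
  then obtain W where W: "W \<subseteq> edges G" "finite W" "card W \<le> n" "conn W z y"
    using Suc adjD by metis
  have "conn (insert {x, z} W) x y"
    using conn_mono[OF W(4), of "insert {x, z} W"] conn_edge[of x z "insert {x, z} W"]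
      conn_trans[of _ x z y] by auto
  moreover have "card (insert {x, z} W) \<le> Suc n"
    using W card_insert_le_m1[of "Suc n" W] by (simp add: card_insert_if)
  ultimately show ?case using W z by (intro exI[of _ "insert {x, z} W"]) (auto simp: adj_def)
qed

lemma conn_gd_bound:
  assumes "conn U x y" "U \<subseteq> edges G" "x \<in> verts G"
  shows "y \<in> verts G"
proof -
  have "y = x \<or> y \<in> \<Union>(edges G)" using conn_verts[OF assms(1)] assms(2) by auto
  then show ?thesis using assms(3) simple unfolding simple_graph_def by auto
qed

definition cball :: "'a \<Rightarrow> nat \<Rightarrow> 'a set" where
  "cball x n = {y \<in> verts G. gd G x y \<le> n}"

lemma finite_cball:
  assumes "locally_finite G" "x \<in> verts G"
  shows "finite (cball x n)"
proof (induction n)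
  case 0
  have "cball x 0 \<subseteq> {x}" using gd_eq_0 assms unfolding cball_def by auto
  then show ?case using finite_subset by auto
next
  case (Suc n)
  have "cball x (Suc n) \<subseteq> cball x n \<union> (\<Union>y\<in>cball x n. neighbours G y)"
  proof
    fix y assume y: "y \<in> cball x (Suc n)"
    show "y \<in> cball x n \<union> (\<Union>y\<in>cball x n. neighbours G y)"
    proof (cases "gd G y x = Suc n")
      case True
      then obtain z where "adj G y z" "gd G z x = n"
        using y assms gd_closer unfolding cball_def by blast
      then show ?thesis using adjD[of y z] gd_sym[of z x] adj_sym[of G y z]
        unfolding cball_def neighbours_def by auto
    next
      case False
      then show ?thesis using y gd_sym[of y x] unfolding cball_def by auto
    qed
  qed
  moreover have "finite (cball x n \<union> (\<Union>y\<in>cball x n. neighbours G y))"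
    using Suc assms unfolding locally_finite_def cball_def by auto
  ultimately show ?case by (rule finite_subset)
qed

lemma automorphism_gd:
  assumes "is_automorphism G \<phi>" "x \<in> verts G" "y \<in> verts G"
  shows "gd G (\<phi> x) (\<phi> y) = gd G x y"
proof -
  have im: "\<phi> z \<in> verts G" if "z \<in> verts G" for z
    using assms(1) that unfolding is_automorphism_def bij_betw_def by auto
  have a: "(adj G ^^ n) (\<phi> x) (\<phi> y)" if "(adj G ^^ n) x y" "x \<in> verts G" for n x y
    using that
  proof (induction n arbitrary: y)
    case (Suc n)
    then obtain z where z: "(adj G ^^ n) x z" "adj G z y" by auto
    then have "adj G (\<phi> z) (\<phi> y)" using assms(1) adjD unfolding is_automorphism_def by blast
    then show ?case using Suc z by auto
  qed auto
  have b: "\<exists>v\<in>verts G. y = \<phi> v \<and> (adj G ^^ n) x v"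
    if "(adj G ^^ n) (\<phi> x) y" "x \<in> verts G" for n x y
    using that
  proof (induction n arbitrary: y)
    case (Suc n)
    then obtain z where z: "(adj G ^^ n) (\<phi> x) z" "adj G z y" by auto
    then obtain v where v: "v \<in> verts G" "z = \<phi> v" "(adj G ^^ n) x v" using Suc by blast
    have "y \<in> verts G" using z adjD by auto
    then have "y \<in> \<phi> ` verts G"
      using assms(1) unfolding is_automorphism_def bij_betw_def by auto
    then obtain w where w: "w \<in> verts G" "y = \<phi> w" by blast
    then have "adj G v w" using z v assms(1) unfolding is_automorphism_def by auto
    then show ?case using v w by auto
  qed auto
  have inj: "inj_on \<phi> (verts G)" using assms(1) unfolding is_automorphism_def bij_betw_def by auto
  have "(adj G ^^ n) (\<phi> x) (\<phi> y) \<longleftrightarrow> (adj G ^^ n) x y" for n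
    using a[of n x y] b[of n x "\<phi> y"] assms inj_onD[OF inj] by blast
  then show ?thesis unfolding gd_def by simp
qed

lemma automorphism_inv:
  assumes "is_automorphism G \<phi>"
  shows "\<exists>\<psi>. is_automorphism G \<psi> \<and> (\<forall>x\<in>verts G. \<psi> (\<phi> x) = x \<and> \<phi> (\<psi> x) = x)"
proof (intro exI conjI)
  let ?\<psi> = "inv_into (verts G) \<phi>"
  have bij: "bij_betw \<phi> (verts G) (verts G)" using assms unfolding is_automorphism_def by auto
  show inv: "\<forall>x\<in>verts G. ?\<psi> (\<phi> x) = x \<and> \<phi> (?\<psi> x) = x"
    using bij by (simp add: bij_betw_inv_into_left bij_betw_inv_into_right)
  have bij': "bij_betw ?\<psi> (verts G) (verts G)" using bij by (rule bij_betw_inv_into)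
  have "adj G (?\<psi> u) (?\<psi> v) \<longleftrightarrow> adj G u v" if "u \<in> verts G" "v \<in> verts G" for u v
  proof -
    have "?\<psi> u \<in> verts G" "?\<psi> v \<in> verts G" using bij' that unfolding bij_betw_def by auto
    then have "adj G (\<phi> (?\<psi> u)) (\<phi> (?\<psi> v)) \<longleftrightarrow> adj G (?\<psi> u) (?\<psi> v)"
      using assms unfolding is_automorphism_def by auto
    then show ?thesis using inv that by simp
  qed
  then show "is_automorphism G ?\<psi>" using bij' unfolding is_automorphism_def by auto
qed

end

lemma is_automorphism_comp:
  assumes "is_automorphism G \<phi>" "is_automorphism G \<psi>"
  shows "is_automorphism G (\<lambda>x. \<phi> (\<psi> x))"
proof -
  have "\<psi> u \<in> verts G" if "u \<in> verts G" for u
    using assms(2) that unfolding is_automorphism_def bij_betw_def by auto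
  moreover have "bij_betw (\<phi> \<circ> \<psi>) (verts G) (verts G)"
    using assms unfolding is_automorphism_def by (auto intro: bij_betw_trans)
  ultimately show ?thesis using assms unfolding is_automorphism_def by (auto simp: comp_def)
qed

locale rtree =
  fixes T :: "'a graph" and d :: nat
  assumes tree: "is_regular_tree (Suc d) T" and d: "2 \<le> d"

sublocale rtree \<subseteq> cgraph T
  using tree unfolding is_regular_tree_def is_tree_def by unfold_locales auto

context rtree
begin

lemma card_neighbours: "v \<in> verts T \<Longrightarrow> card (neighbours T v) = Suc d"
  and finite_neighbours: "v \<in> verts T \<Longrightarrow> finite (neighbours T v)"
  using tree unfolding is_regular_tree_def regular_def by auto

text \<open>A simple path between the endpoints that avoids the edge would close up with it to a
  cycle; it has at least three vertices because it is simple and does not use the edge.\<close>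

lemma bridge:
  assumes "adj T u v"
  shows "\<not> conn (edges T - {{u, v}}) u v"
proof
  assume "conn (edges T - {{u, v}}) u v"
  then obtain xs where "spath (edges T - {{u, v}}) u xs v" by (rule exE[OF conn_spath])
  then have xs: "xs \<noteq> []" "distinct xs" "hd xs = u" "last xs = v"
      "pedges xs \<subseteq> edges T" "{u, v} \<notin> pedges xs"
    unfolding spath_def by auto
  have "u \<noteq> v" using adjD[OF assms] by auto
  have nth: "i + 1 < length ys \<Longrightarrow> {ys ! i, ys ! (i + 1)} \<in> pedges ys" for i and ys :: "'a list"
  proof (induction ys arbitrary: i rule: pedges.induct)
    case (1 a b r)
    then show ?case by (cases i) auto
  qed auto
  have len: "3 \<le> length xs"
  proof (rule ccontr)
    assume "\<not> 3 \<le> length xs"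
    moreover have "0 < length xs" using xs(1) by simp
    ultimately have "length xs = 1 \<or> length xs = 2" by linarith
    then show False
    proof
      assume "length xs = 2"
      then obtain a b where "xs = [a, b]" by (auto simp: length_Suc_conv numeral_2_eq_2)
      then show False using xs by auto
    next
      assume "length xs = 1"
      then show False using xs \<open>u \<noteq> v\<close> by (cases xs) auto
    qed
  qed
  have "is_cycle T xs"
    unfolding is_cycle_def
  proof (intro conjI allI impI)
    fix i assume i: "i < length xs"
    show "adj T (xs ! i) (xs ! (Suc i mod length xs))"
    proof (cases "Suc i < length xs")
      case True
      then show ?thesis using nth[of i xs] xs(5) unfolding adj_def by auto
    next
      case False
      then have "Suc i = length xs" using i by auto
      then have il: "i = length xs - 1" by simp
      then have "xs ! i = v" "Suc i mod length xs = 0" "xs ! 0 = u"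
        using xs il by (auto simp: last_conv_nth hd_conv_nth)
      then show ?thesis using assms adj_sym[of T u v] by simp
    qed
  qed (use len xs in auto)
  then show False using tree unfolding is_regular_tree_def is_tree_def by blast
qed

text \<open>On a geodesic from \<open>w\<close> to \<open>r\<close> all vertices after
  \<open>w\<close> are strictly closer to \<open>r\<close> than \<open>v\<close>, hence differ from
  \<open>v\<close>.\<close>

lemma conn_descend:
  assumes "v \<in> verts T" "r \<in> verts T"
  shows "w \<in> verts T \<Longrightarrow> w \<noteq> v \<Longrightarrow> gd T w r \<le> gd T v r \<Longrightarrow> conn {e \<in> edges T. v \<notin> e} w r"
proof (induction "gd T w r" arbitrary: w)
  case 0
  then show ?case using gd_eq_0[of w r] assms by simp
next
  case (Suc n)
  obtain y where y: "adj T w y" "gd T y r = n"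
    by (rule gd_closer[OF Suc.prems(1) assms(2) Suc.hyps(2)[symmetric]])
  have "y \<noteq> v" using y Suc by auto
  then have "conn {e \<in> edges T. v \<notin> e} y r" using Suc y adjD by auto
  moreover have "conn {e \<in> edges T. v \<notin> e} w y"
    using y Suc(4) \<open>y \<noteq> v\<close> by (intro conn_edge) (auto simp: adj_def)
  ultimately show ?case using conn_trans[of _ w y r] by auto
qed

text \<open>Otherwise both neighbours would be joined to \<open>r\<close>, and so to each other,
  without using \<open>v\<close>. Then \<open>u\<close> would still be joined to \<open>v\<close>
  through \<open>u'\<close> after deletion of \<open>{u, v}\<close>, which is a bridge.\<close>

lemma unique_parent:
  assumes "r \<in> verts T" "adj T v u" "adj T v u'" "gd T u r \<le> gd T v r" "gd T u' r \<le> gd T v r"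
  shows "u = u'"
proof (rule ccontr)
  assume ne: "u \<noteq> u'"
  have V: "v \<in> verts T" "u \<in> verts T" "u' \<in> verts T" "u \<noteq> v" "u' \<noteq> v"
    using adjD[OF assms(2)] adjD[OF assms(3)] by auto
  let ?E = "{e \<in> edges T. v \<notin> e}"
  have "conn ?E u r" "conn ?E u' r" using conn_descend V assms by auto
  then have "conn ?E u u'" using conn_sym[of ?E r u'] conn_trans[of ?E u r u'] by auto
  then have "conn (edges T - {{u, v}}) u u'" by (rule conn_mono) auto
  moreover have "{u', v} \<in> edges T - {{u, v}}"
    using assms ne V by (auto simp: adj_def insert_commute doubleton_eq_iff)
  ultimately have "conn (edges T - {{u, v}}) u v"
    using conn_edge[of u' v "edges T - {{u, v}}"] conn_trans[of "edges T - {{u, v}}" u u' v] by auto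
  then show False using bridge[of u v] assms(2) adj_sym[of T u v] by auto
qed

lemma gd_step:
  assumes "r \<in> verts T" "adj T v u"
  shows "gd T u r = Suc (gd T v r) \<or> gd T v r = Suc (gd T u r)"
proof (rule ccontr)
  assume n: "\<not> ?thesis"
  have V: "v \<in> verts T" "u \<in> verts T" "u \<noteq> v" using adjD[OF assms(2)] by auto
  have eq: "gd T u r = gd T v r"
    using n gd_adj_le[of u v r] gd_adj_le[of v u r] assms adj_sym[of T u v] by auto
  show False
  proof (cases "gd T v r")
    case 0
    then show ?thesis using eq gd_eq_0 V assms by metis
  next
    case (Suc m)
    obtain y where y: "adj T v y" "gd T y r = m" by (rule gd_closer[OF V(1) assms(1) Suc])
    then have "u = y" using unique_parent[of r v u y] assms eq Suc by auto
    then show ?thesis using y eq Suc by auto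
  qed
qed

definition children :: "'a \<Rightarrow> 'a \<Rightarrow> 'a set" where
  "children r v = {w. adj T v w \<and> gd T w r = Suc (gd T v r)}"

definition par :: "'a \<Rightarrow> 'a \<Rightarrow> 'a" where
  "par r v = (SOME w. adj T v w \<and> gd T v r = Suc (gd T w r))"

lemma par:
  assumes "r \<in> verts T" "v \<in> verts T" "v \<noteq> r"
  shows "adj T v (par r v)" "gd T v r = Suc (gd T (par r v) r)"
proof -
  obtain n where n: "gd T v r = Suc n" using assms gd_eq_0[of v r] by (cases "gd T v r") auto
  obtain w where "adj T v w" "gd T w r = n" by (rule gd_closer[OF assms(2,1) n])
  then have "\<exists>w. adj T v w \<and> gd T v r = Suc (gd T w r)" using n by auto
  from someI_ex[OF this] show "adj T v (par r v)" "gd T v r = Suc (gd T (par r v) r)"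
    unfolding par_def by auto
qed

lemma par_eq:
  assumes "r \<in> verts T" "adj T v w" "gd T v r = Suc (gd T w r)"
  shows "par r v = w"
proof -
  have "v \<noteq> r" using assms by auto
  then show ?thesis using par[of r v] assms adjD[of v w] unique_parent[of r v "par r v" w] by auto
qed

lemma neighbours_children:
  assumes "r \<in> verts T" "v \<in> verts T"
  shows "neighbours T v = (if v = r then {} else {par r v}) \<union> children r v"
    "v \<noteq> r \<Longrightarrow> par r v \<notin> children r v"
proof -
  show "v \<noteq> r \<Longrightarrow> par r v \<notin> children r v" using par[of r v] assms unfolding children_def by auto
  show "neighbours T v = (if v = r then {} else {par r v}) \<union> children r v"
  proof (intro set_eqI iffI)
    fix w assume "w \<in> neighbours T v"
    then have w: "adj T v w" unfolding neighbours_def by auto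
    then show "w \<in> (if v = r then {} else {par r v}) \<union> children r v"
      using gd_step[OF assms(1) w] par_eq[OF assms(1) w] unfolding children_def by auto
  next
    fix w assume "w \<in> (if v = r then {} else {par r v}) \<union> children r v"
    then show "w \<in> neighbours T v"
      using par[of r v] assms unfolding children_def neighbours_def by (auto split: if_splits)
  qed
qed

lemma finite_children: "r \<in> verts T \<Longrightarrow> v \<in> verts T \<Longrightarrow> finite (children r v)"
  using neighbours_children(1)[of r v] finite_neighbours[of v] by (metis finite_Un)

lemma card_children:
  assumes "r \<in> verts T" "v \<in> verts T"
  shows "card (children r v) = (if v = r then Suc d else d)"
  using neighbours_children[OF assms] card_neighbours[OF assms(2)] finite_children[OF assms]
  by (auto split: if_splits)

definition sphere :: "'a \<Rightarrow> nat \<Rightarrow> 'a set" where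
  "sphere r n = {v \<in> verts T. gd T v r = n}"

lemma sphere_0: "r \<in> verts T \<Longrightarrow> sphere r 0 = {r}"
  unfolding sphere_def using gd_eq_0 by auto

lemma sphere_Suc:
  assumes "r \<in> verts T"
  shows "sphere r (Suc n) = (\<Union>v\<in>sphere r n. children r v)"
proof (intro set_eqI iffI)
  fix w assume w: "w \<in> sphere r (Suc n)"
  then have "w \<noteq> r" unfolding sphere_def by auto
  then have "adj T w (par r w)" "gd T w r = Suc (gd T (par r w) r)"
    using par[of r w] w assms unfolding sphere_def by auto
  then have "par r w \<in> sphere r n" "w \<in> children r (par r w)"
    using w adjD[of w "par r w"] adj_sym[of T w] unfolding sphere_def children_def by auto
  then show "w \<in> (\<Union>v\<in>sphere r n. children r v)" by blast
next
  fix w assume "w \<in> (\<Union>v\<in>sphere r n. children r v)"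
  then show "w \<in> sphere r (Suc n)" unfolding sphere_def children_def using adjD by auto
qed

lemma children_disjoint:
  assumes "r \<in> verts T" "v \<noteq> v'"
  shows "children r v \<inter> children r v' = {}"
proof (rule equals0I)
  fix w assume "w \<in> children r v \<inter> children r v'"
  then have "par r w = v" "par r w = v'"
    using par_eq[of r w] assms adj_sym[of T w] unfolding children_def by auto
  then show False using assms by auto
qed

lemma finite_sphere: "r \<in> verts T \<Longrightarrow> finite (sphere r n)"
proof (induction n)
  case (Suc n)
  then show ?case using finite_children unfolding sphere_Suc[OF Suc.prems] by (auto simp: sphere_def)
qed (simp add: sphere_0)

lemma card_sphere:
  assumes "r \<in> verts T"
  shows "card (sphere r (Suc n)) = Suc d * d ^ n"
proof (induction n)
  case 0
  then show ?case using assms card_children[of r r] unfolding sphere_Suc[OF assms] by (simp add: sphere_0)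
next
  case (Suc n)
  have "card (sphere r (Suc (Suc n))) = (\<Sum>v\<in>sphere r (Suc n). card (children r v))"
    unfolding sphere_Suc[OF assms, of "Suc n"]
    using assms finite_sphere finite_children children_disjoint[OF assms]
    by (intro card_UN_disjoint) (auto simp: sphere_def)
  also have "\<dots> = (\<Sum>v\<in>sphere r (Suc n). d)"
    using assms card_children by (intro sum.cong) (auto simp: sphere_def)
  finally show ?case using Suc by (simp add: algebra_simps)
qed

lemma card_sphere_bounds:
  assumes "r \<in> verts T"
  shows "d ^ n \<le> card (sphere r n)" "card (sphere r n) \<le> 2 * d ^ n"
  using card_sphere[OF assms] assms d by (cases n; simp add: sphere_0)+

section \<open>Bi-infinite geodesics of the tree\<close>

definition line :: "(int \<Rightarrow> 'a) \<Rightarrow> bool" where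
  "line u \<longleftrightarrow> (\<forall>i. adj T (u i) (u (i + 1)) \<and> u i \<noteq> u (i + 2))"

lemma line_adj: "line u \<Longrightarrow> adj T (u i) (u (i + 1))"
  and line_adj': "line u \<Longrightarrow> adj T (u (i + 1)) (u i)"
  unfolding line_def using adj_sym by metis+

lemma line_verts [simp]: "line u \<Longrightarrow> u i \<in> verts T"
  using line_adj adjD by blast

lemma line_shift: "line u \<Longrightarrow> line (\<lambda>i. u (i + c))"
  unfolding line_def by (metis add.assoc add.commute)

lemma line_rev: "line u \<Longrightarrow> line (\<lambda>i. u (c - i))"
proof -
  assume l: "line u"
  have "adj T (u (c - i)) (u (c - (i + 1))) \<and> u (c - i) \<noteq> u (c - (i + 2))" for i
    using l[unfolded line_def, rule_format, of "c - (i + 2)"]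
      line_adj'[OF l, of "c - (i + 1)"] by (auto simp: algebra_simps)
  then show ?thesis unfolding line_def by auto
qed

text \<open>A vertex has only one neighbour that is not farther from \<open>v\<close>. Once the line
  has moved away from \<open>v\<close>, its previous vertex is that neighbour, and since it does not
  backtrack it has to keep moving away.\<close>

lemma line_increasing:
  assumes "line u" "v \<in> verts T" "gd T v (u i) < gd T v (u (i + 1))"
  shows "gd T v (u (i + int n)) = gd T v (u i) + n"
proof -
  have s: "gd T v (u (i + int n)) = gd T v (u i) + n \<and> gd T v (u (i + int n)) < gd T v (u (i + int n + 1))"
  proof (induction n)
    case (Suc n)
    let ?j = "i + int n"
    have j: "i + int (Suc n) = ?j + 1" by simp
    have a1: "gd T v (u (?j + 1)) = Suc (gd T v (u ?j))"
      using Suc gd_step[OF assms(2) line_adj[OF assms(1), of ?j]] by (auto simp: gd_sym)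
    have "adj T (u (?j + 1)) (u (?j + 2))"
      using line_adj[OF assms(1), of "?j + 1"] by (simp add: algebra_simps)
    moreover have "adj T (u (?j + 1)) (u ?j)" using line_adj' assms by auto
    moreover have "u ?j \<noteq> u (?j + 2)" using assms unfolding line_def by auto
    ultimately have "gd T v (u (?j + 1)) < gd T v (u (?j + 2))"
      using unique_parent[of v "u (?j + 1)" "u (?j + 2)" "u ?j"] assms a1
      by (metis gd_sym le_SucI nle_le not_less)
    then show ?case unfolding j using a1 Suc by (simp add: algebra_simps)
  qed (use assms in simp)
  then show ?thesis by simp
qed

lemma line_gd:
  assumes "line u"
  shows "gd T (u i) (u j) = nat \<bar>i - j\<bar>"
proof -
  have *: "gd T (u i) (u (i + int n)) = n" for i n
    using line_increasing[OF assms, of "u i" i n] assms gd_adj[OF line_adj[OF assms, of i]] by simp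
  show ?thesis
  proof (cases "i \<le> j")
    case True
    then show ?thesis using *[of i "nat (j - i)"] by simp
  next
    case False
    then show ?thesis using *[of j "nat (i - j)"] by (simp add: gd_sym)
  qed
qed

lemma line_inj: "line u \<Longrightarrow> u i = u j \<longleftrightarrow> i = j"
  using line_gd[of u i j] by auto

text \<open>Along the segment the distance to \<open>v\<close> falls by one per step up to a
  minimiser \<open>i\<close> and rises by one per step after it: \<open>line_increasing\<close> is
  applied in both directions.\<close>

lemma line_projection:
  assumes "line u" "v \<in> verts T"
  obtains i j where "i \<le> m" "gd T v (u 0) = i + j" "gd T v (u (int m)) = (m - i) + j"
    "gd T v (u (int i)) = j"
proof -
  let ?h = "\<lambda>l. gd T v (u (int l))"
  have "Min (?h ` {..m}) \<in> ?h ` {..m}" by (intro Min_in) auto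
  then obtain i where i': "i \<in> {..m}" "Min (?h ` {..m}) = ?h i" by blast
  have i: "i \<le> m" "\<And>l. l \<le> m \<Longrightarrow> gd T v (u (int i)) \<le> gd T v (u (int l))"
    using i' by (auto simp flip: i'(2))
  have step: "gd T v (u (k + 1)) \<noteq> gd T v (u k)" for k
    using gd_step[OF assms(2) line_adj[OF assms(1), of k]] by (auto simp: gd_sym)
  have r: "gd T v (u (int m)) = gd T v (u (int i)) + (m - i)"
  proof (cases "i < m")
    case True
    have "gd T v (u (int i)) < gd T v (u (int i + 1))"
      using i(2)[of "Suc i"] True step[of "int i"] by (simp add: add.commute)
    from line_increasing[OF assms this, of "m - i"] show ?thesis using True by (simp add: of_nat_diff)
  qed (use i in auto)
  have l: "gd T v (u 0) = gd T v (u (int i)) + i"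
  proof (cases "0 < i")
    case True
    let ?u = "\<lambda>k. u (int i - k)"
    have "i - 1 \<le> m" using i(1) by simp
    then have "gd T v (?u 0) < gd T v (?u (0 + 1))"
      using i(2)[of "i - 1"] True step[of "int i - 1"] by (simp add: of_nat_diff)
    from line_increasing[OF line_rev[OF assms(1)] assms(2) this, of i] show ?thesis by simp
  qed auto
  show thesis using that[of i "gd T v (u (int i))"] i l r by simp
qed

text \<open>Each \<open>v\<close> is filed under its projection \<open>i\<close> on the segment and
  its distance \<open>j\<close> to it; at most \<open>2 * d ^ j\<close> vertices lie at distance
  \<open>j\<close> from \<open>u i\<close>. Overcounting is harmless for nonnegative
  \<open>f\<close>, and \<open>J\<close> only has to exceed the finitely many distances that occur
  in \<open>A\<close>.\<close>

lemma tree_sum_le: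
  fixes f :: "nat \<Rightarrow> nat \<Rightarrow> real"
  assumes "line u" "finite A" "A \<subseteq> verts T" "\<And>a b. 0 \<le> f a b"
  obtains J where "(\<Sum>v\<in>A. f (gd T v (u 0)) (gd T v (u (int m))))
     \<le> (\<Sum>i\<le>m. \<Sum>j<J. 2 * real d ^ j * f (i + j) ((m - i) + j))"
proof -
  define J where "J = Suc (Max (insert 0 ((\<lambda>(v, i). gd T v (u (int i))) ` (A \<times> {..m}))))"
  have J: "gd T v (u (int i)) < J" if "v \<in> A" "i \<le> m" for v i
    unfolding J_def using assms that by (intro le_imp_less_Suc Max_ge) (auto intro!: image_eqI[of _ _ "(v, i)"])
  let ?I = "{..m} \<times> {..<J}"
  let ?B = "\<lambda>(i, j). sphere (u (int i)) j"
  let ?S = "\<lambda>(i, j). {v \<in> sphere (u (int i)) j. gd T v (u 0) = i + j \<and> gd T v (u (int m)) = (m - i) + j}"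
  have fin: "finite (sphere (u (int i)) j)" for i j using assms by (intro finite_sphere) auto
  have "A \<subseteq> (\<Union>z\<in>?I. ?S z)"
  proof
    fix v assume v: "v \<in> A"
    then obtain i j where ij: "i \<le> m" "gd T v (u 0) = i + j" "gd T v (u (int m)) = (m - i) + j"
        "gd T v (u (int i)) = j"
      using line_projection[OF assms(1), of v m] assms by blast
    then show "v \<in> (\<Union>z\<in>?I. ?S z)"
      using J[OF v, of i] v assms by (intro UN_I[of "(i, j)"]) (auto simp: sphere_def)
  qed
  then have "(\<Sum>v\<in>A. f (gd T v (u 0)) (gd T v (u (int m))))
      \<le> (\<Sum>v\<in>(\<Union>z\<in>?I. ?S z). f (gd T v (u 0)) (gd T v (u (int m))))"
    using assms fin by (intro sum_mono2) auto
  also have "\<dots> \<le> (\<Sum>z\<in>?I. \<Sum>v\<in>?S z. f (gd T v (u 0)) (gd T v (u (int m))))"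
    using assms fin by (intro sum_UN_le) auto
  also have "\<dots> \<le> (\<Sum>(i, j)\<in>?I. 2 * real d ^ j * f (i + j) ((m - i) + j))"
  proof (rule sum_mono, clarify)
    fix i j
    have "(\<Sum>v\<in>?S (i, j). f (gd T v (u 0)) (gd T v (u (int m))))
        = real (card (?S (i, j))) * f (i + j) ((m - i) + j)" by simp
    also have "\<dots> \<le> (2 * real d ^ j) * f (i + j) ((m - i) + j)"
    proof (rule mult_right_mono)
      have "card (?S (i, j)) \<le> card (sphere (u (int i)) j)" using fin by (intro card_mono) auto
      also have "\<dots> \<le> 2 * d ^ j" using assms by (intro card_sphere_bounds) auto
      finally have "real (card (?S (i, j))) \<le> real (2 * d ^ j)" by (rule of_nat_mono)
      then show "real (card (?S (i, j))) \<le> 2 * real d ^ j" by simp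
    qed (use assms in auto)
    finally show "(\<Sum>v\<in>{v \<in> sphere (u (int i)) j. gd T v (u 0) = i + j \<and> gd T v (u (int m)) = m - i + j}.
        f (gd T v (u 0)) (gd T v (u (int m)))) \<le> 2 * real d ^ j * f (i + j) (m - i + j)" by simp
  qed
  finally show thesis by (intro that[of J]) (simp only: sum.cartesian_product)
qed

text \<open>Dependent choice: approach \<open>t\<close> while it lies ahead, afterwards move to any
  child with respect to the root \<open>s\<close>.\<close>

lemma ray_exists:
  assumes "s \<in> verts T" "t \<in> verts T"
  shows "\<exists>f. f 0 = s \<and> f (gd T s t) = t \<and> (\<forall>n. gd T (f n) s = n) \<and> (\<forall>n. adj T (f n) (f (Suc n)))"
proof -
  let ?P = "\<lambda>n v. v \<in> verts T \<and> gd T v s = n \<and> (n \<le> gd T s t \<longrightarrow> gd T v t = gd T s t - n)"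
  have "\<exists>f. \<forall>n. ?P n (f n) \<and> adj T (f n) (f (Suc n))"
  proof (rule dependent_nat_choice)
    show "\<exists>v. ?P 0 v" using assms by (intro exI[of _ s]) auto
  next
    fix v n assume v: "?P n v"
    show "\<exists>w. ?P (Suc n) w \<and> adj T v w"
    proof (cases "n < gd T s t")
      case True
      then have "gd T v t = Suc (gd T s t - Suc n)" using v by auto
      then obtain w where w: "adj T v w" "gd T w t = gd T s t - Suc n"
        using gd_closer[of v t "gd T s t - Suc n"] v assms(2) by blast
      have "w \<in> verts T" using w adjD by auto
      have "gd T s t \<le> gd T w s + gd T w t"
        using gd_triangle[of s w t] assms \<open>w \<in> verts T\<close> by (simp add: gd_sym)
      then have "gd T w s = Suc n"
        using gd_step[OF assms(1) w(1)] v w True by auto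
      then show ?thesis using w \<open>w \<in> verts T\<close> by auto
    next
      case False
      have "children s v \<noteq> {}" using card_children[of s v] v assms d by (auto split: if_splits)
      then show ?thesis using False v adjD unfolding children_def by auto
    qed
  qed
  then obtain f where f: "\<And>n. ?P n (f n)" "\<And>n. adj T (f n) (f (Suc n))" by auto
  have "f 0 = s" "f (gd T s t) = t"
    using f(1)[of 0] f(1)[of "gd T s t"] gd_eq_0[of "f 0" s] gd_eq_0[of "f (gd T s t)" t] assms by auto
  then show ?thesis using f by auto
qed

text \<open>Two rays that leave \<open>s\<close> through different neighbours are glued at
  \<open>s\<close>; the first of them runs through \<open>t\<close>.\<close>

lemma line_exists:
  assumes "s \<in> verts T" "t \<in> verts T"
  obtains u where "line u" "u 0 = s" "u (int (gd T s t)) = t"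
proof -
  obtain f where f: "f 0 = s" "f (gd T s t) = t" "\<And>n. gd T (f n) s = n"
      "\<And>n. adj T (f n) (f (Suc n))" using ray_exists[OF assms] by auto
  have "\<not> neighbours T s \<subseteq> {f 1}"
  proof
    assume "neighbours T s \<subseteq> {f 1}"
    then have "card (neighbours T s) \<le> card {f 1}" by (intro card_mono) auto
    then show False using card_neighbours[OF assms(1)] d by simp
  qed
  then obtain w where w: "adj T s w" "w \<noteq> f 1" unfolding neighbours_def by auto
  then have gw: "gd T s w = 1" "w \<in> verts T" using gd_adj adjD by auto
  obtain g where g: "g 0 = s" "g 1 = w" "\<And>n. gd T (g n) s = n"
      "\<And>n. adj T (g n) (g (Suc n))" using ray_exists[OF assms(1) gw(2)] gw(1) by auto
  define u where "u i = (if i \<ge> 0 then f (nat i) else g (nat (- i)))" for i :: int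
  have "line u"
    unfolding line_def
  proof (intro allI conjI)
    fix i :: int
    show "adj T (u i) (u (i + 1))"
    proof (cases "i \<ge> 0")
      case True
      then show ?thesis using f(4)[of "nat i"] by (simp add: u_def nat_add_distrib)
    next
      case False
      then have "nat (- i) = Suc (nat (- (i + 1)))" by auto
      then have "adj T (u i) (g (nat (- (i + 1))))"
        using g(4)[of "nat (- (i + 1))"] False by (simp add: u_def adj_sym)
      moreover have "g (nat (- (i + 1))) = u (i + 1)"
        using False f(1) g(1) by (cases "i + 1 = 0") (auto simp: u_def)
      ultimately show ?thesis by simp
    qed
    show "u i \<noteq> u (i + 2)"
    proof
      assume eq: "u i = u (i + 2)"
      have gu: "gd T (u i) s = nat \<bar>i\<bar>" for i using f(3) g(3) by (auto simp: u_def)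
      have "i = - 1" using eq gu[of i] gu[of "i + 2"] by (auto simp: abs_if split: if_splits)
      then show False using eq w(2) g(2) by (auto simp: u_def)
    qed
  qed
  moreover have "u 0 = s" "u (int (gd T s t)) = t" using f by (auto simp: u_def)
  ultimately show thesis using that by blast
qed

end

section \<open>Homogeneity of the tree along lines\<close>

lemma bij_betw_extend:
  assumes "finite A" "finite B" "card A = card B"
    "inj_on u J" "inj_on u' J" "u ` J \<subseteq> A" "u' ` J \<subseteq> B"
  shows "\<exists>b. bij_betw b A B \<and> (\<forall>j\<in>J. b (u j) = u' j)"
proof -
  have "finite (u ` J)" using assms finite_subset by auto
  then have fJ: "finite J" using assms(4) by (rule finite_imageD)
  have "card (A - u ` J) = card A - card J" "card (B - u' ` J) = card B - card J"
    using fJ assms by (simp_all add: card_Diff_subset card_image)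
  then have "card (A - u ` J) = card (B - u' ` J)" using assms(3) by simp
  then obtain c where c: "bij_betw c (A - u ` J) (B - u' ` J)"
    using finite_same_card_bij[of "A - u ` J" "B - u' ` J"] assms(1,2) by auto
  define b where "b x = (if x \<in> u ` J then u' (inv_into J u x) else c x)" for x
  have bu: "b (u j) = u' j" if "j \<in> J" for j using that assms(4) by (simp add: b_def)
  have "bij_betw b (u ` J) (u' ` J)"
    unfolding bij_betw_def
  proof
    show "inj_on b (u ` J)" using assms(5) bu by (auto simp: inj_on_def)
    show "b ` u ` J = u' ` J" using bu by (auto simp: image_image)
  qed
  moreover have "bij_betw b (A - u ` J) (B - u' ` J)"
    using c by (rule bij_betw_cong[THEN iffD1, rotated]) (auto simp: b_def)
  ultimately have "bij_betw b (u ` J \<union> (A - u ` J)) (u' ` J \<union> (B - u' ` J))"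
    by (rule bij_betw_combine) auto
  moreover have "u ` J \<union> (A - u ` J) = A" "u' ` J \<union> (B - u' ` J) = B" using assms by auto
  ultimately show ?thesis using bu by auto
qed

context cgraph
begin

lemma adj_iff_gd: "x \<in> verts G \<Longrightarrow> y \<in> verts G \<Longrightarrow> adj G x y \<longleftrightarrow> gd G x y = 1"
proof
  assume a: "x \<in> verts G" "y \<in> verts G" "gd G x y = 1"
  then have "gd G x y = Suc 0" by simp
  then obtain z where z: "adj G x z" "gd G z y = 0" by (rule gd_closer[OF a(1,2)])
  then have "z = y" using gd_eq_0[of z y] adjD[OF z(1)] a by auto
  then show "adj G x y" using z by simp
qed (use gd_adj in auto)

end

context rtree
begin

lemma mem_children_line:
  assumes "line u" "line u'"
  shows "u j \<in> children (u 0) (u i) \<longleftrightarrow> u' j \<in> children (u' 0) (u' i)"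
  using assms by (simp add: children_def adj_iff_gd line_gd)

text \<open>The automorphism is built outwards from the root \<open>u 0\<close>. A vertex and its
  image have equally many children, so these can be matched by a bijection, and where the line
  passes, the bijection is chosen to follow it. Prescribing a whole line yields rotations about a
  vertex and translations along a line by one construction.\<close>

lemma line_homogeneous:
  assumes u: "line u" and u': "line u'"
  shows "\<exists>\<phi>. is_automorphism T \<phi> \<and> (\<forall>i. \<phi> (u i) = u' i)"
proof -
  let ?r = "u 0" and ?r' = "u' 0"
  have V: "?r \<in> verts T" "?r' \<in> verts T" using u u' by auto
  define good where "good p q b \<longleftrightarrow> bij_betw b (children ?r p) (children ?r' q) \<and>
      (\<forall>i j. p = u i \<longrightarrow> q = u' i \<longrightarrow> u j \<in> children ?r p \<longrightarrow> b (u j) = u' j)" for p q b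
  define \<beta> where "\<beta> p q = (SOME b. good p q b)" for p q
  have \<beta>: "good p q (\<beta> p q)" if "p \<in> verts T" "q \<in> verts T" "p = ?r \<longleftrightarrow> q = ?r'" for p q
  proof -
    have c: "card (children ?r p) = card (children ?r' q)"
      using that card_children V by auto
    have f: "finite (children ?r p)" "finite (children ?r' q)"
      using that finite_children V by auto
    have "\<exists>b. good p q b"
    proof (cases "\<exists>i. p = u i \<and> q = u' i")
      case True
      then obtain i where i: "p = u i" "q = u' i" by auto
      let ?J = "{j. u j \<in> children ?r p}"
      have J: "?J = {j. u' j \<in> children ?r' q}" unfolding i using mem_children_line[OF u u'] by auto
      have "inj_on u ?J" "inj_on u' ?J" using line_inj u u' by (auto simp: inj_on_def)
      moreover have "u ` ?J \<subseteq> children ?r p" by auto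
      moreover have "u' ` ?J \<subseteq> children ?r' q" unfolding J by auto
      ultimately obtain b where "bij_betw b (children ?r p) (children ?r' q)"
          "\<forall>j\<in>?J. b (u j) = u' j"
        using bij_betw_extend[OF f c, of u ?J u'] by blast
      then show ?thesis unfolding good_def by (intro exI[of _ b]) auto
    next
      case False
      obtain b where "bij_betw b (children ?r p) (children ?r' q)"
        using finite_same_card_bij[OF f c] by auto
      then show ?thesis using False unfolding good_def by auto
    qed
    then show ?thesis unfolding \<beta>_def by (rule someI_ex)
  qed
  \<comment> \<open>Recursion on the distance to the root: \<open>f\<close> is the map on the
    previous sphere, and at distance 0 the value is the new root.\<close>
  define \<Phi> where "\<Phi> = rec_nat (\<lambda>v. ?r') (\<lambda>n f v. \<beta> (par ?r v) (f (par ?r v)) v)"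
  define \<phi> where "\<phi> v = \<Phi> (gd T v ?r) v" for v
  have \<phi>_r: "\<phi> ?r = ?r'" by (simp add: \<phi>_def \<Phi>_def)
  have \<phi>_rec: "\<phi> v = \<beta> (par ?r v) (\<phi> (par ?r v)) v" if "v \<in> verts T" "v \<noteq> ?r" for v
    unfolding \<phi>_def using par(2)[OF V(1) that] by (simp add: \<Phi>_def)
  have base: "\<phi> v \<in> verts T \<and> gd T (\<phi> v) ?r' = gd T v ?r" if "v \<in> verts T" for v
    using that
  proof (induction "gd T v ?r" arbitrary: v)
    case 0
    then show ?case using gd_eq_0[of v ?r] V \<phi>_r by auto
  next
    case (Suc n)
    let ?p = "par ?r v"
    have v: "v \<noteq> ?r" using Suc by auto
    have p: "adj T v ?p" "gd T v ?r = Suc (gd T ?p ?r)" using par[OF V(1) Suc(3) v] by auto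
    then have pV: "?p \<in> verts T" using adjD by auto
    then have IH: "\<phi> ?p \<in> verts T" "gd T (\<phi> ?p) ?r' = gd T ?p ?r" using Suc p by auto
    then have "?p = ?r \<longleftrightarrow> \<phi> ?p = ?r'" using pV V gd_eq_0[of ?p ?r] gd_eq_0[of "\<phi> ?p" ?r'] by auto
    then have "good ?p (\<phi> ?p) (\<beta> ?p (\<phi> ?p))" using \<beta> pV IH by auto
    moreover have "v \<in> children ?r ?p" using p adj_sym[of T] unfolding children_def by auto
    ultimately have "\<phi> v \<in> children ?r' (\<phi> ?p)"
      unfolding \<phi>_rec[OF Suc(3) v] good_def bij_betw_def by auto
    then show ?case using adjD IH p unfolding children_def by auto
  qed
  have root: "v = ?r \<longleftrightarrow> \<phi> v = ?r'" if "v \<in> verts T" for v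
    using base[OF that] gd_eq_0[of v ?r] gd_eq_0[of "\<phi> v" ?r'] V that by auto
  have good: "good p (\<phi> p) (\<beta> p (\<phi> p))" if "p \<in> verts T" for p
    using \<beta> base that root by auto
  have \<phi>_child: "\<phi> v = \<beta> p (\<phi> p) v" if "v \<in> children ?r p" for p v
  proof -
    have v: "adj T v p" "gd T v ?r = Suc (gd T p ?r)" "v \<in> verts T"
      using that adj_sym[of T] adjD unfolding children_def by auto
    then have "par ?r v = p" "v \<noteq> ?r" using par_eq[OF V(1)] by auto
    then show ?thesis using \<phi>_rec v by auto
  qed
  have bij: "bij_betw \<phi> (children ?r p) (children ?r' (\<phi> p))" if "p \<in> verts T" for p
    using good[OF that] \<phi>_child bij_betw_cong[of "children ?r p" \<phi> "\<beta> p (\<phi> p)"]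
    unfolding good_def by auto
  have par_\<phi>: "par ?r' (\<phi> v) = \<phi> (par ?r v)" "adj T (\<phi> v) (\<phi> (par ?r v))"
    if v: "v \<in> verts T" "v \<noteq> ?r" for v
  proof -
    let ?p = "par ?r v"
    have p: "adj T v ?p" "gd T v ?r = Suc (gd T ?p ?r)" using par[OF V(1) v] by auto
    then have "v \<in> children ?r ?p" "?p \<in> verts T" using adj_sym[of T] adjD unfolding children_def by auto
    then have "\<phi> v \<in> children ?r' (\<phi> ?p)" using bij unfolding bij_betw_def by auto
    then show "par ?r' (\<phi> v) = \<phi> (par ?r v)" "adj T (\<phi> v) (\<phi> (par ?r v))"
      using par_eq[OF V(2)] adj_sym[of T] unfolding children_def by auto
  qed
  have inj: "v = w" if "v \<in> verts T" "w \<in> verts T" "\<phi> v = \<phi> w" for v w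
    using that
  proof (induction "gd T v ?r" arbitrary: v w)
    case 0
    have v: "v = ?r" using gd_eq_0[OF 0(2) V(1)] 0(1) by metis
    have "\<phi> w = ?r'" using 0(4) \<phi>_r unfolding v by metis
    then show ?case using root[OF 0(3)] v by metis
  next
    case (Suc n)
    have ne: "v \<noteq> ?r" using Suc(2) by auto
    then have ne': "w \<noteq> ?r" using root[OF Suc(3)] root[OF Suc(4)] Suc(5) by simp
    note ne = ne ne'
    let ?p = "par ?r v" and ?q = "par ?r w"
    have p: "adj T v ?p" "gd T v ?r = Suc (gd T ?p ?r)" using par[OF V(1) Suc(3) ne(1)] by auto
    have q: "adj T w ?q" "gd T w ?r = Suc (gd T ?q ?r)" using par[OF V(1) Suc(4) ne(2)] by auto
    have "\<phi> ?p = \<phi> ?q" using par_\<phi>(1)[OF Suc(3) ne(1)] par_\<phi>(1)[OF Suc(4) ne(2)] Suc(5) by simp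
    moreover have "n = gd T ?p ?r" using Suc(2) p(2) by simp
    ultimately have pq: "?p = ?q"
      using Suc(1)[of ?p ?q] adjD[OF p(1)] adjD[OF q(1)] by blast
    have "v \<in> children ?r ?p" "w \<in> children ?r ?p"
      using p q pq adj_sym[of T] unfolding children_def by auto
    then show ?case using bij[of ?p] adjD[OF p(1)] Suc(5) unfolding bij_betw_def by (auto dest: inj_onD)
  qed
  have surj: "\<exists>v\<in>verts T. \<phi> v = w" if "w \<in> verts T" for w
    using that
  proof (induction "gd T w ?r'" arbitrary: w)
    case 0
    then show ?case using gd_eq_0[of w ?r'] V \<phi>_r by auto
  next
    case (Suc n)
    have ne: "w \<noteq> ?r'" using Suc by auto
    let ?q = "par ?r' w"
    have q: "adj T w ?q" "gd T w ?r' = Suc (gd T ?q ?r')" using par[OF V(2) Suc(3) ne] by auto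
    then obtain p where p: "p \<in> verts T" "\<phi> p = ?q" using Suc(1)[of ?q] Suc(2) adjD by auto
    have "w \<in> children ?r' (\<phi> p)" using q p adj_sym[of T] unfolding children_def by auto
    then have "w \<in> \<phi> ` children ?r p" using bij[OF p(1)] unfolding bij_betw_def by auto
    then show ?case using adjD unfolding children_def by auto
  qed
  have step: "adj T v w" if "v \<in> verts T" "w \<in> verts T" "adj T (\<phi> v) (\<phi> w)"
      "gd T (\<phi> v) ?r' = Suc (gd T (\<phi> w) ?r')" for v w
  proof -
    have v: "v \<noteq> ?r" using that(4) \<phi>_r by auto
    have "\<phi> (par ?r v) = \<phi> w" using par_eq[OF V(2) that(3,4)] par_\<phi>[OF that(1) v] by simp
    then show ?thesis using inj[of "par ?r v" w] par[OF V(1) that(1) v] that adjD by auto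
  qed
  have "is_automorphism T \<phi>"
    unfolding is_automorphism_def
  proof (intro conjI ballI)
    show "bij_betw \<phi> (verts T) (verts T)"
      unfolding bij_betw_def inj_on_def using inj surj base by blast
    fix v w assume vw: "v \<in> verts T" "w \<in> verts T"
    show "adj T (\<phi> v) (\<phi> w) \<longleftrightarrow> adj T v w"
    proof
      assume a: "adj T v w"
      show "adj T (\<phi> v) (\<phi> w)"
        using gd_step[OF V(1) a]
      proof
        assume "gd T w ?r = Suc (gd T v ?r)"
        then have "par ?r w = v" "w \<noteq> ?r" using par_eq[OF V(1)] a adj_sym[of T] by auto
        then show ?thesis using par_\<phi>(2)[OF vw(2)] adj_sym[of T] by auto
      next
        assume "gd T v ?r = Suc (gd T w ?r)"
        then have "par ?r v = w" "v \<noteq> ?r" using par_eq[OF V(1)] a by auto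
        then show ?thesis using par_\<phi>(2)[OF vw(1)] by auto
      qed
    next
      assume a: "adj T (\<phi> v) (\<phi> w)"
      show "adj T v w"
        using gd_step[OF V(2) a] step[of v w] step[of w v] vw a adj_sym[of T] by auto
    qed
  qed
  moreover have "\<phi> (u i) = u' i" for i
  proof -
    have "\<phi> (u (int n)) = u' (int n) \<and> \<phi> (u (- int n)) = u' (- int n)" for n
    proof (induction n)
      case (Suc n)
      have *: "\<phi> (u j) = u' j" if "u j \<in> children ?r (u i)" "\<phi> (u i) = u' i" for i j
        using good[of "u i"] \<phi>_child[OF that(1)] that u unfolding good_def by auto
      have "u (int (Suc n)) \<in> children ?r (u (int n))" "u (- int (Suc n)) \<in> children ?r (u (- int n))"
        using u by (auto simp: children_def adj_iff_gd line_gd nat_add_distrib)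
      then show ?case using * Suc by blast
    qed (use \<phi>_r in simp)
    from this[of "nat \<bar>i\<bar>"] show ?thesis by (cases "i \<ge> 0") auto
  qed
  ultimately show ?thesis by blast
qed

text \<open>The component of \<open>u i\<close> after the edge from \<open>u i\<close> to \<open>u (i + 1)\<close> is removed from the tree.\<close>

definition L :: "(int \<Rightarrow> 'a) \<Rightarrow> int \<Rightarrow> 'a set" where
  "L u i = {v \<in> verts T. gd T v (u i) < gd T v (u (i + 1))}"

lemma L_subset: "L u i \<subseteq> verts T"
  by (auto simp: L_def)

lemma L_step:
  assumes "line u" "v \<in> verts T"
  shows "v \<in> L u i \<longleftrightarrow> gd T v (u (i + 1)) = Suc (gd T v (u i))"
    "v \<notin> L u i \<longleftrightarrow> gd T v (u i) = Suc (gd T v (u (i + 1)))"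
  using gd_step[OF assms(2) line_adj[OF assms(1), of i]] assms by (auto simp: L_def gd_sym)

lemma L_mono:
  assumes "line u" "i \<le> j"
  shows "L u i \<subseteq> L u j"
proof
  fix v assume v: "v \<in> L u i"
  then have V: "v \<in> verts T" and lt: "gd T v (u i) < gd T v (u (i + 1))" by (auto simp: L_def)
  have "gd T v (u j) = gd T v (u i) + nat (j - i)" "gd T v (u (j + 1)) = gd T v (u i) + nat (j + 1 - i)"
    using line_increasing[OF assms(1) V lt, of "nat (j - i)"]
      line_increasing[OF assms(1) V lt, of "nat (j + 1 - i)"] assms(2) by auto
  then show "v \<in> L u j" using V assms(2) by (auto simp: L_def)
qed

lemma line_mem_L: "line u \<Longrightarrow> u j \<in> L u i \<longleftrightarrow> j \<le> i"
  by (auto simp: L_def line_gd)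

text \<open>Suppose \<open>v\<close> differs from \<open>u i\<close>. Then the neighbour of
  \<open>v\<close> towards \<open>u i\<close> and \<open>v'\<close> are both no farther from
  \<open>u (i + 1)\<close> than \<open>v\<close>, so they coincide by \<open>unique_parent\<close>,
  although \<open>v'\<close> is farther from \<open>u i\<close> than \<open>v\<close>.\<close>

lemma L_cross:
  assumes u: "line u" and a: "adj T v v'" and v: "v \<in> L u i" "v' \<notin> L u i"
  shows "v = u i \<and> v' = u (i + 1)"
proof -
  let ?a = "u i" and ?b = "u (i + 1)"
  have V: "v \<in> verts T" "v' \<in> verts T" "?a \<in> verts T" "?b \<in> verts T" using a adjD u by auto
  have 1: "gd T v ?b = Suc (gd T v ?a)" using L_step(1)[OF u V(1)] v by auto
  have 2: "gd T v' ?a = Suc (gd T v' ?b)" using L_step(2)[OF u V(2)] v by auto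
  have s: "gd T v' ?a = Suc (gd T v ?a) \<or> gd T v ?a = Suc (gd T v' ?a)"
    "gd T v' ?b = Suc (gd T v ?b) \<or> gd T v ?b = Suc (gd T v' ?b)"
    using gd_step[OF V(3) a] gd_step[OF V(4) a] by auto
  have 3: "gd T v' ?b = gd T v ?a" using 1 2 s by linarith
  show ?thesis
  proof (cases "gd T v ?a")
    case 0
    then show ?thesis using 3 gd_eq_0[of v ?a] gd_eq_0[of v' ?b] V by simp
  next
    case (Suc n)
    obtain y where y: "adj T v y" "gd T y ?a = n" by (rule gd_closer[OF V(1,3) Suc])
    have yV: "y \<in> verts T" using y adjD by auto
    have "gd T y ?b \<le> gd T v ?b"
      using gd_triangle[of y ?a ?b] y 1 Suc gd_adj[OF line_adj[OF u]] V yV by auto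
    then have "y = v'" using unique_parent[OF V(4) y(1) a] 3 1 by auto
    then show ?thesis using y 2 3 Suc by auto
  qed
qed

text \<open>The boundary edge of the reversed half-tree joins \<open>u (c - i)\<close> to
  \<open>u (c - i - 1)\<close>, which accounts for the shift by one.\<close>

lemma L_rev:
  assumes "line u"
  shows "L (\<lambda>k. u (c - k)) i = verts T - L u (c - i - 1)"
proof -
  have "v \<in> L (\<lambda>k. u (c - k)) i \<longleftrightarrow> v \<in> verts T - L u (c - i - 1)" for v
  proof (cases "v \<in> verts T")
    case True
    have e: "c - i - 1 + 1 = c - i" "c - (i + 1) = c - i - 1" by simp_all
    show ?thesis using True L_step(2)[OF assms True, of "c - i - 1"] L_step(1)[OF assms True, of "c - i - 1"]
      unfolding e by (auto simp: L_def e)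
  qed (auto simp: L_def)
  then show ?thesis by blast
qed

text \<open>A half-tree depends only on its boundary edge. An estimate for paths that start on the
  line thus carries over to any start \<open>v\<close> in the half-tree, after the line is replaced
  by one through \<open>v\<close>.\<close>

lemma line_into_L:
  assumes u: "line u" and v: "v \<in> L u i"
  obtains w where "line w" "w 0 = v" "w (int (gd T v (u i))) = u i"
    "w (int (gd T v (u i)) + 1) = u (i + 1)"
proof -
  let ?n = "gd T v (u i)"
  have V: "v \<in> verts T" using v by (auto simp: L_def)
  have n: "gd T v (u (i + 1)) = Suc ?n" using L_step(1)[OF u V] v by auto
  obtain w where w: "line w" "w 0 = v" "w (int (Suc ?n)) = u (i + 1)"
    using line_exists[OF V line_verts[OF u, of "i + 1"]] n by metis
  have "w (int ?n) = u i"
  proof (rule unique_parent[of v "u (i + 1)"])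
    show "adj T (u (i + 1)) (w (int ?n))"
      using line_adj'[OF w(1), of "int ?n"] w(3) by (simp add: add.commute)
    show "adj T (u (i + 1)) (u i)" using line_adj'[OF u] .
    show "gd T (w (int ?n)) v \<le> gd T (u (i + 1)) v" using line_gd[OF w(1), of "int ?n" 0] w(2) n by (simp add: gd_sym)
    show "gd T (u i) v \<le> gd T (u (i + 1)) v" using n by (simp add: gd_sym)
  qed (rule V)
  then show thesis using that w by (simp add: add.commute)
qed

end

section \<open>Sharpness of the susceptibility transition\<close>

lemma inj_image_edges:
  assumes "inj_on h W" "\<Union>F \<subseteq> W"
  shows "inj_on ((`) h) F"
  using assms by (meson Union_least Union_upper inj_on_image inj_on_subset)

lemma rs_image:
  assumes "fin_edges F" "inj_on h W" "\<Union>F \<subseteq> W" "x \<in> W" "A \<subseteq> W"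
  shows "rs p ((`) h ` F) (h x) (h ` A) = rs p F x A"
proof -
  have F: "finite F" using assms by (simp add: fin_edges_def)
  have "\<Union>((`) h ` F) = h ` \<Union>F" by auto
  then have "h ` A \<inter> insert (h x) (\<Union>((`) h ` F)) = h ` A \<inter> h ` (insert x (\<Union>F))" by simp
  also have "\<dots> = h ` (A \<inter> insert x (\<Union>F))"
    using assms by (intro inj_on_image_Int[symmetric, of h W]) auto
  finally have e: "h ` A \<inter> insert (h x) (\<Union>((`) h ` F)) = h ` (A \<inter> insert x (\<Union>F))" .
  have i: "inj_on h (A \<inter> insert x (\<Union>F))" using assms by (auto intro: inj_on_subset)
  have "rs p ((`) h ` F) (h x) (h ` A) = (\<Sum>y\<in>A \<inter> insert x (\<Union>F). tau p ((`) h ` F) (h x) (h y))"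
    unfolding rs_def e using i by (simp add: sum.reindex)
  also have "\<dots> = rs p F x A"
    unfolding rs_def using assms F by (intro sum.cong refl tau_image[OF F assms(2,3)]) auto
  finally show ?thesis .
qed

locale lfgraph = cgraph G for G :: "'a graph" +
  assumes lf: "locally_finite G"
begin

lemma Union_edges: "F \<subseteq> edges G \<Longrightarrow> \<Union>F \<subseteq> verts G"
proof clarify
  fix v e assume "F \<subseteq> edges G" "v \<in> e" "e \<in> F"
  then have "e \<in> edges G" "v \<in> e" by auto
  then show "v \<in> verts G" using adjD by (elim edgeE) auto
qed

lemma finite_edge: "e \<in> edges G \<Longrightarrow> finite e"
  by (erule edgeE) auto

lemma fin_edges: "finite F \<Longrightarrow> F \<subseteq> edges G \<Longrightarrow> fin_edges F"
  unfolding fin_edges_def using finite_edge by auto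

lemma finite_inner_edges: "finite S \<Longrightarrow> finite (edges G \<inter> inner S)"
  by (rule finite_subset[of _ "Pow S"]) (auto simp: inner_def)

lemma finite_exits_edges:
  assumes "finite S" "S \<subseteq> verts G"
  shows "finite (exits (edges G) S)"
proof -
  have "exits (edges G) S \<subseteq> (SIGMA a:S. neighbours G a)"
    by (auto simp: exits_def neighbours_def adj_def)
  moreover have "finite (SIGMA a:S. neighbours G a)"
    using assms lf unfolding locally_finite_def by auto
  ultimately show ?thesis by (rule finite_subset)
qed

lemma automorphism_edges:
  assumes "is_automorphism G \<phi>" "F \<subseteq> edges G"
  shows "(`) \<phi> ` F \<subseteq> edges G"
proof clarify
  fix e assume "e \<in> F"
  then have "e \<in> edges G" using assms by auto
  then obtain x y where "e = {x, y}" "adj G x y" by (rule edgeE)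
  then have "adj G (\<phi> x) (\<phi> y)" using assms adjD[of x y] unfolding is_automorphism_def by auto
  then show "\<phi> ` e \<in> edges G" using \<open>e = {x, y}\<close> unfolding adj_def by simp
qed

lemma automorphism_inj: "is_automorphism G \<phi> \<Longrightarrow> inj_on \<phi> (verts G)"
  unfolding is_automorphism_def bij_betw_def by auto

lemma automorphism_verts: "is_automorphism G \<phi> \<Longrightarrow> x \<in> verts G \<Longrightarrow> \<phi> x \<in> verts G"
  unfolding is_automorphism_def bij_betw_def by auto

lemma automorphism_tau:
  assumes "is_automorphism G \<phi>" "finite F" "F \<subseteq> edges G" "x \<in> verts G" "y \<in> verts G"
  shows "tau p ((`) \<phi> ` F) (\<phi> x) (\<phi> y) = tau p F x y"
  using assms by (intro tau_image[OF _ automorphism_inj] Union_edges) auto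

lemma automorphism_rs:
  assumes "is_automorphism G \<phi>" "finite F" "F \<subseteq> edges G" "x \<in> verts G" "A \<subseteq> verts G"
  shows "rs p ((`) \<phi> ` F) (\<phi> x) (\<phi> ` A) = rs p F x A"
  using assms by (intro rs_image[OF _ automorphism_inj] Union_edges fin_edges) auto

text \<open>The functional of Duminil-Copin and Tassion: the expected number of open boundary edges
  of \<open>S\<close> whose inner end is joined to \<open>x\<close> inside \<open>S\<close>.\<close>

definition phi :: "real \<Rightarrow> 'a set \<Rightarrow> 'a \<Rightarrow> real" where
  "phi p S x = (\<Sum>(a, b)\<in>exits (edges G) S. tau p (edges G \<inter> inner S) x a * p)"

lemma phi_nonneg: "0 \<le> p \<Longrightarrow> p \<le> 1 \<Longrightarrow> 0 \<le> phi p S x"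
  unfolding phi_def by (intro sum_nonneg) (auto split: prod.splits)

lemma phi_mono:
  assumes "0 \<le> p" "p \<le> q" "q \<le> 1" "finite S"
  shows "phi p S x \<le> phi q S x"
  unfolding phi_def using assms
  by (intro sum_mono) (auto split: prod.splits intro!: mult_mono tau_mono_p finite_inner_edges)

lemma automorphism_phi:
  assumes \<phi>: "is_automorphism G \<phi>" and S: "finite S" "S \<subseteq> verts G" "x \<in> S"
  shows "phi p (\<phi> ` S) (\<phi> x) \<le> phi p S x"
proof -
  have inj: "inj_on \<phi> (verts G)" by (rule automorphism_inj[OF \<phi>])
  have surj: "\<phi> ` verts G = verts G" using \<phi> unfolding is_automorphism_def bij_betw_def by auto
  have ad: "adj G (\<phi> a) (\<phi> b) \<longleftrightarrow> adj G a b" if "a \<in> verts G" "b \<in> verts G" for a b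
    using \<phi> that unfolding is_automorphism_def by auto
  have ex: "exits (edges G) (\<phi> ` S) = map_prod \<phi> \<phi> ` exits (edges G) S"
  proof (intro set_eqI iffI)
    fix z assume z: "z \<in> exits (edges G) (\<phi> ` S)"
    obtain a' b' where zz: "z = (a', b')" by (cases z)
    then have "adj G a' b'" "a' \<in> \<phi> ` S" "b' \<notin> \<phi> ` S" using z by (auto simp: exits_def adj_def)
    moreover from this obtain a where a: "a \<in> S" "a' = \<phi> a" by auto
    moreover have "b' \<in> \<phi> ` verts G" unfolding surj using \<open>adj G a' b'\<close> adjD by auto
    then obtain b where b: "b \<in> verts G" "b' = \<phi> b" by auto
    ultimately have "adj G a b" "b \<notin> S" using ad[of a b] S by auto
    then have "(a, b) \<in> exits (edges G) S" using a by (auto simp: exits_def adj_def)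
    then show "z \<in> map_prod \<phi> \<phi> ` exits (edges G) S" using zz a b by force
  next
    fix z assume "z \<in> map_prod \<phi> \<phi> ` exits (edges G) S"
    then obtain a b where z: "z = (\<phi> a, \<phi> b)" and ab: "adj G a b" "a \<in> S" "b \<notin> S"
      by (auto simp: exits_def adj_def)
    have "adj G (\<phi> a) (\<phi> b)" using ad ab adjD by metis
    moreover have "\<phi> b \<notin> \<phi> ` S"
      using inj_on_image_mem_iff[OF inj, of b S] ab S adjD[OF ab(1)] by auto
    ultimately show "z \<in> exits (edges G) (\<phi> ` S)" using z ab by (auto simp: exits_def adj_def)
  qed
  have eq: "edges G \<inter> inner (\<phi> ` S) = (`) \<phi> ` (edges G \<inter> inner S)"
  proof (intro set_eqI iffI)
    fix e assume e: "e \<in> edges G \<inter> inner (\<phi> ` S)"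
    then obtain a' b' where e': "e = {a', b'}" "adj G a' b'" using edgeE by blast
    then obtain a b where ab: "a \<in> S" "b \<in> S" "a' = \<phi> a" "b' = \<phi> b" using e by (auto simp: inner_def)
    then have "adj G a b" using ad[of a b] e' S by auto
    then show "e \<in> (`) \<phi> ` (edges G \<inter> inner S)"
      using e' ab by (intro image_eqI[of _ _ "{a, b}"]) (auto simp: adj_def inner_def)
  next
    fix e assume "e \<in> (`) \<phi> ` (edges G \<inter> inner S)"
    then show "e \<in> edges G \<inter> inner (\<phi> ` S)"
      using automorphism_edges[OF \<phi>, of "edges G \<inter> inner S"] by (auto simp: inner_def)
  qed
  have "inj_on (map_prod \<phi> \<phi>) (exits (edges G) S)"
    using inj unfolding exits_def inj_on_def using Union_edges[of "edges G"] by (auto simp: subset_iff) blast+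
  then have "phi p (\<phi> ` S) (\<phi> x) = (\<Sum>(a, b)\<in>exits (edges G) S. tau p ((`) \<phi> ` (edges G \<inter> inner S)) (\<phi> x) (\<phi> a) * p)"
    unfolding phi_def ex eq by (simp add: sum.reindex case_prod_unfold)
  also have "\<dots> = phi p S x"
    unfolding phi_def
  proof (intro sum.cong refl, clarify)
    fix a b assume "(a, b) \<in> exits (edges G) S"
    then have "a \<in> S" by (auto simp: exits_def)
    then have "tau p ((`) \<phi> ` (edges G \<inter> inner S)) (\<phi> x) (\<phi> a) = tau p (edges G \<inter> inner S) x a"
      using S by (intro automorphism_tau[OF \<phi>] finite_inner_edges) auto
    then show "tau p ((`) \<phi> ` (edges G \<inter> inner S)) (\<phi> x) (\<phi> a) * p = tau p (edges G \<inter> inner S) x a * p"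
      by simp
  qed
  finally show ?thesis by simp
qed

text \<open>Simon's inequality at a vertex where the susceptibility in \<open>F\<close> takes its
  largest value \<open>m\<close> gives \<open>m \<le> M + r * m\<close>. As \<open>F\<close> is
  finite, \<open>m\<close> is a finite number and can be absorbed; the resulting bound no longer
  depends on \<open>F\<close>.\<close>

lemma susceptibility_bound:
  assumes p: "0 \<le> p" "p \<le> 1" and r: "r < 1"
    and S: "\<And>x. x \<in> verts G \<Longrightarrow> \<exists>S. finite S \<and> S \<subseteq> verts G \<and> x \<in> S \<and> card S \<le> M \<and> phi p S x \<le> r"
    and F: "finite F" "F \<subseteq> edges G" and o: "o' \<in> verts G"
  shows "rs p F o' (verts G) \<le> real M / (1 - r)"
proof -
  have r0: "0 \<le> r" using S[OF o] phi_nonneg[OF p] by (meson order_trans)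
  have fe: "fin_edges F" using F by (rule fin_edges)
  let ?W = "insert o' (\<Union>F)"
  have W: "finite ?W" "?W \<subseteq> verts G" using fe o Union_edges[OF F(2)] by (auto simp: fin_edges_def)
  define m where "m = Max ((\<lambda>x. rs p F x (verts G)) ` ?W)"
  have m: "rs p F x (verts G) \<le> m" if "x \<in> ?W" for x
    unfolding m_def using W that by (intro Max_ge) auto
  have "m \<in> (\<lambda>x. rs p F x (verts G)) ` ?W" unfolding m_def using W by (intro Max_in) auto
  then obtain x where x: "x \<in> ?W" "m = rs p F x (verts G)" by auto
  obtain S where S: "finite S" "S \<subseteq> verts G" "x \<in> S" "card S \<le> M" "phi p S x \<le> r"
    using S x W by blast
  let ?V = "verts G \<inter> insert x (\<Union>F)"
  have V: "finite ?V" using fe by (auto simp: fin_edges_def)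
  have m0: "0 \<le> m" using x rs_nonneg[OF p] by auto
  have "m = (\<Sum>y\<in>?V \<inter> S. tau p F x y) + (\<Sum>y\<in>?V - S. tau p F x y)"
    unfolding x(2) rs_def using V by (rule sum.Int_Diff)
  also have "(\<Sum>y\<in>?V \<inter> S. tau p F x y) \<le> (\<Sum>y\<in>?V \<inter> S. 1)"
    using p F by (intro sum_mono tau_le_1) auto
  also have "\<dots> \<le> real M" using S card_mono[of S "?V \<inter> S"] by simp
  also have "(\<Sum>y\<in>?V - S. tau p F x y)
      \<le> (\<Sum>y\<in>?V - S. \<Sum>(a, b)\<in>exits F S. tau p (F \<inter> inner S) x a * p * tau p F b y)"
    using S F p by (intro sum_mono Simon) auto
  also have "\<dots> = (\<Sum>(a, b)\<in>exits F S. \<Sum>y\<in>?V - S. tau p (F \<inter> inner S) x a * p * tau p F b y)"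
    unfolding case_prod_unfold by (rule sum.swap)
  also have "\<dots> \<le> (\<Sum>(a, b)\<in>exits F S. tau p (edges G \<inter> inner S) x a * p * m)"
  proof (rule sum_mono, clarify)
    fix a b assume ab: "(a, b) \<in> exits F S"
    have b: "b \<in> ?W" using ab by (auto simp: exits_def)
    have "(\<Sum>y\<in>?V - S. tau p F b y) \<le> rs p F b (verts G)"
      using V p by (intro sum_tau_le_rs fe) auto
    then have 1: "(\<Sum>y\<in>?V - S. tau p F b y) \<le> m" using m[OF b] by simp
    have 2: "tau p (F \<inter> inner S) x a \<le> tau p (edges G \<inter> inner S) x a"
      using F S p by (intro tau_mono finite_inner_edges) auto
    have "(\<Sum>y\<in>?V - S. tau p (F \<inter> inner S) x a * p * tau p F b y)
        = (tau p (F \<inter> inner S) x a * p) * (\<Sum>y\<in>?V - S. tau p F b y)" by (simp add: sum_distrib_left)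
    also have "\<dots> \<le> (tau p (edges G \<inter> inner S) x a * p) * m"
      using 1 2 p by (intro mult_mono mult_right_mono mult_nonneg_nonneg) (auto intro: sum_nonneg)
    finally show "(\<Sum>y\<in>?V - S. tau p (F \<inter> inner S) x a * p * tau p F b y)
       \<le> tau p (edges G \<inter> inner S) x a * p * m" .
  qed
  also have "\<dots> \<le> (\<Sum>(a, b)\<in>exits (edges G) S. tau p (edges G \<inter> inner S) x a * p * m)"
    using S F p m0 by (intro sum_mono2 finite_exits_edges) (auto simp: exits_def split: prod.splits)
  also have "\<dots> = phi p S x * m"
    unfolding phi_def sum_distrib_right by (simp add: case_prod_unfold)
  also have "\<dots> \<le> r * m" using S m0 by (intro mult_right_mono) auto
  finally have "m * (1 - r) \<le> real M" by (simp add: algebra_simps)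
  then have "m \<le> real M / (1 - r)" using r by (simp add: field_simps)
  then show ?thesis using m[of o'] by simp
qed

section \<open>The differential inequality for reaching distance \<open>N\<close>\<close>

definition reach :: "nat \<Rightarrow> 'a \<Rightarrow> 'a set set \<Rightarrow> bool" where
  "reach N x U \<longleftrightarrow> (\<exists>y\<in>verts G. gd G x y = N \<and> conn U x y)"

definition ball_edges :: "'a \<Rightarrow> nat \<Rightarrow> 'a set set" where
  "ball_edges x N = edges G \<inter> inner (cball x N)"

lemma finite_ball_edges: "x \<in> verts G \<Longrightarrow> finite (ball_edges x N)"
  unfolding ball_edges_def using finite_cball[OF lf] by (intro finite_inner_edges)

lemma mono_reach: "mono (reach N x)"
  unfolding reach_def mono_def le_bool_def by (meson conn_mono)

text \<open>The random set \<open>S(U)\<close> of vertices that are not joined to the sphere of radius \<open>N\<close> is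
  determined by the edges outside \<open>inner S\<close>; this independence is the heart of the
  Duminil-Copin--Tassion argument.\<close>

lemma reach_derivative:
  assumes o: "o' \<in> verts G" and N: "0 < N" and q: "0 < q" "q < 1"
    and ph: "\<And>S. finite S \<Longrightarrow> S \<subseteq> verts G \<Longrightarrow> o' \<in> S \<Longrightarrow> 1 \<le> phi q S o'"
  shows "1 - Pr q (ball_edges o' N) (reach N o')
    \<le> (\<Sum>e\<in>ball_edges o' N. Exp q (ball_edges o' N - {e})
        (\<lambda>U. of_bool (reach N o' (insert e U)) - of_bool (reach N o' U)))"
proof -
  let ?F = "ball_edges o' N" and ?A = "reach N o'" and ?B = "cball o' N"
  have fF: "finite ?F" by (rule finite_ball_edges[OF o])
  have fB: "finite ?B" by (rule finite_cball[OF lf o])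
  have BV: "?B \<subseteq> verts G" by (auto simp: cball_def)
  define D where "D U v \<longleftrightarrow> (\<exists>y\<in>verts G. gd G o' y = N \<and> conn U v y)" for U v
  define SS where "SS U = {v \<in> ?B. \<not> D U v}" for U
  have oB: "o' \<in> ?B" using o by (simp add: cball_def)
  have A_iff: "?A U \<longleftrightarrow> o' \<notin> SS U" for U using oB by (simp add: SS_def D_def reach_def)
  have SSlt: "gd G o' v < N" if "v \<in> SS U" for v U
  proof (rule ccontr)
    assume "\<not> gd G o' v < N"
    then have "gd G o' v = N" "v \<in> verts G" using that by (auto simp: SS_def cball_def)
    then have "D U v" unfolding D_def by auto
    then show False using that by (auto simp: SS_def)
  qed
  have closed: "D U a \<longleftrightarrow> D U b" if "{a, b} \<in> U" for U a b
    unfolding D_def using conn_edge[OF that] conn_edge[of b a U] that conn_trans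
    by (metis insert_commute)
  have exit_edge: "{a, b} \<in> ?F \<and> b \<in> ?B" if "(a, b) \<in> exits (edges G) (SS U)" for a b U
  proof -
    have ab: "adj G a b" "a \<in> SS U" using that by (auto simp: exits_def adj_def)
    have "gd G o' b \<le> N"
      using SSlt[OF ab(2)] gd_adj_le[of b a o'] ab(1) adj_sym[of G a b] o by (simp add: gd_sym)
    then have "b \<in> ?B" using adjD[OF ab(1)] by (simp add: cball_def)
    moreover have "a \<in> ?B" using ab by (simp add: SS_def)
    ultimately show ?thesis using that unfolding ball_edges_def inner_def exits_def by auto
  qed
  \<comment> \<open>A path from \<open>v\<close> to the sphere consists of vertices joined to the
    sphere. It therefore avoids \<open>S\<close>, and none of its edges lies inside
    \<open>S\<close>.\<close>
  have out: "D (U - inner S) v" if v: "v \<in> verts G" "D U v" "v \<notin> S" and S: "SS U = S" "U \<subseteq> ?F" for U S v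
  proof -
    obtain y where y: "y \<in> verts G" "gd G o' y = N" "conn U v y" using v by (auto simp: D_def)
    from y(3) obtain xs where xs: "spath U v xs y" by (rule exE[OF conn_spath])
    have "z \<notin> S" if "z \<in> set xs" for z
    proof
      assume "z \<in> S"
      have "conn U z y"
        using conn_in_pedges(2)[OF that] xs unfolding spath_def by (meson conn_mono)
      then show False using y \<open>z \<in> S\<close> S by (auto simp: SS_def D_def)
    qed
    then have "e \<notin> inner S" if "e \<in> pedges xs" for e
    proof -
      have "e \<subseteq> set xs" "e \<in> edges G"
        using that pedges_subset xs S(2) unfolding spath_def ball_edges_def by blast+
      then obtain a b where "e = {a, b}" "a \<in> set xs" by (auto elim: edgeE)
      then show ?thesis using \<open>\<And>z. z \<in> set xs \<Longrightarrow> z \<notin> S\<close> by (auto simp: inner_def)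
    qed
    then have "conn (U - inner S) v y"
      using conn_pedges[of xs] xs unfolding spath_def
      by (metis (no_types, lifting) Diff_iff conn_mono subsetI subsetD)
    then show ?thesis using y by (auto simp: D_def)
  qed
  have dep: "SS U = S \<longleftrightarrow> SS (U - inner S) = S" if U: "U \<subseteq> ?F" for U S
  proof
    assume S: "SS U = S"
    have "D (U - inner S) v \<longleftrightarrow> D U v" if "v \<in> ?B" for v
    proof
      show "D (U - inner S) v \<Longrightarrow> D U v" unfolding D_def using conn_mono[of "U - inner S"] by blast
      assume "D U v"
      moreover from this have "v \<notin> S" using S by (auto simp: SS_def)
      ultimately show "D (U - inner S) v" using out that S U BV by blast
    qed
    then show "SS (U - inner S) = S" using S by (auto simp: SS_def)
  next
    assume S: "SS (U - inner S) = S"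
    have "\<not> D U v" if v: "v \<in> S" for v
    proof
      assume "D U v"
      then obtain y where y: "y \<in> verts G" "gd G o' y = N" "conn U v y" by (auto simp: D_def)
      have yS: "y \<notin> S" using S y SSlt[of y "U - inner S"] by auto
      \<comment> \<open>Traversed from the sphere, the path enters \<open>S\<close> for the first
        time at \<open>b\<close>. Up to there it uses no edge inside \<open>S\<close>, so
        \<open>b\<close> is joined to the sphere in \<open>U - inner S\<close> as well and cannot
        belong to \<open>S\<close>.\<close>
      have "conn U y v" using y(3) conn_sym[of U y v] by simp
      then obtain xs where xs: "spath U y xs v" by (rule exE[OF conn_spath])
      then obtain as a b bs where s: "xs = as @ a # b # bs" "set (as @ [a]) \<subseteq> - S" "b \<notin> - S"
        using path_exit[of U y xs v "- S"] v yS by auto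
      note parts = spath_parts[OF xs[unfolded s]]
      have "e \<notin> inner S" if "e \<in> insert {a, b} (pedges (as @ [a]))" for e
      proof (cases "e = {a, b}")
        case True
        then show ?thesis using s by (auto simp: inner_def)
      next
        case False
        then have "e \<subseteq> - S" "e \<in> edges G"
          using that pedges_subset[of e "as @ [a]"] s parts U unfolding ball_edges_def by blast+
        then show ?thesis by (auto simp: inner_def elim!: edgeE)
      qed
      then have "insert {a, b} (pedges (as @ [a])) \<subseteq> U - inner S" using parts by blast
      then have "conn (U - inner S) y a" "conn (U - inner S) a b"
        using conn_mono[OF parts(1)] conn_edge[of a b] by blast+
      then have "conn (U - inner S) b y" using conn_trans conn_sym[of _ y b] by metis
      then have "D (U - inner S) b" using y by (auto simp: D_def)
      moreover have "b \<in> SS (U - inner S)" using s S by auto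
      ultimately show False by (auto simp: SS_def)
    qed
    moreover have "D U v" if "v \<in> ?B" "v \<notin> S" for v
    proof -
      have "D (U - inner S) v" using S that unfolding SS_def by blast
      then show ?thesis unfolding D_def using conn_mono[of "U - inner S"] by blast
    qed
    moreover have "S \<subseteq> ?B" using S unfolding SS_def by blast
    ultimately show "SS U = S" by (auto simp: SS_def)
  qed
  let ?g = "\<lambda>S V. (\<Sum>(a, b)\<in>exits (edges G) S. of_bool (conn V o' a)) :: real"
  let ?Pow = "{S \<in> Pow ?B. o' \<in> S}"
  let ?piv = "\<lambda>e U. e \<notin> U \<and> ?A (insert e U) \<and> \<not> ?A U"
  \<comment> \<open>Only the term \<open>S = SS U\<close> survives. Every boundary edge of this set
    whose inner end is joined to \<open>o'\<close> inside it is closed and pivotal, because its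
    outer end is joined to the sphere.\<close>
  have pw: "(\<Sum>S\<in>?Pow. of_bool (SS U = S) * ?g S (U \<inter> inner S))
      \<le> (\<Sum>e\<in>?F. of_bool (?piv e U) :: real)" if U: "U \<subseteq> ?F" for U
  proof (cases "?A U")
    case True
    have "(\<Sum>S\<in>?Pow. of_bool (SS U = S) * ?g S (U \<inter> inner S) :: real) = 0"
      using True by (intro sum.neutral) (auto simp: A_iff)
    then show ?thesis by (simp add: sum_nonneg)
  next
    case False
    let ?S = "SS U"
    have oS: "o' \<in> ?S" using False A_iff by auto
    have SB: "?S \<in> ?Pow" using oS by (auto simp: SS_def)
    have fS: "finite ?S" "?S \<subseteq> verts G" using fB BV by (auto simp: SS_def)
    let ?X = "{z \<in> exits (edges G) ?S. conn (U \<inter> inner ?S) o' (fst z)}"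
    have "(\<Sum>S\<in>?Pow. of_bool (SS U = S) * ?g S (U \<inter> inner S) :: real)
       = (\<Sum>S\<in>{?S}. of_bool (SS U = S) * ?g S (U \<inter> inner S))"
      using SB fB by (intro sum.mono_neutral_right) auto
    also have "\<dots> = (\<Sum>z\<in>exits (edges G) ?S. of_bool (conn (U \<inter> inner ?S) o' (fst z)))"
      by (simp add: case_prod_unfold)
    also have "\<dots> = real (card ?X)"
      using finite_exits_edges[OF fS] by (simp add: sum.If_cases of_bool_def Int_def)
    also have "\<dots> = real (card ((\<lambda>(a, b). {a, b}) ` ?X))"
    proof -
      have "inj_on (\<lambda>(a, b). {a, b}) ?X"
        by (auto simp: inj_on_def exits_def doubleton_eq_iff)
      then show ?thesis by (simp add: card_image)
    qed
    also have "\<dots> \<le> real (card {e \<in> ?F. ?piv e U})"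
    proof -
      have "(\<lambda>(a, b). {a, b}) ` ?X \<subseteq> {e \<in> ?F. ?piv e U}"
      proof clarify
        fix a b assume ab: "(a, b) \<in> exits (edges G) ?S" "conn (U \<inter> inner ?S) o' (fst (a, b))"
        have e: "{a, b} \<in> ?F" "b \<in> ?B" using exit_edge[OF ab(1)] by auto
        have aS: "a \<in> ?S" "b \<notin> ?S" using ab by (auto simp: exits_def)
        then have Db: "D U b" "\<not> D U a" using e by (auto simp: SS_def)
        then have nU: "{a, b} \<notin> U" using closed by blast
        obtain y where y: "y \<in> verts G" "gd G o' y = N" "conn U b y" using Db by (auto simp: D_def)
        have "conn (insert {a, b} U) o' a" using ab(2) conn_mono[of "U \<inter> inner ?S" o' a "insert {a, b} U"] by auto
        moreover have "conn (insert {a, b} U) a b" by (rule conn_edge) auto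
        moreover have "conn (insert {a, b} U) b y" using y(3) by (rule conn_mono) auto
        ultimately have "conn (insert {a, b} U) o' y" using conn_trans by metis
        then have "?A (insert {a, b} U)" using y unfolding reach_def by auto
        then show "{a, b} \<in> ?F \<and> ?piv {a, b} U" using e nU False by simp
      qed
      then show ?thesis using fF by (intro of_nat_mono card_mono) auto
    qed
    also have "\<dots> = (\<Sum>e\<in>?F. of_bool (?piv e U))"
      using fF by (simp add: sum.If_cases of_bool_def Int_def)
    finally show ?thesis .
  qed
  have q': "0 \<le> q" "q \<le> 1" using q by auto
  have ind: "Exp q ?F (\<lambda>U. of_bool (SS U = S) * ?g S (U \<inter> inner S))
      \<ge> Pr q ?F (\<lambda>U. SS U = S)" if S: "S \<in> ?Pow" for S
  proof (cases "\<exists>U\<subseteq>?F. SS U = S")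
    case False
    then have "Pr q ?F (\<lambda>U. SS U = S) = Pr q ?F (\<lambda>_. False)" by (intro Pr_cong) auto
    also have "\<dots> = 0" using fF by (simp add: Pr_def)
    finally show ?thesis using q' by (auto intro!: Exp_nonneg sum_nonneg mult_nonneg_nonneg)
  next
    case True
    let ?I = "?F \<inter> inner S" and ?O = "?F - inner S"
    have fS: "finite S" "S \<subseteq> verts G" using S fB BV finite_subset by auto
    have sp: "?I \<union> ?O = ?F" "?I \<inter> ?O = {}" "finite ?I" "finite ?O" using fF by auto
    have I: "?I = edges G \<inter> inner S" using S unfolding ball_edges_def inner_def by auto
    have "Exp q ?F (\<lambda>U. of_bool (SS U = S) * ?g S (U \<inter> inner S))
       = Exp q ?F (\<lambda>U. of_bool (SS (U - inner S) = S) * ?g S (U \<inter> inner S))"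
      using dep by (intro Exp_cong) auto
    also have "\<dots> = Exp q ?I (\<lambda>U. Exp q ?O (\<lambda>V. of_bool (SS ((U \<union> V) - inner S) = S) * ?g S ((U \<union> V) \<inter> inner S)))"
      using Exp_Un[OF sp(3,4,2), of q] unfolding sp(1) .
    also have "\<dots> = Exp q ?I (\<lambda>U. Exp q ?O (\<lambda>V. of_bool (SS V = S) * ?g S U))"
    proof (intro Exp_cong)
      fix U V assume "U \<subseteq> ?I" "V \<subseteq> ?O"
      then have "(U \<union> V) - inner S = V" "(U \<union> V) \<inter> inner S = U" by auto
      then show "of_bool (SS ((U \<union> V) - inner S) = S) * ?g S ((U \<union> V) \<inter> inner S) = of_bool (SS V = S) * ?g S U"
        by simp
    qed
    also have "\<dots> = Exp q ?O (\<lambda>V. of_bool (SS V = S)) * Exp q ?I (?g S)" by (simp only: Exp_multc Exp_cmult)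
    also have "Exp q ?I (?g S) = (\<Sum>(a, b)\<in>exits (edges G) S. tau q (edges G \<inter> inner S) o' a)"
      unfolding Exp_sum case_prod_unfold tau_def Pr_def I by simp
    finally have "Exp q ?F (\<lambda>U. of_bool (SS U = S) * ?g S (U \<inter> inner S))
       = Exp q ?O (\<lambda>V. of_bool (SS V = S)) * (\<Sum>(a, b)\<in>exits (edges G) S. tau q (edges G \<inter> inner S) o' a)" .
    moreover have "(\<Sum>(a, b)\<in>exits (edges G) S. tau q (edges G \<inter> inner S) o' a) * q = phi q S o'"
      unfolding phi_def by (simp add: sum_distrib_right case_prod_unfold)
    ultimately have "Exp q ?F (\<lambda>U. of_bool (SS U = S) * ?g S (U \<inter> inner S)) * q
       = Exp q ?O (\<lambda>V. of_bool (SS V = S)) * phi q S o'" by (simp add: mult.assoc)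
    moreover have "phi q S o' \<ge> 1" using ph fS S by auto
    moreover have O: "Exp q ?O (\<lambda>V. of_bool (SS V = S)) = Pr q ?F (\<lambda>U. SS U = S)"
    proof -
      have "Pr q ?F (\<lambda>U. SS U = S) = Pr q ?F (\<lambda>U. SS (U \<inter> ?O) = S)"
      proof (rule Pr_cong)
        fix U assume U: "U \<subseteq> ?F"
        then have "U \<inter> ?O = U - inner S" by auto
        then show "(SS U = S) = (SS (U \<inter> ?O) = S)" using dep[OF U] by simp
      qed
      also have "\<dots> = Pr q ?O (\<lambda>U. SS U = S)" using fF by (intro Pr_restrict) auto
      finally show ?thesis by (simp add: Pr_def)
    qed
    moreover have "0 \<le> Pr q ?F (\<lambda>U. SS U = S)" using q' by simp
    ultimately have 1: "Pr q ?F (\<lambda>U. SS U = S) \<le> Exp q ?F (\<lambda>U. of_bool (SS U = S) * ?g S (U \<inter> inner S)) * q"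
      using mult_left_mono[of 1 "phi q S o'" "Pr q ?F (\<lambda>U. SS U = S)"] by simp
    have "0 \<le> Exp q ?F (\<lambda>U. of_bool (SS U = S) * ?g S (U \<inter> inner S))"
      using q' by (auto intro!: Exp_nonneg sum_nonneg mult_nonneg_nonneg)
    then have "Exp q ?F (\<lambda>U. of_bool (SS U = S) * ?g S (U \<inter> inner S)) * q
        \<le> Exp q ?F (\<lambda>U. of_bool (SS U = S) * ?g S (U \<inter> inner S)) * 1"
      using q' by (intro mult_left_mono) auto
    then show ?thesis using 1 by simp
  qed
  have "1 - Pr q ?F ?A = Pr q ?F (\<lambda>U. \<not> ?A U)" using fF by (simp add: Pr_compl)
  also have "\<dots> \<le> (\<Sum>S\<in>?Pow. Pr q ?F (\<lambda>U. SS U = S))"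
    using fB q' by (intro Pr_union_bound) (auto simp: A_iff SS_def)
  also have "\<dots> \<le> (\<Sum>S\<in>?Pow. Exp q ?F (\<lambda>U. of_bool (SS U = S) * ?g S (U \<inter> inner S)))"
    by (intro sum_mono ind)
  also have "\<dots> = Exp q ?F (\<lambda>U. \<Sum>S\<in>?Pow. of_bool (SS U = S) * ?g S (U \<inter> inner S))"
    by (simp only: Exp_sum)
  also have "\<dots> \<le> Exp q ?F (\<lambda>U. \<Sum>e\<in>?F. of_bool (?piv e U))"
    using q' pw by (intro Exp_mono) auto
  also have "\<dots> = (\<Sum>e\<in>?F. Pr q ?F (?piv e))" by (simp only: Exp_sum Pr_def)
  also have "\<dots> \<le> (\<Sum>e\<in>?F. Exp q (?F - {e}) (\<lambda>U. of_bool (?A (insert e U)) - of_bool (?A U)))"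
  proof (rule sum_mono)
    fix e assume e: "e \<in> ?F"
    let ?F' = "?F - {e}"
    have nn: "0 \<le> Exp q ?F' (\<lambda>U. of_bool (?A (insert e U)) - of_bool (?A U))"
      using q' mono_predD[OF mono_reach] by (intro Exp_nonneg) (auto simp: subset_insertI)
    have "?F = insert e ?F'" using e by auto
    \<comment> \<open>Pivotality does not look at \<open>e\<close> itself; the requirement that
      \<open>e\<close> be closed contributes the factor \<open>1 - q\<close>, which is at most
      1.\<close>
    then have "Pr q ?F (?piv e) = Pr q (insert e ?F') (?piv e)" by simp
    also have "\<dots> = (1 - q) * Exp q ?F' (\<lambda>U. of_bool (?piv e U)) + q * Exp q ?F' (\<lambda>U. 0)"
      unfolding Pr_def using fF by (subst Exp_insert) auto
    also have "Exp q ?F' (\<lambda>U. of_bool (?piv e U)) = Exp q ?F' (\<lambda>U. of_bool (?A (insert e U)) - of_bool (?A U))"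
    proof (rule Exp_cong)
      fix U assume "U \<subseteq> ?F'"
      then have "e \<notin> U" by auto
      then show "of_bool (?piv e U) = (of_bool (?A (insert e U)) - of_bool (?A U) :: real)"
        using mono_predD[OF mono_reach, of N o' U "insert e U"] by auto
    qed
    also have "(1 - q) * \<dots> + q * Exp q ?F' (\<lambda>U. 0) \<le> 1 * \<dots>"
      using q' nn fF mult_right_mono[of "1 - q" 1, OF _ nn] by simp
    finally show "Pr q ?F (?piv e) \<le> Exp q ?F' (\<lambda>U. of_bool (?A (insert e U)) - of_bool (?A U))" by simp
  qed
  finally show ?thesis .
qed

text \<open>The inequality \<open>f' \<ge> 1 - f\<close> makes \<open>(1 - f r) * exp r\<close>
  nonincreasing on \<open>[p, q]\<close>. The hypothesis at \<open>p\<close> extends to the whole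
  interval because \<open>phi\<close> increases with the parameter.\<close>

lemma reach_lower_bound:
  assumes o: "o' \<in> verts G" and N: "0 < N" and p: "0 < p" "p < q" "q < 1"
    and ph: "\<And>S. finite S \<Longrightarrow> S \<subseteq> verts G \<Longrightarrow> o' \<in> S \<Longrightarrow> 1 \<le> phi p S o'"
  shows "1 - exp (p - q) \<le> Pr q (ball_edges o' N) (reach N o')"
proof -
  let ?f = "\<lambda>r. Pr r (ball_edges o' N) (reach N o')"
  let ?g = "\<lambda>r. (1 - ?f r) * exp r"
  have "\<exists>y. (?g has_real_derivative y) (at r) \<and> y \<le> 0" if r: "p \<le> r" "r \<le> q" for r
  proof -
    let ?D = "\<Sum>e\<in>ball_edges o' N. Exp r (ball_edges o' N - {e})
        (\<lambda>U. of_bool (reach N o' (insert e U)) - of_bool (reach N o' U))"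
    have f: "(?f has_real_derivative ?D) (at r)"
      unfolding Pr_def by (rule Exp_derivative[OF finite_ball_edges[OF o]])
    have "1 \<le> phi r S o'" if "finite S" "S \<subseteq> verts G" "o' \<in> S" for S
      using ph[OF that] phi_mono[of p r S o'] that p r by simp
    then have "1 - ?f r \<le> ?D" using p r by (intro reach_derivative[OF o N]) auto
    then have "(0 - ?D) * exp r + exp r * (1 - ?f r) \<le> 0"
      using mult_right_mono[of "1 - ?f r" ?D "exp r"] by (simp add: algebra_simps)
    moreover have "(?g has_real_derivative ((0 - ?D) * exp r + exp r * (1 - ?f r))) (at r)"
      by (intro DERIV_mult DERIV_diff DERIV_const DERIV_exp f)
    ultimately show ?thesis by blast
  qed
  then have "?g q \<le> ?g p" using p by (intro DERIV_nonpos_imp_nonincreasing[of p q ?g]) auto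
  also have "\<dots> \<le> 1 * exp p" using p by (intro mult_right_mono) auto
  finally have "(1 - ?f q) * exp q \<le> exp p" by simp
  then have "1 - ?f q \<le> exp p / exp q" by (simp add: field_simps)
  then show ?thesis by (simp add: exp_diff)
qed

end

section \<open>Products with a regular tree\<close>

text \<open>BK in the form used for the path decompositions of row sums: every path is cut at a
  vertex of some \<open>Z i\<close>, with its two parts confined to \<open>R i\<close> and
  \<open>R' i\<close>. Summing over the target and then over the cut vertex gives a product of two
  row sums; the confinement is what allows half-tree and strip estimates to be inserted.\<close>

lemma rs_split:
  assumes fe: "fin_edges F" and p: "0 \<le> p" "p \<le> 1" and I: "finite I"
    and path: "\<And>xs y. y \<in> A \<Longrightarrow> spath F x xs y \<Longrightarrow> \<exists>i\<in>I. \<exists>as z bs. xs = as @ z # bs \<and> z \<in> Z i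
        \<and> set (as @ [z]) \<subseteq> R i \<and> set (z # bs) \<subseteq> R' i"
    and b: "\<And>i. i \<in> I \<Longrightarrow> rs p (F \<inter> inner (R i)) x (Z i) \<le> b i"
    and c: "\<And>i z. i \<in> I \<Longrightarrow> z \<in> Z i \<Longrightarrow> z \<in> insert x (\<Union>F) \<Longrightarrow> rs p (F \<inter> inner (R' i)) z A \<le> c i"
    and c0: "\<And>i. i \<in> I \<Longrightarrow> 0 \<le> c i"
  shows "rs p F x A \<le> (\<Sum>i\<in>I. b i * c i)"
proof -
  have F: "finite F" "finite (\<Union>F)" using fe by (auto simp: fin_edges_def)
  let ?W = "insert x (\<Union>F)"
  let ?J = "SIGMA i:I. Z i \<inter> ?W"
  have J: "finite ?J" using I F by auto
  have step: "tau p F x y \<le> (\<Sum>z\<in>?J. tau p (F \<inter> inner (R (fst z))) x (snd z)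
      * tau p (F \<inter> inner (R' (fst z))) (snd z) y)" if y: "y \<in> A" for y
  proof -
    have "tau p F x y \<le> (\<Sum>z\<in>?J. Pr p F (\<lambda>U. conn (U \<inter> inner (R (fst z))) x (snd z))
        * Pr p F (\<lambda>U. conn (U \<inter> inner (R' (fst z))) (snd z) y))"
      unfolding tau_def
    proof (rule BK_sum[OF F(1) p J mono_conn_Int mono_conn_Int])
      fix U assume U: "U \<subseteq> F" "conn U x y"
      from U(2) obtain xs where xs: "spath U x xs y" by (rule exE[OF conn_spath])
      then have "spath F x xs y" using U by (auto simp: spath_def)
      from path[OF y this] obtain i as z bs where s: "i \<in> I" "xs = as @ z # bs" "z \<in> Z i"
          "set (as @ [z]) \<subseteq> R i" "set (z # bs) \<subseteq> R' i" by blast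
      let ?V = "pedges (as @ [z])" and ?V' = "pedges (z # bs)"
      have e: "pedges xs = ?V \<union> ?V'" unfolding s(2) by (rule pedges_append)
      have VU: "?V \<subseteq> U" "?V' \<subseteq> U" using xs e by (auto simp: spath_def)
      have dj: "?V \<inter> ?V' = {}" using xs s(2) by (intro pedges_disjoint) (auto simp: spath_def)
      have "?V \<inter> inner (R i) = ?V" "?V' \<inter> inner (R' i) = ?V'"
        using pedges_subset[of _ "as @ [z]"] pedges_subset[of _ "z # bs"] s(4,5)
        unfolding inner_def by blast+
      moreover have "conn ?V x z" using conn_pedges[of "as @ [z]"] xs s(2) by (cases as) (auto simp: spath_def)
      moreover have "conn ?V' z y" using conn_pedges[of "z # bs"] xs s(2) by (auto simp: spath_def)
      moreover have "z \<in> ?W"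
      proof -
        have "?V \<subseteq> F" using VU U by auto
        then have "conn F x z" by (rule conn_mono[OF \<open>conn ?V x z\<close>])
        then show ?thesis using conn_verts[of F x z] by auto
      qed
      ultimately show "\<exists>z\<in>?J. \<exists>V V'. V \<subseteq> U \<and> V' \<subseteq> U \<and> V \<inter> V' = {}
          \<and> conn (V \<inter> inner (R (fst z))) x (snd z) \<and> conn (V' \<inter> inner (R' (fst z))) (snd z) y"
        using VU dj s(1,3) by (intro bexI[of _ "(i, z)"] exI[of _ ?V] exI[of _ ?V']) auto
    qed
    then show ?thesis using F by (simp add: Pr_conn_Int)
  qed
  have AW: "finite (A \<inter> ?W)" using F by auto
  have "rs p F x A \<le> (\<Sum>y\<in>A \<inter> ?W. \<Sum>z\<in>?J. tau p (F \<inter> inner (R (fst z))) x (snd z)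
      * tau p (F \<inter> inner (R' (fst z))) (snd z) y)"
    unfolding rs_def using step by (intro sum_mono) auto
  also have "\<dots> = (\<Sum>z\<in>?J. tau p (F \<inter> inner (R (fst z))) x (snd z)
      * (\<Sum>y\<in>A \<inter> ?W. tau p (F \<inter> inner (R' (fst z))) (snd z) y))"
    by (subst sum.swap) (simp add: sum_distrib_left)
  also have "\<dots> \<le> (\<Sum>z\<in>?J. tau p (F \<inter> inner (R (fst z))) x (snd z) * c (fst z))"
  proof (intro sum_mono mult_left_mono)
    fix z assume z: "z \<in> ?J"
    have "(\<Sum>y\<in>A \<inter> ?W. tau p (F \<inter> inner (R' (fst z))) (snd z) y)
       \<le> rs p (F \<inter> inner (R' (fst z))) (snd z) A"
      using AW p by (intro sum_tau_le_rs fin_edges_Int fe) auto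
    also have "\<dots> \<le> c (fst z)" using z by (cases z) (simp add: c)
    finally show "(\<Sum>y\<in>A \<inter> ?W. tau p (F \<inter> inner (R' (fst z))) (snd z) y) \<le> c (fst z)" .
  qed (use p in auto)
  also have "\<dots> = (\<Sum>i\<in>I. (\<Sum>z\<in>Z i \<inter> ?W. tau p (F \<inter> inner (R i)) x z) * c i)"
    using I F by (simp add: sum.Sigma sum_distrib_right case_prod_unfold)
  also have "\<dots> \<le> (\<Sum>i\<in>I. b i * c i)"
  proof (intro sum_mono mult_right_mono)
    fix i assume i: "i \<in> I"
    have "(\<Sum>z\<in>Z i \<inter> ?W. tau p (F \<inter> inner (R i)) x z) \<le> rs p (F \<inter> inner (R i)) x (Z i)"
      using F p by (intro sum_tau_le_rs fin_edges_Int fe) auto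
    then show "(\<Sum>z\<in>Z i \<inter> ?W. tau p (F \<inter> inner (R i)) x z) \<le> b i" using b[OF i] by simp
  qed (use c0 in auto)
  finally show ?thesis .
qed

text \<open>\<open>conn_tree_graph\<close> and BK, summed over both endpoints; \<open>w\<close> is
  the branch point of the two connections.\<close>

lemma mixed_moment:
  fixes x :: 'v and F :: "'v set set"
  assumes fe: "fin_edges F" and p: "0 \<le> p" "p \<le> 1"
  defines "W \<equiv> insert x (\<Union>F)"
  shows "Exp p F (\<lambda>U. (\<Sum>y\<in>A \<inter> W. of_bool (conn U x y)) * (\<Sum>y\<in>A' \<inter> W. of_bool (conn U x y)))
    \<le> (\<Sum>w\<in>W. tau p F x w * rs p F w A * rs p F w A')"
proof -
  have F: "finite F" "finite W" using fe by (auto simp: fin_edges_def W_def)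
  have t: "Pr p F (\<lambda>U. conn U x y \<and> conn U x y') \<le> (\<Sum>w\<in>W. tau p F x w * tau p F w y * tau p F w y')"
    for y y'
    unfolding tau_def
  proof (rule BK3_sum[OF F(1) p F(2) mono_conn mono_conn mono_conn])
    fix U assume U: "U \<subseteq> F" "conn U x y \<and> conn U x y'"
    then have "conn U x y" "conn U x y'" by auto
    from conn_tree_graph[OF this] obtain w V1 V2 V3 where w: "V1 \<subseteq> U" "V2 \<subseteq> U" "V3 \<subseteq> U"
      "V1 \<inter> V2 = {}" "V1 \<inter> V3 = {}" "V2 \<inter> V3 = {}" "conn V1 x w" "conn V2 w y" "conn V3 w y'" by blast
    have "conn F x w" using conn_mono[OF w(7), of F] w(1) U(1) by auto
    then have "w \<in> W" using conn_verts[of F x w] by (auto simp: W_def)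
    then show "\<exists>w\<in>W. \<exists>V1 V2 V3. V1 \<subseteq> U \<and> V2 \<subseteq> U \<and> V3 \<subseteq> U \<and> V1 \<inter> V2 = {} \<and> V1 \<inter> V3 = {}
        \<and> V2 \<inter> V3 = {} \<and> conn V1 x w \<and> conn V2 w y \<and> conn V3 w y'"
      using w by blast
  qed
  have "Exp p F (\<lambda>U. (\<Sum>y\<in>A \<inter> W. of_bool (conn U x y)) * (\<Sum>y\<in>A' \<inter> W. of_bool (conn U x y)))
     = (\<Sum>y\<in>A \<inter> W. \<Sum>y'\<in>A' \<inter> W. Pr p F (\<lambda>U. conn U x y \<and> conn U x y'))"
    unfolding sum_product Exp_sum Pr_def of_bool_conj ..
  also have "\<dots> \<le> (\<Sum>y\<in>A \<inter> W. \<Sum>y'\<in>A' \<inter> W. \<Sum>w\<in>W. tau p F x w * tau p F w y * tau p F w y')"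
    by (intro sum_mono t)
  also have "\<dots> = (\<Sum>y\<in>A \<inter> W. \<Sum>w\<in>W. \<Sum>y'\<in>A' \<inter> W. tau p F x w * tau p F w y * tau p F w y')"
    by (intro sum.cong refl sum.swap)
  also have "\<dots> = (\<Sum>w\<in>W. \<Sum>y\<in>A \<inter> W. \<Sum>y'\<in>A' \<inter> W. tau p F x w * tau p F w y * tau p F w y')"
    by (rule sum.swap)
  also have "\<dots> = (\<Sum>w\<in>W. tau p F x w * ((\<Sum>y\<in>A \<inter> W. tau p F w y) * (\<Sum>y'\<in>A' \<inter> W. tau p F w y')))"
    by (simp only: sum_product) (simp only: sum_distrib_left mult.assoc)
  also have "\<dots> = (\<Sum>w\<in>W. tau p F x w * (\<Sum>y\<in>A \<inter> W. tau p F w y) * (\<Sum>y'\<in>A' \<inter> W. tau p F w y'))"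
    by (simp only: mult.assoc)
  also have "\<dots> \<le> (\<Sum>w\<in>W. tau p F x w * rs p F w A * rs p F w A')"
    using F p by (intro sum_mono mult_mono sum_tau_le_rs fe) (auto intro!: mult_nonneg_nonneg sum_nonneg rs_nonneg)
  finally show ?thesis .
qed

section \<open>The Cartesian product and its automorphisms\<close>

lemma adj_box:
  "adj (box_product T G) (u, x) (v, y) \<longleftrightarrow>
     (adj T u v \<and> x = y \<and> x \<in> verts G) \<or> (u = v \<and> u \<in> verts T \<and> adj G x y)"
proof
  assume "adj (box_product T G) (u, x) (v, y)"
  then consider (1) a b z where "{(u, x), (v, y)} = {(a, z), (b, z)}" "adj T a b" "z \<in> verts G"
    | (2) a z w where "{(u, x), (v, y)} = {(a, z), (a, w)}" "a \<in> verts T" "adj G z w"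
    unfolding adj_def box_product_def by auto
  then show "(adj T u v \<and> x = y \<and> x \<in> verts G) \<or> (u = v \<and> u \<in> verts T \<and> adj G x y)"
    by cases (auto simp: doubleton_eq_iff adj_sym)
next
  assume "(adj T u v \<and> x = y \<and> x \<in> verts G) \<or> (u = v \<and> u \<in> verts T \<and> adj G x y)"
  then show "adj (box_product T G) (u, x) (v, y)"
    unfolding adj_def box_product_def by auto
qed

lemma verts_box [simp]: "verts (box_product T G) = verts T \<times> verts G"
  by (simp add: box_product_def)

lemma box_automorphism:
  assumes "is_automorphism T \<phi>" "is_automorphism G \<psi>"
  shows "is_automorphism (box_product T G) (map_prod \<phi> \<psi>)"
proof -
  have "bij_betw (map_prod \<phi> \<psi>) (verts T \<times> verts G) (verts T \<times> verts G)"
    using assms unfolding is_automorphism_def bij_betw_def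
    by (auto intro: map_prod_inj_on simp: map_prod_surj_on)
  moreover have "\<phi> u = \<phi> v \<longleftrightarrow> u = v" if "u \<in> verts T" "v \<in> verts T" for u v
    using assms(1) that unfolding is_automorphism_def bij_betw_def inj_on_def by auto
  moreover have "\<psi> u = \<psi> v \<longleftrightarrow> u = v" if "u \<in> verts G" "v \<in> verts G" for u v
    using assms(2) that unfolding is_automorphism_def bij_betw_def inj_on_def by auto
  moreover have "\<phi> u \<in> verts T" if "u \<in> verts T" for u
    using assms(1) that unfolding is_automorphism_def bij_betw_def by auto
  moreover have "\<psi> u \<in> verts G" if "u \<in> verts G" for u
    using assms(2) that unfolding is_automorphism_def bij_betw_def by auto
  ultimately show ?thesis
    using assms unfolding is_automorphism_def by (auto simp: adj_box)
qed

lemma is_automorphism_id: "is_automorphism G (\<lambda>x. x)"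
  by (simp add: is_automorphism_def bij_betw_def)

locale tprod = rtree T d + G: lfgraph G for T :: "'a graph" and d :: nat and G :: "'b graph" +
  assumes qt: "quasi_transitive G"
begin

abbreviation H :: "('a \<times> 'b) graph" where "H \<equiv> box_product T G"

lemma adj_H_cases:
  assumes "adj H a b"
  shows "(adj T (fst a) (fst b) \<and> snd a = snd b \<and> snd a \<in> verts G)
    \<or> (fst a = fst b \<and> fst a \<in> verts T \<and> adj G (snd a) (snd b))"
  using assms adj_box[of T G "fst a" "snd a" "fst b" "snd b"] by simp

lemma simple_H: "simple_graph H"
  unfolding simple_graph_def
proof
  fix e assume "e \<in> edges H"
  then consider (1) a b z where "e = {(a, z), (b, z)}" "adj T a b" "z \<in> verts G"
    | (2) a z w where "e = {(a, z), (a, w)}" "a \<in> verts T" "adj G z w"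
    unfolding box_product_def by auto
  then show "\<exists>u\<in>verts H. \<exists>v\<in>verts H. u \<noteq> v \<and> e = {u, v}"
  proof cases
    case 1
    then show ?thesis using adjD[of a b] by (intro bexI[of _ "(a, z)"] bexI[of _ "(b, z)"]) auto
  next
    case 2
    then show ?thesis using G.adjD[of z w] by (intro bexI[of _ "(a, z)"] bexI[of _ "(a, w)"]) auto
  qed
qed

lemma conn_fibre:
  assumes "t \<in> verts T" "conn W x y" "W \<subseteq> edges G"
  shows "conn ((`) (Pair t) ` W) (t, x) (t, y)" "(`) (Pair t) ` W \<subseteq> edges H"
proof -
  show "conn ((`) (Pair t) ` W) (t, x) (t, y)" using conn_image[OF assms(2), of "Pair t"] .
  show "(`) (Pair t) ` W \<subseteq> edges H"
  proof clarify
    fix e assume "e \<in> W"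
    then have "e \<in> edges G" using assms by auto
    then obtain a b where "e = {a, b}" "adj G a b" by (rule G.edgeE)
    then show "Pair t ` e \<in> edges H"
      using assms adj_box[of T G t a t b] by (simp add: adj_def)
  qed
qed

lemma conn_vertical:
  assumes "x \<in> verts G" "conn W s t" "W \<subseteq> edges T"
  shows "conn ((`) (\<lambda>t. (t, x)) ` W) (s, x) (t, x)" "(`) (\<lambda>t. (t, x)) ` W \<subseteq> edges H"
proof -
  show "conn ((`) (\<lambda>t. (t, x)) ` W) (s, x) (t, x)" using conn_image[OF assms(2), of "\<lambda>t. (t, x)"] .
  show "(`) (\<lambda>t. (t, x)) ` W \<subseteq> edges H"
  proof clarify
    fix e assume "e \<in> W"
    then have "e \<in> edges T" using assms by auto
    then obtain a b where "e = {a, b}" "adj T a b" by (rule edgeE)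
    then show "(\<lambda>t. (t, x)) ` e \<in> edges H"
      using assms adj_box[of T G a x b x] by (simp add: adj_def)
  qed
qed

lemma connected_H: "connected_graph H"
proof -
  have "verts T \<noteq> {}" "verts G \<noteq> {}"
    using connected G.connected unfolding connected_graph_def by auto
  moreover have "(adj H)\<^sup>*\<^sup>* (s, x) (t, y)" if st: "s \<in> verts T" "t \<in> verts T" "x \<in> verts G" "y \<in> verts G" for s t x y
  proof -
    have "conn (edges T) s t" "conn (edges G) x y"
      using st connected G.connected unfolding connected_graph_def conn_edges G.conn_edges by auto
    then have "conn (edges H) (s, x) (t, x)" "conn (edges H) (t, x) (t, y)"
      using conn_mono[OF conn_vertical(1,2)[of x "edges T" s t]]
        conn_mono[OF conn_fibre(1,2)[of t "edges G" x y]] st by auto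
    then have "conn (edges H) (s, x) (t, y)" by (rule conn_trans)
    then show ?thesis unfolding conn_def adj_def by simp
  qed
  ultimately show ?thesis unfolding connected_graph_def by auto
qed

lemma neighbours_H:
  "neighbours H (u, x) \<subseteq> (\<lambda>v. (v, x)) ` neighbours T u \<union> Pair u ` neighbours G x"
  unfolding neighbours_def by (auto simp: adj_box)

lemma lf_H: "locally_finite H"
  unfolding locally_finite_def
proof clarify
  fix u x assume "(u, x) \<in> verts H"
  then have "finite (neighbours T u)" "finite (neighbours G x)"
    using finite_neighbours G.lf unfolding locally_finite_def by auto
  then show "finite (neighbours H (u, x))" by (intro finite_subset[OF neighbours_H]) auto
qed

end

sublocale tprod \<subseteq> H: lfgraph "box_product T G"
  using simple_H connected_H lf_H by unfold_locales

context tprod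
begin

lemma representatives:
  "\<exists>X. finite X \<and> X \<subseteq> verts G \<and> (\<forall>x\<in>verts G. \<exists>x0\<in>X. \<exists>\<psi>. is_automorphism G \<psi> \<and> \<psi> x0 = x)"
proof -
  let ?O = "vertex_orbit G ` verts G"
  have f: "finite ?O" using qt unfolding quasi_transitive_def .
  have nz: "x \<in> vertex_orbit G x" for x
    unfolding vertex_orbit_def using is_automorphism_id by (intro CollectI exI[of _ "\<lambda>x. x"]) auto
  have "\<forall>Q\<in>?O. \<exists>y. y \<in> verts G \<and> vertex_orbit G y = Q" by auto
  from bchoice[OF this] obtain r where r: "\<forall>Q\<in>?O. r Q \<in> verts G \<and> vertex_orbit G (r Q) = Q"
    by blast
  show ?thesis
  proof (intro exI[of _ "r ` ?O"] conjI ballI)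
    show "finite (r ` ?O)" using f by auto
    show "r ` ?O \<subseteq> verts G" using r by auto
    fix x assume x: "x \<in> verts G"
    then have "x \<in> vertex_orbit G (r (vertex_orbit G x))" using r nz[of x] by auto
    then show "\<exists>x0\<in>r ` ?O. \<exists>\<psi>. is_automorphism G \<psi> \<and> \<psi> x0 = x"
      using x unfolding vertex_orbit_def[of G "r _"]
      by (intro bexI[of _ "r (vertex_orbit G x)"]) auto
  qed
qed

text \<open>Stands in for transitivity of \<open>G\<close>: what is constructed at one vertex can be
  copied close to any other, and the remaining gap of at most \<open>D0\<close> is later bridged at
  the price of a power of \<open>p\<close>.\<close>

lemma coarse_transitive:
  obtains D0 where "\<And>x y. x \<in> verts G \<Longrightarrow> y \<in> verts G \<Longrightarrow> \<exists>\<psi>. is_automorphism G \<psi> \<and> gd G x (\<psi> y) \<le> D0"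
proof -
  obtain X where X: "finite X" "X \<subseteq> verts G"
    "\<And>x. x \<in> verts G \<Longrightarrow> \<exists>x0\<in>X. \<exists>\<psi>. is_automorphism G \<psi> \<and> \<psi> x0 = x"
    using representatives by auto
  let ?D = "Max ((\<lambda>(x, y). gd G x y) ` (X \<times> X))"
  have D: "gd G x y \<le> ?D" if "x \<in> X" "y \<in> X" for x y
    using X that by (intro Max_ge) (auto intro!: image_eqI[of _ _ "(x, y)"])
  show thesis
  proof (rule that[of ?D])
    fix x y assume x: "x \<in> verts G" and y: "y \<in> verts G"
    obtain x0 \<psi> where 1: "x0 \<in> X" "is_automorphism G \<psi>" "\<psi> x0 = x" using X(3)[OF x] by auto
    obtain y0 \<theta> where 2: "y0 \<in> X" "is_automorphism G \<theta>" "\<theta> y0 = y" using X(3)[OF y] by auto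
    obtain \<theta>' where 3: "is_automorphism G \<theta>'" "\<forall>x\<in>verts G. \<theta>' (\<theta> x) = x"
      using G.automorphism_inv[OF 2(2)] by auto
    have "\<theta>' y = y0" using 2 3 X by auto
    then have "gd G x (\<psi> (\<theta>' y)) = gd G x0 y0"
      using G.automorphism_gd[OF 1(2), of x0 y0] 1 2 X by auto
    also have "\<dots> \<le> ?D" using D 1 2 by auto
    finally show "\<exists>\<psi>. is_automorphism G \<psi> \<and> gd G x (\<psi> y) \<le> ?D"
      using is_automorphism_comp[OF 1(2) 3(1)] by auto
  qed
qed

lemma card_cball_le:
  obtains M where "\<And>x. x \<in> verts G \<Longrightarrow> card (G.cball x n) \<le> M"
proof -
  obtain X where X: "finite X" "X \<subseteq> verts G"
    "\<And>x. x \<in> verts G \<Longrightarrow> \<exists>x0\<in>X. \<exists>\<psi>. is_automorphism G \<psi> \<and> \<psi> x0 = x"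
    using representatives by auto
  let ?M = "Max ((\<lambda>x. card (G.cball x n)) ` X)"
  show thesis
  proof (rule that[of ?M])
    fix x assume x: "x \<in> verts G"
    obtain x0 \<psi> where 1: "x0 \<in> X" "is_automorphism G \<psi>" "\<psi> x0 = x" using X(3)[OF x] by auto
    have "G.cball x n \<subseteq> \<psi> ` G.cball x0 n"
    proof
      fix y assume y: "y \<in> G.cball x n"
      then have "y \<in> \<psi> ` verts G"
        using 1(2) unfolding is_automorphism_def bij_betw_def G.cball_def by auto
      then obtain z where z: "z \<in> verts G" "y = \<psi> z" by auto
      then have "gd G x0 z \<le> n"
        using G.automorphism_gd[OF 1(2), of x0 z] 1 X y by (auto simp: G.cball_def)
      then show "y \<in> \<psi> ` G.cball x0 n" using z by (auto simp: G.cball_def)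
    qed
    moreover have fin: "finite (G.cball x0 n)" using G.finite_cball[OF G.lf] 1 X by auto
    ultimately have "card (G.cball x n) \<le> card (G.cball x0 n)"
      by (meson card_image_le card_mono finite_imageI order_trans)
    also have "\<dots> \<le> ?M" using X 1 by (intro Max_ge) auto
    finally show "card (G.cball x n) \<le> ?M" .
  qed
qed

lemma degree_bound:
  obtains \<Delta> where "\<And>v. v \<in> verts H \<Longrightarrow> card (neighbours H v) \<le> \<Delta>"
proof -
  obtain M where M: "\<And>x. x \<in> verts G \<Longrightarrow> card (G.cball x 1) \<le> M" using card_cball_le[of 1] by blast
  show thesis
  proof (rule that[of "Suc d + M"])
    fix v assume "v \<in> verts H"
    then obtain u x where v: "v = (u, x)" "u \<in> verts T" "x \<in> verts G" by auto
    have f: "finite (neighbours T u)" "finite (neighbours G x)"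
      using finite_neighbours G.lf v unfolding locally_finite_def by auto
    have "neighbours G x \<subseteq> G.cball x 1"
      unfolding neighbours_def G.cball_def using G.adjD G.gd_adj by auto
    then have 1: "card (neighbours G x) \<le> M"
      using M[OF v(3)] card_mono[OF G.finite_cball[OF G.lf v(3)]] order_trans by blast
    have "card (neighbours H v) \<le> card ((\<lambda>v. (v, x)) ` neighbours T u \<union> Pair u ` neighbours G x)"
      unfolding v(1) using f by (intro card_mono neighbours_H) auto
    also have "\<dots> \<le> card ((\<lambda>v. (v, x)) ` neighbours T u) + card (Pair u ` neighbours G x)"
      by (rule card_Un_le)
    also have "\<dots> \<le> card (neighbours T u) + card (neighbours G x)"
      using f by (intro add_mono card_image_le)
    also have "\<dots> \<le> Suc d + M" using 1 card_neighbours[OF v(2)] by simp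
    finally show "card (neighbours H v) \<le> Suc d + M" .
  qed
qed

lemma card_exits_le:
  assumes "\<And>v. v \<in> verts H \<Longrightarrow> card (neighbours H v) \<le> \<Delta>" "finite A" "A \<subseteq> verts H"
  shows "card (exits (edges H) S \<inter> A \<times> UNIV) \<le> card A * \<Delta>"
proof -
  have "exits (edges H) S \<inter> A \<times> UNIV \<subseteq> (SIGMA a:A. neighbours H a)"
    by (auto simp: exits_def neighbours_def adj_def)
  moreover have fin: "finite (neighbours H a)" if "a \<in> A" for a
    using lf_H that assms unfolding locally_finite_def by auto
  ultimately have "card (exits (edges H) S \<inter> A \<times> UNIV) \<le> card (SIGMA a:A. neighbours H a)"
    using assms(2) by (intro card_mono finite_SigmaI) auto
  also have "\<dots> = (\<Sum>a\<in>A. card (neighbours H a))" using assms fin by (intro card_SigmaI) auto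
  also have "\<dots> \<le> (\<Sum>a\<in>A. \<Delta>)" using assms by (intro sum_mono) auto
  finally show ?thesis by simp
qed

section \<open>Finite susceptibility\<close>

definition sub_at :: "real \<Rightarrow> bool" where
  "sub_at p \<longleftrightarrow> (\<exists>C. \<forall>F x. finite F \<longrightarrow> F \<subseteq> edges H \<longrightarrow> x \<in> verts H \<longrightarrow> rs p F x (verts H) \<le> C)"

lemma sub_atI:
  "(\<And>F x. finite F \<Longrightarrow> F \<subseteq> edges H \<Longrightarrow> x \<in> verts H \<Longrightarrow> rs p F x (verts H) \<le> C) \<Longrightarrow> sub_at p"
  unfolding sub_at_def by blast

lemma sub_at_mono:
  assumes "sub_at q" "0 \<le> p" "p \<le> q" "q \<le> 1"
  shows "sub_at p"
proof -
  obtain C where C: "\<forall>F x. finite F \<longrightarrow> F \<subseteq> edges H \<longrightarrow> x \<in> verts H \<longrightarrow> rs q F x (verts H) \<le> C"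
    using assms(1) unfolding sub_at_def by (rule exE)
  have "rs p F x (verts H) \<le> C" if "finite F" "F \<subseteq> edges H" "x \<in> verts H" for F x
    using rs_mono_p[OF H.fin_edges[OF that(1,2)], of p q x "verts H"] C that assms
    by (meson order_trans)
  then show ?thesis by (rule sub_atI)
qed

lemma sub_at_small: "\<exists>p>0. p < 1 \<and> sub_at p"
proof -
  obtain \<Delta> where \<Delta>: "\<And>v. v \<in> verts H \<Longrightarrow> card (neighbours H v) \<le> \<Delta>" using degree_bound by blast
  \<comment> \<open>Chosen so that a singleton \<open>S\<close> has \<open>phi\<close> at most
    \<open>\<Delta> * p \<le> 1 / 2\<close>.\<close>
  define p where "p = 1 / (2 * (real \<Delta> + 1))"
  have p: "0 < p" "p < 1" "real \<Delta> * p \<le> 1 / 2" unfolding p_def by (auto simp: field_simps)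
  have "H.phi p S x \<le> 1 / 2" if "S = {x}" "x \<in> verts H" for S x
  proof -
    have "H.phi p S x \<le> (\<Sum>(a, b)\<in>exits (edges H) S. p)"
      unfolding H.phi_def using p that
      by (intro sum_mono) (auto split: prod.splits intro!: mult_left_le_one_le tau_le_1 H.finite_inner_edges)
    also have "\<dots> = card (exits (edges H) S) * p" by (simp add: case_prod_unfold)
    also have "exits (edges H) S = exits (edges H) S \<inter> {x} \<times> UNIV" using that by (auto simp: exits_def)
    also have "real (card \<dots>) * p \<le> real (card {x} * \<Delta>) * p"
      using that p by (intro mult_right_mono of_nat_mono card_exits_le \<Delta>) auto
    finally show ?thesis using p by simp
  qed
  then have "\<exists>S. finite S \<and> S \<subseteq> verts H \<and> x \<in> S \<and> card S \<le> 1 \<and> H.phi p S x \<le> 1 / 2" if "x \<in> verts H" for x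
    using that by (intro exI[of _ "{x}"]) auto
  then have "rs p F x (verts H) \<le> real 1 / (1 - 1 / 2)" if "finite F" "F \<subseteq> edges H" "x \<in> verts H" for F x
    using p that by (intro H.susceptibility_bound) auto
  then have "sub_at p" by (rule sub_atI)
  then show ?thesis using p by auto
qed

text \<open>If every vertex had a finite set with \<open>phi < 1\<close>, sets chosen for one vertex
  per orbit and moved by automorphisms would provide a common bound \<open>r < 1\<close> and a
  common size, hence finite susceptibility. Since the tree is transitive, orbit representatives of
  \<open>G\<close> over a single \<open>t0\<close> suffice.\<close>

lemma not_sub_at_phi:
  assumes p: "0 \<le> p" "p \<le> 1" and n: "\<not> sub_at p"
  shows "\<exists>x\<in>verts H. \<forall>S. finite S \<longrightarrow> S \<subseteq> verts H \<longrightarrow> x \<in> S \<longrightarrow> 1 \<le> H.phi p S x"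
proof (rule ccontr)
  assume "\<not> ?thesis"
  then have ex: "\<exists>S. finite S \<and> S \<subseteq> verts H \<and> x \<in> S \<and> H.phi p S x < 1" if "x \<in> verts H" for x
    using that by (meson not_le)
  obtain t0 where t0: "t0 \<in> verts T" using connected unfolding connected_graph_def by auto
  obtain X where X: "finite X" "X \<subseteq> verts G"
    "\<And>x. x \<in> verts G \<Longrightarrow> \<exists>x0\<in>X. \<exists>\<psi>. is_automorphism G \<psi> \<and> \<psi> x0 = x"
    using representatives by auto
  have "\<forall>x. \<exists>S. x \<in> X \<longrightarrow> finite S \<and> S \<subseteq> verts H \<and> (t0, x) \<in> S \<and> H.phi p S (t0, x) < 1"
    using ex t0 X by (metis SigmaI subsetD verts_box)
  then obtain S where S: "\<And>x. x \<in> X \<Longrightarrow> finite (S x) \<and> S x \<subseteq> verts H \<and> (t0, x) \<in> S x \<and> H.phi p (S x) (t0, x) < 1"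
    by metis
  define r where "r = Max (insert 0 ((\<lambda>x. H.phi p (S x) (t0, x)) ` X))"
  define M where "M = Max (insert 0 ((\<lambda>x. card (S x)) ` X))"
  have r: "H.phi p (S x) (t0, x) \<le> r" "card (S x) \<le> M" if "x \<in> X" for x
    unfolding r_def M_def using X that by auto
  have "r < 1" unfolding r_def using X S by (subst Max_less_iff) auto
  have "\<exists>S. finite S \<and> S \<subseteq> verts H \<and> v \<in> S \<and> card S \<le> M \<and> H.phi p S v \<le> r" if v: "v \<in> verts H" for v
  proof -
    obtain t x where tx: "v = (t, x)" "t \<in> verts T" "x \<in> verts G" using v by auto
    obtain x0 \<psi> where 1: "x0 \<in> X" "is_automorphism G \<psi>" "\<psi> x0 = x" using X(3)[OF tx(3)] by auto
    obtain u where u: "line u" "u 0 = t0" using line_exists[OF t0 t0] by metis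
    obtain u' where u': "line u'" "u' 0 = t" using line_exists[OF tx(2) tx(2)] by metis
    obtain \<phi> where \<phi>: "is_automorphism T \<phi>" "\<phi> t0 = t" using line_homogeneous[OF u(1) u'(1)] u u' by auto
    note a = box_automorphism[OF \<phi>(1) 1(2)]
    let ?f = "map_prod \<phi> \<psi>"
    have s: "finite (S x0)" "S x0 \<subseteq> verts H" "(t0, x0) \<in> S x0" using S 1 by auto
    have "H.phi p (?f ` S x0) (?f (t0, x0)) \<le> H.phi p (S x0) (t0, x0)"
      using H.automorphism_phi[OF a s] .
    moreover have "?f (t0, x0) = v" using \<phi> 1 tx by simp
    moreover have "?f ` S x0 \<subseteq> verts H"
      by (intro image_subsetI H.automorphism_verts[OF a]) (use s in blast)
    moreover have "card (?f ` S x0) \<le> M" using card_image_le[OF s(1), of ?f] r(2)[OF 1(1)] by simp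
    ultimately show ?thesis
      using s r(1)[OF 1(1)] by (intro exI[of _ "?f ` S x0"]) (auto intro!: image_eqI[of _ _ "(t0, x0)"])
  qed
  then have "rs p F x (verts H) \<le> real M / (1 - r)" if "finite F" "F \<subseteq> edges H" "x \<in> verts H" for F x
    using p \<open>r < 1\<close> that by (intro H.susceptibility_bound) auto
  then have "sub_at p" by (rule sub_atI)
  then show False using n by simp
qed

lemma not_sub_at_reach:
  assumes "0 < p" "p < q" "q < 1" "\<not> sub_at p"
  shows "\<exists>x\<in>verts H. \<forall>N>0. 1 - exp (p - q) \<le> Pr q (H.ball_edges x N) (H.reach N x)"
proof -
  obtain x where x: "x \<in> verts H" "\<And>S. finite S \<Longrightarrow> S \<subseteq> verts H \<Longrightarrow> x \<in> S \<Longrightarrow> 1 \<le> H.phi p S x"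
    using not_sub_at_phi[of p] assms by auto
  have "1 - exp (p - q) \<le> Pr q (H.ball_edges x N) (H.reach N x)" if "N > 0" for N
    using x assms that by (intro H.reach_lower_bound) auto
  then show ?thesis using x by blast
qed

section \<open>Fibres and half-trees of the product\<close>

definition fib :: "'a \<Rightarrow> ('a \<times> 'b) set" where
  "fib t = {t} \<times> verts G"

definition reg :: "'a set \<Rightarrow> ('a \<times> 'b) set" where
  "reg S = S \<times> verts G"

definition EE :: "'a set \<Rightarrow> ('a \<times> 'b) set set" where
  "EE S = edges H \<inter> inner (reg S)"

lemma EE_subset: "EE S \<subseteq> edges H"
  by (auto simp: EE_def)

lemma EE_mono: "S \<subseteq> S' \<Longrightarrow> EE S \<subseteq> EE S'"
  by (auto simp: EE_def inner_def reg_def)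

lemma EE_Int_inner: "F \<subseteq> edges H \<Longrightarrow> F \<inter> inner (reg S) \<subseteq> EE S"
  by (auto simp: EE_def)

lemma fib_image:
  assumes "is_automorphism G \<psi>"
  shows "map_prod \<phi> \<psi> ` fib t = fib (\<phi> t)"
  using assms unfolding fib_def is_automorphism_def bij_betw_def by (intro map_prod_surj_on) auto

lemma fib_verts: "t \<in> verts T \<Longrightarrow> fib t \<subseteq> verts H"
  by (auto simp: fib_def)

lemma stay:
  assumes "pedges xs \<subseteq> edges H" "xs \<noteq> []" "hd xs \<in> S"
    "\<And>a b. a \<in> S \<Longrightarrow> adj H a b \<Longrightarrow> b \<in> set xs \<Longrightarrow> b \<in> S"
  shows "set xs \<subseteq> S"
  using assms
proof (induction xs rule: pedges.induct)
  case (1 a b r)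
  have "b \<in> S" using 1(2,4) 1(5)[of a b] by (auto simp: adj_def)
  then have "set (b # r) \<subseteq> S" using 1 by auto
  then show ?case using 1 by auto
qed auto

text \<open>By \<open>L_cross\<close> the other side of the half-tree is accessible only through the
  fibre over \<open>u (m + 1)\<close>, which the path avoids.\<close>

lemma stay_L:
  assumes u: "line u" and xs: "pedges xs \<subseteq> edges H" "xs \<noteq> []" "hd xs \<in> reg (L u m)"
    "\<And>z. z \<in> set xs \<Longrightarrow> fst z \<noteq> u (m + 1)"
  shows "set xs \<subseteq> reg (L u m)"
proof (rule stay[OF xs(1-3)])
  fix a b assume a: "a \<in> reg (L u m)" "adj H a b" "b \<in> set xs"
  then have b: "snd b \<in> verts G" using H.adjD[OF a(2)] by (cases b) auto
  have "fst b \<in> L u m"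
  proof (rule ccontr)
    assume n: "fst b \<notin> L u m"
    then have "adj T (fst a) (fst b)" using adj_H_cases[OF a(2)] a(1) by (auto simp: reg_def)
    then have "fst b = u (m + 1)" using L_cross[OF u] a(1) n by (auto simp: reg_def)
    then show False using xs(4) a(3) by auto
  qed
  then show "b \<in> reg (L u m)" using b by (cases b) (auto simp: reg_def)
qed

lemma stay_compl_L:
  assumes u: "line u" and xs: "pedges xs \<subseteq> edges H" "xs \<noteq> []" "hd xs \<in> reg (verts T - L u m)"
    "\<And>z. z \<in> set xs \<Longrightarrow> fst z \<noteq> u m"
  shows "set xs \<subseteq> reg (verts T - L u m)"
proof -
  let ?r = "\<lambda>k. u (0 - k)"
  have r: "line ?r" using line_rev[OF u, of 0] .
  have e: "L ?r (- m - 1) = verts T - L u m" using L_rev[OF u, of 0 "- m - 1"] by simp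
  have "set xs \<subseteq> reg (L ?r (- m - 1))"
    by (rule stay_L[OF r xs(1,2)]) (use xs(3,4) e in auto)
  then show ?thesis using e by simp
qed

lemma L_shift: "L (\<lambda>i. u (i + c)) m = L u (m + c)"
  by (simp add: L_def add.commute add.left_commute)

lemma mem_regI: "t \<in> S \<Longrightarrow> x \<in> verts G \<Longrightarrow> (t, x) \<in> reg S"
  by (simp add: reg_def)

text \<open>Since \<open>T\<close> is homogeneous, the at least \<open>d ^ n\<close> fibres at distance \<open>n\<close> contribute equally to
  the susceptibility.\<close>

lemma fibre_decay:
  assumes p: "0 \<le> p" "p \<le> 1"
    and C: "\<And>F x. finite F \<Longrightarrow> F \<subseteq> edges H \<Longrightarrow> x \<in> verts H \<Longrightarrow> rs p F x (verts H) \<le> C"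
    and st: "s \<in> verts T" "t \<in> verts T" and x: "x \<in> verts G" and F: "finite F" "F \<subseteq> edges H"
  shows "real d ^ gd T s t * rs p F (s, x) (fib t) \<le> C"
proof -
  let ?n = "gd T s t"
  obtain u where u: "line u" "u 0 = s" "u (int ?n) = t" using line_exists[OF st] by metis
  have "\<exists>\<phi>. is_automorphism T \<phi> \<and> \<phi> s = s \<and> \<phi> t = t'" if t': "t' \<in> sphere s ?n" for t'
  proof -
    have g: "t' \<in> verts T" "gd T s t' = ?n" using t' by (auto simp: sphere_def gd_sym)
    obtain u' where u': "line u'" "u' 0 = s" "u' (int ?n) = t'"
      using line_exists[OF st(1) g(1)] g(2) by metis
    obtain \<phi> where \<phi>: "is_automorphism T \<phi>" "\<forall>i. \<phi> (u i) = u' i"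
      using line_homogeneous[OF u(1) u'(1)] by auto
    have "\<phi> s = s" "\<phi> t = t'" using \<phi>(2)[rule_format, of 0] \<phi>(2)[rule_format, of "int ?n"]
      unfolding u(2,3) u'(2,3) by auto
    then show ?thesis using \<phi>(1) by blast
  qed
  then obtain \<phi> where \<phi>: "\<And>t'. t' \<in> sphere s ?n \<Longrightarrow> is_automorphism T (\<phi> t') \<and> \<phi> t' s = s \<and> \<phi> t' t = t'"
    by metis
  let ?f = "\<lambda>t'. map_prod (\<phi> t') (\<lambda>x. x)"
  \<comment> \<open>The union of the rotated copies of \<open>F\<close>: one finite edge set that
    serves all fibres over the sphere at once.\<close>
  let ?F = "\<Union>t'\<in>sphere s ?n. (`) (?f t') ` F"
  have S: "finite (sphere s ?n)" using finite_sphere st by auto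
  have F': "finite ?F" "?F \<subseteq> edges H"
    using S F H.automorphism_edges[OF box_automorphism[OF _ is_automorphism_id] F(2)] \<phi> by auto
  have eq: "rs p F (s, x) (fib t) \<le> rs p ?F (s, x) (fib t')" if t': "t' \<in> sphere s ?n" for t'
  proof -
    have a: "is_automorphism H (?f t')" using \<phi>[OF t'] is_automorphism_id by (intro box_automorphism) auto
    have "rs p F (s, x) (fib t) = rs p ((`) (?f t') ` F) (?f t' (s, x)) (?f t' ` fib t)"
      using F x st by (intro H.automorphism_rs[OF a, symmetric] fib_verts) auto
    also have "\<dots> = rs p ((`) (?f t') ` F) (s, x) (fib t')"
      using \<phi>[OF t'] fib_image[OF is_automorphism_id, of "\<phi> t'" t] by simp
    also have "\<dots> \<le> rs p ?F (s, x) (fib t')"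
      using t' p by (intro rs_mono H.fin_edges F') auto
    finally show ?thesis .
  qed
  have W: "finite (insert (s, x) (\<Union>?F))" using H.fin_edges[OF F'] by (auto simp: fin_edges_def)
  have "real (d ^ ?n) * rs p F (s, x) (fib t) \<le> real (card (sphere s ?n)) * rs p F (s, x) (fib t)"
    using card_sphere_bounds[OF st(1)] rs_nonneg[OF p] by (intro mult_right_mono of_nat_mono)
  also have "\<dots> = (\<Sum>t'\<in>sphere s ?n. rs p F (s, x) (fib t))" by simp
  also have "\<dots> \<le> (\<Sum>t'\<in>sphere s ?n. rs p ?F (s, x) (fib t'))" by (intro sum_mono eq)
  also have "\<dots> = (\<Sum>y\<in>(\<Union>t'\<in>sphere s ?n. fib t' \<inter> insert (s, x) (\<Union>?F)). tau p ?F (s, x) y)"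
    unfolding rs_def using S W by (intro sum.UNION_disjoint[symmetric]) (auto simp: fib_def)
  also have "\<dots> \<le> rs p ?F (s, x) (verts H)"
    using S W p by (intro sum_tau_le_rs H.fin_edges F') (auto simp: fib_def sphere_def)
  also have "\<dots> \<le> C" using C F' x st by auto
  finally show ?thesis by simp
qed

end

section \<open>Interpolation between moments\<close>

lemma geometric_sum_le:
  fixes q :: real
  assumes "finite J" "0 \<le> q" "q < 1"
  shows "(\<Sum>j\<in>J. q ^ j) \<le> 1 / (1 - q)"
proof -
  have "(\<Sum>j\<in>J. q ^ j) \<le> (\<Sum>j. q ^ j)"
    using assms by (intro sum_le_suminf summable_geometric) auto
  then show ?thesis using assms by (simp add: suminf_geometric)
qed

lemma pow_merge:
  fixes a b :: real
  shows "(a * b ^ (n + j)) * (a * b ^ j) = a\<^sup>2 * b ^ n * b ^ (2 * j)"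
  by (simp add: power2_eq_square power_add mult_2)

lemma cancel_factor:
  fixes a b c D e f X Y :: real
  assumes "a * b = 1" "X * Y = b * c * e * f"
  shows "2 * a * (2 * D * X * Y) = (4 * D * c * e) * f"
proof -
  have "2 * a * (2 * D * X * Y) = 4 * D * a * (X * Y)" by simp
  also have "\<dots> = (a * b) * (4 * D * c * e) * f" unfolding assms(2) by simp
  finally show ?thesis using assms(1) by simp
qed

text \<open>\<open>card\<close> is 0 on infinite sets; this never interferes, since the
  configurations considered lie in a set with \<open>fin_edges\<close>.\<close>

definition cnt :: "'v set set \<Rightarrow> 'v \<Rightarrow> 'v set \<Rightarrow> real" where
  "cnt U x A = real (card {y \<in> A. conn U x y})"

lemma sum_of_bool_card: "finite B \<Longrightarrow> (\<Sum>y\<in>B. of_bool (P y)) = real (card {y \<in> B. P y})"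
  by (simp add: of_bool_def sum.If_cases Int_def)

lemma cnt_eq:
  assumes "fin_edges F" "U \<subseteq> F"
  shows "cnt U x A = (\<Sum>y\<in>A \<inter> insert x (\<Union>F). of_bool (conn U x y))"
proof -
  have "{y \<in> A. conn U x y} = {y \<in> A \<inter> insert x (\<Union>F). conn U x y}"
    using conn_verts[of U x] assms(2) by blast
  moreover have "finite (A \<inter> insert x (\<Union>F))" using assms(1) by (auto simp: fin_edges_def)
  ultimately show ?thesis by (simp only: cnt_def sum_of_bool_card)
qed

lemma Exp_cnt: "fin_edges F \<Longrightarrow> Exp p F (\<lambda>U. cnt U x A) = rs p F x A"
proof -
  assume F: "fin_edges F"
  then have "Exp p F (\<lambda>U. cnt U x A) = Exp p F (\<lambda>U. \<Sum>y\<in>A \<inter> insert x (\<Union>F). of_bool (conn U x y))"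
    by (intro Exp_cong cnt_eq)
  then show ?thesis by (simp only: Exp_sum rs_def tau_def Pr_def)
qed

lemma spath_mem:
  assumes "spath F x xs y" "z \<in> set xs"
  shows "z \<in> insert x (\<Union>F)"
proof -
  have "conn (pedges xs) x z" using conn_in_pedges(1)[OF assms(2)] assms(1) by (simp add: spath_def)
  then have "conn F x z" by (rule conn_mono) (use assms in \<open>simp add: spath_def\<close>)
  then show ?thesis using conn_verts[of F x z] by auto
qed

lemma spath_ends: "spath F x xs y \<Longrightarrow> x \<in> set xs" "spath F x xs y \<Longrightarrow> y \<in> set xs"
  unfolding spath_def by (auto intro: hd_in_set last_in_set)

text \<open>If \<open>j\<close> is just large enough for the second term to be at most
  \<open>D / 2\<close>, then \<open>d ^ (2 * j)\<close> is of the order of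
  \<open>x = 4 * C * D powr \<epsilon>\<close>, so that \<open>P ^ j\<close> is at most
  \<open>P\<close> times a power of \<open>x\<close>. The hypothesis on \<epsilon> keeps the total
  power of \<open>D\<close> on the right at most one half.\<close>

lemma self_improving_bound:
  fixes D :: real
  assumes d: "2 \<le> (d :: real)" and D: "1 \<le> D" and C: "1 \<le> C" and P: "1 \<le> P" and \<epsilon>: "0 \<le> \<epsilon>"
    and \<kappa>: "\<epsilon> * (1 + ln P / (2 * ln d)) \<le> 1 / 2"
    and bound: "\<And>j. 1 \<le> j \<Longrightarrow> D \<le> P ^ j * (C * D powr \<epsilon>) + 2 * D * (C * D powr \<epsilon>) * (1 / d) ^ (2 * j)"
  shows "D \<le> (P * (4 * C) powr (1 + ln P / (2 * ln d)))\<^sup>2"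
proof -
  let ?\<kappa> = "ln P / (2 * ln d)"
  define x where "x = 4 * (C * D powr \<epsilon>)"
  have "1 * 1 \<le> C * D powr \<epsilon>" using C D \<epsilon> by (intro mult_mono) (auto intro: ge_one_powr_ge_zero)
  then have x: "4 \<le> x" by (simp add: x_def)
  have lnd: "0 < ln d" "0 \<le> ln P" using d P by auto
  have lnx: "0 < ln x" using x by simp
  \<comment> \<open>The least \<open>j\<close> with \<open>x \<le> d ^ (2 * j)\<close>; rounding up
    costs at most one further factor \<open>P\<close>.\<close>
  define j where "j = nat \<lceil>ln x / (2 * ln d)\<rceil>"
  have pos: "0 < ln x / (2 * ln d)" using lnd lnx by simp
  then have j1: "1 \<le> j" unfolding j_def by linarith
  have jl: "ln x / (2 * ln d) \<le> real j" "real j \<le> ln x / (2 * ln d) + 1"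
    unfolding j_def using pos by linarith+
  have "ln x \<le> real (2 * j) * ln d" using jl(1) lnd by (simp add: field_simps)
  then have "ln x \<le> ln (d ^ (2 * j))" using d by (simp add: ln_realpow)
  then have dj: "x \<le> d ^ (2 * j)" using x d by (subst (asm) ln_le_cancel_iff) auto
  have "2 * D * (C * D powr \<epsilon>) * (1 / d) ^ (2 * j) = D / 2 * (x / d ^ (2 * j))"
    by (simp add: x_def power_one_over field_simps)
  also have "\<dots> \<le> D / 2 * 1" using dj d D x by (intro mult_left_mono) (auto simp: divide_le_eq_1)
  finally have h: "2 * D * (C * D powr \<epsilon>) * (1 / d) ^ (2 * j) \<le> D / 2" by simp
  have "P ^ j = P powr real j" using P by (simp add: powr_realpow)
  also have "\<dots> \<le> P powr (ln x / (2 * ln d) + 1)" using jl P by (intro powr_mono) auto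
  also have "\<dots> = P * x powr ?\<kappa>"
    using P x by (simp add: powr_def exp_add field_simps)
  finally have Pj: "P ^ j \<le> P * x powr ?\<kappa>" .
  have "D \<le> P ^ j * (C * D powr \<epsilon>) + D / 2" using bound[OF j1] h by linarith
  then have "D \<le> 2 * (P ^ j * (C * D powr \<epsilon>))" by linarith
  also have "\<dots> \<le> 4 * (P ^ j * (C * D powr \<epsilon>))" using C P by simp
  also have "\<dots> = P ^ j * x" by (simp add: x_def)
  also have "\<dots> \<le> (P * x powr ?\<kappa>) * x" using Pj x by (intro mult_right_mono) auto
  also have "\<dots> = P * x powr (1 + ?\<kappa>)" using x by (simp add: powr_add)
  also have "x powr (1 + ?\<kappa>) = (4 * C) powr (1 + ?\<kappa>) * D powr (\<epsilon> * (1 + ?\<kappa>))"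
    using C by (simp add: x_def powr_mult powr_powr mult.assoc[symmetric])
  also have "P * ((4 * C) powr (1 + ?\<kappa>) * D powr (\<epsilon> * (1 + ?\<kappa>)))
      \<le> P * ((4 * C) powr (1 + ?\<kappa>) * D powr (1 / 2))"
    using \<kappa> D P by (intro mult_left_mono powr_mono) auto
  finally have "D \<le> (P * (4 * C) powr (1 + ?\<kappa>)) * sqrt D"
    using D by (simp add: powr_half_sqrt mult.assoc)
  then have "sqrt D * sqrt D \<le> (P * (4 * C) powr (1 + ?\<kappa>)) * sqrt D" using D by simp
  then have "sqrt D \<le> P * (4 * C) powr (1 + ?\<kappa>)" using D by (subst (asm) mult_le_cancel_right) auto
  then have "(sqrt D)\<^sup>2 \<le> (P * (4 * C) powr (1 + ?\<kappa>))\<^sup>2" using D by (intro power_mono) auto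
  then show ?thesis using D by simp
qed

section \<open>The self-improving bound for fibre sums\<close>

context tprod
begin

abbreviation \<delta> :: real where "\<delta> \<equiv> 1 / real d"

lemma \<delta>: "0 < \<delta>" "\<delta> \<le> 1 / 2" "\<delta> < 1"
  using d by (auto simp: field_simps)

lemma \<delta>_pow: "0 < \<delta> ^ n" "\<delta> ^ n \<le> 1"
  using \<delta> by (auto intro: power_le_one simp del: power_one_over)

lemma \<delta>2_sum: "finite J \<Longrightarrow> (\<Sum>j\<in>J. \<delta> ^ (2 * j)) \<le> 2"
proof -
  assume J: "finite J"
  have "\<delta> * \<delta> \<le> 1 / 2 * (1 / 2)" using \<delta> by (intro mult_mono) auto
  then have q: "\<delta>\<^sup>2 \<le> 1 / 4" "\<delta>\<^sup>2 < 1" by (auto simp: power2_eq_square)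
  have "(\<Sum>j\<in>J. (\<delta>\<^sup>2) ^ j) \<le> 1 / (1 - \<delta>\<^sup>2)" using q J by (intro geometric_sum_le) auto
  also have "\<dots> \<le> 2" using q by (simp add: divide_le_eq)
  finally show ?thesis by (simp only: power_mult)
qed

lemma \<delta>_sum: "finite J \<Longrightarrow> (\<Sum>j\<in>J. \<delta> ^ j) \<le> 2"
proof -
  assume J: "finite J"
  have "(\<Sum>j\<in>J. \<delta> ^ j) \<le> 1 / (1 - \<delta>)" using \<delta> J by (intro geometric_sum_le) auto
  also have "\<dots> \<le> 2" using \<delta> by (simp add: divide_le_eq)
  finally show ?thesis .
qed

text \<open>Rows and columns are both needed: \<open>H\<close> need not be unimodular, so neither bounds the other.\<close>

definition Dvals :: "real \<Rightarrow> real set" where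
  "Dvals p = insert 1
    ({real d ^ m * rs p F (u 0, x) (fib (u (int m))) | u m x F.
        line u \<and> x \<in> verts G \<and> finite F \<and> F \<subseteq> EE (L u (int m))}
     \<union> {real d ^ m * rs p F (u (int m), x) (fib (u 0)) | u m x F.
        line u \<and> x \<in> verts G \<and> finite F \<and> F \<subseteq> EE (L u (int m))})"

text \<open>Confinement to the half-tree of the far end means that a path which overshoots its
  target can be cut at the farthest fibre it visits, with both parts still covered by
  \<open>DD\<close>. The member 1 of \<open>Dvals\<close> ensures that \<open>DD p\<close> is at
  least 1. The supremum is meaningful for \<open>sub_at p\<close>, by
  \<open>Dvals_bdd\<close>.\<close>

definition DD :: "real \<Rightarrow> real" where
  "DD p = Sup (Dvals p)"

lemma Dvals_bdd:
  assumes p: "0 \<le> p" "p \<le> 1" and s: "sub_at p"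
  shows "bdd_above (Dvals p)"
proof -
  obtain C where C: "\<forall>F x. finite F \<longrightarrow> F \<subseteq> edges H \<longrightarrow> x \<in> verts H \<longrightarrow> rs p F x (verts H) \<le> C"
    using s unfolding sub_at_def by (rule exE)
  have 1: "real d ^ m * rs p F (u 0, x) (fib (u (int m))) \<le> max 1 C"
    if "line u" "x \<in> verts G" "finite F" "F \<subseteq> EE (L u (int m))" for u m x F
  proof -
    have "F \<subseteq> edges H" using that(4) EE_subset by (rule order_trans)
    then have "real d ^ gd T (u 0) (u (int m)) * rs p F (u 0, x) (fib (u (int m))) \<le> C"
      using C that by (intro fibre_decay[OF p]) auto
    then show ?thesis using line_gd[OF that(1)] by simp
  qed
  have 2: "real d ^ m * rs p F (u (int m), x) (fib (u 0)) \<le> max 1 C"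
    if "line u" "x \<in> verts G" "finite F" "F \<subseteq> EE (L u (int m))" for u m x F
  proof -
    have "F \<subseteq> edges H" using that(4) EE_subset by (rule order_trans)
    then have "real d ^ gd T (u (int m)) (u 0) * rs p F (u (int m), x) (fib (u 0)) \<le> C"
      using C that by (intro fibre_decay[OF p]) auto
    then show ?thesis using line_gd[OF that(1)] by simp
  qed
  show ?thesis
    by (rule bdd_aboveI[of _ "max 1 C"]) (use 1 2 in \<open>auto simp: Dvals_def\<close>)
qed

lemma DD_ge_1: "0 \<le> p \<Longrightarrow> p \<le> 1 \<Longrightarrow> sub_at p \<Longrightarrow> 1 \<le> DD p"
  unfolding DD_def by (rule cSup_upper[OF _ Dvals_bdd]) (auto simp: Dvals_def)

lemma DD_forward:
  assumes p: "0 \<le> p" "p \<le> 1" "sub_at p" and u: "line u" and ij: "i \<le> j" and x: "x \<in> verts G"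
    and F: "finite F" "F \<subseteq> EE (L u j)"
  shows "rs p F (u i, x) (fib (u j)) \<le> DD p * \<delta> ^ nat (j - i)"
proof -
  let ?v = "\<lambda>k. u (k + i)" and ?m = "nat (j - i)"
  have "real d ^ ?m * rs p F (?v 0, x) (fib (?v (int ?m))) \<in> Dvals p"
    unfolding Dvals_def using line_shift[OF u, of i] x F ij
    by (intro insertI2 UnI1 CollectI exI[of _ ?v] exI[of _ ?m] exI[of _ x] exI[of _ F]) (auto simp: L_shift)
  then have "real d ^ ?m * rs p F (u i, x) (fib (u j)) \<le> DD p"
    unfolding DD_def using ij by (intro cSup_upper Dvals_bdd p) auto
  then show ?thesis using d by (simp add: field_simps)
qed

lemma DD_backward:
  assumes p: "0 \<le> p" "p \<le> 1" "sub_at p" and u: "line u" and ij: "i \<le> j" and x: "x \<in> verts G"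
    and F: "finite F" "F \<subseteq> EE (L u j)"
  shows "rs p F (u j, x) (fib (u i)) \<le> DD p * \<delta> ^ nat (j - i)"
proof -
  let ?v = "\<lambda>k. u (k + i)" and ?m = "nat (j - i)"
  have "real d ^ ?m * rs p F (?v (int ?m), x) (fib (?v 0)) \<in> Dvals p"
    unfolding Dvals_def using line_shift[OF u, of i] x F ij
    by (intro insertI2 UnI2 CollectI exI[of _ ?v] exI[of _ ?m] exI[of _ x] exI[of _ F]) (auto simp: L_shift)
  then have "real d ^ ?m * rs p F (u j, x) (fib (u i)) \<le> DD p"
    unfolding DD_def using ij by (intro cSup_upper Dvals_bdd p) auto
  then show ?thesis using d by (simp add: field_simps)
qed

lemma finite_visited:
  assumes u: "line u" and W: "finite W" and c: "c = 1 \<or> c = - 1"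
  shows "finite {j::nat. u (a + c * int j) \<in> fst ` W}"
proof (rule finite_subset[of _ "(\<lambda>j. u (a + c * int j)) -` (fst ` W)"])
  show "finite ((\<lambda>j::nat. u (a + c * int j)) -` (fst ` W))"
    using W c by (intro finite_vimageI) (auto simp: inj_on_def line_inj[OF u])
qed auto

text \<open>A path meets finitely many fibres of a ray, so there is a farthest one. The next fibre
  is then avoided, as \<open>stay_L\<close> and \<open>stay_compl_L\<close> require. The sign
  \<open>c\<close> covers both directions of the line.\<close>

lemma visit_max:
  assumes u: "line u" and sp: "spath F x xs y" and F: "fin_edges F" and c: "c = 1 \<or> c = - 1"
    and z0: "z0 \<in> set xs" "fst z0 = u (a + c * int j0)"
  shows "\<exists>j z as bs. j0 \<le> j \<and> z \<in> set xs \<and> fst z = u (a + c * int j) \<and> xs = as @ z # bs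
    \<and> u (a + c * int j) \<in> fst ` insert x (\<Union>F) \<and> (\<forall>z\<in>set xs. fst z \<noteq> u (a + c * int (Suc j)))"
proof -
  let ?J = "{j. \<exists>z\<in>set xs. fst z = u (a + c * int j)}"
  have sub: "?J \<subseteq> {j. u (a + c * int j) \<in> fst ` insert x (\<Union>F)}"
    using spath_mem[OF sp] by (force simp: image_iff)
  have fin: "finite ?J"
    by (rule finite_subset[OF sub finite_visited[OF u _ c]]) (use F in \<open>auto simp: fin_edges_def\<close>)
  have j0: "j0 \<in> ?J" using z0 by auto
  let ?j = "Max ?J"
  have j: "?j \<in> ?J" using fin j0 by (intro Max_in) auto
  then obtain z where z: "z \<in> set xs" "fst z = u (a + c * int ?j)" by auto
  obtain as bs where s: "xs = as @ z # bs" using z(1) by (meson split_list)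
  have Sj: "Suc ?j \<notin> ?J"
  proof
    assume "Suc ?j \<in> ?J"
    from Max_ge[OF fin this] show False by simp
  qed
  show ?thesis
  proof (rule exI[of _ ?j], rule exI[of _ z], rule exI[of _ as], rule exI[of _ bs],
      intro conjI Max_ge[OF fin j0] z s ballI)
    show "u (a + c * int ?j) \<in> fst ` insert x (\<Union>F)" using sub j by blast
    show "fst z \<noteq> u (a + c * int (Suc ?j))" if "z \<in> set xs" for z using Sj that by blast
  qed
qed

text \<open>A path to the fibre over \<open>t\<close> may go past it. Cut at the farthest fibre it
  visits on a ray beyond \<open>t\<close>, at distance \<open>j\<close> from \<open>t\<close>, it
  costs \<open>\<delta> ^ (n + j)\<close> on the way out and \<open>\<delta> ^ j\<close> on the way
  back, where \<open>n\<close> is the distance from \<open>s\<close> to \<open>t\<close>; the series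
  in \<open>j\<close> is at most 2. Freedom from the half-tree is thus bought with a second factor
  \<open>DD p\<close>.\<close>

lemma two_point_row:
  assumes p: "0 \<le> p" "p \<le> 1" "sub_at p" and st: "s \<in> verts T" "t \<in> verts T" and x: "x \<in> verts G"
    and F: "finite F" "F \<subseteq> edges H"
  shows "rs p F (s, x) (fib t) \<le> 2 * (DD p)\<^sup>2 * \<delta> ^ gd T s t"
proof -
  let ?n = "gd T s t"
  obtain u where u: "line u" "u 0 = s" "u (int ?n) = t" using line_exists[OF st] by metis
  let ?w = "\<lambda>j. u (int ?n + 1 * int j)"
  let ?I = "{j. ?w j \<in> fst ` insert (s, x) (\<Union>F)}"
  have fe: "fin_edges F" using F by (rule H.fin_edges)
  have I: "finite ?I" by (rule finite_visited[OF u(1)]) (use fe in \<open>auto simp: fin_edges_def\<close>)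
  let ?R = "\<lambda>j. reg (L u (int ?n + 1 * int j))"
  have fR: "finite (F \<inter> inner (?R j))" "F \<inter> inner (?R j) \<subseteq> EE (L u (int ?n + 1 * int j))" for j
    using F EE_Int_inner by auto
  have D: "1 \<le> DD p" by (rule DD_ge_1[OF p])
  have "rs p F (s, x) (fib t) \<le> (\<Sum>j\<in>?I. (DD p * \<delta> ^ (?n + j)) * (DD p * \<delta> ^ j))"
  proof (rule rs_split[where Z = "\<lambda>j. fib (?w j)" and R = ?R and R' = ?R, OF fe p(1,2) I])
    fix xs y assume y: "y \<in> fib t" and sp: "spath F (s, x) xs y"
    have ye: "y \<in> set xs" "fst y = u (int ?n + 1 * int 0)" using spath_ends[OF sp] y u by (auto simp: fib_def)
    from visit_max[OF u(1) sp fe disjI1[OF refl] ye]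
    obtain j z as bs where j: "z \<in> set xs" "fst z = ?w j" "xs = as @ z # bs"
      "?w j \<in> fst ` insert (s, x) (\<Union>F)" "\<forall>z\<in>set xs. fst z \<noteq> ?w (Suc j)"
      by (elim exE conjE) (rule that)
    have sx: "set xs \<subseteq> ?R j"
    proof (rule stay_L[OF u(1)])
      show "pedges xs \<subseteq> edges H" "xs \<noteq> []" using sp F by (auto simp: spath_def)
      have "u 0 \<in> L u (int ?n + 1 * int j)" using line_mem_L[OF u(1)] by simp
      then show "hd xs \<in> ?R j" using sp x u by (auto simp: spath_def reg_def)
      fix z assume "z \<in> set xs"
      then show "fst z \<noteq> u (int ?n + 1 * int j + 1)" using j(5) by (auto simp: algebra_simps)
    qed
    have "z \<in> fib (?w j)" using sx j(1,2) by (cases z) (auto simp: fib_def reg_def)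
    then show "\<exists>j\<in>?I. \<exists>as z bs. xs = as @ z # bs \<and> z \<in> fib (?w j) \<and> set (as @ [z]) \<subseteq> ?R j \<and> set (z # bs) \<subseteq> ?R j"
      using sx j(3,4) by (intro bexI[of _ j] exI[of _ as] exI[of _ z] exI[of _ bs]) auto
  next
    fix j
    have "rs p (F \<inter> inner (?R j)) (u 0, x) (fib (?w j)) \<le> DD p * \<delta> ^ nat (int ?n + 1 * int j - 0)"
      using x by (intro DD_forward[OF p u(1)] fR) auto
    then show "rs p (F \<inter> inner (?R j)) (s, x) (fib (?w j)) \<le> DD p * \<delta> ^ (?n + j)"
      using u by (simp add: nat_add_distrib)
  next
    fix j z assume "z \<in> fib (?w j)"
    then obtain y where "z = (?w j, y)" "y \<in> verts G" by (auto simp: fib_def)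
    then show "rs p (F \<inter> inner (?R j)) z (fib t) \<le> DD p * \<delta> ^ j"
      using DD_backward[OF p u(1) _ _ fR(1,2), of "int ?n" j y] u by simp
  next
    show "0 \<le> DD p * \<delta> ^ j" for j using D \<delta>_pow by simp
  qed
  also have "\<dots> = (DD p)\<^sup>2 * \<delta> ^ ?n * (\<Sum>j\<in>?I. \<delta> ^ (2 * j))"
    unfolding sum_distrib_left
    by (intro sum.cong refl) (rule pow_merge)
  also have "\<dots> \<le> (DD p)\<^sup>2 * \<delta> ^ ?n * 2"
    using \<delta>2_sum[OF I] \<delta>_pow[of ?n] by (intro mult_left_mono) auto
  finally show ?thesis by simp
qed

text \<open>Tree-graph inequality with branch point \<open>w\<close>. The rows from \<open>w\<close>
  to the target give one factor \<open>DD p\<close> each: they are of half-tree type for every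
  \<open>w\<close>, once the line is replaced by one through \<open>w\<close>. The connection to
  \<open>w\<close> gives two more factors.\<close>

lemma second_moment:
  assumes p: "0 \<le> p" "p \<le> 1" "sub_at p" and u: "line u" and x: "x \<in> verts G"
    and F: "finite F" "F \<subseteq> EE (L u (int m) - L u (- 1))"
  shows "Exp p F (\<lambda>U. (cnt U (u 0, x) (fib (u (int m))))\<^sup>2) \<le> 16 * DD p ^ 4 * \<delta> ^ m"
proof -
  let ?A = "fib (u (int m))" and ?o = "(u 0, x)"
  let ?W = "insert ?o (\<Union>F)"
  have FL: "F \<subseteq> EE (L u (int m))" using F(2) EE_mono[of "L u (int m) - L u (- 1)" "L u (int m)"] by auto
  have FH: "F \<subseteq> edges H" using FL EE_subset by auto
  have fe: "fin_edges F" using F(1) FH by (rule H.fin_edges)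
  have W: "finite ?W" using fe by (auto simp: fin_edges_def)
  have D: "1 \<le> DD p" by (rule DD_ge_1[OF p])
  have WL: "fst w \<in> L u (int m) \<and> snd w \<in> verts G" if "w \<in> ?W" for w
  proof (cases "w = ?o")
    case False
    then have "w \<in> \<Union>F" using that by auto
    then have "w \<in> reg (L u (int m))" using FL by (auto simp: EE_def inner_def)
    then show ?thesis by (auto simp: reg_def)
  qed (use x line_mem_L[OF u] in auto)
  have row: "rs p F w ?A \<le> DD p * \<delta> ^ gd T (fst w) (u (int m))" if w: "w \<in> ?W" for w
  proof -
    obtain v y where vy: "w = (v, y)" by (cases w)
    have v: "v \<in> L u (int m)" "y \<in> verts G" using WL[OF w] vy by auto
    let ?n = "gd T v (u (int m))"
    obtain r where r: "line r" "r 0 = v" "r (int ?n) = u (int m)" "r (int ?n + 1) = u (int m + 1)"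
      by (rule line_into_L[OF u v(1)])
    have "L r (int ?n) = L u (int m)" by (simp add: L_def r)
    then have "rs p F (r 0, y) (fib (r (int ?n))) \<le> DD p * \<delta> ^ nat (int ?n - 0)"
      using F FL v by (intro DD_forward[OF p r(1)]) auto
    then show ?thesis using r vy by simp
  qed
  let ?f = "\<lambda>a b. 2 * DD p ^ 4 * \<delta> ^ a * \<delta> ^ (2 * b)"
  have "Exp p F (\<lambda>U. (cnt U ?o ?A)\<^sup>2)
     = Exp p F (\<lambda>U. (\<Sum>y\<in>?A \<inter> ?W. of_bool (conn U ?o y)) * (\<Sum>y\<in>?A \<inter> ?W. of_bool (conn U ?o y)))"
    by (rule Exp_cong) (simp add: cnt_eq[OF fe] power2_eq_square)
  also have "\<dots> \<le> (\<Sum>w\<in>?W. tau p F ?o w * rs p F w ?A * rs p F w ?A)"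
    by (rule mixed_moment[OF fe p(1,2)])
  also have "\<dots> \<le> (\<Sum>w\<in>?W. tau p F ?o w * (DD p * \<delta> ^ gd T (fst w) (u (int m))) * (DD p * \<delta> ^ gd T (fst w) (u (int m))))"
    using p row rs_nonneg[OF p(1,2)] D \<delta>_pow by (intro sum_mono mult_mono mult_nonneg_nonneg) auto
  also have "\<dots> = (\<Sum>v\<in>fst ` ?W. \<Sum>w\<in>{w \<in> ?W. fst w = v}.
      tau p F ?o w * (DD p * \<delta> ^ gd T (fst w) (u (int m))) * (DD p * \<delta> ^ gd T (fst w) (u (int m))))"
    using W by (intro sum.group[symmetric]) auto
  also have "\<dots> = (\<Sum>v\<in>fst ` ?W. (\<Sum>w\<in>{w \<in> ?W. fst w = v}. tau p F ?o w) * ((DD p)\<^sup>2 * \<delta> ^ (2 * gd T v (u (int m)))))"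
  proof (intro sum.cong refl)
    fix v
    have "(\<Sum>w\<in>{w \<in> ?W. fst w = v}.
      tau p F ?o w * (DD p * \<delta> ^ gd T (fst w) (u (int m))) * (DD p * \<delta> ^ gd T (fst w) (u (int m))))
      = (\<Sum>w\<in>{w \<in> ?W. fst w = v}. tau p F ?o w * ((DD p)\<^sup>2 * \<delta> ^ (2 * gd T v (u (int m)))))"
      by (intro sum.cong refl) (auto simp: power2_eq_square mult_2 power_add)
    then show "(\<Sum>w\<in>{w \<in> ?W. fst w = v}.
      tau p F ?o w * (DD p * \<delta> ^ gd T (fst w) (u (int m))) * (DD p * \<delta> ^ gd T (fst w) (u (int m))))
      = (\<Sum>w\<in>{w \<in> ?W. fst w = v}. tau p F ?o w) * ((DD p)\<^sup>2 * \<delta> ^ (2 * gd T v (u (int m))))"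
      by (simp only: sum_distrib_right)
  qed
  also have "\<dots> \<le> (\<Sum>v\<in>fst ` ?W. ?f (gd T v (u 0)) (gd T v (u (int m))))"
  proof (rule sum_mono)
    fix v assume v: "v \<in> fst ` ?W"
    obtain w where "v = fst w" "w \<in> ?W" using v by (rule imageE)
    then have vT: "v \<in> verts T" using WL[of w] L_subset[of u "int m"] by auto
    have "(\<Sum>w\<in>{w \<in> ?W. fst w = v}. tau p F ?o w) \<le> rs p F ?o (fib v)"
    proof (rule sum_tau_le_rs[OF fe _ _ p(1,2)])
      show "finite {w \<in> ?W. fst w = v}" using W by (rule finite_subset[rotated]) auto
      show "{w \<in> ?W. fst w = v} \<subseteq> fib v"
      proof
        fix w assume "w \<in> {w \<in> ?W. fst w = v}"
        then show "w \<in> fib v" using WL[of w] by (cases w) (simp add: fib_def)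
      qed
    qed
    also have "\<dots> \<le> 2 * (DD p)\<^sup>2 * \<delta> ^ gd T (u 0) v"
      using vT x F(1) FH u by (intro two_point_row[OF p]) auto
    finally have "(\<Sum>w\<in>{w \<in> ?W. fst w = v}. tau p F ?o w) * ((DD p)\<^sup>2 * \<delta> ^ (2 * gd T v (u (int m))))
       \<le> (2 * (DD p)\<^sup>2 * \<delta> ^ gd T (u 0) v) * ((DD p)\<^sup>2 * \<delta> ^ (2 * gd T v (u (int m))))"
      using \<delta>_pow[of "2 * gd T v (u (int m))"] by (intro mult_right_mono) auto
    also have "\<dots> = ?f (gd T v (u 0)) (gd T v (u (int m)))"
      by (simp add: gd_sym power4_eq_xxxx power2_eq_square)
    finally show "(\<Sum>w\<in>{w \<in> ?W. fst w = v}. tau p F ?o w) * ((DD p)\<^sup>2 * \<delta> ^ (2 * gd T v (u (int m))))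
       \<le> ?f (gd T v (u 0)) (gd T v (u (int m)))" .
  qed
  also have "\<dots> \<le> 16 * DD p ^ 4 * \<delta> ^ m"
  proof -
    have fV: "finite (fst ` ?W)" "fst ` ?W \<subseteq> verts T"
      using W WL L_subset[of u "int m"] by (blast intro: finite_imageI)+
    have f0: "0 \<le> ?f a b" for a b using D \<delta>_pow[of a] \<delta>_pow[of "2 * b"] by simp
    obtain J where "(\<Sum>v\<in>fst ` ?W. ?f (gd T v (u 0)) (gd T v (u (int m))))
        \<le> (\<Sum>i\<le>m. \<Sum>j<J. 2 * real d ^ j * ?f (i + j) ((m - i) + j))"
      using tree_sum_le[OF u fV, of ?f m] f0 by blast
    \<comment> \<open>The \<open>d ^ j\<close> vertices at distance \<open>j\<close> cancel one
      \<open>\<delta> ^ j\<close>. What remains besides \<open>\<delta> ^ m\<close> is a geometric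
      series in \<open>j\<close> and another in \<open>m - i\<close>.\<close>
    also have "\<dots> = (\<Sum>i\<le>m. \<Sum>j<J. (4 * DD p ^ 4 * \<delta> ^ m * \<delta> ^ (m - i)) * \<delta> ^ (2 * j))"
    proof (intro sum.cong refl)
      fix i j assume i: "i \<in> {..m}"
      have "real d ^ j * \<delta> ^ j = 1" using d by (simp add: power_one_over)
      moreover have "\<delta> ^ (i + j) * \<delta> ^ (2 * ((m - i) + j)) = \<delta> ^ j * \<delta> ^ m * \<delta> ^ (m - i) * \<delta> ^ (2 * j)"
      proof -
        have "(i + j) + 2 * ((m - i) + j) = j + m + (m - i) + 2 * j" using i by auto
        then show ?thesis by (metis power_add)
      qed
      ultimately show "2 * real d ^ j * ?f (i + j) ((m - i) + j)
          = (4 * DD p ^ 4 * \<delta> ^ m * \<delta> ^ (m - i)) * \<delta> ^ (2 * j)"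
        by (rule cancel_factor)
    qed
    also have "\<dots> = (\<Sum>i\<le>m. (4 * DD p ^ 4 * \<delta> ^ m * \<delta> ^ (m - i)) * (\<Sum>j<J. \<delta> ^ (2 * j)))"
      by (simp only: sum_distrib_left)
    also have "\<dots> \<le> (\<Sum>i\<le>m. (4 * DD p ^ 4 * \<delta> ^ m * \<delta> ^ (m - i)) * 2)"
      using D \<delta>_pow \<delta>2_sum by (intro sum_mono mult_left_mono mult_nonneg_nonneg) (auto simp: less_imp_le)
    also have "\<dots> = (8 * DD p ^ 4 * \<delta> ^ m) * (\<Sum>i\<le>m. \<delta> ^ (m - i))"
      unfolding sum_distrib_left by (intro sum.cong) auto
    also have "(\<Sum>i\<le>m. \<delta> ^ (m - i)) = (\<Sum>i\<le>m. \<delta> ^ i)"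
      by (rule sum.reindex_bij_witness[of _ "\<lambda>i. m - i" "\<lambda>i. m - i"]) auto
    also have "(8 * DD p ^ 4 * \<delta> ^ m) * \<dots> \<le> (8 * DD p ^ 4 * \<delta> ^ m) * 2"
      using D \<delta>_pow[of m] \<delta>_sum[of "{..m}"] by (intro mult_left_mono) auto
    finally show ?thesis by simp
  qed
  finally show ?thesis .
qed

text \<open>The strip lacks the branch beyond \<open>u m\<close>: the edges there are independent of the count and serve for
  the further steps of the coasting argument.\<close>

definition moment_bound :: "real \<Rightarrow> real \<Rightarrow> real \<Rightarrow> bool" where
  "moment_bound p a K \<longleftrightarrow> (\<forall>u x m F. line u \<longrightarrow> x \<in> verts G \<longrightarrow> finite F \<longrightarrow>
     F \<subseteq> EE (L u (int m) - L u (- 1)) \<longrightarrow>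
     Exp p F (\<lambda>U. cnt U (u 0, x) (fib (u (int m))) powr a) \<le> K * \<delta> ^ m)"

text \<open>Interpolation between the moment of order \<open>a < 1\<close> and the second moment.\<close>

lemma strip_row:
  assumes p: "0 \<le> p" "p \<le> 1" "sub_at p" and a: "0 < a" "a < 1" and K: "moment_bound p a K" "0 \<le> K"
    and u: "line u" and x: "x \<in> verts G" and F: "finite F" "F \<subseteq> EE (L u (int m) - L u (- 1))"
  shows "rs p F (u 0, x) (fib (u (int m))) \<le> (K + 16) * DD p powr (4 * (1 - a)) * \<delta> ^ m"
proof -
  let ?Y = "\<lambda>U. cnt U (u 0, x) (fib (u (int m)))"
  have fe: "fin_edges F" using F EE_subset by (intro H.fin_edges) auto
  have D: "1 \<le> DD p" by (rule DD_ge_1[OF p])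
  \<comment> \<open>The truncation level is the second moment bound without its constant and its
    decay: counts up to \<open>V\<close> are charged to the moment of order \<open>a\<close>, larger
    counts to the second moment.\<close>
  define V where "V = DD p ^ 4"
  have V: "1 \<le> V" unfolding V_def using D by (rule one_le_power)
  have Va: "V powr (1 - a) = DD p powr (4 * (1 - a))"
    unfolding V_def using D by (simp add: powr_powr flip: powr_numeral)
  have Va1: "1 \<le> V powr (1 - a)" using V a by (simp add: ge_one_powr_ge_zero)
  have pw: "y \<le> V powr (1 - a) * y powr a + y\<^sup>2 * (1 / V)" if "0 \<le> y" for y
  proof (cases "y = 0 \<or> V < y")
    case True
    have "V * y \<le> y * y \<or> y = 0" using True mult_right_mono[of V y y] that by auto
    then have "y \<le> y\<^sup>2 * (1 / V)" using V by (auto simp: power2_eq_square field_simps)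
    then show ?thesis by (simp add: add_increasing)
  next
    case False
    then have y: "0 < y" "y \<le> V" using that by auto
    have "y = y powr (1 - a) * y powr a" using y by (simp add: powr_add[symmetric])
    also have "\<dots> \<le> V powr (1 - a) * y powr a" using y a by (intro mult_right_mono powr_mono2) auto
    also have "\<dots> \<le> V powr (1 - a) * y powr a + y\<^sup>2 * (1 / V)" using V by simp
    finally show ?thesis .
  qed
  have "rs p F (u 0, x) (fib (u (int m))) = Exp p F ?Y" by (simp add: Exp_cnt[OF fe])
  also have "\<dots> \<le> Exp p F (\<lambda>U. V powr (1 - a) * ?Y U powr a + (?Y U)\<^sup>2 * (1 / V))"
    using p pw by (intro Exp_mono) (auto simp: cnt_def)
  also have "\<dots> = V powr (1 - a) * Exp p F (\<lambda>U. ?Y U powr a) + Exp p F (\<lambda>U. (?Y U)\<^sup>2) * (1 / V)"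
    by (simp only: Exp_add Exp_cmult Exp_multc)
  also have "\<dots> \<le> V powr (1 - a) * (K * \<delta> ^ m) + (16 * V * \<delta> ^ m) * (1 / V)"
    using K(1)[unfolded moment_bound_def] u x F V second_moment[OF p u x F]
    by (intro add_mono mult_left_mono mult_right_mono) (auto simp: V_def)
  also have "\<dots> = V powr (1 - a) * (K * \<delta> ^ m) + 1 * (16 * \<delta> ^ m)" using V by simp
  also have "\<dots> \<le> V powr (1 - a) * (K * \<delta> ^ m) + V powr (1 - a) * (16 * \<delta> ^ m)"
    using Va1 \<delta>_pow[of m] by (intro add_left_mono mult_right_mono) auto
  finally show ?thesis unfolding Va by (simp add: algebra_simps)
qed

text \<open>A strip looks the same from both ends, so reversing the line turns the column estimate
  into a row estimate.\<close>

lemma strip_row_offset: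
  assumes p: "0 \<le> p" "p \<le> 1" "sub_at p" and a: "0 < a" "a < 1" and K: "moment_bound p a K" "0 \<le> K"
    and u: "line u" and ij: "i \<le> j" and x: "x \<in> verts G" and F: "finite F" "F \<subseteq> EE (L u j - L u (i - 1))"
  shows "rs p F (u i, x) (fib (u j)) \<le> (K + 16) * DD p powr (4 * (1 - a)) * \<delta> ^ nat (j - i)"
    "rs p F (u j, x) (fib (u i)) \<le> (K + 16) * DD p powr (4 * (1 - a)) * \<delta> ^ nat (j - i)"
proof -
  let ?m = "nat (j - i)"
  let ?v = "\<lambda>k. u (k + i)" and ?w = "\<lambda>k. u (j - k)"
  have "L ?v (int ?m) - L ?v (- 1) = L u j - L u (i - 1)" using ij by (simp add: L_shift)
  then have "rs p F (?v 0, x) (fib (?v (int ?m))) \<le> (K + 16) * DD p powr (4 * (1 - a)) * \<delta> ^ ?m"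
    using F by (intro strip_row[OF p a K line_shift[OF u] x]) auto
  then show "rs p F (u i, x) (fib (u j)) \<le> (K + 16) * DD p powr (4 * (1 - a)) * \<delta> ^ ?m" using ij by simp
  have "L ?w (int ?m) - L ?w (- 1) = (verts T - L u (i - 1)) - (verts T - L u j)"
    using L_rev[OF u, of j "int ?m"] L_rev[OF u, of j "- 1"] ij by simp
  also have "\<dots> = L u j - L u (i - 1)" using L_subset[of u j] by auto
  finally have "rs p F (?w 0, x) (fib (?w (int ?m))) \<le> (K + 16) * DD p powr (4 * (1 - a)) * \<delta> ^ ?m"
    using F by (intro strip_row[OF p a K line_rev[OF u] x]) auto
  then show "rs p F (u j, x) (fib (u i)) \<le> (K + 16) * DD p powr (4 * (1 - a)) * \<delta> ^ ?m" using ij by simp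
qed

lemma vertical_walk:
  assumes u: "line u" and x: "x \<in> verts G"
  shows "\<exists>W. finite W \<and> card W \<le> n \<and> W \<subseteq> EE (u ` {i..i + int n}) \<and> conn W (u i, x) (u (i + int n), x)"
proof (induction n)
  case 0
  then show ?case by (intro exI[of _ "{}"]) auto
next
  case (Suc n)
  then obtain W where W: "finite W" "card W \<le> n" "W \<subseteq> EE (u ` {i..i + int n})" "conn W (u i, x) (u (i + int n), x)"
    by auto
  let ?e = "{(u (i + int n), x), (u (i + int (Suc n)), x)}"
  have "adj H (u (i + int n), x) (u (i + int (Suc n)), x)"
    using line_adj[OF u, of "i + int n"] x by (simp add: adj_box add.commute add.left_commute)
  then have "?e \<in> EE (u ` {i..i + int (Suc n)})"
    using x by (auto simp: EE_def inner_def reg_def adj_def)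
  moreover have "W \<subseteq> EE (u ` {i..i + int (Suc n)})"
    using W(3) EE_mono[of "u ` {i..i + int n}" "u ` {i..i + int (Suc n)}"] by fastforce
  moreover have "conn (insert ?e W) (u i, x) (u (i + int (Suc n)), x)"
    using conn_mono[OF W(4), of "insert ?e W"] conn_edge[of "(u (i + int n), x)" "(u (i + int (Suc n)), x)" "insert ?e W"]
      conn_trans[of "insert ?e W" "(u i, x)" "(u (i + int n), x)" "(u (i + int (Suc n)), x)"] by auto
  moreover have "card (insert ?e W) \<le> Suc n" using W by (simp add: card_insert_if)
  ultimately show ?case using W(1) by (intro exI[of _ "insert ?e W"]) auto
qed

text \<open>A path in the half-tree either avoids the fibre over \<open>u (- j)\<close> or has a
  farthest visited fibre over some \<open>u (- i)\<close> with \<open>i \<ge> j\<close>. In the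
  first case a vertical path of \<open>j - 1\<close> edges moves the end over \<open>u 0\<close>
  back to where the strip estimate applies, at the price of a power of \<open>1 / p\<close>. In the
  second case the excursion beyond \<open>u 0\<close> costs \<open>DD p * \<delta> ^ i\<close> and
  the passage through the strip costs \<open>g * \<delta> ^ (m + i)\<close>; the sum over
  \<open>i \<ge> j\<close> produces the small factor \<open>\<delta> ^ (2 * j)\<close> in front of
  \<open>DD p\<close>.\<close>

lemma telescope_forward:
  assumes p: "0 < p" "p \<le> 1" "sub_at p" and a: "0 < a" "a < 1" and K: "moment_bound p a K" "0 \<le> K"
    and u: "line u" and x: "x \<in> verts G" and F: "finite F" "F \<subseteq> EE (L u (int m))" and j: "1 \<le> j"
  defines "g \<equiv> (K + 16) * DD p powr (4 * (1 - a))"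
  shows "rs p F (u 0, x) (fib (u (int m))) \<le> \<delta> ^ m * ((1 / p) ^ j * g + 2 * DD p * g * \<delta> ^ (2 * j))"
    and "rs p F (u (int m), x) (fib (u 0)) \<le> \<delta> ^ m * ((1 / p) ^ j * g + 2 * DD p * g * \<delta> ^ (2 * j))"
proof -
  have p': "0 \<le> p" using p by simp
  note pp = p' p(2,3)
  have D: "1 \<le> DD p" by (rule DD_ge_1[OF pp])
  have g: "0 \<le> g" unfolding g_def using K D by simp
  have FH: "F \<subseteq> edges H" using F EE_subset by auto
  have fe: "fin_edges F" using F(1) FH by (rule H.fin_edges)
  let ?s = "(u 0, x)" and ?t = "(u (int m), x)"
  let ?w = "\<lambda>i. u (0 + - 1 * int i)"
  let ?r = "\<lambda>k. u (0 - k)"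
  \<comment> \<open>\<open>?N\<close> ends just before the fibre over \<open>u (- j)\<close>,
    whereas \<open>?S i\<close> still contains the fibre over \<open>u (- i)\<close>.
    \<open>?C i\<close> is a half-tree of the reversed line, as needed for
    \<open>DD\<close>.\<close>
  let ?N = "reg (L u (int m) - L u (- int j))"
  let ?C = "\<lambda>i. reg (verts T - L u (- int i - 1))"
  let ?S = "\<lambda>i. reg (L u (int m) - L u (- int i - 1))"
  have r: "line ?r" "L ?r (int i) = verts T - L u (- int i - 1)" for i
    using line_rev[OF u, of 0] L_rev[OF u, of 0 "int i"] by simp_all
  have inF: "finite (F \<inter> inner (reg S))" "F \<inter> inner (reg S) \<subseteq> EE S" for S
    using F FH EE_Int_inner by auto
  have path: "(\<forall>z. z \<in> set xs \<longrightarrow> z \<in> ?N) \<or> (\<exists>i as z bs. j \<le> i \<and> xs = as @ z # bs \<and> z \<in> fib (?w i)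
      \<and> set xs \<subseteq> ?S i \<and> ?w i \<in> fst ` insert o' (\<Union>F))"
    if sp: "spath F o' xs y" and o': "o' = ?s \<or> o' = ?t" for o' xs y
  proof -
    have xs: "pedges xs \<subseteq> edges H" "xs \<noteq> []" "hd xs = o'" using sp FH by (auto simp: spath_def)
    have hN: "o' \<in> reg (verts T - L u (- int i))" if "1 \<le> i" for i
      using o' x u that line_mem_L[OF u] by (auto simp: reg_def)
    have z: "z \<in> reg (L u (int m))" if "z \<in> set xs" for z
    proof (cases "z = o'")
      case True
      then show ?thesis using o' x line_mem_L[OF u] by (auto simp: reg_def)
    next
      case False
      then have "z \<in> \<Union>F" using spath_mem[OF sp that] by auto
      then show ?thesis using F(2) by (auto simp: EE_def inner_def)
    qed
    have split: "z \<in> reg (L u (int m) - L u k)" if "z \<in> set xs" "set xs \<subseteq> reg (verts T - L u k)" for z k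
      using that z[OF that(1)] by (auto simp: reg_def)
    show ?thesis
    proof (cases "\<exists>z0\<in>set xs. fst z0 = u (0 + - 1 * int j)")
      case False
      have "set xs \<subseteq> reg (verts T - L u (- int j))"
        using False hN[OF j] xs by (intro stay_compl_L[OF u xs(1,2)]) auto
      then show ?thesis using split by auto
    next
      case True
      then obtain z0 where z0: "z0 \<in> set xs" "fst z0 = u (0 + - 1 * int j)" by auto
      from visit_max[OF u sp fe disjI2[OF refl] z0]
      obtain i v as bs where i: "j \<le> i" "v \<in> set xs" "fst v = ?w i" "xs = as @ v # bs"
        "?w i \<in> fst ` insert o' (\<Union>F)" "\<forall>z\<in>set xs. fst z \<noteq> ?w (Suc i)"
        by (elim exE conjE) (rule that)
      have "set xs \<subseteq> reg (verts T - L u (- int i - 1))"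
      proof (rule stay_compl_L[OF u xs(1,2)])
        show "hd xs \<in> reg (verts T - L u (- int i - 1))" 
        proof -
          have "- int (Suc i) = - int i - 1" by simp
          then show ?thesis using hN[of "Suc i"] xs(3) by (metis le_add1 plus_1_eq_Suc)
        qed
        fix z assume "z \<in> set xs"
        moreover have "0 + - 1 * int (Suc i) = - int i - 1" by simp
        ultimately show "fst z \<noteq> u (- int i - 1)" using i(6) by metis
      qed
      then have "set xs \<subseteq> ?S i" using split by auto
      moreover have "v \<in> fib (?w i)" using i(2,3) z[of v] by (cases v) (auto simp: fib_def reg_def)
      ultimately show ?thesis using i by blast
    qed
  qed
  have vertS: "EE (u ` {- int (j - 1)..- int (j - 1) + int (j - 1)}) \<subseteq> EE (L u (int m) - L u (- int (j - 1) - 1))"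
    using line_mem_L[OF u] by (intro EE_mono) auto
  have vert: "\<exists>W. finite W \<and> card W \<le> j - 1 \<and> W \<subseteq> EE (L u (int m) - L u (- int (j - 1) - 1))
      \<and> conn W (u (- int (j - 1)), w) (u 0, w)" if w: "w \<in> verts G" for w
    using vertical_walk[OF u w, of "j - 1" "- int (j - 1)"] vertS by auto
  \<comment> \<open>A strip starting at \<open>u (- (j - 1))\<close> excludes \<open>u (- j)\<close>
    and what lies behind it, so it matches \<open>?N\<close> exactly; hence \<open>j - 1\<close>
    vertical edges and not \<open>j\<close>.\<close>
  have jj: "- int (j - 1) - 1 = - int j" using j by auto
  let ?A = "\<delta> ^ m * ((1 / p) ^ j * g)" and ?B = "\<lambda>i. DD p * g * \<delta> ^ m * \<delta> ^ (2 * i)"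
  let ?R = "\<delta> ^ m * ((1 / p) ^ j * g + 2 * DD p * g * \<delta> ^ (2 * j))"
  have fold: "p ^ (j - 1) * R \<le> g * \<delta> ^ (m + (j - 1)) \<Longrightarrow> R \<le> ?A" for R
  proof -
    assume h: "p ^ (j - 1) * R \<le> g * \<delta> ^ (m + (j - 1))"
    have "R = (1 / p) ^ (j - 1) * (p ^ (j - 1) * R)" using p by (simp add: power_one_over)
    also have "\<dots> \<le> (1 / p) ^ (j - 1) * (g * \<delta> ^ (m + (j - 1)))"
      using h p by (intro mult_left_mono) auto
    also have "\<dots> \<le> (1 / p) ^ j * (g * \<delta> ^ m)"
      using p g \<delta> \<delta>_pow by (intro mult_mono mult_left_mono power_increasing power_decreasing) auto
    finally show ?thesis by (simp add: algebra_simps)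
  qed
  have total: "R \<le> (\<Sum>i\<in>insert 0 I. if i = 0 then ?A else ?B i) \<Longrightarrow>
     R \<le> ?R"
    if I: "finite I" "\<And>i. i \<in> I \<Longrightarrow> j \<le> i" for R and I :: "nat set"
  proof -
    assume h: "R \<le> (\<Sum>i\<in>insert 0 I. if i = 0 then ?A else ?B i)"
    have n0: "0 \<notin> I" using I(2) j by force
    have "(\<Sum>i\<in>I. \<delta> ^ (2 * i)) = (\<Sum>i\<in>(\<lambda>i. i - j) ` I. \<delta> ^ (2 * (i + j)))"
    proof (subst sum.reindex)
      show "inj_on (\<lambda>i. i - j) I" using I(2) by (meson eq_diff_iff inj_onI)
      show "(\<Sum>i\<in>I. \<delta> ^ (2 * i)) = sum ((\<lambda>i. \<delta> ^ (2 * (i + j))) \<circ> (\<lambda>i. i - j)) I"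
        by (intro sum.cong refl) (simp only: comp_def I(2) le_add_diff_inverse2)
    qed
    also have "\<dots> = \<delta> ^ (2 * j) * (\<Sum>i\<in>(\<lambda>i. i - j) ` I. \<delta> ^ (2 * i))"
      unfolding sum_distrib_left by (intro sum.cong refl) (simp add: power_add algebra_simps)
    also have "\<dots> \<le> \<delta> ^ (2 * j) * 2"
      using I(1) \<delta>_pow[of "2 * j"] by (intro mult_left_mono \<delta>2_sum) auto
    finally have s: "(\<Sum>i\<in>I. \<delta> ^ (2 * i)) \<le> \<delta> ^ (2 * j) * 2" .
    have "(\<Sum>i\<in>I. if i = 0 then ?A else ?B i)
       = (DD p * g * \<delta> ^ m) * (\<Sum>i\<in>I. \<delta> ^ (2 * i))"
      unfolding sum_distrib_left using n0 by (intro sum.cong) auto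
    also have "\<dots> \<le> (DD p * g * \<delta> ^ m) * (\<delta> ^ (2 * j) * 2)"
      using D g \<delta>_pow[of m] by (intro mult_left_mono s) auto
    finally show ?thesis using h n0 I(1) by (simp add: algebra_simps)
  qed
  let ?I = "\<lambda>o'. {i. j \<le> i \<and> ?w i \<in> fst ` insert o' (\<Union>F)}"
  have I: "finite (?I o')" for o'
    by (rule finite_subset[OF _ finite_visited[OF u, of "insert o' (\<Union>F)" "-1" 0]])
      (use fe in \<open>auto simp: fin_edges_def\<close>)
  have A0: "rs p (F \<inter> inner ?N) ?s (fib (u (int m))) \<le> ?A"
  proof (rule fold)
    obtain W where W: "finite W" "card W \<le> j - 1" "W \<subseteq> EE (L u (int m) - L u (- int (j - 1) - 1))"
        "conn W (u (- int (j - 1)), x) (u 0, x)" using vert[OF x] by auto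
    let ?F = "F \<inter> inner ?N" and ?F' = "F \<inter> inner ?N \<union> W"
    have F': "finite ?F'" "?F' \<subseteq> EE (L u (int m) - L u (- int (j - 1) - 1))"
      using inF[of "L u (int m) - L u (- int j)"] W jj by auto
    have fe': "fin_edges ?F'" by (rule H.fin_edges[OF F'(1) order_trans[OF F'(2) EE_subset]])
    have "p ^ (j - 1) * tau p ?F ?s y \<le> tau p ?F' (u (- int (j - 1)), x) y" for y
    proof -
      have "p ^ (j - 1) * tau p ?F ?s y \<le> tau p ?F' (u (- int (j - 1)), x) ?s * tau p ?F' ?s y"
        using W p F' by (intro mult_mono tau_path[of _ _ W] tau_mono) auto
      also have "\<dots> \<le> tau p ?F' (u (- int (j - 1)), x) y" using F' p by (intro tau_triangle_Harris) auto
      finally show ?thesis .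
    qed
    then have "p ^ (j - 1) * rs p ?F ?s (fib (u (int m)))
      \<le> (\<Sum>y\<in>fib (u (int m)) \<inter> insert ?s (\<Union>?F). tau p ?F' (u (- int (j - 1)), x) y)"
      unfolding rs_def sum_distrib_left by (intro sum_mono) auto
    also have "\<dots> \<le> rs p ?F' (u (- int (j - 1)), x) (fib (u (int m)))"
      using fe p by (intro sum_tau_le_rs fe') (auto simp: fin_edges_def intro!: finite_subset[of "\<Union>(F \<inter> _)" "\<Union>F"])
    also have "\<dots> \<le> g * \<delta> ^ nat (int m - - int (j - 1))"
      unfolding g_def using x F' by (intro strip_row_offset(1)[OF pp a K u]) auto
    also have "nat (int m - - int (j - 1)) = m + (j - 1)" by auto
    finally show "p ^ (j - 1) * rs p ?F ?s (fib (u (int m))) \<le> g * \<delta> ^ (m + (j - 1))" .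
  qed
  have B0: "rs p (F \<inter> inner ?N) ?t (fib (u 0)) \<le> ?A"
  proof (rule fold)
    let ?F = "F \<inter> inner ?N"
    let ?Y = "fib (u 0) \<inter> insert ?t (\<Union>?F)"
    have Y: "finite ?Y" using fe by (auto simp: fin_edges_def intro!: finite_subset[of "\<Union>(F \<inter> _)" "\<Union>F"])
    \<comment> \<open>The end to be moved now varies over a fibre: each endpoint gets its own
      vertical path, and distinct endpoints are carried to distinct ones.\<close>
    obtain W where W: "\<And>w. w \<in> verts G \<Longrightarrow> finite (W w) \<and> card (W w) \<le> j - 1
        \<and> W w \<subseteq> EE (L u (int m) - L u (- int (j - 1) - 1)) \<and> conn (W w) (u (- int (j - 1)), w) (u 0, w)"
      using vert by metis
    let ?F' = "?F \<union> (\<Union>y\<in>?Y. W (snd y))"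
    have snd: "snd y \<in> verts G" "fst y = u 0" if "y \<in> ?Y" for y using that by (auto simp: fib_def)
    have F': "finite ?F'" "?F' \<subseteq> EE (L u (int m) - L u (- int (j - 1) - 1))"
    proof -
      have Wy: "finite (W (snd y))" "W (snd y) \<subseteq> EE (L u (int m) - L u (- int (j - 1) - 1))"
        if "y \<in> ?Y" for y using W[OF snd(1)[OF that]] by blast+
      show "finite ?F'" by (intro finite_UnI finite_UN_I inF Y Wy)
      show "?F' \<subseteq> EE (L u (int m) - L u (- int (j - 1) - 1))"
        unfolding jj by (intro Un_least UN_least inF Wy[unfolded jj])
    qed
    have fe': "fin_edges ?F'" by (rule H.fin_edges[OF F'(1) order_trans[OF F'(2) EE_subset]])
    let ?h = "\<lambda>y. (u (- int (j - 1)), snd y)"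
    have "p ^ (j - 1) * tau p ?F ?t y \<le> tau p ?F' ?t (?h y)" if y: "y \<in> ?Y" for y
    proof -
      have yy: "y = (u 0, snd y)" using snd[OF y] by (cases y) auto
      have "conn (W (snd y)) (?h y) y" using W[OF snd(1)[OF y]] yy by simp
      then have "conn (W (snd y)) y (?h y)" using conn_sym[of _ "?h y" y] by simp
      then have "tau p ?F ?t y * p ^ (j - 1) \<le> tau p ?F' ?t y * tau p ?F' y (?h y)"
        using W[OF snd(1)[OF y]] p F' y by (intro mult_mono tau_path[of _ _ "W (snd y)"] tau_mono) auto
      also have "\<dots> \<le> tau p ?F' ?t (?h y)" using F' p by (intro tau_triangle_Harris) auto
      finally show ?thesis by (simp add: mult.commute)
    qed
    then have "p ^ (j - 1) * rs p ?F ?t (fib (u 0)) \<le> (\<Sum>y\<in>?Y. tau p ?F' ?t (?h y))"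
      unfolding rs_def sum_distrib_left by (intro sum_mono) auto
    also have "\<dots> = (\<Sum>y\<in>?h ` ?Y. tau p ?F' ?t y)"
      by (subst sum.reindex) (auto simp: inj_on_def fib_def)
    also have "\<dots> \<le> rs p ?F' ?t (fib (u (- int (j - 1))))"
      using Y p snd by (intro sum_tau_le_rs fe') (auto simp: fib_def)
    also have "\<dots> \<le> g * \<delta> ^ nat (int m - - int (j - 1))"
      unfolding g_def using x F' by (intro strip_row_offset(2)[OF pp a K u]) auto
    also have "nat (int m - - int (j - 1)) = m + (j - 1)" by auto
    finally show "p ^ (j - 1) * rs p ?F ?t (fib (u 0)) \<le> g * \<delta> ^ (m + (j - 1))" .
  qed
  have gi: "rs p (F \<inter> inner (?S i)) (?w i, y) (fib (u (int m))) \<le> g * \<delta> ^ (m + i)"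
      "rs p (F \<inter> inner (?S i)) ?t (fib (?w i)) \<le> g * \<delta> ^ (m + i)" if "y \<in> verts G" for i y
  proof -
    have n: "nat (int m - - int i) = m + i" by auto
    show "rs p (F \<inter> inner (?S i)) (?w i, y) (fib (u (int m))) \<le> g * \<delta> ^ (m + i)"
      using strip_row_offset(1)[OF pp a K u _ that inF, of "- int i" "int m"] unfolding g_def n by simp
    show "rs p (F \<inter> inner (?S i)) ?t (fib (?w i)) \<le> g * \<delta> ^ (m + i)"
      using strip_row_offset(2)[OF pp a K u _ x inF, of "- int i" "int m"] unfolding g_def n by simp
  qed
  have Di: "rs p (F \<inter> inner (?C i)) ?s (fib (?w i)) \<le> DD p * \<delta> ^ i"
      "rs p (F \<inter> inner (?C i)) (?w i, y) (fib (u 0)) \<le> DD p * \<delta> ^ i" if "y \<in> verts G" for i y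
    using DD_forward[OF pp r(1), of 0 "int i" x "F \<inter> inner (?C i)"] inF[of "verts T - L u (- int i - 1)"] x
      DD_backward[OF pp r(1), of 0 "int i" y "F \<inter> inner (?C i)"] that r(2)[of i] by auto
  have sum1: "(if i = 0 then 1 else DD p * \<delta> ^ i) * (if i = 0 then ?A else g * \<delta> ^ (m + i))
      = (if i = 0 then ?A else ?B i)"
    "(if i = 0 then 1 else g * \<delta> ^ (m + i)) * (if i = 0 then ?A else DD p * \<delta> ^ i)
      = (if i = 0 then ?A else ?B i)" for i
    by (simp_all add: power_add mult_2)
  have SC: "?S i \<subseteq> ?C i" for i using L_subset[of u "int m"] by (auto simp: reg_def)
  have one: "rs p (F \<inter> inner {o'}) o' {o'} \<le> 1" for o'
    using F by (simp add: rs_def)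
  \<comment> \<open>Index 0 encodes a path confined to \<open>?N\<close>, which is cut trivially at
    its first vertex. The genuine indices are at least \<open>j \<ge> 1\<close>, so there is no
    clash.\<close>
  have split: "rs p F o' A \<le> (\<Sum>i\<in>insert 0 (?I o'). (if i = 0 then 1 else f i) * (if i = 0 then ?A else h i))"
    if o': "o' = ?s \<or> o' = ?t" and RS: "\<And>i. ?S i \<subseteq> R i" "\<And>i. ?S i \<subseteq> R' i"
      and f: "\<And>i. rs p (F \<inter> inner (R i)) o' (fib (?w i)) \<le> f i" and h0: "rs p (F \<inter> inner ?N) o' A \<le> ?A"
      and h: "\<And>i y. y \<in> verts G \<Longrightarrow> rs p (F \<inter> inner (R' i)) (?w i, y) A \<le> h i" "\<And>i. 0 \<le> h i" for o' R R' A f h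
  proof (rule rs_split[where Z = "\<lambda>i. if i = 0 then {o'} else fib (?w i)"
        and R = "\<lambda>i. if i = 0 then {o'} else R i" and R' = "\<lambda>i. if i = 0 then ?N else R' i", OF fe pp(1,2)])
    show "finite (insert 0 (?I o'))" by (rule finite.insertI[OF I])
  next
    fix xs y assume sp: "spath F o' xs y"
    have xs: "xs \<noteq> []" "hd xs = o'" using sp by (auto simp: spath_def)
    consider "set xs \<subseteq> ?N" | i as z bs where "j \<le> i" "xs = as @ z # bs" "z \<in> fib (?w i)"
      "set xs \<subseteq> ?S i" "?w i \<in> fst ` insert o' (\<Union>F)" using path[OF sp o'] by blast
    then show "\<exists>i\<in>insert 0 (?I o'). \<exists>as z bs. xs = as @ z # bs \<and> z \<in> (if i = 0 then {o'} else fib (?w i))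
       \<and> set (as @ [z]) \<subseteq> (if i = 0 then {o'} else R i) \<and> set (z # bs) \<subseteq> (if i = 0 then ?N else R' i)"
    proof cases
      case 1
      have e: "xs = [] @ o' # tl xs" using xs by (cases xs) auto
      then have "set (o' # tl xs) \<subseteq> ?N" using 1 by (metis append_Nil)
      with e show ?thesis
        by (intro bexI[of _ 0] exI[of _ "[]"] exI[of _ o'] exI[of _ "tl xs"] conjI) simp_all
    next
      case (2 i as z bs)
      then have i: "i \<noteq> 0" "i \<in> ?I o'" using j by auto
      have "set (as @ [z]) \<subseteq> ?S i" "set (z # bs) \<subseteq> ?S i" using 2(2,4) by auto
      then show ?thesis
        using 2(2,3) i RS[of i] by (intro bexI[of _ i] exI[of _ as] exI[of _ z] exI[of _ bs] conjI) auto
    qed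
  next
    fix i assume "i \<in> insert 0 (?I o')"
    show "rs p (F \<inter> inner (if i = 0 then {o'} else R i)) o' (if i = 0 then {o'} else fib (?w i))
        \<le> (if i = 0 then 1 else f i)"
      using one[of o'] f[of i] by auto
  next
    fix i z assume "z \<in> (if i = 0 then {o'} else fib (?w i))"
    then show "rs p (F \<inter> inner (if i = 0 then ?N else R' i)) z A \<le> (if i = 0 then ?A else h i)"
      using h0 h(1)[of "snd z" i] by (auto simp: fib_def split: if_splits)
  next
    show "0 \<le> (if i = 0 then ?A else h i)" for i using g p \<delta>_pow[of m] h(2) by auto
  qed
  have "rs p F ?s (fib (u (int m))) \<le> (\<Sum>i\<in>insert 0 (?I ?s). if i = 0 then ?A else ?B i)"
    using split[of ?s ?C ?S "\<lambda>i. DD p * \<delta> ^ i" "fib (u (int m))" "\<lambda>i. g * \<delta> ^ (m + i)",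
      OF disjI1[OF refl] SC order_refl Di(1)[OF x] A0 gi(1)] g \<delta>_pow unfolding sum1(1) by simp
  then show "rs p F ?s (fib (u (int m))) \<le> ?R" by (rule total[rotated 2]) (rule I, blast)
  have "rs p F ?t (fib (u 0)) \<le> (\<Sum>i\<in>insert 0 (?I ?t). if i = 0 then ?A else ?B i)"
    using split[of ?t ?S ?C "\<lambda>i. g * \<delta> ^ (m + i)" "fib (u 0)" "\<lambda>i. DD p * \<delta> ^ i",
      OF disjI2[OF refl] order_refl SC gi(2)[OF x] B0 Di(2)] D \<delta>_pow unfolding sum1(2) by simp
  then show "rs p F ?t (fib (u 0)) \<le> ?R" by (rule total[rotated 2]) (rule I, blast)
qed

text \<open>\<open>telescope_forward\<close> bounds the row and column members of
  \<open>Dvals p\<close>; the extra member 1 lies below the bound because \<open>g\<close> is at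
  least 16.\<close>

lemma DD_self_improving:
  assumes p: "0 < p" "p \<le> 1" "sub_at p" and a: "0 < a" "a < 1" and K: "moment_bound p a K" "0 \<le> K" and j: "1 \<le> j"
  defines "g \<equiv> (K + 16) * DD p powr (4 * (1 - a))"
  shows "DD p \<le> (1 / p) ^ j * g + 2 * DD p * g * \<delta> ^ (2 * j)"
proof -
  let ?B = "(1 / p) ^ j * g + 2 * DD p * g * \<delta> ^ (2 * j)"
  have D: "1 \<le> DD p" using p by (intro DD_ge_1) auto
  have "16 * 1 \<le> g"
    unfolding g_def using K D a by (intro mult_mono ge_one_powr_ge_zero) auto
  then have g: "1 \<le> g" by simp
  have "1 * 1 \<le> (1 / p) ^ j * g" using g p by (intro mult_mono one_le_power) auto
  moreover have "0 \<le> 2 * DD p * g * \<delta> ^ (2 * j)" using D g \<delta>_pow[of "2 * j"] by simp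
  ultimately have B1: "1 \<le> ?B" by linarith
  have u: "real d ^ m * R \<le> ?B" if "R \<le> \<delta> ^ m * ?B" for R m
    using mult_left_mono[OF that, of "real d ^ m"] d by (simp add: power_one_over)
  show ?thesis
    unfolding DD_def
  proof (rule cSup_least)
    show "Dvals p \<noteq> {}" by (auto simp: Dvals_def)
    fix v assume "v \<in> Dvals p"
    then have "v \<le> ?B"
      unfolding Dvals_def
    proof (elim insertE UnE CollectE exE conjE)
      fix l m x F assume v: "v = real d ^ m * rs p F (l 0, x) (fib (l (int m)))" and
        h: "line l" "x \<in> verts G" "finite F" "F \<subseteq> EE (L l (int m))"
      show "v \<le> ?B" unfolding v g_def by (rule u[unfolded g_def], rule telescope_forward(1)[OF p a K h j])
    next
      fix l m x F assume v: "v = real d ^ m * rs p F (l (int m), x) (fib (l 0))" and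
        h: "line l" "x \<in> verts G" "finite F" "F \<subseteq> EE (L l (int m))"
      show "v \<le> ?B" unfolding v g_def by (rule u[unfolded g_def], rule telescope_forward(2)[OF p a K h j])
    qed (use B1 in simp)
    then show "v \<le> (1 / p) ^ j * g + 2 * Sup (Dvals p) * g * \<delta> ^ (2 * j)"
      by (simp only: DD_def)
  qed
qed

text \<open>The constant involves \<open>p\<close> only through its lower bound \<open>p0\<close>,
  so it does not deteriorate as \<open>p\<close> increases.\<close>

lemma DD_uniform:
  assumes P: "0 < p0" "p0 \<le> 1" and a: "0 < a" "a < 1"
    and ka: "4 * (1 - a) * (1 + ln (1 / p0) / (2 * ln (real d))) \<le> 1 / 2" and K: "0 \<le> K"
  obtains C where "\<And>p. p0 \<le> p \<Longrightarrow> p \<le> 1 \<Longrightarrow> sub_at p \<Longrightarrow> moment_bound p a K \<Longrightarrow> DD p \<le> C"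
proof -
  let ?C = "(1 / p0 * (4 * (K + 16)) powr (1 + ln (1 / p0) / (2 * ln (real d))))\<^sup>2"
  show thesis
  proof (rule that[of ?C])
    fix p assume p: "p0 \<le> p" "p \<le> 1" "sub_at p" "moment_bound p a K"
    have pp: "0 < p" using p P by simp
    have D: "1 \<le> DD p" using p pp by (intro DD_ge_1) auto
    show "DD p \<le> ?C"
    proof (rule self_improving_bound[of "real d" "DD p" "K + 16" "1 / p0" "4 * (1 - a)"])
      fix j :: nat assume j: "1 \<le> j"
      let ?g = "(K + 16) * DD p powr (4 * (1 - a))"
      have "DD p \<le> (1 / p) ^ j * ?g + 2 * DD p * ?g * \<delta> ^ (2 * j)"
        by (rule DD_self_improving[OF pp p(2,3) a p(4) K j])
      also have "\<dots> \<le> (1 / p0) ^ j * ?g + 2 * DD p * ?g * \<delta> ^ (2 * j)"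
        using p P K by (intro add_right_mono mult_right_mono power_mono divide_left_mono) auto
      finally show "DD p \<le> (1 / p0) ^ j * ?g + 2 * DD p * ?g * \<delta> ^ (2 * j)" .
    qed (use D K d P a ka in auto)
  qed
qed

end

section \<open>Hitting a distant fibre\<close>

lemma power_bound_limit:
  fixes q t C :: real
  assumes "0 \<le> q" "0 < t" "\<And>j. 1 \<le> j \<Longrightarrow> q ^ j \<le> C * t ^ j"
  shows "q \<le> t"
proof (rule ccontr)
  assume "\<not> q \<le> t"
  then have "1 < q / t" using assms by simp
  then obtain j where "C < (q / t) ^ j" using real_arch_pow by blast
  moreover have "(q / t) ^ j \<le> (q / t) ^ Suc j" using \<open>1 < q / t\<close> by (intro power_increasing) auto
  ultimately have "C < (q / t) ^ Suc j" by simp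
  then have "C * t ^ Suc j < q ^ Suc j" using assms(2) by (simp only: power_divide) (simp add: field_simps)
  then show False using assms(3)[of "Suc j"] by simp
qed

text \<open>Exploration in two stages: given the configuration \<open>U\<close> of
  \<open>F1\<close>, the event \<open>B U\<close> is tested on edges that have not yet been
  examined.\<close>

lemma hit_compose:
  assumes F: "finite F1" "finite F2" "F1 \<inter> F2 = {}" and p: "0 \<le> p" "p \<le> 1"
    and mono: "\<And>U V. U \<subseteq> F1 \<Longrightarrow> V \<subseteq> F2 \<Longrightarrow> A U \<Longrightarrow> B U V \<Longrightarrow> E (U \<union> V)"
    and B: "\<And>U. U \<subseteq> F1 \<Longrightarrow> A U \<Longrightarrow> r \<le> Pr p F2 (B U)" and r: "0 \<le> r"
  shows "Pr p F1 A * r \<le> Pr p (F1 \<union> F2) E"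
proof -
  have "Pr p F1 A * r = Exp p F1 (\<lambda>U. of_bool (A U) * r)" unfolding Pr_def by (simp only: Exp_multc)
  also have "\<dots> \<le> Exp p F1 (\<lambda>U. Exp p F2 (\<lambda>V. of_bool (E (U \<union> V))))"
  proof (rule Exp_mono[OF p])
    fix U assume U: "U \<subseteq> F1"
    show "of_bool (A U) * r \<le> Exp p F2 (\<lambda>V. of_bool (E (U \<union> V)))"
    proof (cases "A U")
      case True
      have "r \<le> Pr p F2 (B U)" by (rule B[OF U True])
      also have "\<dots> \<le> Pr p F2 (\<lambda>V. E (U \<union> V))"
        using p mono[OF U _ True] by (intro Pr_mono) auto
      finally show ?thesis using True by (simp add: Pr_def)
    qed (use p in \<open>auto intro: Exp_nonneg\<close>)
  qed
  also have "\<dots> = Pr p (F1 \<union> F2) E" unfolding Pr_def using F by (simp add: Exp_Un)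
  finally show ?thesis .
qed

section \<open>The common exponential rate of fibre sums\<close>

context tprod
begin

definition sb :: "real \<Rightarrow> bool" where
  "sb p \<longleftrightarrow> 0 \<le> p \<and> p \<le> 1 \<and> sub_at p"

lemma sbD: "sb p \<Longrightarrow> 0 \<le> p" "sb p \<Longrightarrow> p \<le> 1" "sb p \<Longrightarrow> sub_at p"
  by (auto simp: sb_def)

definition Bbd :: "real \<Rightarrow> nat \<Rightarrow> real \<Rightarrow> bool" where
  "Bbd p n c \<longleftrightarrow> (\<forall>s t x F. s \<in> verts T \<longrightarrow> t \<in> verts T \<longrightarrow> gd T s t = n \<longrightarrow> x \<in> verts G \<longrightarrow>
     finite F \<longrightarrow> F \<subseteq> edges H \<longrightarrow> rs p F (s, x) (fib t) \<le> c)"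

lemma BbdD:
  "Bbd p n c \<Longrightarrow> s \<in> verts T \<Longrightarrow> t \<in> verts T \<Longrightarrow> gd T s t = n \<Longrightarrow> x \<in> verts G \<Longrightarrow>
     finite F \<Longrightarrow> F \<subseteq> edges H \<Longrightarrow> rs p F (s, x) (fib t) \<le> c"
  unfolding Bbd_def by blast

lemma Bbd_mono: "Bbd p n c \<Longrightarrow> c \<le> c' \<Longrightarrow> Bbd p n c'"
  unfolding Bbd_def
proof (intro allI impI)
  fix s t x F
  assume B: "\<forall>s t x F. s \<in> verts T \<longrightarrow> t \<in> verts T \<longrightarrow> gd T s t = n \<longrightarrow> x \<in> verts G \<longrightarrow>
     finite F \<longrightarrow> F \<subseteq> edges H \<longrightarrow> rs p F (s, x) (fib t) \<le> c" and c: "c \<le> c'"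
    and h: "s \<in> verts T" "t \<in> verts T" "gd T s t = n" "x \<in> verts G" "finite F" "F \<subseteq> edges H"
  have "rs p F (s, x) (fib t) \<le> c" using B h by blast
  then show "rs p F (s, x) (fib t) \<le> c'" using c by simp
qed

lemma Bbd_mono_p:
  assumes "Bbd q n c" "0 \<le> p" "p \<le> q" "q \<le> 1"
  shows "Bbd p n c"
  unfolding Bbd_def
proof (intro allI impI)
  fix s t x F assume h: "s \<in> verts T" "t \<in> verts T" "gd T s t = n" "x \<in> verts G" "finite F" "F \<subseteq> edges H"
  have "rs p F (s, x) (fib t) \<le> rs q F (s, x) (fib t)"
    using H.fin_edges[OF h(5,6)] assms(2-4) by (rule rs_mono_p)
  also have "\<dots> \<le> c" by (rule BbdD[OF assms(1) h])
  finally show "rs p F (s, x) (fib t) \<le> c" .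
qed

lemma nonempty_T: "\<exists>t. t \<in> verts T"
  using connected unfolding connected_graph_def by auto

lemma nonempty_G: "\<exists>x. x \<in> verts G"
  using G.connected unfolding connected_graph_def by auto

lemma line_ex: "\<exists>u. line u"
proof -
  obtain t where "t \<in> verts T" using nonempty_T by auto
  then show ?thesis using line_exists[of t t] by metis
qed

lemma Bbd_lower:
  assumes p: "0 \<le> p" "p \<le> 1" and b: "Bbd p n c"
  shows "p ^ n \<le> c"
proof -
  obtain u where u: "line u" using line_ex by auto
  obtain x where x: "x \<in> verts G" using nonempty_G by auto
  obtain W where W: "finite W" "card W \<le> n" "W \<subseteq> EE (u ` {0..0 + int n})" "conn W (u 0, x) (u (0 + int n), x)"
    using vertical_walk[OF u x, of n 0] by auto
  have WH: "W \<subseteq> edges H" using W(3) EE_subset by (rule order_trans)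
  have fe: "fin_edges W" using W(1) WH by (rule H.fin_edges)
  have "p ^ n \<le> tau p W (u 0, x) (u (int n), x)" using W p by (intro tau_path[of W _ W]) auto
  also have "\<dots> = (\<Sum>y\<in>{(u (int n), x)}. tau p W (u 0, x) y)" by simp
  also have "\<dots> \<le> rs p W (u 0, x) (fib (u (int n)))"
    using x p by (intro sum_tau_le_rs fe) (auto simp: fib_def)
  also have "\<dots> \<le> c" using u x W(1) WH by (intro BbdD[OF b]) (auto simp: line_gd)
  finally show ?thesis .
qed

lemma passes:
  assumes u: "line u" and F: "F \<subseteq> edges H" and sp: "spath F x xs y"
    and x: "x \<in> reg (L u m)" and y: "fst y \<notin> L u m"
  shows "\<exists>z\<in>set xs. fst z = u (m + 1)"
proof (rule ccontr)
  assume n: "\<not> ?thesis"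
  have "set xs \<subseteq> reg (L u m)"
    by (rule stay_L[OF u]) (use sp F x n in \<open>auto simp: spath_def\<close>)
  then show False using spath_ends(2)[OF sp] y by (auto simp: reg_def)
qed

lemma spath_verts: "spath F x xs y \<Longrightarrow> F \<subseteq> edges H \<Longrightarrow> x \<in> verts H \<Longrightarrow> z \<in> set xs \<Longrightarrow> z \<in> verts H"
  using spath_mem[of F x xs y z] H.Union_edges[of F] by auto

text \<open>A path to the fibre over \<open>t\<close> has to visit the fibre over every vertex of
  the geodesic from \<open>s\<close> to \<open>t\<close>.\<close>

lemma Bbd_mult:
  assumes p: "0 \<le> p" "p \<le> 1" and b: "Bbd p n b" and c: "Bbd p m c"
  shows "Bbd p (n + m) (b * c)"
  unfolding Bbd_def
proof (intro allI impI)
  fix s t x F assume h: "s \<in> verts T" "t \<in> verts T" "gd T s t = n + m" "x \<in> verts G" "finite F" "F \<subseteq> edges H"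
  obtain u where u: "line u" "u 0 = s" "u (int (n + m)) = t" using line_exists[OF h(1,2)] h(3) by metis
  have c0: "0 \<le> c" using Bbd_lower[OF p c] p by (meson order_trans zero_le_power)
  have fe: "fin_edges F" using h by (intro H.fin_edges)
  have "rs p F (s, x) (fib t) \<le> (\<Sum>i\<in>{0::nat}. b * c)"
  proof (rule rs_split[where Z = "\<lambda>_. fib (u (int n))" and R = "\<lambda>_. UNIV" and R' = "\<lambda>_. UNIV", OF fe p])
    fix xs y assume y: "y \<in> fib t" and sp: "spath F (s, x) xs y"
    have "\<exists>z\<in>set xs. fst z = u (int n)"
    proof (cases "n = 0")
      case True
      then show ?thesis using spath_ends(1)[OF sp] u by force
    next
      case False
      have "(s, x) \<in> reg (L u (int n - 1))" using False h u line_mem_L[OF u(1), of 0 "int n - 1"] by (auto simp: reg_def)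
      moreover have "fst y \<notin> L u (int n - 1)" using y u(3) line_mem_L[OF u(1)] by (auto simp: fib_def simp flip: u(3))
      ultimately show ?thesis using passes[OF u(1) h(6) sp] by force
    qed
    then obtain z where z: "z \<in> set xs" "fst z = u (int n)" by auto
    then have "z \<in> fib (u (int n))" using spath_verts[OF sp h(6) _ z(1)] h by (cases z) (auto simp: fib_def)
    moreover obtain as bs where "xs = as @ z # bs" using z(1) by (meson split_list)
    ultimately show "\<exists>i\<in>{0::nat}. \<exists>as z bs. xs = as @ z # bs \<and> z \<in> fib (u (int n)) \<and> set (as @ [z]) \<subseteq> UNIV \<and> set (z # bs) \<subseteq> UNIV"
      by blast
  next
    have "inner UNIV = (UNIV :: ('a \<times> 'b) set set)" by (auto simp: inner_def)
    then show "rs p (F \<inter> inner UNIV) (s, x) (fib (u (int n))) \<le> b"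
      using h u line_gd[OF u(1), of 0 "int n"] by (auto intro!: BbdD[OF b])
  next
    fix z assume "z \<in> fib (u (int n))"
    then obtain w where "z = (u (int n), w)" "w \<in> verts G" by (auto simp: fib_def)
    moreover have "inner UNIV = (UNIV :: ('a \<times> 'b) set set)" by (auto simp: inner_def)
    ultimately show "rs p (F \<inter> inner UNIV) z (fib t) \<le> c"
      using h u line_gd[OF u(1), of "int n" "int (n + m)"] by (auto intro!: BbdD[OF c])
  qed (use c0 in auto)
  then show "rs p F (s, x) (fib t) \<le> b * c" by simp
qed

text \<open>By submultiplicativity, attaining \<open>b ^ m\<close> without prefactor at a single
  scale \<open>m\<close> gives the rate \<open>b\<close> at all scales; the remainder modulo
  \<open>m\<close> goes into the constant. Read backwards: if the rate \<open>b\<close> fails at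
  \<open>p\<close>, it fails at every scale.\<close>

lemma Bbd_fekete:
  assumes p: "sb p" and b: "0 < b" and m: "1 \<le> m" and Bm: "Bbd p m (b ^ m)"
  shows "\<exists>C. \<forall>n. Bbd p n (C * b ^ n)"
proof -
  note pp = sbD(1,2)[OF p]
  obtain C where C: "\<forall>F x. finite F \<longrightarrow> F \<subseteq> edges H \<longrightarrow> x \<in> verts H \<longrightarrow> rs p F x (verts H) \<le> C"
    using sbD(3)[OF p] unfolding sub_at_def by (rule exE)
  have BC: "Bbd p n C" for n
    unfolding Bbd_def
  proof (intro allI impI)
    fix s t x F assume h: "s \<in> verts T" "t \<in> verts T" "gd T s t = n" "x \<in> verts G" "finite F" "F \<subseteq> edges H"
    have "rs p F (s, x) (fib t) \<le> rs p F (s, x) (verts H)"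
      using h pp by (intro rs_mono H.fin_edges fib_verts) auto
    also have "\<dots> \<le> C" using C h by auto
    finally show "rs p F (s, x) (fib t) \<le> C" .
  qed
  have C0: "0 \<le> C" using Bbd_lower[OF pp BC[of 0]] by simp
  have q: "Bbd p (q * m) ((b ^ m) ^ q * C)" if "1 \<le> C" for q
  proof (induction q)
    case 0
    then show ?case using BC by simp
  next
    case (Suc q)
    then show ?case using Bbd_mult[OF pp Bm Suc] by (simp add: mult.assoc)
  qed
  have C1: "1 \<le> C" using Bbd_lower[OF pp BC[of 0]] by simp
  define K where "K = C * C * (\<Sum>r<m. (1 / b) ^ r)"
  have "Bbd p n (K * b ^ n)" for n
  proof -
    have n: "(n div m) * m + n mod m = n" by simp
    have "Bbd p ((n div m) * m + n mod m) (((b ^ m) ^ (n div m) * C) * C)"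
      by (rule Bbd_mult[OF pp q[OF C1] BC])
    then have B: "Bbd p n ((b ^ m) ^ (n div m) * C * C)" unfolding n .
    have "b ^ n = (b ^ m) ^ (n div m) * b ^ (n mod m)"
      by (metis n power_add power_mult mult.commute)
    then have "(b ^ m) ^ (n div m) * C * C = C * C * (1 / b) ^ (n mod m) * b ^ n"
      using b by (simp add: power_one_over)
    also have "\<dots> \<le> K * b ^ n"
      unfolding K_def using b m C0
      by (intro mult_right_mono mult_left_mono member_le_sum) auto
    finally show ?thesis by (rule Bbd_mono[OF B])
  qed
  then show ?thesis by blast
qed

definition good :: "real \<Rightarrow> bool" where
  "good b \<longleftrightarrow> 0 < b \<and> (\<forall>p. sb p \<longrightarrow> (\<exists>C. \<forall>n. Bbd p n (C * b ^ n)))"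

text \<open>The best exponential rate common to all subcritical \<open>p\<close>, with prefactors
  that may depend on \<open>p\<close>. Being independent of \<open>p\<close>, it is the yardstick
  for uniform estimates; \<open>fibre_decay\<close> shows that it is at most \<delta>.\<close>

definition \<beta> :: real where "\<beta> = Inf {b. good b}"

lemma good_\<delta>: "good \<delta>"
  unfolding good_def
proof (intro conjI allI impI)
  fix p assume p: "sb p"
  note pp = sbD(1,2)[OF p]
  obtain C where C: "\<forall>F x. finite F \<longrightarrow> F \<subseteq> edges H \<longrightarrow> x \<in> verts H \<longrightarrow> rs p F x (verts H) \<le> C"
    using sbD(3)[OF p] unfolding sub_at_def by (rule exE)
  have "Bbd p n (C * \<delta> ^ n)" for n
    unfolding Bbd_def
  proof (intro allI impI)
    fix s t x F assume h: "s \<in> verts T" "t \<in> verts T" "gd T s t = n" "x \<in> verts G" "finite F" "F \<subseteq> edges H"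
    have "real d ^ gd T s t * rs p F (s, x) (fib t) \<le> C" using C h by (intro fibre_decay[OF pp]) auto
    then show "rs p F (s, x) (fib t) \<le> C * \<delta> ^ n"
      using h(3) d by (simp add: power_one_over field_simps)
  qed
  then show "\<exists>C. \<forall>n. Bbd p n (C * \<delta> ^ n)" by blast
qed (use \<delta> in auto)

lemma good_lower:
  assumes "good b" "sb p"
  shows "p \<le> b"
proof -
  obtain C where C: "\<And>n. Bbd p n (C * b ^ n)" using assms unfolding good_def by blast
  show ?thesis
    using sbD[OF assms(2)] assms(1) Bbd_lower[OF _ _ C] by (intro power_bound_limit[of p b C]) (auto simp: good_def)
qed

lemma good_mono: "good b \<Longrightarrow> b \<le> b' \<Longrightarrow> good b'"
proof -
  assume g: "good b" and b: "b \<le> b'"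
  have "\<exists>C. \<forall>n. Bbd p n (C * b' ^ n)" if p: "sb p" for p
  proof -
    obtain C where C: "\<And>n. Bbd p n (C * b ^ n)" using g p unfolding good_def by blast
    have "0 \<le> C" using Bbd_lower[OF sbD(1,2)[OF p] C[of 0]] by simp
    then have "Bbd p n (C * b' ^ n)" for n
      using g b by (intro Bbd_mono[OF C] mult_left_mono power_mono) (auto simp: good_def)
    then show ?thesis by blast
  qed
  then show ?thesis using g b by (auto simp: good_def)
qed

lemma \<beta>_bounds: "\<beta> \<le> \<delta>" "0 < \<beta>" "sb p \<Longrightarrow> p \<le> \<beta>"
proof -
  have bdd: "bdd_below {b. good b}" by (rule bdd_belowI[of _ 0]) (auto simp: good_def)
  show "\<beta> \<le> \<delta>" unfolding \<beta>_def using good_\<delta> bdd by (intro cInf_lower) auto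
  show *: "sb p \<Longrightarrow> p \<le> \<beta>" for p
    unfolding \<beta>_def using good_\<delta> good_lower by (intro cInf_greatest) auto
  obtain p where "0 < p" "p < 1" "sub_at p" using sub_at_small by auto
  then show "0 < \<beta>" using *[of p] by (auto simp: sb_def)
qed

lemma above_\<beta>: "\<beta> < b \<Longrightarrow> good b"
proof -
  assume "\<beta> < b"
  then obtain b' where "good b'" "b' < b"
    unfolding \<beta>_def using good_\<delta> by (metis (mono_tags, lifting) cInf_lessD empty_iff mem_Collect_eq)
  then show ?thesis using good_mono by auto
qed

text \<open>Such a rate fails at some subcritical \<open>p\<close>, and by \<open>Bbd_fekete\<close>
  it fails there at every scale. A single \<open>p\<close> thus supplies lower bounds for the means
  at all distances.\<close>

lemma below_\<beta>:
  assumes b: "0 < b" "b < \<beta>"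
  shows "\<exists>p. sb p \<and> (\<forall>m\<ge>1. \<not> Bbd p m (b ^ m))"
proof -
  have "\<not> good b"
  proof
    assume "good b"
    moreover have "bdd_below {b. good b}" by (rule bdd_belowI[of _ 0]) (auto simp: good_def)
    ultimately have "\<beta> \<le> b" unfolding \<beta>_def by (intro cInf_lower) auto
    then show False using b by simp
  qed
  then obtain p where "sb p" "\<not> (\<exists>C. \<forall>n. Bbd p n (C * b ^ n))" using b unfolding good_def by auto
  then show ?thesis using Bbd_fekete b by blast
qed

text \<open>Blocks over consecutive intervals of a line are disjoint, hence independent.\<close>

definition Bk :: "(int \<Rightarrow> 'a) \<Rightarrow> int \<Rightarrow> int \<Rightarrow> ('a \<times> 'b) set set" where
  "Bk u i j = EE (L u j) - EE (L u i)"

lemma Bk_edges: "Bk u i j \<subseteq> edges H"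
  using EE_subset unfolding Bk_def by auto

lemma Bk_disjoint: "Bk u i j \<inter> Bk u j l = {}"
  unfolding Bk_def by auto

lemma Bk_subset:
  assumes "line u" "i \<le> i'" "j' \<le> j"
  shows "Bk u i' j' \<subseteq> Bk u i j"
  using EE_mono[OF L_mono[OF assms(1,2)]] EE_mono[OF L_mono[OF assms(1,3)]] unfolding Bk_def by blast

lemma strip_subset_Bk: "EE (L u j - L u i) \<subseteq> Bk u i j"
proof
  fix e assume e: "e \<in> EE (L u j - L u i)"
  then have "e \<in> edges H" "e \<subseteq> reg (L u j - L u i)" by (auto simp: EE_def inner_def)
  moreover from this obtain a b where "e = {a, b}" by (auto elim: H.edgeE)
  ultimately show "e \<in> Bk u i j" by (auto simp: Bk_def EE_def inner_def reg_def)
qed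

lemma vertical_edge_Bk:
  assumes u: "line u" and "i < j" "x \<in> verts G"
  shows "{(u i, x), (u (i + 1), x)} \<in> Bk u i j"
  using assms line_mem_L[OF u] line_adj[OF u, of i] adj_box[of T G "u i" x "u (i + 1)" x]
  by (auto simp: Bk_def EE_def inner_def reg_def adj_def)

lemma transport:
  assumes u: "line u" and v: "line v" and \<psi>: "is_automorphism G \<psi>"
  shows "\<exists>f. is_automorphism H f \<and> (\<forall>i x. f (u i, x) = (v i, \<psi> x)) \<and> (\<forall>i. f ` fib (u i) = fib (v i))
    \<and> (\<forall>F i j. F \<subseteq> Bk u i j \<longrightarrow> (`) f ` F \<subseteq> Bk v i j)
    \<and> (\<forall>F i j. F \<subseteq> EE (L u j - L u i) \<longrightarrow> (`) f ` F \<subseteq> EE (L v j - L v i))"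
proof -
  obtain \<phi> where \<phi>: "is_automorphism T \<phi>" "\<And>i. \<phi> (u i) = v i" using line_homogeneous[OF u v] by auto
  let ?f = "map_prod \<phi> \<psi>"
  note a = box_automorphism[OF \<phi>(1) \<psi>]
  have \<psi>G: "\<psi> x \<in> verts G" if "x \<in> verts G" for x using G.automorphism_verts[OF \<psi> that] .
  have \<phi>T: "\<phi> x \<in> verts T" if "x \<in> verts T" for x
    using \<phi>(1) that unfolding is_automorphism_def bij_betw_def by auto
  have L: "\<phi> t \<in> L v i \<longleftrightarrow> t \<in> L u i" if "t \<in> verts T" for t i
    using automorphism_gd[OF \<phi>(1) that line_verts[OF u]] \<phi>T that
    by (simp add: L_def flip: \<phi>(2))
  have in_reg: "?f ` e \<subseteq> reg (L v i) \<longleftrightarrow> e \<subseteq> reg (L u i)" if "e \<subseteq> verts H" for e i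
  proof -
    have "?f z \<in> reg (L v i) \<longleftrightarrow> z \<in> reg (L u i)" if z: "z \<in> e" for z
      using \<open>e \<subseteq> verts H\<close> z L \<psi>G by (cases z) (auto simp: reg_def)
    then have "(\<forall>z\<in>e. ?f z \<in> reg (L v i)) \<longleftrightarrow> (\<forall>z\<in>e. z \<in> reg (L u i))" by (rule ball_cong[OF refl])
    then show ?thesis unfolding image_subset_iff subset_eq[of e] .
  qed
  have eH: "?f ` e \<in> edges H" "e \<subseteq> verts H" if "e \<in> edges H" for e
    using H.automorphism_edges[OF a, of "{e}"] H.Union_edges[of "{e}"] that by auto
  show ?thesis
  proof (rule exI[of _ ?f], intro conjI allI impI)
    show "is_automorphism H ?f" by (rule a)
    show "?f (u i, x) = (v i, \<psi> x)" for i x using \<phi> by simp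
    show "?f ` fib (u i) = fib (v i)" for i using fib_image[OF \<psi>, of \<phi> "u i"] \<phi> by simp
    show "(`) ?f ` F \<subseteq> Bk v i j" if F: "F \<subseteq> Bk u i j" for F i j
    proof clarify
      fix e assume "e \<in> F"
      then have "e \<in> EE (L u j)" "e \<notin> EE (L u i)" using F by (auto simp: Bk_def)
      then show "?f ` e \<in> Bk v i j" using eH[of e] in_reg[of e] by (auto simp: Bk_def EE_def inner_def)
    qed
    show "(`) ?f ` F \<subseteq> EE (L v j - L v i)" if F: "F \<subseteq> EE (L u j - L u i)" for F i j
    proof clarify
      fix e assume "e \<in> F"
      then have e: "e \<in> edges H" "e \<subseteq> reg (L u j - L u i)" using F by (auto simp: EE_def inner_def)
      have "?f z \<in> reg (L v j - L v i)" if "z \<in> e" for z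
        using that e(2) L[of "fst z"] \<psi>G L_subset[of u j] by (cases z) (auto simp: reg_def)
      then show "?f ` e \<in> EE (L v j - L v i)" using eH[OF e(1)] by (auto simp: EE_def inner_def)
    qed
  qed
qed

lemma Bk_shift: "Bk (\<lambda>i. u (i + c)) i j = Bk u (i + c) (j + c)"
  by (simp add: Bk_def L_shift)

section \<open>Supermultiplicativity of hitting probabilities\<close>

definition hit :: "'v set set \<Rightarrow> 'v \<Rightarrow> 'v set \<Rightarrow> bool" where
  "hit U x A \<longleftrightarrow> (\<exists>y\<in>A. conn U x y)"

lemma mono_hit: "mono (\<lambda>U. hit U x A)"
  unfolding hit_def by (intro monoI le_boolI) (blast intro: conn_mono)

lemma automorphism_hit:
  assumes f: "is_automorphism H f" and F: "finite F" "F \<subseteq> edges H" and x: "x \<in> verts H" and A: "A \<subseteq> verts H"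
  shows "Pr p ((`) f ` F) (\<lambda>U. hit U (f x) (f ` A)) = Pr p F (\<lambda>U. hit U x A)"
proof -
  have inj: "inj_on f (verts H)" by (rule H.automorphism_inj[OF f])
  have "inj_on ((`) f) F" by (rule inj_image_edges[OF inj H.Union_edges[OF F(2)]])
  then have "Pr p ((`) f ` F) (\<lambda>U. hit U (f x) (f ` A)) = Pr p F (\<lambda>U. hit ((`) f ` U) (f x) (f ` A))"
    using F by (intro Pr_image)
  also have "\<dots> = Pr p F (\<lambda>U. hit U x A)"
  proof (rule Pr_cong)
    fix U assume "U \<subseteq> F"
    then have "\<Union>U \<subseteq> verts H" using H.Union_edges[of U] F by blast
    then have "conn ((`) f ` U) (f x) (f y) \<longleftrightarrow> conn U x y" if "y \<in> A" for y
      using that A x by (intro conn_inj[OF inj]) auto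
    then show "hit ((`) f ` U) (f x) (f ` A) = hit U x A" unfolding hit_def by auto
  qed
  finally show ?thesis .
qed

text \<open>Up one vertical edge, along the fibre, and down again.\<close>

lemma detour:
  assumes u: "line u" and ij: "i < j" and x: "x \<in> verts G" "y \<in> verts G" and D: "gd G x y \<le> D"
  shows "\<exists>W. finite W \<and> card W \<le> 1 + D \<and> W \<subseteq> Bk u i j \<and> conn W (u i, x) (u (i + 1), y)"
    "\<exists>W. finite W \<and> card W \<le> 2 + D \<and> W \<subseteq> Bk u i j \<and> conn W (u i, x) (u i, y)"
proof -
  obtain W0 where W0: "W0 \<subseteq> edges G" "finite W0" "card W0 \<le> gd G x y" "conn W0 x y"
    using G.gd_walk[OF x refl] by blast
  let ?t = "u (i + 1)"
  let ?W = "(`) (Pair ?t) ` W0"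
  have t: "?t \<in> verts T" using u by auto
  have c: "conn ?W (?t, x) (?t, y)" "?W \<subseteq> edges H" using conn_fibre[OF t W0(4,1)] by auto
  have WB: "?W \<subseteq> Bk u i j"
  proof
    fix e assume e: "e \<in> ?W"
    then obtain e0 where e0: "e = Pair ?t ` e0" "e0 \<in> W0" by auto
    then obtain a b where ab: "e0 = {a, b}" "a \<in> verts G" "b \<in> verts G" using W0(1) G.edgeE G.adjD by (metis subsetD)
    then show "e \<in> Bk u i j" using e c(2) e0 ij line_mem_L[OF u, of "i + 1"]
      by (auto simp: Bk_def EE_def inner_def reg_def)
  qed
  let ?e = "{(u i, x), (?t, x)}" and ?e' = "{(u i, y), (?t, y)}"
  have eB: "?e \<in> Bk u i j" "?e' \<in> Bk u i j" using vertical_edge_Bk[OF u ij] x by auto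
  have fW: "finite ?W" "card ?W \<le> D" using W0 card_image_le[OF W0(2), of "(`) (Pair ?t)"] D by auto
  have c1: "conn (insert ?e ?W) (u i, x) (?t, y)"
    using conn_mono[OF c(1), of "insert ?e ?W"] conn_edge[of "(u i, x)" "(?t, x)" "insert ?e ?W"]
      conn_trans[of "insert ?e ?W" "(u i, x)" "(?t, x)" "(?t, y)"] by auto
  show "\<exists>W. finite W \<and> card W \<le> 1 + D \<and> W \<subseteq> Bk u i j \<and> conn W (u i, x) (u (i + 1), y)"
    using c1 fW WB eB by (intro exI[of _ "insert ?e ?W"]) (auto simp: card_insert_if)
  let ?W2 = "insert ?e' (insert ?e ?W)"
  have "conn ?W2 (?t, y) (u i, y)" by (rule conn_edge) auto
  then have "conn ?W2 (u i, x) (u i, y)" using conn_mono[OF c1, of ?W2] conn_trans[of ?W2] by blast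
  then show "\<exists>W. finite W \<and> card W \<le> 2 + D \<and> W \<subseteq> Bk u i j \<and> conn W (u i, x) (u i, y)"
    using fW WB eB by (intro exI[of _ ?W2]) (auto simp: card_insert_if)
qed

lemma Pr_path_hit:
  assumes "finite F" "0 \<le> p" "p \<le> 1" "W \<subseteq> F" "F' \<subseteq> F" "conn W x y" "card W \<le> n"
  shows "p ^ n * Pr p F' (\<lambda>U. hit U y A) \<le> Pr p F (\<lambda>U. hit U x A)"
proof -
  have "p ^ n * Pr p F' (\<lambda>U. hit U y A) \<le> tau p F x y * Pr p F (\<lambda>U. hit U y A)"
    using assms by (intro mult_mono tau_path[of F p W] Pr_mono_set mono_hit) auto
  also have "\<dots> \<le> Pr p F (\<lambda>U. conn U x y \<and> hit U y A)"
    unfolding tau_def using assms by (intro Pr_Harris mono_conn mono_hit)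
  also have "\<dots> \<le> Pr p F (\<lambda>U. hit U x A)"
    using assms by (intro Pr_mono) (auto simp: hit_def intro: conn_trans)
  finally show ?thesis .
qed

lemma finite_reach_set:
  assumes "finite F" "F \<subseteq> edges H" "U \<subseteq> F" "finite S"
  shows "finite {z. \<exists>x\<in>S. conn U x z}"
proof -
  have "{z. \<exists>x\<in>S. conn U x z} \<subseteq> S \<union> \<Union>F"
  proof clarify
    fix x z assume "x \<in> S" "conn U x z" "z \<notin> \<Union>F"
    then show "z \<in> S" using conn_verts[of U x z] assms(3) by auto
  qed
  moreover have "finite (\<Union>F)" using H.fin_edges[OF assms(1,2)] by (simp add: fin_edges_def)
  ultimately show ?thesis using assms(4) by (meson finite_Un finite_subset)
qed

text \<open>From the vertex at which one block is left, the next block is crossed by a copy of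
  \<open>F\<close> that an automorphism brings close to that vertex; a detour of at most
  \<open>2 + D0\<close> edges closes the gap. Hitting probabilities are therefore
  supermultiplicative up to the factor \<open>p ^ (2 + D0)\<close>.\<close>

lemma hit_chain:
  assumes D0: "\<And>x y. x \<in> verts G \<Longrightarrow> y \<in> verts G \<Longrightarrow> \<exists>\<psi>. is_automorphism G \<psi> \<and> gd G x (\<psi> y) \<le> D0"
    and p: "0 \<le> p" "p \<le> 1" and u: "line u" and n: "1 \<le> n" and x: "x \<in> verts G"
    and F: "finite F" "F \<subseteq> Bk u 0 (int n)"
  defines "r \<equiv> Pr p F (\<lambda>U. hit U (u 0, x) (fib (u (int n))))"
  shows "\<exists>F'. finite F' \<and> F' \<subseteq> Bk u 0 (int (Suc j * n)) \<and>
    (p ^ (2 + D0) * r) ^ j * r \<le> Pr p F' (\<lambda>U. hit U (u 0, x) (fib (u (int (Suc j * n)))))"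
proof (induction j)
  case 0
  then show ?case using F by (intro exI[of _ F]) (simp add: r_def)
next
  case (Suc j)
  let ?m = "int (Suc j * n)" and ?m' = "int (Suc (Suc j) * n)"
  obtain F1 where F1: "finite F1" "F1 \<subseteq> Bk u 0 ?m"
    "(p ^ (2 + D0) * r) ^ j * r \<le> Pr p F1 (\<lambda>U. hit U (u 0, x) (fib (u ?m)))"
    using Suc by auto
  have mm: "?m' = int n + ?m" by simp
  have F1H: "F1 \<subseteq> edges H" using F1(2) Bk_edges by (rule order_trans)
  have FH: "F \<subseteq> edges H" using F(2) Bk_edges by (rule order_trans)
  have r0: "0 \<le> r" using p by (simp add: r_def)
  have "\<exists>F2. finite F2 \<and> F2 \<subseteq> Bk u ?m ?m' \<and> p ^ (2 + D0) * r \<le> Pr p F2 (\<lambda>U. hit U (u ?m, z) (fib (u ?m')))"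
    if z: "z \<in> verts G" for z
  proof -
    obtain \<psi> where \<psi>: "is_automorphism G \<psi>" "gd G z (\<psi> x) \<le> D0" using D0[OF z x] by auto
    from transport[OF u line_shift[OF u, of ?m] \<psi>(1)]
    obtain f where f0: "is_automorphism H f" "\<forall>i x. f (u i, x) = (u (i + ?m), \<psi> x)"
        "\<forall>i. f ` fib (u i) = fib (u (i + ?m))"
        "\<forall>F i j. F \<subseteq> Bk u i j \<longrightarrow> (`) f ` F \<subseteq> Bk (\<lambda>i. u (i + ?m)) i j"
      by (elim exE conjE) (rule that)
    note f = f0(1) f0(2-4)[rule_format]
    have fF: "(`) f ` F \<subseteq> Bk u ?m ?m'" using f(4)[OF F(2)] unfolding Bk_shift mm by simp
    have "?m < ?m'" using n by simp
    then obtain W where W: "finite W" "card W \<le> 2 + D0" "W \<subseteq> Bk u ?m ?m'" "conn W (u ?m, z) (u ?m, \<psi> x)"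
      using detour(2)[OF u _ z G.automorphism_verts[OF \<psi>(1) x] \<psi>(2), of ?m ?m'] by auto
    let ?F2 = "W \<union> (`) f ` F"
    have "p ^ (2 + D0) * r = p ^ (2 + D0) * Pr p ((`) f ` F) (\<lambda>U. hit U (f (u 0, x)) (f ` fib (u (int n))))"
      unfolding r_def using x u
      by (subst automorphism_hit[OF f(1) F(1) FH]) (auto simp: fib_def)
    also have "\<dots> = p ^ (2 + D0) * Pr p ((`) f ` F) (\<lambda>U. hit U (u ?m, \<psi> x) (fib (u ?m')))"
      unfolding f(2,3) mm by simp
    also have "\<dots> \<le> Pr p ?F2 (\<lambda>U. hit U (u ?m, z) (fib (u ?m')))"
      using W F(1) p by (intro Pr_path_hit[of _ p W]) auto
    finally show ?thesis using W fF F(1) by (intro exI[of _ ?F2]) auto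
  qed
  then obtain F2 where F2: "\<And>z. z \<in> verts G \<Longrightarrow> finite (F2 z) \<and> F2 z \<subseteq> Bk u ?m ?m' \<and>
      p ^ (2 + D0) * r \<le> Pr p (F2 z) (\<lambda>U. hit U (u ?m, z) (fib (u ?m')))" by metis
  \<comment> \<open>\<open>?Z\<close> collects the possible entrance points. As it is finite, one
    finite set \<open>?G\<close> contains the continuations from all of them.\<close>
  let ?Z = "snd ` (fib (u ?m) \<inter> insert (u 0, x) (\<Union>F1))"
  have Z: "finite ?Z" "?Z \<subseteq> verts G" using H.fin_edges[OF F1(1) F1H] by (auto simp: fin_edges_def fib_def)
  let ?G = "\<Union>z\<in>?Z. F2 z"
  have fG: "finite ?G" using Z F2 by (intro finite_UN_I) auto
  have GB: "?G \<subseteq> Bk u ?m ?m'" using Z F2 by blast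
  have dj: "F1 \<inter> ?G = {}" using F1(2) GB Bk_disjoint[of u 0 ?m ?m'] by blast
  have "(p ^ (2 + D0) * r) ^ Suc j * r = ((p ^ (2 + D0) * r) ^ j * r) * (p ^ (2 + D0) * r)" by simp
  also have "\<dots> \<le> Pr p F1 (\<lambda>U. hit U (u 0, x) (fib (u ?m))) * (p ^ (2 + D0) * r)"
    using F1(3) p r0 by (intro mult_right_mono) auto
  also have "\<dots> \<le> Pr p (F1 \<union> ?G) (\<lambda>U. hit U (u 0, x) (fib (u ?m')))"
  proof (rule hit_compose[OF F1(1) fG dj p, where B = "\<lambda>U V. \<forall>z\<in>?Z. conn U (u 0, x) (u ?m, z) \<longrightarrow> z = (SOME z. z \<in> ?Z \<and> conn U (u 0, x) (u ?m, z)) \<longrightarrow> hit V (u ?m, z) (fib (u ?m'))"])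
    fix U V assume U: "U \<subseteq> F1" and h: "hit U (u 0, x) (fib (u ?m))" and
      B: "\<forall>z\<in>?Z. conn U (u 0, x) (u ?m, z) \<longrightarrow> z = (SOME z. z \<in> ?Z \<and> conn U (u 0, x) (u ?m, z)) \<longrightarrow> hit V (u ?m, z) (fib (u ?m'))"
    obtain y where y: "y \<in> fib (u ?m)" "conn U (u 0, x) y" using h by (auto simp: hit_def)
    have "y \<in> insert (u 0, x) (\<Union>F1)" using conn_verts[OF y(2)] U by blast
    then have ex: "\<exists>z. z \<in> ?Z \<and> conn U (u 0, x) (u ?m, z)"
      using y by (intro exI[of _ "snd y"]) (auto simp: fib_def intro!: image_eqI[of _ _ y])
    \<comment> \<open>One entrance point is selected as a function of the first stage, so that the
      event of the second stage concerns a single vertex.\<close>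
    define z where "z = (SOME z. z \<in> ?Z \<and> conn U (u 0, x) (u ?m, z))"
    have z: "z \<in> ?Z \<and> conn U (u 0, x) (u ?m, z)" unfolding z_def by (rule someI_ex[OF ex])
    then have "hit V (u ?m, z) (fib (u ?m'))" using B z_def by blast
    then obtain w where w: "w \<in> fib (u ?m')" "conn V (u ?m, z) w" by (auto simp: hit_def)
    have "conn (U \<union> V) (u 0, x) (u ?m, z)" using z conn_mono[of U _ _ "U \<union> V"] by blast
    moreover have "conn (U \<union> V) (u ?m, z) w" using w(2) by (rule conn_mono) auto
    ultimately show "hit (U \<union> V) (u 0, x) (fib (u ?m'))" using w(1) conn_trans unfolding hit_def by metis
  next
    fix U assume U: "U \<subseteq> F1" and h: "hit U (u 0, x) (fib (u ?m))"
    obtain y where y: "y \<in> fib (u ?m)" "conn U (u 0, x) y" using h by (auto simp: hit_def)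
    have "y \<in> insert (u 0, x) (\<Union>F1)" using conn_verts[OF y(2)] U by blast
    then have ex: "\<exists>z. z \<in> ?Z \<and> conn U (u 0, x) (u ?m, z)"
      using y by (intro exI[of _ "snd y"]) (auto simp: fib_def intro!: image_eqI[of _ _ y])
    define z where "z = (SOME z. z \<in> ?Z \<and> conn U (u 0, x) (u ?m, z))"
    have z: "z \<in> ?Z \<and> conn U (u 0, x) (u ?m, z)" unfolding z_def by (rule someI_ex[OF ex])
    then have zG: "z \<in> verts G" using Z by auto
    have "p ^ (2 + D0) * r \<le> Pr p (F2 z) (\<lambda>U. hit U (u ?m, z) (fib (u ?m')))" using F2[OF zG] by auto
    also have "\<dots> \<le> Pr p ?G (\<lambda>U. hit U (u ?m, z) (fib (u ?m')))"
      using fG z p by (intro Pr_mono_set mono_hit) auto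
    also have "\<dots> \<le> Pr p ?G (\<lambda>V. \<forall>z\<in>?Z. conn U (u 0, x) (u ?m, z) \<longrightarrow> z = (SOME z. z \<in> ?Z \<and> conn U (u 0, x) (u ?m, z)) \<longrightarrow> hit V (u ?m, z) (fib (u ?m')))"
      unfolding z_def using p by (intro Pr_mono) blast+
    finally show "p ^ (2 + D0) * r \<le> Pr p ?G (\<lambda>V. \<forall>z\<in>?Z. conn U (u 0, x) (u ?m, z) \<longrightarrow> z = (SOME z. z \<in> ?Z \<and> conn U (u 0, x) (u ?m, z)) \<longrightarrow> hit V (u ?m, z) (fib (u ?m')))" .
  qed (use p r0 in auto)
  finally have "(p ^ (2 + D0) * r) ^ Suc j * r \<le> Pr p (F1 \<union> ?G) (\<lambda>U. hit U (u 0, x) (fib (u ?m')))" .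
  moreover have "F1 \<union> ?G \<subseteq> Bk u 0 ?m'"
    using order_trans[OF F1(2) Bk_subset[OF u, of 0 0 ?m ?m']]
      order_trans[OF GB Bk_subset[OF u, of 0 ?m ?m' ?m']] by (intro Un_least) auto
  ultimately show ?case using F1(1) fG by (intro exI[of _ "F1 \<union> ?G"]) auto
qed

text \<open>A chain of \<open>j\<close> copies is compared with the mean, which is at most
  \<open>C * b ^ (j * n)\<close> for any \<open>b > \<beta>\<close>. Large \<open>j\<close>
  eliminates \<open>C\<close>, and then \<open>b\<close> tends to \<beta>. No prefactor is left but
  a power of \<open>p\<close>.\<close>

lemma hit_bound:
  assumes D0: "\<And>x y. x \<in> verts G \<Longrightarrow> y \<in> verts G \<Longrightarrow> \<exists>\<psi>. is_automorphism G \<psi> \<and> gd G x (\<psi> y) \<le> D0"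
    and p: "sb p" and u: "line u" and n: "1 \<le> n" and x: "x \<in> verts G"
    and F: "finite F" "F \<subseteq> Bk u 0 (int n)"
  shows "p ^ (2 + D0) * Pr p F (\<lambda>U. hit U (u 0, x) (fib (u (int n)))) \<le> \<beta> ^ n"
proof -
  note pp = sbD(1,2)[OF p]
  let ?r = "Pr p F (\<lambda>U. hit U (u 0, x) (fib (u (int n))))"
  let ?c = "p ^ (2 + D0)"
  have c: "0 \<le> ?c" "?c \<le> 1" using power_le_one[OF pp] pp(1) by (auto simp del: power_Suc power_add_numeral)
  have "?c * ?r \<le> b ^ n" if b: "\<beta> < b" for b
  proof -
    obtain C where C: "\<And>n. Bbd p n (C * b ^ n)" using above_\<beta>[OF b] p unfolding good_def by blast
    have b0: "0 < b" using b \<beta>_bounds by simp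
    show ?thesis
    proof (rule power_bound_limit)
      fix j :: nat assume "1 \<le> j"
      then obtain i where j: "j = Suc i" by (cases j) auto
      obtain F' where F': "finite F'" "F' \<subseteq> Bk u 0 (int (j * n))"
        "(?c * ?r) ^ i * ?r \<le> Pr p F' (\<lambda>U. hit U (u 0, x) (fib (u (int (j * n)))))"
        using hit_chain[OF D0 pp u n x F, of i] unfolding j by auto
      have F'H: "F' \<subseteq> edges H" using F'(2) Bk_edges by (rule order_trans)
      have fe: "fin_edges F'" by (rule H.fin_edges[OF F'(1) F'H])
      let ?A = "fib (u (int (j * n)))"
      have "(?c * ?r) ^ j = ?c * ((?c * ?r) ^ i * ?r)" by (simp add: j)
      also have "\<dots> \<le> 1 * ((?c * ?r) ^ i * ?r)" using c pp by (intro mult_right_mono) auto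
      also have "\<dots> \<le> Pr p F' (\<lambda>U. hit U (u 0, x) ?A)" using F'(3) by simp
      also have "\<dots> \<le> (\<Sum>y\<in>?A \<inter> insert (u 0, x) (\<Union>F'). Pr p F' (\<lambda>U. conn U (u 0, x) y))"
      proof (rule Pr_union_bound[OF pp])
        show "finite (?A \<inter> insert (u 0, x) (\<Union>F'))" using fe by (auto simp: fin_edges_def)
        fix U assume U: "U \<subseteq> F'" "hit U (u 0, x) ?A"
        then obtain y where y: "y \<in> ?A" "conn U (u 0, x) y" by (auto simp: hit_def)
        then have "y \<in> insert (u 0, x) (\<Union>F')" using conn_verts[OF y(2)] U(1) by blast
        then show "\<exists>y\<in>?A \<inter> insert (u 0, x) (\<Union>F'). conn U (u 0, x) y" using y by blast
      qed
      also have "\<dots> = rs p F' (u 0, x) ?A" by (simp add: rs_def tau_def)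
      also have "\<dots> \<le> C * b ^ (j * n)"
      proof (rule BbdD[OF C _ _ _ x F'(1) F'H])
        show "gd T (u 0) (u (int (j * n))) = j * n"
          using line_gd[OF u, of 0 "int (j * n)"] by (simp del: of_nat_mult)
      qed (use u in auto)
      also have "b ^ (j * n) = (b ^ n) ^ j" by (simp add: power_mult[symmetric] mult.commute)
      finally show "(?c * ?r) ^ j \<le> C * (b ^ n) ^ j" .
    qed (use pp b0 in auto)
  qed
  then have *: "?c * ?r \<le> (\<beta> + \<epsilon>) ^ n" if "0 < \<epsilon>" for \<epsilon> using that by simp
  have "((\<lambda>\<epsilon>. (\<beta> + \<epsilon>) ^ n) \<longlongrightarrow> (\<beta> + 0) ^ n) (at_right 0)" by (intro tendsto_intros)
  moreover have "\<forall>\<^sub>F \<epsilon> in at_right 0. ?c * ?r \<le> (\<beta> + \<epsilon>) ^ n"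
    using * by (simp add: eventually_at_filter)
  ultimately show ?thesis by (intro tendsto_lowerbound[of "\<lambda>\<epsilon>. (\<beta> + \<epsilon>) ^ n" _ "at_right 0"]) auto
qed

end

section \<open>Coasting\<close>

lemma Exp_indep:
  assumes "finite F" "A \<subseteq> F" "B \<subseteq> F" "A \<inter> B = {}"
  shows "Exp p F (\<lambda>U. f (U \<inter> A) * g (U \<inter> B)) = Exp p A f * Exp p B g"
proof -
  have fin: "finite A" "finite B" using assms by (auto intro: finite_subset)
  have "Exp p F (\<lambda>U. f (U \<inter> A) * g (U \<inter> B))
     = Exp p F (\<lambda>U. (\<lambda>W. f (W \<inter> A) * g (W \<inter> B)) (U \<inter> (A \<union> B)))"
  proof (rule Exp_cong)
    fix U
    have "U \<inter> (A \<union> B) \<inter> A = U \<inter> A" "U \<inter> (A \<union> B) \<inter> B = U \<inter> B" by auto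
    then show "f (U \<inter> A) * g (U \<inter> B) = (\<lambda>W. f (W \<inter> A) * g (W \<inter> B)) (U \<inter> (A \<union> B))" by simp
  qed
  also have "\<dots> = Exp p (A \<union> B) (\<lambda>W. f (W \<inter> A) * g (W \<inter> B))"
    using assms by (intro Exp_restrict) auto
  also have "\<dots> = Exp p A (\<lambda>U. Exp p B (\<lambda>V. f ((U \<union> V) \<inter> A) * g ((U \<union> V) \<inter> B)))"
    using fin assms(4) by (rule Exp_Un)
  also have "\<dots> = Exp p A (\<lambda>U. Exp p B (\<lambda>V. f U * g V))"
  proof (intro Exp_cong)
    fix U V assume "U \<subseteq> A" "V \<subseteq> B"
    then have "(U \<union> V) \<inter> A = U" "(U \<union> V) \<inter> B = V" using assms(4) by auto
    then show "f ((U \<union> V) \<inter> A) * g ((U \<union> V) \<inter> B) = f U * g V" by simp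
  qed
  also have "\<dots> = Exp p A f * Exp p B g" by (simp only: Exp_cmult Exp_multc)
  finally show ?thesis .
qed

text \<open>Chebyshev's inequality: only pairs with intersecting dependency sets contribute to the variance.\<close>

lemma local_dependence:
  fixes I :: "'i \<Rightarrow> 'e set \<Rightarrow> bool" and M :: "'i \<Rightarrow> 'e set"
  assumes F: "finite F" and p: "0 \<le> p" "p \<le> 1" and Z: "finite Z"
    and M: "\<And>z. z \<in> Z \<Longrightarrow> M z \<subseteq> F"
    and V: "\<And>z. z \<in> Z \<Longrightarrow> card {z' \<in> Z. M z \<inter> M z' \<noteq> {}} \<le> V"
  defines "X \<equiv> \<lambda>U. \<Sum>z\<in>Z. of_bool (I z (U \<inter> M z)) :: real"
  assumes m: "8 * real V \<le> Exp p F X" "0 < Exp p F X"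
  shows "1 / 2 \<le> Pr p F (\<lambda>U. Exp p F X / 2 \<le> X U)"
proof -
  let ?m = "Exp p F X"
  let ?P = "\<lambda>z. Pr p F (\<lambda>U. I z (U \<inter> M z))"
  have m_eq: "?m = (\<Sum>z\<in>Z. ?P z)" unfolding X_def Pr_def by (simp only: Exp_sum)
  have P0: "0 \<le> ?P z" for z using p by simp
  have sq: "Exp p F (\<lambda>U. X U * X U) \<le> ?m * ?m + real V * ?m"
  proof -
    have "Exp p F (\<lambda>U. X U * X U) = (\<Sum>z\<in>Z. \<Sum>z'\<in>Z. Exp p F (\<lambda>U. of_bool (I z (U \<inter> M z)) * of_bool (I z' (U \<inter> M z'))))"
      unfolding X_def sum_product by (simp only: Exp_sum)
    also have "\<dots> \<le> (\<Sum>z\<in>Z. \<Sum>z'\<in>Z. ?P z * ?P z' + (if M z \<inter> M z' \<noteq> {} then ?P z else 0))"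
    proof (intro sum_mono)
      fix z z' assume z: "z \<in> Z" "z' \<in> Z"
      show "Exp p F (\<lambda>U. of_bool (I z (U \<inter> M z)) * of_bool (I z' (U \<inter> M z')))
          \<le> ?P z * ?P z' + (if M z \<inter> M z' \<noteq> {} then ?P z else 0)"
      proof (cases "M z \<inter> M z' = {}")
        case True
        have "Exp p F (\<lambda>U. of_bool (I z (U \<inter> M z)) * of_bool (I z' (U \<inter> M z')))
           = Exp p (M z) (\<lambda>U. of_bool (I z U)) * Exp p (M z') (\<lambda>U. of_bool (I z' U))"
          using Exp_indep[OF F M[OF z(1)] M[OF z(2)] True, of p "\<lambda>U. of_bool (I z U)" "\<lambda>U. of_bool (I z' U)"] .
        also have "\<dots> = ?P z * ?P z'"
          using Exp_restrict[OF F M[OF z(1)], of p "\<lambda>U. of_bool (I z U)"]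
            Exp_restrict[OF F M[OF z(2)], of p "\<lambda>U. of_bool (I z' U)"] by (simp add: Pr_def)
        finally show ?thesis using True by simp
      next
        case False
        have "Exp p F (\<lambda>U. of_bool (I z (U \<inter> M z)) * of_bool (I z' (U \<inter> M z'))) \<le> ?P z"
          unfolding Pr_def using p by (intro Exp_mono) auto
        moreover have "0 \<le> ?P z * ?P z'" by (rule mult_nonneg_nonneg[OF P0 P0])
        ultimately have "Exp p F (\<lambda>U. of_bool (I z (U \<inter> M z)) * of_bool (I z' (U \<inter> M z'))) \<le> ?P z * ?P z' + ?P z"
          by linarith
        then show ?thesis using False by simp
      qed
    qed
    also have "\<dots> = ?m * ?m + (\<Sum>z\<in>Z. real (card {z' \<in> Z. M z \<inter> M z' \<noteq> {}}) * ?P z)"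
    proof -
      have "(\<Sum>z'\<in>Z. if M z \<inter> M z' \<noteq> {} then ?P z else 0) = real (card {z' \<in> Z. M z \<inter> M z' \<noteq> {}}) * ?P z" for z
        using Z by (simp add: sum.If_cases Int_def)
      then show ?thesis unfolding m_eq sum_product sum.distrib by simp
    qed
    also have "\<dots> \<le> ?m * ?m + (\<Sum>z\<in>Z. real V * ?P z)"
      using V P0 by (intro add_left_mono sum_mono mult_right_mono) auto
    finally show ?thesis by (simp add: m_eq sum_distrib_left)
  qed
  have "Pr p F (\<lambda>U. \<not> ?m / 2 \<le> X U) \<le> Exp p F (\<lambda>U. (X U * X U + (?m * ?m + (- 2 * ?m) * X U)) * (4 / (?m * ?m)))"
    unfolding Pr_def
  proof (rule Exp_mono[OF p])
    fix U
    have e: "X U * X U + (?m * ?m + (- 2 * ?m) * X U) = (?m - X U)\<^sup>2" by (simp add: power2_eq_square algebra_simps)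
    show "of_bool (\<not> ?m / 2 \<le> X U) \<le> (X U * X U + (?m * ?m + (- 2 * ?m) * X U)) * (4 / (?m * ?m))"
    proof (cases "?m / 2 \<le> X U")
      case False
      then have "(?m / 2)\<^sup>2 \<le> (?m - X U)\<^sup>2" using m by (intro power_mono) auto
      then have "1 \<le> (?m - X U)\<^sup>2 * (4 / (?m * ?m))" using m(2) by (simp add: power2_eq_square field_simps)
      then show ?thesis unfolding e using False by simp
    next
      case True
      then show ?thesis unfolding e using m(2) by simp
    qed
  qed
  also have "\<dots> = (Exp p F (\<lambda>U. X U * X U) - ?m * ?m) * (4 / (?m * ?m))"
    unfolding Exp_multc Exp_add Exp_cmult using F by (simp add: algebra_simps)
  also have "\<dots> \<le> (real V * ?m) * (4 / (?m * ?m))"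
    using sq m(2) by (intro mult_right_mono) auto
  also have "\<dots> = 4 * real V / ?m" using m(2) by (simp add: field_simps)
  also have "\<dots> \<le> 1 / 2" using m by (simp add: field_simps)
  finally have "Pr p F (\<lambda>U. \<not> ?m / 2 \<le> X U) \<le> 1 / 2" .
  then show ?thesis using Pr_compl[OF F, of p "\<lambda>U. ?m / 2 \<le> X U"] by simp
qed

section \<open>Lower bounds for block means and the coasting estimate\<close>

context tprod
begin

lemma inner_UNIV: "inner (UNIV :: ('a \<times> 'b) set) = UNIV"
  by (auto simp: inner_def)

lemma Bbd_const:
  assumes p: "sb p"
  shows "\<exists>C\<ge>1. \<forall>n. Bbd p n C"
proof -
  obtain C where C: "\<And>n. Bbd p n (C * \<delta> ^ n)" using good_\<delta> p unfolding good_def by blast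
  have C1: "1 \<le> C" using Bbd_lower[OF sbD(1,2)[OF p] C[of 0]] by simp
  have "C * \<delta> ^ n \<le> C" for n using C1 \<delta>_pow(2)[of n] by (simp add: mult_left_le)
  then have "Bbd p n C" for n by (rule Bbd_mono[OF C])
  then show ?thesis using C1 by blast
qed

text \<open>A path from \<open>s\<close> to the fibre over \<open>t = u n\<close> is cut at the step
  to \<open>u 1\<close> after its last visit over \<open>u 0\<close>, and at the first visit over
  \<open>u n\<close> after that. The outer parts cost a factor \<open>C\<close> each; if the part
  inside the strip never contributed more than \<open>B / C\<^sup>2\<close>, the whole row would be
  at most \<open>B\<close>.\<close>

lemma strip_mean:
  assumes p: "0 \<le> p" "p \<le> 1" and C: "1 \<le> C" "\<And>n. Bbd p n C" and n: "1 \<le> n" and nB: "\<not> Bbd p n B"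
  shows "\<exists>u w F. line u \<and> w \<in> verts G \<and> finite F \<and> F \<subseteq> EE (L u (int n) - L u 0)
    \<and> B / C\<^sup>2 < rs p F (u 1, w) (fib (u (int n)))"
proof (rule ccontr)
  assume "\<not> ?thesis"
  then have le: "rs p F (u 1, w) (fib (u (int n))) \<le> B / C\<^sup>2"
    if "line u" "w \<in> verts G" "finite F" "F \<subseteq> EE (L u (int n) - L u 0)" for u w F
    using that by (meson not_le)
  have "0 \<le> rs p {} (u 1, w) (fib (u (int n)))" for u w by (rule rs_nonneg[OF p])
  moreover obtain u0 where "line u0" using line_ex by auto
  moreover obtain w0 where "w0 \<in> verts G" using nonempty_G by auto
  ultimately have e0: "0 \<le> B / C\<^sup>2" using le[of u0 w0 "{}"] by (meson empty_subsetI finite.emptyI order_trans)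
  have "rs p F (s, x) (fib t) \<le> B" if h: "s \<in> verts T" "t \<in> verts T" "gd T s t = n" "x \<in> verts G" "finite F" "F \<subseteq> edges H" for s t x F
  proof -
    obtain u where u: "line u" "u 0 = s" "u (int n) = t" using line_exists[OF h(1,2)] h(3) by metis
    have fe: "fin_edges F" using h by (intro H.fin_edges)
    let ?R = "reg (verts T - L u 0)"
    have second: "rs p F' (u 1, w) (fib t) \<le> B / C\<^sup>2 * C"
      if w: "w \<in> verts G" and F': "finite F'" "F' \<subseteq> EE (verts T - L u 0)" for w F'
    proof -
      have F'H: "F' \<subseteq> edges H" using F'(2) EE_subset by (rule order_trans)
      have fe': "fin_edges F'" by (rule H.fin_edges[OF F'(1) F'H])
      let ?S = "reg (L u (int n) - L u 0)"
      have "rs p F' (u 1, w) (fib t) \<le> (\<Sum>i\<in>{0::nat}. B / C\<^sup>2 * C)"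
      proof (rule rs_split[where Z = "\<lambda>_. fib t" and R = "\<lambda>_. ?S" and R' = "\<lambda>_. UNIV", OF fe' p])
        fix xs y assume y: "y \<in> fib t" and sp: "spath F' (u 1, w) xs y"
        have "\<exists>z\<in>set xs. fst z = u (int n)"
          using spath_ends(2)[OF sp] y u(3) by (intro bexI[of _ y]) (auto simp: fib_def)
        from split_list_first_prop[OF this]
        obtain as z bs where s: "xs = as @ z # bs" "fst z = u (int n)" "\<forall>v\<in>set as. fst v \<noteq> u (int n)" by blast
        have comp: "v \<in> ?R" if "v \<in> set xs" for v
        proof (cases "v = (u 1, w)")
          case True
          then show ?thesis using w u(1) line_mem_L[OF u(1)] by (auto simp: reg_def)
        next
          case False
          then have "v \<in> \<Union>F'" using spath_mem[OF sp that] by auto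
          then show ?thesis using F'(2) by (auto simp: EE_def inner_def)
        qed
        have as_sub: "set as \<subseteq> reg (L u (int n - 1))"
        proof (cases "as = []")
          case False
          have hd: "hd as = (u 1, w)" using sp s(1) False by (cases as) (auto simp: spath_def)
          then have "n \<noteq> 1" using s(3) False hd_in_set[OF False] by force
          show ?thesis
          proof (rule stay_L[OF u(1)])
            have "pedges xs = pedges (as @ [z]) \<union> pedges (z # bs)" unfolding s(1) by (rule pedges_append)
            moreover have "pedges as \<subseteq> pedges (as @ [z])"
            proof -
              have "as = butlast as @ [last as]" using False by simp
              then have "pedges (as @ [z]) = pedges (butlast as @ [last as]) \<union> pedges [last as, z]"
                using pedges_append[of "butlast as" "last as" "[z]"] by (metis append.assoc append_Cons append_Nil)
              moreover have "pedges (butlast as @ [last as]) = pedges as"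
                using \<open>as = butlast as @ [last as]\<close>[symmetric] by (rule arg_cong)
              ultimately show ?thesis by blast
            qed
            ultimately show "pedges as \<subseteq> edges H" using sp F'H by (auto simp: spath_def)
            show "hd as \<in> reg (L u (int n - 1))"
              using hd w \<open>n \<noteq> 1\<close> n line_mem_L[OF u(1)] by (auto simp: reg_def)
          qed (use False s(3) in auto)
        qed simp
        have "v \<in> ?S" if v: "v \<in> set (as @ [z])" for v
        proof -
          have "v \<in> set xs" using v s(1) by auto
          then have "v \<in> ?R" by (rule comp)
          moreover have "fst v \<in> L u (int n)"
          proof (cases "v = z")
            case True
            then show ?thesis using s(2) line_mem_L[OF u(1)] by simp
          next
            case False
            then have "fst v \<in> L u (int n - 1)" using v as_sub by (auto simp: reg_def)
            then show ?thesis using L_mono[OF u(1), of "int n - 1" "int n"] by auto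
          qed
          ultimately show ?thesis by (auto simp: reg_def)
        qed
        then have "set (as @ [z]) \<subseteq> ?S" by blast
        moreover have "z \<in> fib t" using comp[of z] s(1,2) u(3) by (cases z) (auto simp: fib_def reg_def)
        ultimately show "\<exists>i\<in>{0::nat}. \<exists>as z bs. xs = as @ z # bs \<and> z \<in> fib t \<and> set (as @ [z]) \<subseteq> ?S \<and> set (z # bs) \<subseteq> UNIV"
          using s(1) by blast
      next
        have "finite (F' \<inter> inner ?S)" "F' \<inter> inner ?S \<subseteq> EE (L u (int n) - L u 0)"
          using F'(1) EE_Int_inner[OF F'H] by auto
        then show "rs p (F' \<inter> inner ?S) (u 1, w) (fib t) \<le> B / C\<^sup>2"
          using le[OF u(1) w] u(3) by simp
      next
        fix z assume "z \<in> fib t"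
        then obtain y where "z = (t, y)" "y \<in> verts G" by (auto simp: fib_def)
        then show "rs p (F' \<inter> inner UNIV) z (fib t) \<le> C"
          unfolding inner_UNIV using h(2) F'(1) F'H by (auto intro!: BbdD[OF C(2)[of 0]])
      qed (use C in auto)
      then show ?thesis by simp
    qed
    have "rs p F (s, x) (fib t) \<le> (\<Sum>i\<in>{0::nat}. C * (B / C\<^sup>2 * C))"
    proof (rule rs_split[where Z = "\<lambda>_. fib (u 1)" and R = "\<lambda>_. UNIV" and R' = "\<lambda>_. ?R", OF fe p])
      fix xs y assume y: "y \<in> fib t" and sp: "spath F (s, x) xs y"
      have "\<exists>z\<in>set xs. fst z = u 0" using spath_ends(1)[OF sp] u(2) by force
      from split_list_last_prop[OF this]
      obtain as z bs where s: "xs = as @ z # bs" "fst z = u 0" "\<forall>v\<in>set bs. fst v \<noteq> u 0" by blast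
      have yn: "fst y = u (int n)" using y u(3) by (auto simp: fib_def)
      have "bs \<noteq> []"
      proof
        assume "bs = []"
        then have "z = y" using sp s(1) by (auto simp: spath_def)
        then show False using s(2) yn line_inj[OF u(1), of 0 "int n"] n by auto
      qed
      then obtain z' bs' where bs: "bs = z' # bs'" by (cases bs) auto
      have pe: "pedges xs = pedges (as @ [z]) \<union> insert {z, z'} (pedges bs)"
        unfolding s(1) bs by (subst pedges_append) simp
      have ly: "last bs = y" using sp s(1) bs by (auto simp: spath_def)
      have yV: "y \<in> reg (verts T - L u 0)"
      proof -
        have "u (int n) \<in> verts T - L u 0" using u(1) n line_mem_L[OF u(1), of "int n" 0] by simp
        moreover have "snd y \<in> verts G" using y by (auto simp: fib_def)
        ultimately have "(u (int n), snd y) \<in> reg (verts T - L u 0)" by (rule mem_regI)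
        then show ?thesis using yn by (metis prod.collapse)
      qed
      have "set (rev bs) \<subseteq> ?R"
      proof (rule stay_compl_L[OF u(1)])
        show "pedges (rev bs) \<subseteq> edges H" unfolding pedges_rev using pe sp h(6) by (auto simp: spath_def)
        show "hd (rev bs) \<in> ?R" using ly yV \<open>bs \<noteq> []\<close> by (simp add: hd_rev)
      qed (use bs s(3) in auto)
      then have bR: "set bs \<subseteq> ?R" by simp
      then have z'R: "z' \<in> ?R" using bs by auto
      have "adj H z z'" using pe sp h(6) by (auto simp: spath_def adj_def)
      moreover have "fst z \<in> L u 0" using s(2) line_mem_L[OF u(1)] by simp
      moreover have "fst z' \<notin> L u 0" using z'R by (auto simp: reg_def)
      ultimately have "adj T (fst z) (fst z')" using adj_H_cases by metis
      then have "fst z' = u 1" using L_cross[OF u(1), of "fst z" "fst z'" 0] \<open>fst z \<in> L u 0\<close> \<open>fst z' \<notin> L u 0\<close> by auto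
      then have "z' \<in> fib (u 1)" using z'R by (cases z') (auto simp: fib_def reg_def)
      moreover have "xs = (as @ [z]) @ z' # bs'" using s(1) bs by simp
      ultimately show "\<exists>i\<in>{0::nat}. \<exists>as z bs. xs = as @ z # bs \<and> z \<in> fib (u 1) \<and> set (as @ [z]) \<subseteq> UNIV \<and> set (z # bs) \<subseteq> ?R"
        using bR bs by blast
    next
      show "rs p (F \<inter> inner UNIV) (s, x) (fib (u 1)) \<le> C"
        unfolding inner_UNIV using h u line_gd[OF u(1), of 0 1] by (auto intro!: BbdD[OF C(2)[of 1]])
    next
      fix z assume "z \<in> fib (u 1)"
      then obtain w where "z = (u 1, w)" "w \<in> verts G" by (auto simp: fib_def)
      then show "rs p (F \<inter> inner ?R) z (fib t) \<le> B / C\<^sup>2 * C"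
        using second[of w "F \<inter> inner ?R"] h(5,6) EE_Int_inner by auto
    qed (use C mult_nonneg_nonneg[OF e0, of C] in simp_all)
    also have "\<dots> = B" using C(1) by (simp add: power2_eq_square field_simps)
    finally show ?thesis .
  qed
  then have "Bbd p n B" unfolding Bbd_def by blast
  then show False using nB by simp
qed

text \<open>The start found by \<open>strip_mean\<close> is moved close to the given
  \<open>x\<close> by an automorphism. The edge from \<open>v 0\<close> to \<open>v 1\<close> and a
  path in the fibre over \<open>v 1\<close> then join \<open>x\<close> to it, at the price of
  \<open>p ^ (1 + D0)\<close>.\<close>

lemma block_mean:
  assumes D0: "\<And>x y. x \<in> verts G \<Longrightarrow> y \<in> verts G \<Longrightarrow> \<exists>\<psi>. is_automorphism G \<psi> \<and> gd G x (\<psi> y) \<le> D0"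
    and p: "0 \<le> p" "p \<le> 1" and C: "1 \<le> C" "\<And>n. Bbd p n C" and n: "1 \<le> n" and nB: "\<not> Bbd p n B"
    and v: "line v" and x: "x \<in> verts G"
  shows "\<exists>F. finite F \<and> F \<subseteq> Bk v 0 (int n) \<and> p ^ (1 + D0) * (B / C\<^sup>2) \<le> rs p F (v 0, x) (fib (v (int n)))"
proof -
  obtain u w F where uwF: "line u" "w \<in> verts G" "finite F" "F \<subseteq> EE (L u (int n) - L u 0)"
      "B / C\<^sup>2 < rs p F (u 1, w) (fib (u (int n)))"
    using strip_mean[OF p C n nB] by auto
  obtain \<psi> where \<psi>: "is_automorphism G \<psi>" "gd G x (\<psi> w) \<le> D0" using D0[OF x uwF(2)] by auto
  from transport[OF uwF(1) v \<psi>(1)]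
  obtain f where f0: "is_automorphism H f" "\<forall>i x. f (u i, x) = (v i, \<psi> x)"
      "\<forall>i. f ` fib (u i) = fib (v i)"
      "\<forall>F i j. F \<subseteq> EE (L u j - L u i) \<longrightarrow> (`) f ` F \<subseteq> EE (L v j - L v i)"
    by (elim exE conjE) (rule that)
  note f = f0(1) f0(2-4)[rule_format]
  have FH: "F \<subseteq> edges H" using uwF(4) EE_subset by (rule order_trans)
  have fF: "(`) f ` F \<subseteq> Bk v 0 (int n)" using f(4)[OF uwF(4)] strip_subset_Bk by (rule order_trans)
  obtain W where W: "finite W" "card W \<le> 1 + D0" "W \<subseteq> Bk v 0 (int n)" "conn W (v 0, x) (v (0 + 1), \<psi> w)"
    using detour(1)[OF v _ x G.automorphism_verts[OF \<psi>(1) uwF(2)] \<psi>(2), of 0 "int n"] n by auto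
  let ?F = "W \<union> (`) f ` F" and ?A = "fib (v (int n))"
  have F: "finite ?F" "?F \<subseteq> Bk v 0 (int n)" using W fF uwF(3) by auto
  have fe: "fin_edges ?F" by (rule H.fin_edges[OF F(1) order_trans[OF F(2) Bk_edges]])
  have fe': "fin_edges ((`) f ` F)" by (rule fin_edges_subset[OF fe]) auto
  have "rs p F (u 1, w) (fib (u (int n))) = rs p ((`) f ` F) (f (u 1, w)) (f ` fib (u (int n)))"
    using uwF by (intro H.automorphism_rs[OF f(1) uwF(3) FH, symmetric]) (auto simp: fib_def)
  also have "\<dots> = rs p ((`) f ` F) (v 1, \<psi> w) ?A" by (simp only: f(2,3))
  finally have B: "B / C\<^sup>2 \<le> rs p ((`) f ` F) (v 1, \<psi> w) ?A" using uwF(5) by simp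
  have "p ^ (1 + D0) * (B / C\<^sup>2) \<le> p ^ (1 + D0) * rs p ((`) f ` F) (v 1, \<psi> w) ?A"
    using B p by (intro mult_left_mono) auto
  also have "\<dots> \<le> (\<Sum>y\<in>?A \<inter> insert (v 1, \<psi> w) (\<Union>((`) f ` F)). tau p ?F (v 0, x) y)"
    unfolding rs_def sum_distrib_left
  proof (rule sum_mono)
    fix y
    have "p ^ (1 + D0) * tau p ((`) f ` F) (v 1, \<psi> w) y \<le> tau p ?F (v 0, x) (v 1, \<psi> w) * tau p ?F (v 1, \<psi> w) y"
      using W F(1) p by (intro mult_mono tau_path[of _ _ W] tau_mono) auto
    also have "\<dots> \<le> tau p ?F (v 0, x) y" using F(1) p by (rule tau_triangle_Harris)
    finally show "p ^ (1 + D0) * tau p ((`) f ` F) (v 1, \<psi> w) y \<le> tau p ?F (v 0, x) y" .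
  qed
  also have "\<dots> \<le> rs p ?F (v 0, x) ?A"
    using fe' p by (intro sum_tau_le_rs fe) (auto simp: fin_edges_def)
  finally show ?thesis using F by blast
qed

lemma sum_by_fibre:
  assumes p: "0 \<le> p" "p \<le> 1" and F: "finite F" "F \<subseteq> edges H" and o': "o' \<in> verts H" and g: "\<And>v. 0 \<le> g v"
  shows "(\<Sum>w\<in>insert o' (\<Union>F). tau p F o' w * g (fst w)) \<le> (\<Sum>v\<in>fst ` insert o' (\<Union>F). rs p F o' (fib v) * g v)"
proof -
  let ?W = "insert o' (\<Union>F)"
  have fe: "fin_edges F" using F by (rule H.fin_edges)
  have W: "finite ?W" "?W \<subseteq> verts H" using fe o' H.Union_edges[OF F(2)] by (auto simp: fin_edges_def)
  have "(\<Sum>w\<in>?W. tau p F o' w * g (fst w)) = (\<Sum>v\<in>fst ` ?W. \<Sum>w\<in>{w \<in> ?W. fst w = v}. tau p F o' w * g (fst w))"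
    using W by (intro sum.group[symmetric]) auto
  also have "\<dots> = (\<Sum>v\<in>fst ` ?W. (\<Sum>w\<in>{w \<in> ?W. fst w = v}. tau p F o' w) * g v)"
  proof (intro sum.cong refl)
    fix v
    have "(\<Sum>w\<in>{w \<in> ?W. fst w = v}. tau p F o' w * g (fst w)) = (\<Sum>w\<in>{w \<in> ?W. fst w = v}. tau p F o' w * g v)"
      by (intro sum.cong) auto
    then show "(\<Sum>w\<in>{w \<in> ?W. fst w = v}. tau p F o' w * g (fst w)) = (\<Sum>w\<in>{w \<in> ?W. fst w = v}. tau p F o' w) * g v"
      by (simp only: sum_distrib_right)
  qed
  also have "\<dots> \<le> (\<Sum>v\<in>fst ` ?W. rs p F o' (fib v) * g v)"
  proof (intro sum_mono mult_right_mono g sum_tau_le_rs[OF fe _ _ p])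
    fix v
    show "finite {w \<in> ?W. fst w = v}" using W(1) by (rule finite_subset[rotated]) auto
    show "{w \<in> ?W. fst w = v} \<subseteq> fib v"
    proof
      fix w assume "w \<in> {w \<in> ?W. fst w = v}"
      then have "w \<in> verts H" "fst w = v" using W(2) by auto
      then show "w \<in> fib v" by (cases w) (auto simp: fib_def)
    qed
  qed
  finally show ?thesis .
qed

text \<open>The second count is taken in the starting fibre because coasting must discount starting
  points that share a cluster. Summing over the projection of the branch point, \<open>d ^ j\<close>
  vertices meet \<open>b ^ (3 * j)\<close>, and the assumption on \<open>b ^ 3\<close> gives
  \<open>d * b ^ 3 \<le> 1 / 2\<close>. The constant 12 is 2 from the spheres, 2 from the series in
  \<open>j\<close> and 3 from the series in \<open>i\<close>.\<close>

lemma mixed_moment_bound: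
  assumes p: "0 \<le> p" "p \<le> 1" and C: "1 \<le> C" "\<And>n. Bbd p n (C * b ^ n)" and b: "0 < b" "b ^ 3 \<le> 2 * \<delta> ^ 3"
    and u: "line u" and x: "x \<in> verts G" and F: "finite F" "F \<subseteq> edges H"
  shows "Exp p F (\<lambda>U. cnt U (u 0, x) (fib (u (int n))) * cnt U (u 0, x) (fib (u 0))) \<le> 12 * C ^ 3 * b ^ n"
proof -
  let ?o = "(u 0, x)" and ?A = "fib (u (int n))" and ?A' = "fib (u 0)"
  let ?W = "insert ?o (\<Union>F)"
  have fe: "fin_edges F" using F by (rule H.fin_edges)
  have W: "finite ?W" "?W \<subseteq> verts H" using fe x u H.Union_edges[OF F(2)] by (auto simp: fin_edges_def)
  let ?g = "\<lambda>v. (C * b ^ gd T v (u (int n))) * (C * b ^ gd T v (u 0))"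
  have b1: "b \<le> 2 / 3"
  proof (rule ccontr)
    assume "\<not> b \<le> 2 / 3"
    then have "(2 / 3) ^ 3 < b ^ 3" by (intro power_strict_mono) auto
    also have "\<dots> \<le> 2 * \<delta> ^ 3" by (rule b(2))
    also have "\<dots> \<le> 2 * (1 / 2) ^ 3" using \<delta> by (intro mult_left_mono power_mono) auto
    finally show False by (simp add: power3_eq_cube)
  qed
  have b3: "real d * b ^ 3 \<le> 1 / 2"
  proof -
    have "real d * b ^ 3 \<le> real d * (2 * \<delta> ^ 3)" using b by (intro mult_left_mono) auto
    also have "\<dots> = 2 * \<delta> * \<delta>" using d by (simp add: power3_eq_cube)
    also have "\<dots> \<le> 2 * (1 / 2) * (1 / 2)" using \<delta> by (intro mult_mono) auto
    finally show ?thesis by simp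
  qed
  have f0: "0 \<le> C ^ 3 * b ^ (2 * m + l)" for m l using C b by simp
  have "Exp p F (\<lambda>U. cnt U ?o ?A * cnt U ?o ?A')
      = Exp p F (\<lambda>U. (\<Sum>y\<in>?A \<inter> ?W. of_bool (conn U ?o y)) * (\<Sum>y\<in>?A' \<inter> ?W. of_bool (conn U ?o y)))"
    by (rule Exp_cong) (simp add: cnt_eq[OF fe])
  also have "\<dots> \<le> (\<Sum>w\<in>?W. tau p F ?o w * rs p F w ?A * rs p F w ?A')"
    by (rule mixed_moment[OF fe p])
  also have "\<dots> \<le> (\<Sum>w\<in>?W. tau p F ?o w * ?g (fst w))"
  proof (rule sum_mono)
    fix w assume "w \<in> ?W"
    then have wH: "w \<in> verts H" using W(2) by (rule subsetD[rotated])
    obtain v y where vy: "w = (v, y)" by (cases w)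
    then have w: "w = (v, y)" "v \<in> verts T" "y \<in> verts G" using wH by auto
    have "rs p F w ?A * rs p F w ?A' \<le> ?g (fst w)"
    proof -
      have "rs p F w ?A \<le> C * b ^ gd T v (u (int n))" "rs p F w ?A' \<le> C * b ^ gd T v (u 0)"
        unfolding w(1) by (rule BbdD[OF C(2) w(2) line_verts[OF u] refl w(3) F])+
      then show ?thesis unfolding w(1) fst_conv using rs_nonneg[OF p] C(1) b(1) by (intro mult_mono) auto
    qed
    then show "tau p F ?o w * rs p F w ?A * rs p F w ?A' \<le> tau p F ?o w * ?g (fst w)"
      unfolding mult.assoc[of "tau p F ?o w"] using p by (intro mult_left_mono) auto
  qed
  also have "\<dots> \<le> (\<Sum>v\<in>fst ` ?W. rs p F ?o (fib v) * ?g v)"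
    using x u C b by (intro sum_by_fibre p F) auto
  also have "\<dots> \<le> (\<Sum>v\<in>fst ` ?W. C ^ 3 * b ^ (2 * gd T v (u 0) + gd T v (u (int n))))"
  proof (rule sum_mono)
    fix v assume "v \<in> fst ` ?W"
    then have v: "v \<in> verts T" using W(2) by auto
    have "rs p F ?o (fib v) \<le> C * b ^ gd T v (u 0)"
      using v x u F by (intro BbdD[OF C(2)]) (auto simp: gd_sym)
    then have "rs p F ?o (fib v) * ?g v \<le> (C * b ^ gd T v (u 0)) * ?g v"
      using C b by (intro mult_right_mono) auto
    also have "\<dots> = C ^ 3 * b ^ (2 * gd T v (u 0) + gd T v (u (int n)))"
      by (simp add: power_add mult_2 power3_eq_cube)
    finally show "rs p F ?o (fib v) * ?g v \<le> C ^ 3 * b ^ (2 * gd T v (u 0) + gd T v (u (int n)))" .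
  qed
  also have "\<dots> \<le> 12 * C ^ 3 * b ^ n"
  proof -
    have fV: "finite (fst ` ?W)" "fst ` ?W \<subseteq> verts T" using W by auto
    obtain J where "(\<Sum>v\<in>fst ` ?W. C ^ 3 * b ^ (2 * gd T v (u 0) + gd T v (u (int n))))
        \<le> (\<Sum>i\<le>n. \<Sum>j<J. 2 * real d ^ j * (C ^ 3 * b ^ (2 * (i + j) + ((n - i) + j))))"
      using tree_sum_le[OF u fV, of "\<lambda>m l. C ^ 3 * b ^ (2 * m + l)" n] f0 by blast
    also have "\<dots> = (\<Sum>i\<le>n. \<Sum>j<J. (2 * C ^ 3 * b ^ n * b ^ i) * (real d * b ^ 3) ^ j)"
    proof (intro sum.cong refl)
      fix i j assume "i \<in> {..n}"
      then have "2 * (i + j) + ((n - i) + j) = n + i + 3 * j" by auto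
      then have "b ^ (2 * (i + j) + ((n - i) + j)) = b ^ n * b ^ i * (b ^ 3) ^ j"
        by (simp only: power_add power_mult)
      then show "2 * real d ^ j * (C ^ 3 * b ^ (2 * (i + j) + ((n - i) + j)))
          = (2 * C ^ 3 * b ^ n * b ^ i) * (real d * b ^ 3) ^ j"
        by (simp only: power_mult_distrib) (simp only: mult.assoc mult.commute mult.left_commute)
    qed
    also have "\<dots> = (\<Sum>i\<le>n. (2 * C ^ 3 * b ^ n * b ^ i) * (\<Sum>j<J. (real d * b ^ 3) ^ j))"
      by (simp only: sum_distrib_left)
    also have "\<dots> \<le> (\<Sum>i\<le>n. (2 * C ^ 3 * b ^ n * b ^ i) * 2)"
    proof (intro sum_mono mult_left_mono)
      have "(\<Sum>j<J. (real d * b ^ 3) ^ j) \<le> 1 / (1 - real d * b ^ 3)"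
        using b3 b by (intro geometric_sum_le) auto
      also have "\<dots> \<le> 2" using b3 by (simp add: divide_le_eq)
      finally show "(\<Sum>j<J. (real d * b ^ 3) ^ j) \<le> 2" .
    qed (use C b in auto)
    also have "\<dots> = (4 * C ^ 3 * b ^ n) * (\<Sum>i\<le>n. b ^ i)"
      unfolding sum_distrib_left by (intro sum.cong) auto
    also have "\<dots> \<le> (4 * C ^ 3 * b ^ n) * 3"
    proof (intro mult_left_mono)
      have "(\<Sum>i\<le>n. b ^ i) \<le> 1 / (1 - b)" using b1 b by (intro geometric_sum_le) auto
      also have "\<dots> \<le> 3" using b1 by (simp add: divide_le_eq)
      finally show "(\<Sum>i\<le>n. b ^ i) \<le> 3" .
    qed (use C b in auto)
    finally show ?thesis by simp
  qed
  finally show ?thesis .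
qed

abbreviation spread :: "'b set \<Rightarrow> ('a \<times> 'b) set set \<Rightarrow> 'a \<Rightarrow> 'a \<Rightarrow> 'b set" where
  "spread S U s t \<equiv> {z \<in> verts G. \<exists>x\<in>S. conn U (s, x) (t, z)}"

text \<open>The same \<open>h\<close> and \<open>C\<close> serve every line and every
  \<open>S\<close>. The edge set may depend on \<open>S\<close>, but it lies in one block, which
  keeps successive rounds independent.\<close>

definition coasts :: "real \<Rightarrow> nat \<Rightarrow> real \<Rightarrow> real \<Rightarrow> bool" where
  "coasts p n h C \<longleftrightarrow> (\<forall>v S. line v \<longrightarrow> finite S \<longrightarrow> S \<subseteq> verts G \<longrightarrow> C \<le> real (card S) \<longrightarrow>
     (\<exists>F. finite F \<and> F \<subseteq> Bk v 0 (int n) \<and>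
       1 / 2 \<le> Pr p F (\<lambda>U. h * real (card S) \<le> real (card (spread S U (v 0) (v (int n)))))))"

lemma Bk_vertical_image:
  assumes \<psi>: "is_automorphism G \<psi>" and F: "F \<subseteq> Bk u i j"
  shows "(`) (map_prod (\<lambda>t. t) \<psi>) ` F \<subseteq> Bk u i j"
proof clarify
  fix e assume e: "e \<in> F"
  let ?f = "map_prod (\<lambda>t. t) \<psi>"
  have eB: "e \<in> edges H" "e \<subseteq> reg (L u j)" "\<not> e \<subseteq> reg (L u i)" using F e by (auto simp: Bk_def EE_def inner_def)
  have "?f ` e \<in> edges H"
    using H.automorphism_edges[OF box_automorphism[OF is_automorphism_id \<psi>], of "{e}"] eB by auto
  moreover have V: "e \<subseteq> verts H" using H.Union_edges[of "{e}"] eB(1) by auto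
  have "?f z \<in> reg S \<longleftrightarrow> z \<in> reg S" if "z \<in> e" for z S
    using V that G.automorphism_verts[OF \<psi>] by (cases z) (auto simp: reg_def)
  then have "(\<forall>z\<in>e. ?f z \<in> reg S) \<longleftrightarrow> (\<forall>z\<in>e. z \<in> reg S)" for S by (intro ball_cong refl)
  then have "?f ` e \<subseteq> reg S \<longleftrightarrow> e \<subseteq> reg S" for S unfolding image_subset_iff subset_eq[of e] .
  ultimately show "?f ` e \<in> Bk u i j" using eB by (auto simp: Bk_def EE_def inner_def)
qed

text \<open>\<open>N x\<close> counts the vertices reached from \<open>x\<close> through edges near
  them, and \<open>XX x\<close> the vertices of the cluster of \<open>x\<close> in the starting
  fibre. The sum over \<open>x\<close> of \<open>N x / XX x\<close> is at most the number of
  vertices reached, since starting points in one cluster share their weight. By Cauchy-Schwarz, the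
  mean of each quotient is at least the squared mean of \<open>N x\<close> divided by the mean of
  \<open>N x * XX x\<close>. As only edges of bounded extent are used, the number reached
  concentrates once \<open>S\<close> is large (\<open>local_dependence\<close>).\<close>

lemma coasting:
  assumes D0: "\<And>x y. x \<in> verts G \<Longrightarrow> y \<in> verts G \<Longrightarrow> \<exists>\<psi>. is_automorphism G \<psi> \<and> gd G x (\<psi> y) \<le> D0"
    and p: "0 < p" "p \<le> 1" and C: "1 \<le> C" "\<And>n. Bbd p n C" and n: "1 \<le> n" and nB: "\<not> Bbd p n (b ^ n)" and b: "0 < b"
    and C1: "1 \<le> C1" "\<And>n. Bbd p n (C1 * b' ^ n)" and b': "0 < b'" "b' ^ 3 \<le> 2 * \<delta> ^ 3"
  shows "\<exists>c. coasts p n ((p ^ (1 + D0) * (b ^ n / C\<^sup>2))\<^sup>2 / (12 * C1 ^ 3 * b' ^ n) / 2) c"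
proof -
  have p': "0 \<le> p" using p by simp
  note pp = p' p(2)
  obtain u where u: "line u" using line_ex by auto
  define e1 where "e1 = p ^ (1 + D0) * (b ^ n / C\<^sup>2)"
  define e2 where "e2 = 12 * C1 ^ 3 * b' ^ n"
  define g where "g = e1\<^sup>2 / e2"
  have e: "0 < e1" "0 < e2" "0 < g" unfolding g_def e1_def e2_def using p b C C1 b' by auto
  let ?n = "int n"
  have un: "u ?n \<noteq> u 0" using line_inj[OF u, of ?n 0] n by simp
  obtain X where X: "finite X" "X \<subseteq> verts G" "\<forall>x\<in>verts G. \<exists>x0\<in>X. \<exists>\<psi>. is_automorphism G \<psi> \<and> \<psi> x0 = x"
    using representatives by auto
  \<comment> \<open>Edge sets are chosen for orbit representatives only and moved by automorphisms
    of \<open>G\<close>; this gives one radius \<rho> for all vertices.\<close>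
  have "\<forall>x\<in>X. \<exists>F. finite F \<and> F \<subseteq> Bk u 0 ?n \<and> e1 \<le> rs p F (u 0, x) (fib (u ?n))"
    unfolding e1_def using block_mean[OF D0 pp C n nB u] X(2) by blast
  from bchoice[OF this] obtain F0 where F0: "\<And>x. x \<in> X \<Longrightarrow> finite (F0 x) \<and> F0 x \<subseteq> Bk u 0 ?n \<and> e1 \<le> rs p (F0 x) (u 0, x) (fib (u ?n))"
    by blast
  let ?VV = "\<Union>x\<in>X. \<Union>(F0 x)"
  have F0H: "F0 x \<subseteq> edges H" if "x \<in> X" for x using F0[OF that] Bk_edges by blast
  have VV: "finite ?VV"
    using X(1) F0 H.fin_edges[OF _ F0H] by (intro finite_UN_I) (auto simp: fin_edges_def)
  define A where "A = fst ` ?VV"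
  define \<rho> where "\<rho> = Max (insert 0 ((\<lambda>(x, z). gd G x (snd z)) ` (X \<times> ?VV)))"
  have A: "finite A" using VV by (simp add: A_def)
  have \<rho>: "gd G x (snd z) \<le> \<rho>" if "x \<in> X" "z \<in> ?VV" for x z
    unfolding \<rho>_def using X(1) VV that by (intro Max_ge) (auto intro!: image_eqI[of _ _ "(x, z)"])
  have loc: "\<exists>F. finite F \<and> F \<subseteq> Bk u 0 ?n \<and> (\<forall>e\<in>F. e \<subseteq> A \<times> G.cball x \<rho>) \<and> e1 \<le> rs p F (u 0, x) (fib (u ?n))"
    if x: "x \<in> verts G" for x
  proof -
    obtain x0 \<psi> where 1: "x0 \<in> X" "is_automorphism G \<psi>" "\<psi> x0 = x" using X(3) x by blast
    let ?f = "map_prod (\<lambda>t. t) \<psi>"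
    let ?F = "(`) ?f ` F0 x0"
    have fin: "finite (F0 x0)" "F0 x0 \<subseteq> Bk u 0 ?n" "e1 \<le> rs p (F0 x0) (u 0, x0) (fib (u ?n))" using F0[OF 1(1)] by auto
    have x0: "x0 \<in> verts G" using 1(1) X(2) by auto
    have "rs p ?F (?f (u 0, x0)) (?f ` fib (u ?n)) = rs p (F0 x0) (u 0, x0) (fib (u ?n))"
      using x0 u by (intro H.automorphism_rs[OF box_automorphism[OF is_automorphism_id 1(2)] fin(1) F0H[OF 1(1)]]) (auto simp: fib_def)
    then have "rs p ?F (u 0, x) (fib (u ?n)) = rs p (F0 x0) (u 0, x0) (fib (u ?n))"
      using fib_image[OF 1(2), of "\<lambda>t. t" "u ?n"] 1(3) by simp
    moreover have "e \<subseteq> A \<times> G.cball x \<rho>" if "e \<in> ?F" for e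
    proof
      fix y assume "y \<in> e"
      then obtain e0 z where z: "e0 \<in> F0 x0" "z \<in> e0" "y = ?f z" using \<open>e \<in> ?F\<close> by auto
      have zV: "z \<in> ?VV" using z 1(1) by auto
      have "z \<in> verts H" using H.Union_edges[OF F0H[OF 1(1)]] z(1,2) by blast
      then have zG: "snd z \<in> verts G" by (cases z) auto
      have "gd G x (\<psi> (snd z)) = gd G x0 (snd z)" using G.automorphism_gd[OF 1(2) x0 zG] 1(3) by simp
      also have "\<dots> \<le> \<rho>" by (rule \<rho>[OF 1(1) zV])
      finally have "\<psi> (snd z) \<in> G.cball x \<rho>" using G.automorphism_verts[OF 1(2) zG] by (simp add: G.cball_def)
      moreover have "fst z \<in> A" using zV by (simp add: A_def)
      ultimately show "y \<in> A \<times> G.cball x \<rho>" unfolding z(3) by (cases z) auto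
    qed
    ultimately show ?thesis
      using fin Bk_vertical_image[OF 1(2) fin(2)] by (intro exI[of _ ?F]) auto
  qed
  obtain V where V: "\<And>x. x \<in> verts G \<Longrightarrow> card (G.cball x (4 * \<rho>)) \<le> V" using card_cball_le[of "4 * \<rho>"] by blast
  \<comment> \<open>Large enough for the mean to reach \<open>8 * V\<close>, as
    \<open>local_dependence\<close> demands; dependency sets can intersect only for targets within
    \<open>4 * \<rho>\<close> of each other.\<close>
  define c where "c = max 1 (8 * real V / g)"
  \<comment> \<open>The radius \<open>2 * \<rho>\<close> lets \<open>M z\<close> contain the edge
    set chosen for any starting point within \<rho> of \<open>z\<close>.\<close>
  define M where "M z = {e \<in> Bk u 0 ?n. e \<subseteq> A \<times> G.cball z (2 * \<rho>)}" for z
  have Mfin: "finite (M z)" if "z \<in> verts G" for z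
  proof (rule finite_subset[of _ "Pow (A \<times> G.cball z (2 * \<rho>))"])
    show "finite (Pow (A \<times> G.cball z (2 * \<rho>)))" using A G.finite_cball[OF G.lf that] by auto
  qed (auto simp: M_def)
  have coast_u: "\<exists>F. finite F \<and> F \<subseteq> Bk u 0 ?n \<and>
       1 / 2 \<le> Pr p F (\<lambda>U. g / 2 * real (card S) \<le> real (card (spread S U (u 0) (u ?n))))"
    if S: "finite S" "S \<subseteq> verts G" "c \<le> real (card S)" for S
  proof -
    define Z where "Z = (\<Union>x\<in>S. G.cball x \<rho>)"
    have Z: "finite Z" "Z \<subseteq> verts G"
      unfolding Z_def using S G.finite_cball[OF G.lf] by (auto simp: G.cball_def)
    define F where "F = (\<Union>z\<in>Z. M z)"
    have F: "finite F" "F \<subseteq> Bk u 0 ?n" unfolding F_def using Z Mfin by (auto simp: M_def)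
    have FH: "F \<subseteq> edges H" using F(2) Bk_edges by (rule order_trans)
    have fe: "fin_edges F" by (rule H.fin_edges[OF F(1) FH])
    have MF: "M z \<subseteq> F" if "z \<in> Z" for z using that by (auto simp: F_def)
    let ?c = "\<lambda>U x z. conn (U \<inter> M z) (u 0, x) (u ?n, z)"
    define I where "I z W \<longleftrightarrow> (\<exists>x\<in>S. conn W (u 0, x) (u ?n, z))" for z W
    define Y where "Y = (\<lambda>U. \<Sum>z\<in>Z. of_bool (I z (U \<inter> M z)) :: real)"
    define N where "N x U = (\<Sum>z\<in>Z. of_bool (?c U x z) :: real)" for x U
    define XX where "XX x U = cnt U (u 0, x) (fib (u 0))" for x U
    have reach_fin: "finite {y. conn U (u 0, x) y}" if "U \<subseteq> F" for U x
    proof -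
      have "{y. conn U (u 0, x) y} \<subseteq> insert (u 0, x) (\<Union>F)" using conn_verts[of U "(u 0, x)"] that by blast
      then show ?thesis using fe finite_subset by (auto simp: fin_edges_def)
    qed
    have XX1: "1 \<le> XX x U" if "x \<in> S" "U \<subseteq> F" for x U
    proof -
      have "{(u 0, x)} \<subseteq> {y \<in> fib (u 0). conn U (u 0, x) y}" using that(1) S(2) by (auto simp: fib_def)
      moreover have "finite {y \<in> fib (u 0). conn U (u 0, x) y}" using reach_fin[OF that(2)] by (rule finite_subset[rotated]) auto
      ultimately have "card {(u 0, x)} \<le> card {y \<in> fib (u 0). conn U (u 0, x) y}" by (intro card_mono)
      then show ?thesis by (simp add: XX_def cnt_def)
    qed
    have Yge: "(\<Sum>x\<in>S. N x U / XX x U) \<le> Y U" if U: "U \<subseteq> F" for U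
    proof -
      have "(\<Sum>x\<in>S. N x U / XX x U) = (\<Sum>z\<in>Z. \<Sum>x\<in>S. of_bool (?c U x z) / XX x U)"
        unfolding N_def sum_divide_distrib by (rule sum.swap)
      also have "\<dots> \<le> Y U"
        unfolding Y_def
      proof (rule sum_mono)
        fix z assume "z \<in> Z"
        let ?Sz = "{x \<in> S. ?c U x z}"
        have Sz: "finite ?Sz" using S by auto
        \<comment> \<open>All starting points joined to \<open>z\<close> lie in one cluster, so each
          of them has \<open>XX x \<ge> card ?Sz\<close>, and their weights at \<open>z\<close> add
          up to at most 1.\<close>
        have big: "real (card ?Sz) \<le> XX x U" if x: "x \<in> ?Sz" for x
        proof -
          have "Pair (u 0) ` ?Sz \<subseteq> {y \<in> fib (u 0). conn U (u 0, x) y}"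
          proof clarify
            fix x' assume x': "x' \<in> S" "?c U x' z"
            have "conn U (u 0, x) (u ?n, z)" "conn U (u 0, x') (u ?n, z)"
              using x x' by (auto intro: conn_mono)
            then have "conn U (u 0, x) (u 0, x')" using conn_sym[of U "(u 0, x')"] conn_trans[of U] by blast
            then show "(u 0, x') \<in> fib (u 0) \<and> conn U (u 0, x) (u 0, x')" using x' S(2) by (auto simp: fib_def)
          qed
          moreover have "finite {y \<in> fib (u 0). conn U (u 0, x) y}" using reach_fin[OF U] by (rule finite_subset[rotated]) auto
          ultimately have "card (Pair (u 0) ` ?Sz) \<le> card {y \<in> fib (u 0). conn U (u 0, x) y}" by (intro card_mono)
          moreover have "card (Pair (u 0) ` ?Sz) = card ?Sz" by (intro card_image) (auto simp: inj_on_def)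
          ultimately show ?thesis by (simp add: XX_def cnt_def)
        qed
        have "(\<Sum>x\<in>S. of_bool (?c U x z) / XX x U) = (\<Sum>x\<in>?Sz. 1 / XX x U)"
          using S(1) by (intro sum.mono_neutral_cong_right) auto
        also have "\<dots> \<le> (\<Sum>x\<in>?Sz. 1 / real (card ?Sz))"
        proof (rule sum_mono)
          fix x assume x: "x \<in> ?Sz"
          then have "0 < card ?Sz" using Sz by (auto simp: card_gt_0_iff)
          then show "1 / XX x U \<le> 1 / real (card ?Sz)" using big[OF x] by (intro divide_left_mono) auto
        qed
        also have "\<dots> = of_bool (?Sz \<noteq> {})"
        proof (cases "?Sz = {}")
          case True
          then show ?thesis by (simp only: sum.empty) simp
        next
          case False
          then have "0 < card ?Sz" using Sz by (simp only: card_gt_0_iff) simp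
          then have "(\<Sum>x\<in>?Sz. 1 / real (card ?Sz)) = 1" by simp
          then show ?thesis using False by (simp only: of_bool_eq simp_thms)
        qed
        also have "\<dots> \<le> of_bool (I z (U \<inter> M z))" unfolding I_def by auto
        finally show "(\<Sum>x\<in>S. of_bool (?c U x z) / XX x U) \<le> of_bool (I z (U \<inter> M z))" .
      qed
      finally show ?thesis .
    qed
    have EN: "e1 \<le> Exp p F (N x)" if x: "x \<in> S" for x
    proof -
      have xG: "x \<in> verts G" using x S by auto
      obtain Fx where Fx: "finite Fx" "Fx \<subseteq> Bk u 0 ?n" "\<forall>e\<in>Fx. e \<subseteq> A \<times> G.cball x \<rho>" "e1 \<le> rs p Fx (u 0, x) (fib (u ?n))"
        using loc[OF xG] by auto
      let ?Y = "fib (u ?n) \<inter> insert (u 0, x) (\<Union>Fx)"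
      have Yx: "snd y \<in> G.cball x \<rho>" "fst y = u ?n" if "y \<in> ?Y" for y
      proof -
        show fy: "fst y = u ?n" using that by (auto simp: fib_def)
        have "y \<noteq> (u 0, x)" using fy un by auto
        then have "y \<in> \<Union>Fx" using that by blast
        then obtain e where "e \<in> Fx" "y \<in> e" by blast
        then have "y \<in> A \<times> G.cball x \<rho>" using Fx(3) by blast
        then show "snd y \<in> G.cball x \<rho>" by auto
      qed
      have FxM: "Fx \<subseteq> M z" if z: "z \<in> G.cball x \<rho>" for z
      proof
        fix e assume e: "e \<in> Fx"
        have "G.cball x \<rho> \<subseteq> G.cball z (2 * \<rho>)"
        proof
          fix w assume w: "w \<in> G.cball x \<rho>"
          then have "gd G z w \<le> gd G z x + gd G x w" using z xG by (intro G.gd_triangle) (auto simp: G.cball_def)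
          then show "w \<in> G.cball z (2 * \<rho>)" using w z by (auto simp: G.cball_def G.gd_sym)
        qed
        then show "e \<in> M z" using e Fx(2,3) by (auto simp: M_def)
      qed
      have "e1 \<le> (\<Sum>y\<in>?Y. tau p Fx (u 0, x) y)" using Fx(4) by (simp add: rs_def)
      also have "\<dots> \<le> (\<Sum>y\<in>?Y. tau p (M (snd y)) (u 0, x) (u ?n, snd y))"
      proof (rule sum_mono)
        fix y assume y: "y \<in> ?Y"
        have yy: "(u ?n, snd y) = y" using Yx(2)[OF y] by (cases y) auto
        show "tau p Fx (u 0, x) y \<le> tau p (M (snd y)) (u 0, x) (u ?n, snd y)"
          unfolding yy using Yx(1)[OF y] FxM pp by (intro tau_mono Mfin) (auto simp: G.cball_def)
      qed
      also have "\<dots> = (\<Sum>z\<in>snd ` ?Y. tau p (M z) (u 0, x) (u ?n, z))"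
      proof (subst sum.reindex)
        show "inj_on snd ?Y"
        proof (intro inj_onI prod_eqI)
          fix y y' assume "y \<in> ?Y" "y' \<in> ?Y"
          then show "fst y = fst y'" using Yx(2)[of y] Yx(2)[of y'] by simp
        qed
      qed (simp add: comp_def)
      also have "\<dots> \<le> (\<Sum>z\<in>Z. tau p (M z) (u 0, x) (u ?n, z))"
        using Z(1) Yx(1) x pp by (intro sum_mono2) (auto simp: Z_def)
      also have "\<dots> = (\<Sum>z\<in>Z. Pr p F (\<lambda>U. ?c U x z))"
      proof (rule sum.cong[OF refl])
        fix z assume "z \<in> Z"
        then have "F \<inter> M z = M z" using MF by blast
        then show "tau p (M z) (u 0, x) (u ?n, z) = Pr p F (\<lambda>U. ?c U x z)"
          using Pr_conn_Int[OF F(1), of p "M z" "(u 0, x)" "(u ?n, z)"] by simp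
      qed
      also have "\<dots> = Exp p F (N x)" unfolding N_def Pr_def by (simp only: Exp_sum)
      finally show ?thesis .
    qed
    have ENX: "Exp p F (\<lambda>U. N x U * XX x U) \<le> e2" if x: "x \<in> S" for x
    proof -
      have xG: "x \<in> verts G" using x S by auto
      have "N x U \<le> cnt U (u 0, x) (fib (u ?n))" if U: "U \<subseteq> F" for U
      proof -
        have "N x U = real (card {z \<in> Z. ?c U x z})" unfolding N_def using Z(1) by (rule sum_of_bool_card)
        also have "card {z \<in> Z. ?c U x z} = card (Pair (u ?n) ` {z \<in> Z. ?c U x z})"
          by (intro card_image[symmetric]) (auto simp: inj_on_def)
        also have "\<dots> \<le> card {y \<in> fib (u ?n). conn U (u 0, x) y}"
        proof (intro card_mono)
          show "finite {y \<in> fib (u ?n). conn U (u 0, x) y}" using reach_fin[OF U] by (rule finite_subset[rotated]) auto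
          show "Pair (u ?n) ` {z \<in> Z. ?c U x z} \<subseteq> {y \<in> fib (u ?n). conn U (u 0, x) y}"
            using Z(2) by (auto simp: fib_def intro: conn_mono)
        qed
        finally show ?thesis by (simp add: cnt_def)
      qed
      then have "Exp p F (\<lambda>U. N x U * XX x U) \<le> Exp p F (\<lambda>U. cnt U (u 0, x) (fib (u ?n)) * cnt U (u 0, x) (fib (u 0)))"
        unfolding XX_def by (intro Exp_mono[OF pp] mult_right_mono) (auto simp: cnt_def)
      also have "\<dots> \<le> e2" unfolding e2_def by (rule mixed_moment_bound[OF pp C1 b' u xG F(1) FH])
      finally show ?thesis .
    qed
    have quot: "g \<le> Exp p F (\<lambda>U. N x U / XX x U)" if x: "x \<in> S" for x
    proof -
      \<comment> \<open>Cauchy-Schwarz in tangent form: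
        \<open>1 / X \<ge> 2 * l - l\<^sup>2 * X\<close> for \<open>X > 0\<close> and every
        \<open>l\<close>. The choice \<open>e1 / e2\<close> is optimal for the two bounds at
        hand.\<close>
      let ?l = "e1 / e2"
      have N0: "0 \<le> N x U" for U unfolding N_def by (intro sum_nonneg) auto
      have l: "0 < ?l" using e by simp
      have "g = 2 * ?l * e1 - ?l\<^sup>2 * e2" unfolding g_def using e by (simp add: power2_eq_square field_simps)
      also have "\<dots> \<le> 2 * ?l * Exp p F (N x) - ?l\<^sup>2 * Exp p F (\<lambda>U. N x U * XX x U)"
        using EN[OF x] ENX[OF x] l by (intro diff_mono mult_left_mono) auto
      also have "\<dots> = Exp p F (\<lambda>U. 2 * ?l * N x U - ?l\<^sup>2 * (N x U * XX x U))" by (simp only: Exp_diff Exp_cmult)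
      also have "\<dots> \<le> Exp p F (\<lambda>U. N x U / XX x U)"
      proof (rule Exp_mono[OF pp])
        fix U assume U: "U \<subseteq> F"
        have X1: "1 \<le> XX x U" by (rule XX1[OF x U])
        have "0 \<le> (1 - ?l * XX x U)\<^sup>2" by simp
        then have "2 * ?l * XX x U - ?l\<^sup>2 * (XX x U * XX x U) \<le> 1"
          by (simp add: power2_eq_square algebra_simps)
        then have "(2 * ?l * XX x U - ?l\<^sup>2 * (XX x U * XX x U)) / XX x U \<le> 1 / XX x U"
          using X1 by (intro divide_right_mono) auto
        then have "2 * ?l - ?l\<^sup>2 * XX x U \<le> 1 / XX x U" using X1 by (simp add: diff_divide_distrib)
        then have "N x U * (2 * ?l - ?l\<^sup>2 * XX x U) \<le> N x U * (1 / XX x U)" using N0 by (rule mult_left_mono)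
        then show "2 * ?l * N x U - ?l\<^sup>2 * (N x U * XX x U) \<le> N x U / XX x U" by (simp add: algebra_simps)
      qed
      finally show ?thesis .
    qed
    have EY: "g * real (card S) \<le> Exp p F Y"
    proof -
      have "g * real (card S) = (\<Sum>x\<in>S. g)" by simp
      also have "\<dots> \<le> (\<Sum>x\<in>S. Exp p F (\<lambda>U. N x U / XX x U))" by (intro sum_mono quot)
      also have "\<dots> = Exp p F (\<lambda>U. \<Sum>x\<in>S. N x U / XX x U)" by (simp only: Exp_sum)
      also have "\<dots> \<le> Exp p F Y" by (intro Exp_mono[OF pp] Yge)
      finally show ?thesis .
    qed
    have cS: "1 \<le> real (card S)" "8 * real V / g \<le> real (card S)" using S(3) by (auto simp: c_def)
    have "8 * real V \<le> g * real (card S)" using cS(2) e by (simp add: field_simps)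
    moreover have "0 < g * real (card S)" using e cS(1) by simp
    ultimately have EY': "8 * real V \<le> Exp p F Y" "0 < Exp p F Y" using EY by auto
    have "1 / 2 \<le> Pr p F (\<lambda>U. Exp p F Y / 2 \<le> Y U)"
      unfolding Y_def
    proof (rule local_dependence[OF F(1) pp Z(1) MF])
      fix z assume z: "z \<in> Z"
      have zG: "z \<in> verts G" using z Z by auto
      have "{z' \<in> Z. M z \<inter> M z' \<noteq> {}} \<subseteq> G.cball z (4 * \<rho>)"
      proof
        fix z' assume "z' \<in> {z' \<in> Z. M z \<inter> M z' \<noteq> {}}"
        then obtain e where h: "z' \<in> Z" "e \<in> M z" "e \<in> M z'" by blast
        have "e \<in> edges H" using h(2) Bk_edges[of u 0 ?n] unfolding M_def by blast
        then obtain a b where "e = {a, b}" by (auto elim: H.edgeE)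
        then have "snd a \<in> G.cball z (2 * \<rho>)" "snd a \<in> G.cball z' (2 * \<rho>)" using h by (auto simp: M_def)
        moreover have "z' \<in> verts G" using h Z by auto
        ultimately show "z' \<in> G.cball z (4 * \<rho>)"
          using G.gd_triangle[of z "snd a" z'] zG by (auto simp: G.cball_def G.gd_sym[of "snd a" z'])
      qed
      then have "card {z' \<in> Z. M z \<inter> M z' \<noteq> {}} \<le> card (G.cball z (4 * \<rho>))"
        by (intro card_mono G.finite_cball[OF G.lf zG])
      also have "\<dots> \<le> V" by (rule V[OF zG])
      finally show "card {z' \<in> Z. M z \<inter> M z' \<noteq> {}} \<le> V" .
    qed (use EY' in \<open>simp_all only: Y_def\<close>)
    also have "\<dots> \<le> Pr p F (\<lambda>U. g / 2 * real (card S) \<le> real (card (spread S U (u 0) (u ?n))))"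
    proof (rule Pr_mono[OF pp])
      fix U assume U: "U \<subseteq> F" and h: "Exp p F Y / 2 \<le> Y U"
      have "g / 2 * real (card S) \<le> Y U" using EY h by simp
      also have "Y U = real (card {z \<in> Z. I z (U \<inter> M z)})" unfolding Y_def using Z(1) by (rule sum_of_bool_card)
      also have "\<dots> \<le> real (card (spread S U (u 0) (u ?n)))"
      proof (intro of_nat_mono card_mono)
        have "spread S U (u 0) (u ?n) \<subseteq> snd ` (\<Union>x\<in>S. {y. conn U (u 0, x) y})" by force
        then show "finite (spread S U (u 0) (u ?n))"
          using reach_fin[OF U] S(1) by (meson finite_UN_I finite_imageI finite_subset)
        show "{z \<in> Z. I z (U \<inter> M z)} \<subseteq> spread S U (u 0) (u ?n)"
          using Z(2) unfolding I_def by (auto intro: conn_mono)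
      qed
      finally show "g / 2 * real (card S) \<le> real (card (spread S U (u 0) (u ?n)))" .
    qed
    finally show ?thesis using F by blast
  qed
  have "coasts p n (g / 2) c"
    unfolding coasts_def
  proof (intro allI impI)
    fix v S assume v: "line v" and S: "finite S" "S \<subseteq> verts G" "c \<le> real (card S)"
    let ?ev = "\<lambda>w U. g / 2 * real (card S) \<le> real (card (spread S U (w 0) (w ?n)))"
    obtain F where F: "finite F" "F \<subseteq> Bk u 0 ?n"
      "1 / 2 \<le> Pr p F (?ev u)"
      using coast_u[OF S] by auto
    from transport[OF u v is_automorphism_id]
    obtain f where f0: "is_automorphism H f" "\<forall>i x. f (u i, x) = (v i, x)"
        "\<forall>F i j. F \<subseteq> Bk u i j \<longrightarrow> (`) f ` F \<subseteq> Bk v i j"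
      by (elim exE conjE) (rule that)
    note f = f0(1) f0(2-3)[rule_format]
    have FH: "F \<subseteq> edges H" using F(2) Bk_edges by (rule order_trans)
    have inj: "inj_on f (verts H)" by (rule H.automorphism_inj[OF f(1)])
    have "Pr p ((`) f ` F) (?ev v)
       = Pr p F (\<lambda>U. ?ev v ((`) f ` U))"
      by (intro Pr_image F(1) inj_image_edges[OF inj H.Union_edges[OF FH]])
    also have "\<dots> = Pr p F (?ev u)"
    proof (rule Pr_cong)
      fix U assume "U \<subseteq> F"
      then have UV: "\<Union>U \<subseteq> verts H" using H.Union_edges[of U] FH by blast
      have "conn ((`) f ` U) (v 0, x) (v ?n, z) \<longleftrightarrow> conn U (u 0, x) (u ?n, z)" if "x \<in> S" "z \<in> verts G" for x z
        using conn_inj[OF inj UV, of "(u 0, x)" "(u ?n, z)"] that S(2) u f(2) by auto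
      then have "spread S ((`) f ` U) (v 0) (v ?n) = spread S U (u 0) (u ?n)"
        by auto
      then show "(?ev v ((`) f ` U))
        = (?ev u U)" by simp
    qed
    finally show "\<exists>F. finite F \<and> F \<subseteq> Bk v 0 ?n \<and>
       1 / 2 \<le> Pr p F (?ev v)"
      using F f(3)[OF F(2)] by (intro exI[of _ "(`) f ` F"]) auto
  qed
  then show ?thesis unfolding g_def e1_def e2_def by blast
qed

end

section \<open>From coasting to uniform moments\<close>

context tprod
begin

lemma card_conn_fib:
  assumes "t \<in> verts T"
  shows "card {z \<in> verts G. conn U x (t, z)} = card {y \<in> fib t. conn U x y}"
proof -
  have "{y \<in> fib t. conn U x y} = Pair t ` {z \<in> verts G. conn U x (t, z)}" by (auto simp: fib_def)
  then show ?thesis by (simp add: card_image inj_on_def)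
qed

lemma finite_targets:
  assumes "finite F" "F \<subseteq> edges H" "U \<subseteq> F" "finite S"
  shows "finite (spread S U s t)"
proof -
  have "spread S U s t \<subseteq> snd ` {y. \<exists>x\<in>Pair s ` S. conn U x y}" by force
  then show ?thesis
    using finite_reach_set[OF assms(1-3), of "Pair s ` S"] assms(4) by (meson finite_imageI finite_subset)
qed

lemma mono_Bex_hit: "mono (\<lambda>V. \<exists>z\<in>Q. hit V (f z) A)"
  unfolding hit_def by (intro monoI le_boolI) (blast intro: conn_mono)

text \<open>A successful round, of probability at least 1/2, shrinks the set by no more than the
  factor \<open>h\<close>. Starting from size \<open>C * (1 / h) ^ k\<close>, the set is still above
  the threshold \<open>C\<close> when each of the \<open>k\<close> rounds begins.\<close>

lemma coast_chain:
  assumes p: "0 \<le> p" "p \<le> 1" and co: "coasts p n h C" and h: "0 < h" "h \<le> 1" and C: "1 \<le> C"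
  shows "line v \<Longrightarrow> finite S \<Longrightarrow> S \<subseteq> verts G \<Longrightarrow> C * (1 / h) ^ k \<le> real (card S) \<Longrightarrow>
    \<exists>F. finite F \<and> F \<subseteq> Bk v 0 (int (k * n)) \<and>
      (1 / 2) ^ k \<le> Pr p F (\<lambda>U. \<exists>x\<in>S. hit U (v 0, x) (fib (v (int (k * n)))))"
proof (induction k arbitrary: v S)
  case 0
  then have "S \<noteq> {}" using C by auto
  then obtain x where "x \<in> S" by auto
  then have "hit {} (v 0, x) (fib (v 0))" using 0 by (auto simp: hit_def fib_def)
  then have "Pr p {} (\<lambda>U. \<exists>x\<in>S. hit U (v 0, x) (fib (v 0))) = 1" using \<open>x \<in> S\<close> by (auto simp: Pr_def)
  then show ?case by (intro exI[of _ "{}"]) simp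
next
  case (Suc k)
  have hk: "1 \<le> (1 / h) ^ j" for j using h by (intro one_le_power) simp
  have "C * 1 \<le> C * (1 / h) ^ Suc k" using hk[of "Suc k"] C by (intro mult_left_mono) auto
  then have cS: "C \<le> real (card S)" using Suc.prems(4) by simp
  let ?T = "\<lambda>U. spread S U (v 0) (v (int n))"
  obtain F1 where F1: "finite F1" "F1 \<subseteq> Bk v 0 (int n)" "1 / 2 \<le> Pr p F1 (\<lambda>U. h * real (card S) \<le> real (card (?T U)))"
    using co[unfolded coasts_def, rule_format, OF Suc.prems(1,2,3) cS] by (elim exE conjE) (rule that)
  have F1H: "F1 \<subseteq> edges H" using F1(2) Bk_edges by (rule order_trans)
  let ?w = "\<lambda>i. v (i + int n)"
  have w: "line ?w" by (rule line_shift[OF Suc.prems(1)])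
  let ?A = "\<lambda>U. h * real (card S) \<le> real (card (?T U))"
  let ?B = "\<lambda>Q V. \<exists>z\<in>Q. hit V (?w 0, z) (fib (?w (int (k * n))))"
  have ex: "\<exists>F2. finite F2 \<and> F2 \<subseteq> Bk ?w 0 (int (k * n)) \<and> (1 / 2) ^ k \<le> Pr p F2 (?B (?T U))"
    if U: "U \<subseteq> F1" "?A U" for U
  proof (rule Suc.IH[OF w])
    show "finite (?T U)" by (rule finite_targets[OF F1(1) F1H U(1) Suc.prems(2)])
    show "?T U \<subseteq> verts G" by auto
    have "C * (1 / h) ^ k = h * (C * (1 / h) ^ Suc k)" using h by simp
    also have "\<dots> \<le> h * real (card S)" using Suc.prems(4) h by (intro mult_left_mono) auto
    finally show "C * (1 / h) ^ k \<le> real (card (?T U))" using U(2) by simp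
  qed
  have "\<forall>U\<in>{U. U \<subseteq> F1 \<and> ?A U}. \<exists>F2. finite F2 \<and> F2 \<subseteq> Bk ?w 0 (int (k * n)) \<and> (1 / 2) ^ k \<le> Pr p F2 (?B (?T U))"
    using ex by blast
  from bchoice[OF this] obtain F2 where F2: "\<And>U. U \<subseteq> F1 \<Longrightarrow> ?A U \<Longrightarrow> finite (F2 U) \<and> F2 U \<subseteq> Bk ?w 0 (int (k * n))
      \<and> (1 / 2) ^ k \<le> Pr p (F2 U) (?B (?T U))" by blast
  let ?G = "\<Union>U\<in>{U. U \<subseteq> F1 \<and> ?A U}. F2 U"
  have fU: "finite {U. U \<subseteq> F1 \<and> ?A U}" by (rule finite_subset[of _ "Pow F1"]) (use F1(1) in auto)
  have fG: "finite ?G" using fU F2 by (intro finite_UN_I) auto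
  have kk: "int (k * n) + int n = int (Suc k * n)" by simp
  have "?G \<subseteq> Bk ?w 0 (int (k * n))" using F2 by blast
  then have GB: "?G \<subseteq> Bk v (int n) (int (Suc k * n))" unfolding Bk_shift kk by simp
  have dj: "F1 \<inter> ?G = {}" using F1(2) GB Bk_disjoint[of v 0 "int n" "int (Suc k * n)"] by blast
  have wk: "?w (int (k * n)) = v (int (Suc k * n))" by (simp only: kk)
  have "(1 / 2) ^ Suc k = 1 / 2 * (1 / 2) ^ k" by simp
  also have "\<dots> \<le> Pr p F1 ?A * (1 / 2) ^ k" using F1(3) by (intro mult_right_mono) auto
  also have "\<dots> \<le> Pr p (F1 \<union> ?G) (\<lambda>U. \<exists>x\<in>S. hit U (v 0, x) (fib (v (int (Suc k * n)))))"
  proof (rule hit_compose[OF F1(1) fG dj p, where B = "\<lambda>U. ?B (?T U)"])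
    fix U V assume "?B (?T U) V"
    then obtain z y x where z: "x \<in> S" "conn U (v 0, x) (v (int n), z)" "y \<in> fib (?w (int (k * n)))" "conn V (?w 0, z) y"
      by (auto simp: hit_def)
    have "conn (U \<union> V) (v 0, x) (v (int n), z)" using z(2) by (rule conn_mono) auto
    moreover have "conn (U \<union> V) (v (int n), z) y" using conn_mono[OF z(4), of "U \<union> V"] by simp
    ultimately have "conn (U \<union> V) (v 0, x) y" by (rule conn_trans)
    then show "\<exists>x\<in>S. hit (U \<union> V) (v 0, x) (fib (v (int (Suc k * n))))" using z(1,3) unfolding hit_def wk by blast
  next
    fix U assume U: "U \<subseteq> F1" "?A U"
    have "(1 / 2) ^ k \<le> Pr p (F2 U) (?B (?T U))" using F2[OF U] by auto
    also have "\<dots> \<le> Pr p ?G (?B (?T U))"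
    proof (rule Pr_mono_set[OF fG _ _ p])
      show "F2 U \<subseteq> ?G" using U by blast
      show "mono (?B (?T U))" by (rule mono_Bex_hit)
    qed
    finally show "(1 / 2) ^ k \<le> Pr p ?G (?B (?T U))" .
  qed simp
  finally have "(1 / 2) ^ Suc k \<le> Pr p (F1 \<union> ?G) (\<lambda>U. \<exists>x\<in>S. hit U (v 0, x) (fib (v (int (Suc k * n)))))" .
  moreover have "F1 \<union> ?G \<subseteq> Bk v 0 (int (Suc k * n))"
    using order_trans[OF F1(2) Bk_subset[OF Suc.prems(1), of 0 0 "int n" "int (Suc k * n)"]]
      order_trans[OF GB Bk_subset[OF Suc.prems(1), of 0 "int n" "int (Suc k * n)" "int (Suc k * n)"]]
    by (intro Un_least) auto
  ultimately show ?case using F1(1) fG by (intro exI[of _ "F1 \<union> ?G"]) auto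
qed

text \<open>If the count over \<open>u m\<close> is at least \<open>c\<close>, the cluster goes on
  to distance \<open>m + l\<close> with conditional probability at least \<open>q\<close>, through
  fresh edges; the joint event is a hit and obeys \<open>hit_bound\<close>. The strip sits in a
  block that starts at \<open>u (- 1)\<close>, so one vertical edge moves the start there: hence the
  exponents \<open>m + l + 1\<close> and \<open>3 + D0\<close>.\<close>

lemma tail_bound:
  assumes D0: "\<And>x y. x \<in> verts G \<Longrightarrow> y \<in> verts G \<Longrightarrow> \<exists>\<psi>. is_automorphism G \<psi> \<and> gd G x (\<psi> y) \<le> D0"
    and p: "sb p" and u: "line u" and x: "x \<in> verts G" and F: "finite F" "F \<subseteq> EE (L u (int m) - L u (- 1))"
    and q: "0 \<le> q" and chain: "\<And>S. finite S \<Longrightarrow> S \<subseteq> verts G \<Longrightarrow> c \<le> real (card S) \<Longrightarrow>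
      \<exists>F'. finite F' \<and> F' \<subseteq> Bk u (int m) (int (m + l)) \<and>
        q \<le> Pr p F' (\<lambda>U. \<exists>z\<in>S. hit U (u (int m), z) (fib (u (int (m + l)))))"
  shows "p ^ (3 + D0) * (Pr p F (\<lambda>U. c \<le> cnt U (u 0, x) (fib (u (int m)))) * q) \<le> \<beta> ^ (m + l + 1)"
proof -
  note pp = sbD(1,2)[OF p]
  let ?o = "(u 0, x)"
  have FH: "F \<subseteq> edges H" using F(2) EE_subset by (rule order_trans)
  let ?T = "\<lambda>U. {z \<in> verts G. \<exists>y\<in>{x}. conn U (u 0, y) (u (int m), z)}"
  let ?A = "\<lambda>U. c \<le> cnt U ?o (fib (u (int m)))"
  have cT: "cnt U ?o (fib (u (int m))) = real (card (?T U))" for U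
    using card_conn_fib[of "u (int m)" U ?o] u by (simp add: cnt_def)
  let ?B = "\<lambda>Q V. \<exists>z\<in>Q. hit V (u (int m), z) (fib (u (int (m + l))))"
  have ex: "\<exists>F2. finite F2 \<and> F2 \<subseteq> Bk u (int m) (int (m + l)) \<and> q \<le> Pr p F2 (?B (?T U))"
    if U: "U \<subseteq> F" "?A U" for U
    using U cT by (intro chain finite_targets[OF F(1) FH U(1)]) auto
  have "\<forall>U\<in>{U. U \<subseteq> F \<and> ?A U}. \<exists>F2. finite F2 \<and> F2 \<subseteq> Bk u (int m) (int (m + l)) \<and> q \<le> Pr p F2 (?B (?T U))"
    using ex by blast
  from bchoice[OF this] obtain F2 where F2: "\<And>U. U \<subseteq> F \<Longrightarrow> ?A U \<Longrightarrow> finite (F2 U) \<and> F2 U \<subseteq> Bk u (int m) (int (m + l))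
      \<and> q \<le> Pr p (F2 U) (?B (?T U))" by blast
  let ?G = "\<Union>U\<in>{U. U \<subseteq> F \<and> ?A U}. F2 U"
  have fU: "finite {U. U \<subseteq> F \<and> ?A U}" by (rule finite_subset[of _ "Pow F"]) (use F(1) in auto)
  have fG: "finite ?G" using fU F2 by (intro finite_UN_I) auto
  have GB: "?G \<subseteq> Bk u (int m) (int (m + l))" using F2 by blast
  have FB: "F \<subseteq> Bk u (- 1) (int m)" using F(2) strip_subset_Bk by (rule order_trans)
  have dj: "F \<inter> ?G = {}" using FB GB Bk_disjoint[of u "- 1" "int m" "int (m + l)"] by blast
  have 1: "Pr p F ?A * q \<le> Pr p (F \<union> ?G) (\<lambda>U. hit U ?o (fib (u (int (m + l)))))"
  proof (rule hit_compose[OF F(1) fG dj pp, where B = "\<lambda>U. ?B (?T U)"])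
    fix U V assume "?B (?T U) V"
    then obtain z y where z: "conn U ?o (u (int m), z)" "y \<in> fib (u (int (m + l)))" "conn V (u (int m), z) y"
      by (auto simp: hit_def)
    have "conn (U \<union> V) ?o (u (int m), z)" using z(1) by (rule conn_mono) auto
    moreover have "conn (U \<union> V) (u (int m), z) y" using z(3) by (rule conn_mono) auto
    ultimately have "conn (U \<union> V) ?o y" by (rule conn_trans)
    then show "hit (U \<union> V) ?o (fib (u (int (m + l))))" using z(2) unfolding hit_def by blast
  next
    fix U assume U: "U \<subseteq> F" "?A U"
    have "q \<le> Pr p (F2 U) (?B (?T U))" using F2[OF U] by auto
    also have "\<dots> \<le> Pr p ?G (?B (?T U))"
    proof (rule Pr_mono_set[OF fG _ _ pp])
      show "F2 U \<subseteq> ?G" using U by blast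
      show "mono (?B (?T U))" by (rule mono_Bex_hit)
    qed
    finally show "q \<le> Pr p ?G (?B (?T U))" .
  qed (rule q)
  let ?e = "{(u (- 1), x), (u (- 1 + 1), x)}"
  let ?F = "insert ?e (F \<union> ?G)"
  have eB: "?e \<in> Bk u (- 1) (int (m + l))" by (rule vertical_edge_Bk[OF u _ x]) simp
  have FF: "finite ?F" "?F \<subseteq> Bk u (- 1) (int (m + l))"
    using eB F(1) fG order_trans[OF FB Bk_subset[OF u, of "- 1" "- 1" "int m" "int (m + l)"]]
      order_trans[OF GB Bk_subset[OF u, of "- 1" "int m" "int (m + l)" "int (m + l)"]] by auto
  have "conn {?e} (u (- 1), x) (u (- 1 + 1), x)" by (rule conn_edge) simp
  then have 2: "p ^ 1 * Pr p (F \<union> ?G) (\<lambda>U. hit U ?o (fib (u (int (m + l)))))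
      \<le> Pr p ?F (\<lambda>U. hit U (u (- 1), x) (fib (u (int (m + l)))))"
    using FF(1) by (intro Pr_path_hit[OF _ pp, of _ "{?e}"]) auto
  let ?w = "\<lambda>i. u (i + - 1)"
  have ii: "int (m + l + 1) + - 1 = int (m + l)" by simp
  have B: "?F \<subseteq> Bk ?w 0 (int (m + l + 1))" unfolding Bk_shift ii using FF(2) by simp
  have "p ^ (2 + D0) * Pr p ?F (\<lambda>U. hit U (?w 0, x) (fib (?w (int (m + l + 1))))) \<le> \<beta> ^ (m + l + 1)"
    by (rule hit_bound[OF D0 p line_shift[OF u] _ x FF(1) B]) auto
  then have 3: "p ^ (2 + D0) * Pr p ?F (\<lambda>U. hit U (u (- 1), x) (fib (u (int (m + l))))) \<le> \<beta> ^ (m + l + 1)"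
    unfolding ii by simp
  have "p ^ (3 + D0) * (Pr p F ?A * q) = p ^ (2 + D0) * (p ^ 1 * (Pr p F ?A * q))" by (simp add: power_add numeral_3_eq_3 numeral_2_eq_2)
  also have "\<dots> \<le> p ^ (2 + D0) * (p ^ 1 * Pr p (F \<union> ?G) (\<lambda>U. hit U ?o (fib (u (int (m + l))))))"
    using 1 pp by (intro mult_left_mono) auto
  also have "\<dots> \<le> p ^ (2 + D0) * Pr p ?F (\<lambda>U. hit U (u (- 1), x) (fib (u (int (m + l)))))"
    using 2 pp by (intro mult_left_mono) auto
  also have "\<dots> \<le> \<beta> ^ (m + l + 1)" by (rule 3)
  finally show ?thesis .
qed

lemma pow_powr: "0 < c \<Longrightarrow> (c ^ j) powr a = (c powr a) ^ j" for c a :: real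
  by (simp add: powr_powr mult.commute flip: powr_realpow)

text \<open>The levels grow geometrically with ratio \<open>1 / h\<close>; a value \<open>y\<close>
  above \<open>C\<close> is charged to the highest level below it at the price of the next
  one.\<close>

lemma powr_level_sum:
  fixes y C h a :: real
  assumes "0 \<le> y" "y = 0 \<or> 1 \<le> y" "1 \<le> C" "0 < h" "h < 1" "0 < a" "y < C * (1 / h) ^ K"
  shows "y powr a \<le> C powr a * of_bool (1 \<le> y)
    + (\<Sum>k<K. (C * (1 / h) ^ Suc k) powr a * of_bool (C * (1 / h) ^ k \<le> y))"
proof -
  have s0: "0 \<le> (\<Sum>k<K. (C * (1 / h) ^ Suc k) powr a * of_bool (C * (1 / h) ^ k \<le> y))"
    by (intro sum_nonneg) auto
  consider "y = 0" | "1 \<le> y" "y < C" | "C \<le> y" using assms(2) by linarith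
  then show ?thesis
  proof cases
    case 1
    then show ?thesis using s0 by simp
  next
    case 2
    then have "y powr a \<le> C powr a" using assms by (intro powr_mono2) auto
    then show ?thesis using s0 2 by simp
  next
    case 3
    let ?P = "\<lambda>k. y < C * (1 / h) ^ k"
    define k where "k = (LEAST k. ?P k)"
    have k: "?P k" "k \<le> K" unfolding k_def using assms(7) by (auto intro: LeastI Least_le)
    have "k \<noteq> 0" using k(1) 3 by (cases k) auto
    then obtain j where j: "k = Suc j" by (cases k) auto
    have "\<not> ?P j" using not_less_Least[of j ?P] j k_def by simp
    then have cj: "C * (1 / h) ^ j \<le> y" by simp
    have "y powr a \<le> (C * (1 / h) ^ Suc j) powr a" using k(1) j assms by (intro powr_mono2) auto
    also have "\<dots> = (C * (1 / h) ^ Suc j) powr a * of_bool (C * (1 / h) ^ j \<le> y)" using cj by simp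
    also have "\<dots> \<le> (\<Sum>k<K. (C * (1 / h) ^ Suc k) powr a * of_bool (C * (1 / h) ^ k \<le> y))"
      using j k(2) by (intro member_le_sum) auto
    finally show ?thesis by (simp add: add_increasing)
  qed
qed

text \<open>With \<open>k\<close> rounds of coasting, the tail at level
  \<open>C * (1 / h) ^ k\<close> is at most \<open>2 ^ k * \<beta> ^ (k * n)\<close> times
  \<open>\<delta> ^ m / p00 ^ (3 + D0)\<close>. The assumption \<open>r\<close> makes the sum over
  the levels geometric with ratio at most 1/2. In the resulting constant \<open>p\<close> is
  represented only by its lower bound \<open>p00\<close>.\<close>

lemma moment_bound_coasts:
  assumes D0: "\<And>x y. x \<in> verts G \<Longrightarrow> y \<in> verts G \<Longrightarrow> \<exists>\<psi>. is_automorphism G \<psi> \<and> gd G x (\<psi> y) \<le> D0"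
    and p: "sb p" and p00: "0 < p00" "p00 \<le> p" and co: "coasts p n h C" and h: "0 < h" "h < 1" and C: "1 \<le> C"
    and a: "0 < a" and r: "2 * \<beta> ^ n * (1 / h) powr a \<le> 1 / 2"
  shows "moment_bound p a (C powr a / p00 ^ (3 + D0) * (1 + 2 * (1 / h) powr a))"
  unfolding moment_bound_def
proof (intro allI impI)
  fix u x m F assume u: "line u" and x: "x \<in> verts G" and F: "finite F" "F \<subseteq> EE (L u (int m) - L u (- 1))"
  note pp = sbD(1,2)[OF p]
  let ?Y = "\<lambda>U. cnt U (u 0, x) (fib (u (int m)))"
  let ?c0 = "p00 ^ (3 + D0)"
  have c0: "0 < ?c0" "?c0 \<le> p ^ (3 + D0)" using p00 by (auto intro: power_mono)
  have \<beta>1: "0 < \<beta>" "\<beta> \<le> 1" "\<beta> \<le> \<delta>"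
    using order.strict_trans1[OF \<beta>_bounds(1) \<delta>(3)] \<beta>_bounds(1,2) by (auto simp del: divide_le_eq_1)
  have FH: "F \<subseteq> edges H" using F(2) EE_subset by (rule order_trans)
  have fe: "fin_edges F" by (rule H.fin_edges[OF F(1) FH])
  have div: "P \<le> X / ?c0" if "p ^ (3 + D0) * P \<le> X" "0 \<le> P" for P X
  proof -
    have "?c0 * P \<le> p ^ (3 + D0) * P" using c0 that by (intro mult_right_mono) auto
    then show ?thesis using that c0 by (simp add: field_simps)
  qed
  have t1: "Pr p F (\<lambda>U. 1 \<le> ?Y U) \<le> \<delta> ^ m / ?c0"
  proof (rule div)
    have "p ^ (3 + D0) * (Pr p F (\<lambda>U. 1 \<le> ?Y U) * 1) \<le> \<beta> ^ (m + 0 + 1)"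
    proof (rule tail_bound[OF D0 p u x F])
      fix S assume S: "finite S" "S \<subseteq> verts G" "1 \<le> real (card S)"
      then obtain z where "z \<in> S" by fastforce
      then have "hit {} (u (int m), z) (fib (u (int m)))" using S by (auto simp: hit_def fib_def)
      then have "Pr p {} (\<lambda>U. \<exists>z\<in>S. hit U (u (int m), z) (fib (u (int m)))) = 1" using \<open>z \<in> S\<close> by (auto simp: Pr_def)
      then show "\<exists>F'. finite F' \<and> F' \<subseteq> Bk u (int m) (int (m + 0)) \<and>
          1 \<le> Pr p F' (\<lambda>U. \<exists>z\<in>S. hit U (u (int m), z) (fib (u (int (m + 0)))))"
        by (intro exI[of _ "{}"]) simp
    qed auto
    also have "\<dots> \<le> \<beta> ^ m" using \<beta>1 by (intro power_decreasing) auto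
    also have "\<dots> \<le> \<delta> ^ m" using \<beta>1 by (intro power_mono) auto
    finally show "p ^ (3 + D0) * Pr p F (\<lambda>U. 1 \<le> ?Y U) \<le> \<delta> ^ m" by simp
  qed (use pp in simp)
  have tk: "Pr p F (\<lambda>U. C * (1 / h) ^ k \<le> ?Y U) \<le> 2 ^ k * \<delta> ^ m * \<beta> ^ (k * n) / ?c0" for k
  proof (rule div)
    have "p ^ (3 + D0) * (Pr p F (\<lambda>U. C * (1 / h) ^ k \<le> ?Y U) * (1 / 2) ^ k) \<le> \<beta> ^ (m + k * n + 1)"
    proof (rule tail_bound[OF D0 p u x F])
      fix S assume S: "finite S" "S \<subseteq> verts G" "C * (1 / h) ^ k \<le> real (card S)"
      let ?v = "\<lambda>i. u (i + int m)"
      obtain F' where F': "finite F'" "F' \<subseteq> Bk ?v 0 (int (k * n))"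
          "(1 / 2) ^ k \<le> Pr p F' (\<lambda>U. \<exists>x\<in>S. hit U (?v 0, x) (fib (?v (int (k * n)))))"
        using coast_chain[OF pp co h(1) _ C line_shift[OF u] S] h(2) by auto
      have ii: "int (k * n) + int m = int (m + k * n)" by simp
      show "\<exists>F'. finite F' \<and> F' \<subseteq> Bk u (int m) (int (m + k * n)) \<and>
          (1 / 2) ^ k \<le> Pr p F' (\<lambda>U. \<exists>z\<in>S. hit U (u (int m), z) (fib (u (int (m + k * n)))))"
        using F' unfolding Bk_shift ii by auto
    qed auto
    also have "\<dots> \<le> \<beta> ^ (m + k * n)" using \<beta>1 by (intro power_decreasing) auto
    also have "\<dots> \<le> \<delta> ^ m * \<beta> ^ (k * n)"
      unfolding power_add using \<beta>1 by (intro mult_right_mono power_mono) auto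
    finally have "2 ^ k * (p ^ (3 + D0) * (Pr p F (\<lambda>U. C * (1 / h) ^ k \<le> ?Y U) * (1 / 2) ^ k)) \<le> 2 ^ k * (\<delta> ^ m * \<beta> ^ (k * n))"
      by (intro mult_left_mono) auto
    then show "p ^ (3 + D0) * Pr p F (\<lambda>U. C * (1 / h) ^ k \<le> ?Y U) \<le> 2 ^ k * \<delta> ^ m * \<beta> ^ (k * n)"
      by (simp add: power_one_over field_simps)
  qed (use pp in simp)
  \<comment> \<open>The count cannot exceed the number of vertices incident to \<open>F\<close>, so
    finitely many levels occur.\<close>
  obtain K where K: "real (card (insert (u 0, x) (\<Union>F))) < (1 / h) ^ K"
    using real_arch_pow[of "1 / h"] h by auto
  have YK: "?Y U < C * (1 / h) ^ K" if "U \<subseteq> F" for U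
  proof -
    have "{y \<in> fib (u (int m)). conn U (u 0, x) y} \<subseteq> insert (u 0, x) (\<Union>F)"
      using conn_verts[of U "(u 0, x)"] that by blast
    then have "?Y U \<le> real (card (insert (u 0, x) (\<Union>F)))"
      unfolding cnt_def using fe by (intro of_nat_mono card_mono) (auto simp: fin_edges_def)
    also have "\<dots> < 1 * (1 / h) ^ K" using K by simp
    also have "\<dots> \<le> C * (1 / h) ^ K" using C h by (intro mult_right_mono) auto
    finally show ?thesis .
  qed
  have "Exp p F (\<lambda>U. ?Y U powr a) \<le> Exp p F (\<lambda>U. C powr a * of_bool (1 \<le> ?Y U)
      + (\<Sum>k<K. (C * (1 / h) ^ Suc k) powr a * of_bool (C * (1 / h) ^ k \<le> ?Y U)))"
    using YK h C a by (intro Exp_mono[OF pp] powr_level_sum) (auto simp: cnt_def)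
  also have "\<dots> = C powr a * Pr p F (\<lambda>U. 1 \<le> ?Y U) + (\<Sum>k<K. (C * (1 / h) ^ Suc k) powr a * Pr p F (\<lambda>U. C * (1 / h) ^ k \<le> ?Y U))"
    by (simp only: Exp_add Exp_sum Exp_cmult Pr_def)
  also have "\<dots> \<le> C powr a * (\<delta> ^ m / ?c0) + (\<Sum>k<K. (C * (1 / h) ^ Suc k) powr a * (2 ^ k * \<delta> ^ m * \<beta> ^ (k * n) / ?c0))"
    by (intro add_mono mult_left_mono sum_mono t1 tk) auto
  also have "(\<Sum>k<K. (C * (1 / h) ^ Suc k) powr a * (2 ^ k * \<delta> ^ m * \<beta> ^ (k * n) / ?c0))
      = (C powr a * (\<delta> ^ m / ?c0) * (1 / h) powr a) * (\<Sum>k<K. (2 * \<beta> ^ n * (1 / h) powr a) ^ k)"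
    unfolding sum_distrib_left
  proof (intro sum.cong refl)
    fix k
    have "(C * (1 / h) ^ Suc k) powr a = C powr a * ((1 / h) powr a) ^ Suc k"
    proof -
      have "((1 / h) ^ Suc k) powr a = ((1 / h) powr a) ^ Suc k" using h by (intro pow_powr) simp
      then show ?thesis using C h by (subst powr_mult) auto
    qed
    moreover have "\<beta> ^ (k * n) = (\<beta> ^ n) ^ k" by (metis mult.commute power_mult)
    ultimately show "(C * (1 / h) ^ Suc k) powr a * (2 ^ k * \<delta> ^ m * \<beta> ^ (k * n) / ?c0)
      = (C powr a * (\<delta> ^ m / ?c0) * (1 / h) powr a) * (2 * \<beta> ^ n * (1 / h) powr a) ^ k"
      by (simp only: power_mult_distrib power_Suc) (simp add: mult_ac)
  qed
  also have "C powr a * (\<delta> ^ m / ?c0) + (C powr a * (\<delta> ^ m / ?c0) * (1 / h) powr a) * (\<Sum>k<K. (2 * \<beta> ^ n * (1 / h) powr a) ^ k)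
     \<le> C powr a * (\<delta> ^ m / ?c0) + (C powr a * (\<delta> ^ m / ?c0) * (1 / h) powr a) * 2"
  proof (intro add_left_mono mult_left_mono)
    have "(\<Sum>k<K. (2 * \<beta> ^ n * (1 / h) powr a) ^ k) \<le> 1 / (1 - 2 * \<beta> ^ n * (1 / h) powr a)"
      using r \<beta>1 by (intro geometric_sum_le) auto
    also have "\<dots> \<le> 2" using r by (simp add: divide_le_eq)
    finally show "(\<Sum>k<K. (2 * \<beta> ^ n * (1 / h) powr a) ^ k) \<le> 2" .
    show "0 \<le> C powr a * (\<delta> ^ m / ?c0) * (1 / h) powr a"
      using c0 \<delta>_pow(1)[of m] by (intro mult_nonneg_nonneg divide_nonneg_nonneg) auto
  qed
  finally show "Exp p F (\<lambda>U. ?Y U powr a) \<le> C powr a / ?c0 * (1 + 2 * (1 / h) powr a) * \<delta> ^ m"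
    by (simp add: algebra_simps add_divide_distrib)
qed

text \<open>Spreading to many vertices is an increasing event. Coasting established at one parameter
  therefore holds at all larger ones with the same \<open>h\<close> and threshold; uniformity in
  \<open>p\<close> originates here.\<close>

lemma coasts_mono:
  assumes "coasts p n h C" "0 \<le> p" "p \<le> q" "q \<le> 1" "C \<le> C'"
  shows "coasts q n h C'"
  unfolding coasts_def
proof (intro allI impI)
  fix v S assume v: "line v" and S: "finite S" "S \<subseteq> verts G" "C' \<le> real (card S)"
  let ?T = "\<lambda>U. spread S U (v 0) (v (int n))"
  \<comment> \<open>Expressed through finite subsets, the event is monotone on all configurations;
    \<open>card\<close> alone would drop to 0 on infinite sets.\<close>
  let ?E = "\<lambda>U. \<exists>Z. finite Z \<and> Z \<subseteq> ?T U \<and> h * real (card S) \<le> real (card Z)"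
  obtain F where F: "finite F" "F \<subseteq> Bk v 0 (int n)" "1 / 2 \<le> Pr p F (\<lambda>U. h * real (card S) \<le> real (card (?T U)))"
    using assms(1)[unfolded coasts_def] v S assms(5) by (meson order_trans)
  have FH: "F \<subseteq> edges H" using F(2) Bk_edges by (rule order_trans)
  have eq: "(h * real (card S) \<le> real (card (?T U))) \<longleftrightarrow> ?E U" if "U \<subseteq> F" for U
  proof -
    have fin: "finite (?T U)" by (rule finite_targets[OF F(1) FH that S(1)])
    have "real (card Z) \<le> real (card (?T U))" if "Z \<subseteq> ?T U" for Z using card_mono[OF fin that] by simp
    then show ?thesis using fin by (meson order_refl order_trans)
  qed
  have "mono ?E"
  proof (intro monoI le_boolI)
    fix U V assume UV: "U \<subseteq> V" "?E U"
    have "?T U \<subseteq> ?T V" using UV(1) by (auto intro: conn_mono)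
    then show "?E V" using UV(2) by (meson order_trans)
  qed
  have "1 / 2 \<le> Pr p F ?E" by (rule order_trans[OF F(3) eq_refl[OF Pr_cong[OF eq]]])
  also have "\<dots> \<le> Pr q F ?E" using F(1) \<open>mono ?E\<close> assms by (intro Pr_mono_p) auto
  also have "\<dots> = Pr q F (\<lambda>U. h * real (card S) \<le> real (card (?T U)))" by (rule Pr_cong[OF eq, symmetric])
  finally show "\<exists>F. finite F \<and> F \<subseteq> Bk v 0 (int n) \<and> 1 / 2 \<le> Pr q F (\<lambda>U. h * real (card S) \<le> real (card (?T U)))"
    using F by blast
qed

text \<open>Up to constants, means are at least \<open>w ^ n\<close> and mixed moments at most
  \<open>b' ^ n\<close>, with \<open>w < \<beta> < b'\<close>, so the coasting factor
  \<open>h n\<close> is of order \<open>t ^ n\<close> with \<open>t = w * w / b'\<close>. Both rates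
  are taken so close to \<beta> that \<open>\<beta> < t powr a\<close>, which is possible because
  \<open>a < 1\<close>. Then \<open>\<beta> ^ n * (1 / h n) powr a\<close> tends to 0, and a large
  \<open>n\<close> meets the condition of \<open>moment_bound_coasts\<close>.\<close>

lemma uniform_moment_bound:
  assumes a: "0 < a" "a < 1" and p00: "0 < p00" "sb p00"
  shows "\<exists>p0 K. sb p0 \<and> p00 \<le> p0 \<and> 0 \<le> K \<and> (\<forall>p. sb p \<longrightarrow> p0 \<le> p \<longrightarrow> moment_bound p a K)"
proof -
  obtain D0 where D0: "\<And>x y. x \<in> verts G \<Longrightarrow> y \<in> verts G \<Longrightarrow> \<exists>\<psi>. is_automorphism G \<psi> \<and> gd G x (\<psi> y) \<le> D0"
    using coarse_transitive by blast
  have \<beta>1: "0 < \<beta>" "\<beta> < 1" "\<beta> \<le> \<delta>"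
    using order.strict_trans1[OF \<beta>_bounds(1) \<delta>(3)] \<beta>_bounds(1,2) by auto
  \<comment> \<open>\<theta> has to satisfy \<open>\<theta> ^ 3 > \<beta> powr (1 / a - 1)\<close>,
    so that \<open>t = \<beta> * \<theta> ^ 3\<close> has \<open>\<beta> < t powr a\<close>, and
    \<open>\<theta> ^ 3 \<ge> 1 / 2\<close>, so that \<open>b' ^ 3 \<le> 2 * \<delta> ^ 3\<close>.
    Bernoulli's inequality provides an explicit choice.\<close>
  define M where "M = max (1 / 2) (\<beta> powr (1 / a - 1))"
  have "\<beta> powr (1 / a - 1) < 1 powr (1 / a - 1)" using \<beta>1 a by (intro powr_less_mono2) auto
  then have M: "1 / 2 \<le> M" "M < 1" "\<beta> powr (1 / a - 1) \<le> M" by (auto simp: M_def)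
  define \<theta> where "\<theta> = 1 - (1 - M) / 6"
  have \<theta>: "0 < \<theta>" "\<theta> < 1" using M by (auto simp: \<theta>_def)
  have "M < 1 + real 3 * (- ((1 - M) / 6))" using M by (simp add: field_simps)
  also have "\<dots> \<le> (1 + - ((1 - M) / 6)) ^ 3" using M by (intro Bernoulli_inequality) auto
  also have "\<dots> = \<theta> ^ 3" by (simp add: \<theta>_def)
  finally have \<theta>3: "M < \<theta> ^ 3" .
  define w where "w = \<beta> * \<theta>"
  define b' where "b' = \<beta> / \<theta>"
  have w: "0 < w" "w < \<beta>" using \<beta>1 \<theta> by (auto simp: w_def)
  have b': "0 < b'" "\<beta> < b'" using \<beta>1 \<theta> by (auto simp: b'_def field_simps)
  have "b' ^ 3 = \<beta> ^ 3 / \<theta> ^ 3" by (simp add: b'_def power_divide)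
  also have "\<dots> \<le> \<delta> ^ 3 / (1 / 2)" using \<beta>1 \<theta> \<theta>3 M by (intro frac_le power_mono) auto
  finally have b'3: "b' ^ 3 \<le> 2 * \<delta> ^ 3" by simp
  obtain p1 where p1: "sb p1" "\<forall>m\<ge>1. \<not> Bbd p1 m (w ^ m)" using below_\<beta>[OF w] by auto
  \<comment> \<open>Failure of the rate \<open>w\<close> passes from \<open>p1\<close> to larger
    subcritical parameters, so \<open>p1\<close> may be raised to \<open>p00\<close>.\<close>
  define p0 where "p0 = max p00 p1"
  have p0: "sb p0" "p00 \<le> p0" "p1 \<le> p0" "0 < p0" using p00 p1 by (auto simp: p0_def max_def)
  note pp0 = sbD(1,2)[OF p0(1)]
  have nB: "\<not> Bbd p0 m (w ^ m)" if "1 \<le> m" for m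
    using p1 that Bbd_mono_p[of p0 m "w ^ m" p1] sbD[OF p1(1)] p0 pp0 by auto
  obtain C where C: "1 \<le> C" "\<And>n. Bbd p0 n C" using Bbd_const[OF p0(1)] by auto
  obtain C1 where C1: "\<And>n. Bbd p0 n (C1 * b' ^ n)" using above_\<beta>[OF b'(2)] p0(1) unfolding good_def by blast
  have C11: "1 \<le> C1" using Bbd_lower[OF pp0 C1[of 0]] by simp
  define \<kappa> where "\<kappa> = (p0 ^ (1 + D0) / C\<^sup>2)\<^sup>2 / (24 * C1 ^ 3)"
  define t where "t = \<beta> * \<theta> ^ 3"
  define h where "h n = (p0 ^ (1 + D0) * (w ^ n / C\<^sup>2))\<^sup>2 / (12 * C1 ^ 3 * b' ^ n) / 2" for n
  have \<kappa>: "0 < \<kappa>" unfolding \<kappa>_def using p0(4) C C11 by simp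
  have \<kappa>1: "\<kappa> < 1"
  proof -
    have "p0 ^ (1 + D0) \<le> 1" using pp0 by (intro power_le_one)
    moreover have "1 \<le> C\<^sup>2" using C(1) by (intro one_le_power)
    ultimately have "p0 ^ (1 + D0) \<le> C\<^sup>2" by linarith
    then have "p0 ^ (1 + D0) / C\<^sup>2 \<le> C\<^sup>2 / C\<^sup>2" by (rule divide_right_mono) simp
    then have "p0 ^ (1 + D0) / C\<^sup>2 \<le> 1" using C(1) by simp
    then have "(p0 ^ (1 + D0) / C\<^sup>2)\<^sup>2 \<le> 1" using pp0 by (intro power_le_one) auto
    also have "1 < 24 * C1 ^ 3" using one_le_power[OF C11, of 3] by simp
    finally show ?thesis using C11 unfolding \<kappa>_def by (subst divide_less_eq_1_pos) auto
  qed
  have t: "0 < t" "t < 1" unfolding t_def using \<beta>1 \<theta> by (auto intro!: mult_less_le_imp_less[of \<beta> 1 "\<theta> ^ 3" 1, simplified] power_le_one)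
  have wt: "w * w / b' = t" unfolding w_def b'_def t_def using \<beta>1 \<theta> by (simp add: power3_eq_cube field_simps)
  have hn: "h n = \<kappa> * t ^ n" for n
  proof -
    have "h n = \<kappa> * (w ^ n * w ^ n / b' ^ n)"
      unfolding h_def \<kappa>_def using b' C C11 by (simp add: power2_eq_square field_simps)
    then show ?thesis by (simp add: wt[symmetric] power_divide power_mult_distrib)
  qed
  have hb: "0 < h n" "h n < 1" for n
  proof -
    show "0 < h n" unfolding hn using \<kappa> t by simp
    have "\<kappa> * t ^ n \<le> \<kappa> * 1" using \<kappa> t by (intro mult_left_mono power_le_one) auto
    then show "h n < 1" unfolding hn using \<kappa>1 by simp
  qed
  have "\<beta> powr (1 / a) = \<beta> * \<beta> powr (1 / a - 1)" using \<beta>1 by (simp add: powr_diff)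
  also have "\<dots> < t" unfolding t_def using \<beta>1 M \<theta>3 by (intro mult_strict_left_mono) auto
  finally have "(\<beta> powr (1 / a)) powr a < t powr a" using a by (intro powr_less_mono2) auto
  then have bt: "\<beta> < t powr a" using a \<beta>1 by (simp add: powr_powr)
  define q where "q = \<beta> / t powr a"
  have q: "0 < q" "q < 1" unfolding q_def using bt \<beta>1 t by auto
  obtain n where n: "q ^ n < min 1 (\<kappa> powr a / 4)" using real_arch_pow_inv[of "min 1 (\<kappa> powr a / 4)" q] q \<kappa> by auto
  have n1: "1 \<le> n" using n by (cases n) auto
  have hpow: "(1 / h n) powr a = 1 / (\<kappa> powr a * (t powr a) ^ n)"
  proof -
    have "(t ^ n) powr a = (t powr a) ^ n" using t by (simp add: powr_powr mult.commute flip: powr_realpow)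
    then show ?thesis unfolding hn using \<kappa> t by (simp add: powr_divide powr_mult)
  qed
  have "2 * \<beta> ^ n * (1 / h n) powr a = 2 * q ^ n / \<kappa> powr a"
    unfolding hpow q_def by (simp add: power_divide)
  also have "\<dots> \<le> 1 / 2" using n \<kappa> by (simp add: field_simps)
  finally have r: "2 * \<beta> ^ n * (1 / h n) powr a \<le> 1 / 2" .
  obtain c where c: "coasts p0 n (h n) c"
    using coasting[OF D0 p0(4) pp0(2) C n1 nB[OF n1] w(1) C11 C1 b'(1) b'3] unfolding h_def by auto
  let ?K = "(max 1 c) powr a / p00 ^ (3 + D0) * (1 + 2 * (1 / h n) powr a)"
  have K0: "0 \<le> ?K" using p00(1) by (intro mult_nonneg_nonneg divide_nonneg_nonneg) auto
  have "moment_bound p a ?K" if p: "sb p" "p0 \<le> p" for p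
    using p p0 sbD[OF p(1)] pp0
    by (intro moment_bound_coasts[OF D0 p(1) p00(1) _ coasts_mono[OF c]] hb a r) auto
  then show ?thesis using p0 K0 by blast
qed

text \<open>From \<open>p0\<close> on, \<open>DD_uniform\<close> and \<open>two_point_row\<close>
  apply with one constant; smaller parameters inherit the bound by monotonicity in
  \<open>p\<close>.\<close>

lemma uniform_decay:
  "\<exists>K\<ge>1. \<forall>p n. sb p \<longrightarrow> Bbd p n (K * \<delta> ^ n)"
proof -
  obtain p00 where p00: "0 < p00" "p00 < 1" "sub_at p00" using sub_at_small by auto
  then have s00: "sb p00" by (simp add: sb_def)
  define \<kappa> where "\<kappa> = 1 + ln (1 / p00) / (2 * ln (real d))"
  have lnp: "0 \<le> ln (1 / p00)" using p00 by (intro ln_ge_zero) simp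
  have lnd: "0 < ln (real d)" using d by simp
  have \<kappa>: "1 \<le> \<kappa>" unfolding \<kappa>_def using lnp lnd by simp
  \<comment> \<open>Makes \<open>4 * (1 - a) * \<kappa>\<close> equal to 1/2, the largest exponent
    that \<open>self_improving_bound\<close> tolerates.\<close>
  define a where "a = 1 - 1 / (8 * \<kappa>)"
  have "1 / (8 * \<kappa>) \<le> 1 / 8" using \<kappa> by (simp add: field_simps)
  then have a: "0 < a" "a < 1" unfolding a_def using \<kappa> by auto
  have ka: "4 * (1 - a) * (1 + ln (1 / p00) / (2 * ln (real d))) \<le> 1 / 2"
    unfolding \<kappa>_def[symmetric] a_def using \<kappa> by simp
  obtain p0 K where K: "sb p0" "p00 \<le> p0" "0 \<le> K" "\<And>p. sb p \<Longrightarrow> p0 \<le> p \<Longrightarrow> moment_bound p a K"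
    using uniform_moment_bound[OF a p00(1) s00] by blast
  obtain C where C: "\<And>p. p00 \<le> p \<Longrightarrow> p \<le> 1 \<Longrightarrow> sub_at p \<Longrightarrow> moment_bound p a K \<Longrightarrow> DD p \<le> C"
    using DD_uniform[OF p00(1) _ a ka K(3)] p00(2) by force
  have big: "Bbd p n (2 * C\<^sup>2 * \<delta> ^ n)" if p: "sb p" "p0 \<le> p" for p n
    unfolding Bbd_def
  proof (intro allI impI)
    fix s t x F assume h: "s \<in> verts T" "t \<in> verts T" "gd T s t = n" "x \<in> verts G" "finite F" "F \<subseteq> edges H"
    have "DD p \<le> C" using p K sbD[OF p(1)] by (intro C) auto
    moreover have "1 \<le> DD p" using DD_ge_1 sbD[OF p(1)] by auto
    ultimately have sq: "(DD p)\<^sup>2 \<le> C\<^sup>2" by (intro power_mono) auto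
    have "rs p F (s, x) (fib t) \<le> 2 * (DD p)\<^sup>2 * \<delta> ^ gd T s t"
      using h by (intro two_point_row sbD[OF p(1)]) auto
    also have "\<dots> \<le> 2 * C\<^sup>2 * \<delta> ^ n"
      unfolding h(3) using sq \<delta>_pow(1)[of n] by (intro mult_right_mono) auto
    finally show "rs p F (s, x) (fib t) \<le> 2 * C\<^sup>2 * \<delta> ^ n" .
  qed
  have all: "Bbd p n (2 * C\<^sup>2 * \<delta> ^ n)" if p: "sb p" for p n
  proof (cases "p0 \<le> p")
    case False
    then show ?thesis using Bbd_mono_p[OF big[OF K(1)], of p] sbD[OF p] sbD[OF K(1)] by auto
  qed (use big p in auto)
  have "1 \<le> 2 * C\<^sup>2" using Bbd_lower[OF sbD(1,2)[OF s00] all[OF s00, of 0]] by simp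
  then show ?thesis using all by blast
qed

section \<open>The susceptibility threshold and the decay at it\<close>

definition p_chi :: real where "p_chi = Sup {p. sb p}"

lemma p_chi: "0 < p_chi" "p_chi \<le> 1" "0 \<le> p \<Longrightarrow> p < p_chi \<Longrightarrow> sb p" "sb p \<Longrightarrow> p \<le> p_chi"
proof -
  obtain p00 where p00: "0 < p00" "p00 < 1" "sub_at p00" using sub_at_small by auto
  have bdd: "bdd_above {p. sb p}" by (rule bdd_aboveI[of _ 1]) (auto simp: sb_def)
  show up: "sb p \<Longrightarrow> p \<le> p_chi" for p unfolding p_chi_def using bdd by (intro cSup_upper) auto
  have ne: "p00 \<in> {p. sb p}" using p00 by (auto simp: sb_def)
  show "0 < p_chi" using up[of p00] p00 ne by auto
  show "p_chi \<le> 1" unfolding p_chi_def using ne by (intro cSup_least) (auto simp: sb_def)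
  show "sb p" if h: "0 \<le> p" "p < p_chi" for p
  proof -
    obtain q where q: "sb q" "p < q" using h ne unfolding p_chi_def by (metis (mono_tags, lifting) empty_iff less_cSupD mem_Collect_eq)
    then show ?thesis using sub_at_mono[of q p] h by (auto simp: sb_def)
  qed
qed

lemma isCont_rs: "finite F \<Longrightarrow> isCont (\<lambda>p. rs p F x A) p"
  unfolding rs_def tau_def Pr_def
  by (intro continuous_intros DERIV_isCont[OF Exp_derivative])

text \<open>For fixed \<open>F\<close> the fibre sum is a polynomial in \<open>p\<close>, so the
  bound passes to the limit from the left; it is uniform in \<open>F\<close> before and
  after.\<close>

lemma critical_decay:
  assumes K: "\<And>p n. sb p \<Longrightarrow> Bbd p n (K * \<delta> ^ n)"
  shows "Bbd p_chi n (K * \<delta> ^ n)"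
  unfolding Bbd_def
proof (intro allI impI)
  fix s t x F assume h: "s \<in> verts T" "t \<in> verts T" "gd T s t = n" "x \<in> verts G" "finite F" "F \<subseteq> edges H"
  have "((\<lambda>p. rs p F (s, x) (fib t)) \<longlongrightarrow> rs p_chi F (s, x) (fib t)) (at_left p_chi)"
    using isCont_rs[OF h(5), where x = "(s, x)" and A = "fib t" and p = p_chi] by (simp add: isCont_def filterlim_at_split)
  moreover have "\<forall>\<^sub>F p in at_left p_chi. rs p F (s, x) (fib t) \<le> K * \<delta> ^ n"
    unfolding eventually_at_left_field
    using p_chi h by (intro exI[of _ 0]) (auto intro!: BbdD[OF K])
  ultimately show "rs p_chi F (s, x) (fib t) \<le> K * \<delta> ^ n"
    by (intro tendsto_upperbound[of "\<lambda>p. rs p F (s, x) (fib t)" _ "at_left p_chi"]) auto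
qed

end

section \<open>Decay slightly above the threshold\<close>

context tprod
begin

abbreviation q :: real where "q \<equiv> 1 / sqrt (real d)"

lemma q: "0 < q" "q \<le> 3 / 4" "q < 1" "q * q = \<delta>"
proof -
  show "0 < q" using d by simp
  show qq: "q * q = \<delta>" using d by simp
  show "q \<le> 3 / 4"
  proof (rule ccontr)
    assume "\<not> q \<le> 3 / 4"
    then have "3 / 4 * (3 / 4) \<le> q * q" by (intro mult_mono) auto
    then show False using qq \<delta>(2) by simp
  qed
  then show "q < 1" by simp
qed

lemma q_sum: "finite J \<Longrightarrow> (\<Sum>j\<in>J. q ^ j) \<le> 4"
proof -
  assume J: "finite J"
  have "(\<Sum>j\<in>J. q ^ j) \<le> 1 / (1 - q)" using q J by (intro geometric_sum_le) auto
  also have "\<dots> \<le> 4" using q(2,3) by (simp add: divide_le_eq)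
  finally show ?thesis .
qed

text \<open>With \<open>\<delta> = q * q\<close> and \<open>n\<close> the distance from
  \<open>s\<close> to \<open>t\<close>, the factor
  \<open>\<delta> ^ (i + j) * q ^ (n - i + j)\<close> and the \<open>d ^ j\<close> vertices combine
  to \<open>q ^ n * q ^ i * q ^ j\<close>. Both series converge because \<open>q\<close> lies
  strictly between \<delta> and 1. The constant 32 is 2 from the spheres and 4 from each
  series.\<close>

lemma weighted_row:
  assumes p: "0 \<le> p" "p \<le> 1" and K: "1 \<le> K" "\<And>n. Bbd p n (K * \<delta> ^ n)"
    and st: "s \<in> verts T" "t \<in> verts T" and x: "x \<in> verts G" and F: "finite F" "F \<subseteq> edges H"
  shows "(\<Sum>w\<in>insert (s, x) (\<Union>F). tau p F (s, x) w * q ^ gd T (fst w) t) \<le> 32 * K * q ^ gd T s t"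
proof -
  let ?o = "(s, x)" and ?n = "gd T s t"
  let ?W = "insert ?o (\<Union>F)"
  have fe: "fin_edges F" using F by (rule H.fin_edges)
  have oH: "?o \<in> verts H" using st x by simp
  have W: "finite ?W" "?W \<subseteq> verts H" using fe oH H.Union_edges[OF F(2)] by (auto simp: fin_edges_def)
  obtain u where u: "line u" "u 0 = s" "u (int ?n) = t" using line_exists[OF st] by metis
  let ?f = "\<lambda>a b. K * \<delta> ^ a * q ^ b"
  have f0: "0 \<le> ?f a b" for a b
  proof -
    have "0 \<le> \<delta> ^ a" "0 \<le> q ^ b" using \<delta>(1) q(1) by simp_all
    then show ?thesis using K(1) by (intro mult_nonneg_nonneg) auto
  qed
  have "(\<Sum>w\<in>?W. tau p F ?o w * q ^ gd T (fst w) t) \<le> (\<Sum>v\<in>fst ` ?W. rs p F ?o (fib v) * q ^ gd T v t)"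
    using q(1) by (intro sum_by_fibre p F oH) auto
  also have "\<dots> \<le> (\<Sum>v\<in>fst ` ?W. ?f (gd T v (u 0)) (gd T v (u (int ?n))))"
  proof (rule sum_mono)
    fix v assume "v \<in> fst ` ?W"
    then have v: "v \<in> verts T" using W(2) by auto
    have "rs p F ?o (fib v) \<le> K * \<delta> ^ gd T s v" by (rule BbdD[OF K(2) st(1) v refl x F])
    then have "rs p F ?o (fib v) * q ^ gd T v t \<le> (K * \<delta> ^ gd T s v) * q ^ gd T v t"
      using q(1) by (intro mult_right_mono) auto
    then show "rs p F ?o (fib v) * q ^ gd T v t \<le> ?f (gd T v (u 0)) (gd T v (u (int ?n)))"
      unfolding u(2,3) by (simp only: gd_sym[of s v])
  qed
  also have "\<dots> \<le> 32 * K * q ^ ?n"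
  proof -
    have fV: "finite (fst ` ?W)" "fst ` ?W \<subseteq> verts T" using W by auto
    obtain J where "(\<Sum>v\<in>fst ` ?W. ?f (gd T v (u 0)) (gd T v (u (int ?n))))
        \<le> (\<Sum>i\<le>?n. \<Sum>j<J. 2 * real d ^ j * ?f (i + j) ((?n - i) + j))"
      using tree_sum_le[OF u(1) fV, of ?f ?n] f0 by blast
    also have "\<dots> = (\<Sum>i\<le>?n. \<Sum>j<J. (2 * K * q ^ ?n * q ^ i) * q ^ j)"
    proof (intro sum.cong refl)
      fix i j assume i: "i \<in> {..?n}"
      have "\<delta> ^ (i + j) * q ^ ((?n - i) + j) = \<delta> ^ j * (q * q) ^ i * q ^ ((?n - i) + j)"
        unfolding q(4) by (simp only: power_add) (simp only: mult.assoc mult.commute mult.left_commute)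
      also have "\<dots> = \<delta> ^ j * q ^ (i + i + ((?n - i) + j))"
        by (simp only: power_add power_mult_distrib mult.assoc)
      also have "i + i + ((?n - i) + j) = ?n + i + j" using i by auto
      finally have e: "\<delta> ^ (i + j) * q ^ ((?n - i) + j) = \<delta> ^ j * q ^ ?n * q ^ i * q ^ j" by (simp only: power_add mult.assoc)
      have one: "real d ^ j * \<delta> ^ j = 1" using d by (simp add: power_one_over)
      have "2 * real d ^ j * ?f (i + j) ((?n - i) + j) = 2 * real d ^ j * K * (\<delta> ^ (i + j) * q ^ ((?n - i) + j))"
        by (simp only: mult.assoc)
      also have "\<dots> = (real d ^ j * \<delta> ^ j) * (2 * K * q ^ ?n * q ^ i * q ^ j)"
        unfolding e by (simp only: mult.assoc mult.commute mult.left_commute)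
      finally show "2 * real d ^ j * ?f (i + j) ((?n - i) + j) = (2 * K * q ^ ?n * q ^ i) * q ^ j"
        unfolding one by simp
    qed
    also have "\<dots> = (\<Sum>i\<le>?n. (2 * K * q ^ ?n * q ^ i) * (\<Sum>j<J. q ^ j))" by (simp only: sum_distrib_left)
    also have "\<dots> \<le> (\<Sum>i\<le>?n. (2 * K * q ^ ?n * q ^ i) * 4)"
      using q_sum K q(1) by (intro sum_mono mult_left_mono) auto
    also have "\<dots> = (8 * K * q ^ ?n) * (\<Sum>i\<le>?n. q ^ i)" unfolding sum_distrib_left by (intro sum.cong) auto
    also have "\<dots> \<le> (8 * K * q ^ ?n) * 4" using q_sum K q(1) by (intro mult_left_mono) auto
    finally show ?thesis by simp
  qed
  finally show ?thesis .
qed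

lemma gd_T_le_gd_H:
  assumes "a \<in> verts H" "b \<in> verts H"
  shows "gd T (fst a) (fst b) \<le> gd H a b"
proof -
  have "(adj H ^^ n) a b \<Longrightarrow> gd T (fst a) (fst b) \<le> n" for n b
  proof (induction n arbitrary: b)
    case (Suc n)
    then obtain c where c: "(adj H ^^ n) a c" "adj H c b" by auto
    then have V: "c \<in> verts H" "b \<in> verts H" using H.adjD by auto
    have "gd T (fst c) (fst b) \<le> 1" using adj_H_cases[OF c(2)] gd_adj[of "fst c" "fst b"] by auto
    moreover have "gd T (fst a) (fst b) \<le> gd T (fst a) (fst c) + gd T (fst c) (fst b)"
      using assms(1) V by (intro gd_triangle) auto
    ultimately show ?case using Suc.IH[OF c(1)] by simp
  qed simp
  then show ?thesis using H.gd_relpow[OF assms] by blast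
qed

lemma card_H_cball:
  assumes \<Delta>: "\<And>v. v \<in> verts H \<Longrightarrow> card (neighbours H v) \<le> \<Delta>" and v: "v \<in> verts H"
  shows "card (H.cball v n) \<le> (1 + \<Delta>) ^ n"
proof (induction n)
  case 0
  have "H.cball v 0 \<subseteq> {v}" using H.gd_eq_0 v unfolding H.cball_def by auto
  then show ?case using card_mono[of "{v}" "H.cball v 0"] by simp
next
  case (Suc n)
  let ?B = "H.cball v n"
  have B: "finite ?B" "?B \<subseteq> verts H" using H.finite_cball[OF lf_H v] by (auto simp: H.cball_def)
  have nf: "finite (neighbours H y)" if "y \<in> ?B" for y using lf_H B that unfolding locally_finite_def by auto
  have "H.cball v (Suc n) \<subseteq> ?B \<union> (\<Union>y\<in>?B. neighbours H y)"
  proof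
    fix y assume y: "y \<in> H.cball v (Suc n)"
    show "y \<in> ?B \<union> (\<Union>y\<in>?B. neighbours H y)"
    proof (cases "gd H y v = Suc n")
      case True
      have yH: "y \<in> verts H" using y by (simp add: H.cball_def)
      obtain z where z: "adj H y z" "gd H z v = n" by (rule H.gd_closer[OF yH v True])
      then have "z \<in> ?B" "y \<in> neighbours H z"
        using H.adjD[OF z(1)] by (auto simp: H.cball_def neighbours_def H.gd_sym[of v z] adj_sym[of H z y])
      then show ?thesis by blast
    next
      case False
      then show ?thesis using y H.gd_sym[of y v] unfolding H.cball_def by auto
    qed
  qed
  then have "card (H.cball v (Suc n)) \<le> card (?B \<union> (\<Union>y\<in>?B. neighbours H y))"
    using B nf by (intro card_mono) auto
  also have "\<dots> \<le> card ?B + card (\<Union>y\<in>?B. neighbours H y)" by (rule card_Un_le)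
  also have "card (\<Union>y\<in>?B. neighbours H y) \<le> (\<Sum>y\<in>?B. card (neighbours H y))" using B(1) by (rule card_UN_le)
  also have "\<dots> \<le> (\<Sum>y\<in>?B. \<Delta>)" using \<Delta> B(2) by (intro sum_mono) auto
  finally have "card (H.cball v (Suc n)) \<le> card ?B * (1 + \<Delta>)" by simp
  also have "\<dots> \<le> (1 + \<Delta>) ^ n * (1 + \<Delta>)" using Suc by (intro mult_right_mono) auto
  finally show ?case by (simp add: mult.commute)
qed

text \<open>The weighted counterpart of \<open>phi\<close> on balls. Comparing it with
  \<open>q ^ gd T (fst v) t\<close>, the weight at the centre, replaces comparing \<open>phi\<close>
  with 1.\<close>

definition wphi :: "real \<Rightarrow> nat \<Rightarrow> 'a \<times> 'b \<Rightarrow> 'a \<Rightarrow> real" where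
  "wphi p l v t = (\<Sum>(a, b)\<in>exits (edges H) (H.cball v l).
     tau p (H.ball_edges v l) v a * p * q ^ gd T (fst b) t)"

lemma exits_cball:
  assumes v: "v \<in> verts H" and ab: "(a, b) \<in> exits (edges H) (H.cball v l)"
  shows "adj H a b" "gd H v a = l" "b \<in> H.cball v (Suc l)" "a \<in> H.cball v l"
proof -
  show ad: "adj H a b" and a: "a \<in> H.cball v l" using ab by (auto simp: exits_def adj_def)
  have V: "a \<in> verts H" "b \<in> verts H" using H.adjD[OF ad] by auto
  have "b \<notin> H.cball v l" using ab by (auto simp: exits_def)
  then have "l < gd H v b" using V by (auto simp: H.cball_def)
  moreover have "gd H v b \<le> Suc (gd H v a)"
    using H.gd_adj_le[of b a v] ad adj_sym[of H a b] v by (simp add: H.gd_sym)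
  moreover have "gd H v a \<le> l" using a by (simp add: H.cball_def)
  ultimately show "gd H v a = l" "b \<in> H.cball v (Suc l)" using V by (auto simp: H.cball_def)
qed

text \<open>By \<open>weighted_row\<close>, the values for the radii \<open>l < N\<close> add up to
  at most a constant times \<open>q ^ gd T (fst v) t\<close>, with a constant that does not grow
  with \<open>N\<close>. If all of them exceeded a quarter of this weight, their sum would grow
  linearly in \<open>N\<close>.\<close>

lemma wphi_small:
  assumes \<Delta>: "\<And>v. v \<in> verts H \<Longrightarrow> card (neighbours H v) \<le> \<Delta>"
    and p: "0 \<le> p" "p \<le> 1" and K: "1 \<le> K" "\<And>n. Bbd p n (K * \<delta> ^ n)"
    and t: "t \<in> verts T" and v: "v \<in> verts H" and N: "4 * (real \<Delta> * sqrt (real d) * (32 * K)) < real N"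
  shows "\<exists>l<N. wphi p l v t \<le> 1 / 4 * q ^ gd T (fst v) t"
proof (rule ccontr)
  assume n: "\<not> ?thesis"
  let ?r = "sqrt (real d)" and ?w = "q ^ gd T (fst v) t"
  let ?F = "H.ball_edges v N"
  let ?S = "\<lambda>l. {a \<in> H.cball v N. gd H v a = l}"
  have F: "finite ?F" "?F \<subseteq> edges H" using H.finite_ball_edges[OF v] by (auto simp: H.ball_edges_def)
  have B: "finite (H.cball v N)" "H.cball v N \<subseteq> verts H" using H.finite_cball[OF lf_H v] by (auto simp: H.cball_def)
  have r: "0 < ?r" "q * ?r = 1" using d by auto
  let ?g = "\<lambda>a. tau p ?F v a * (?r * q ^ gd T (fst a) t)"
  have g0: "0 \<le> ?g a" for a using p r q(1) by (intro mult_nonneg_nonneg) auto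
  have one: "wphi p l v t \<le> real \<Delta> * (\<Sum>a\<in>?S l. ?g a)" if l: "l < N" for l
  proof -
    let ?X = "exits (edges H) (H.cball v l)"
    have sub: "?X \<subseteq> (SIGMA a:?S l. neighbours H a)"
    proof clarify
      fix a b assume "(a, b) \<in> ?X"
      from exits_cball[OF v this] show "a \<in> ?S l \<and> b \<in> neighbours H a"
        using l by (auto simp: H.cball_def neighbours_def)
    qed
    have nf: "finite (neighbours H a)" "card (neighbours H a) \<le> \<Delta>" if "a \<in> ?S l" for a
      using lf_H \<Delta> B that unfolding locally_finite_def by auto
    have fin: "finite (SIGMA a:?S l. neighbours H a)" using B(1) nf by auto
    have "wphi p l v t \<le> (\<Sum>(a, b)\<in>?X. ?g a)"
      unfolding wphi_def
    proof (rule sum_mono, clarify)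
      fix a b assume ab: "(a, b) \<in> ?X"
      note e = exits_cball[OF v ab]
      have "H.ball_edges v l \<subseteq> ?F" using l by (auto simp: H.ball_edges_def inner_def H.cball_def)
      then have 1: "tau p (H.ball_edges v l) v a \<le> tau p ?F v a" using F p by (intro tau_mono) auto
      have V: "a \<in> verts H" "b \<in> verts H" using H.adjD[OF e(1)] by auto
      have gab: "gd T (fst a) (fst b) \<le> 1" using adj_H_cases[OF e(1)] gd_adj[of "fst a" "fst b"] by auto
      have "gd T (fst a) t \<le> gd T (fst a) (fst b) + gd T (fst b) t" using V t by (intro gd_triangle) auto
      then have "q ^ (gd T (fst b) t + 1) \<le> q ^ gd T (fst a) t" using gab q by (intro power_decreasing) auto
      then have "?r * (q ^ (gd T (fst b) t + 1)) \<le> ?r * q ^ gd T (fst a) t" using r by (intro mult_left_mono) auto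
      moreover have "?r * (q ^ (gd T (fst b) t + 1)) = q ^ gd T (fst b) t" using r by simp
      ultimately have 2: "q ^ gd T (fst b) t \<le> ?r * q ^ gd T (fst a) t" by simp
      have "tau p (H.ball_edges v l) v a * p * q ^ gd T (fst b) t \<le> tau p ?F v a * 1 * (?r * q ^ gd T (fst a) t)"
        using 1 2 p q(1) by (intro mult_mono mult_nonneg_nonneg) auto
      then show "tau p (H.ball_edges v l) v a * p * q ^ gd T (fst b) t \<le> ?g a" by simp
    qed
    also have "\<dots> \<le> (\<Sum>(a, b)\<in>(SIGMA a:?S l. neighbours H a). ?g a)"
      using fin sub g0 by (intro sum_mono2) (auto split: prod.splits)
    also have "\<dots> = (\<Sum>a\<in>?S l. \<Sum>b\<in>neighbours H a. ?g a)"
      using B(1) nf by (intro sum.Sigma[symmetric]) auto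
    also have "\<dots> = (\<Sum>a\<in>?S l. real (card (neighbours H a)) * ?g a)" by simp
    also have "\<dots> \<le> (\<Sum>a\<in>?S l. real \<Delta> * ?g a)" using nf g0 by (intro sum_mono mult_right_mono) auto
    finally show ?thesis by (simp add: sum_distrib_left)
  qed
  have "(\<Sum>l<N. 1 / 4 * ?w) \<le> (\<Sum>l<N. wphi p l v t)" using n by (intro sum_mono) (auto simp: not_le less_imp_le)
  also have "\<dots> \<le> (\<Sum>l<N. real \<Delta> * (\<Sum>a\<in>?S l. ?g a))" by (intro sum_mono one) auto
  also have "\<dots> = real \<Delta> * (\<Sum>l<N. \<Sum>a\<in>?S l. ?g a)" by (simp only: sum_distrib_left)
  also have "\<dots> \<le> real \<Delta> * (\<Sum>a\<in>H.cball v N. ?g a)"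
  proof (rule mult_left_mono)
    have "(\<Sum>l<N. \<Sum>a\<in>?S l. ?g a) = (\<Sum>a\<in>(\<Union>l<N. ?S l). ?g a)"
      using B(1) by (intro sum.UNION_disjoint[symmetric]) auto
    also have "\<dots> \<le> (\<Sum>a\<in>H.cball v N. ?g a)" using B(1) g0 by (intro sum_mono2) auto
    finally show "(\<Sum>l<N. \<Sum>a\<in>?S l. ?g a) \<le> (\<Sum>a\<in>H.cball v N. ?g a)" .
  qed simp
  also have "(\<Sum>a\<in>H.cball v N. ?g a) \<le> ?r * (32 * K * ?w)"
  proof -
    let ?W = "insert v (\<Union>?F)"
    have W: "finite ?W" using H.fin_edges[OF F] by (auto simp: fin_edges_def)
    have "(\<Sum>a\<in>H.cball v N. ?g a) = (\<Sum>a\<in>H.cball v N \<inter> ?W. ?g a)"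
    proof (rule sum.mono_neutral_right[OF B(1)])
      show "\<forall>i\<in>H.cball v N - H.cball v N \<inter> ?W. ?g i = 0"
        using tau_eq_0[OF F(1)] by auto
    qed auto
    also have "\<dots> \<le> (\<Sum>a\<in>?W. ?g a)" using W g0 by (intro sum_mono2) auto
    also have "\<dots> = ?r * (\<Sum>a\<in>?W. tau p ?F v a * q ^ gd T (fst a) t)"
      unfolding sum_distrib_left by (intro sum.cong) auto
    also have "\<dots> \<le> ?r * (32 * K * ?w)"
    proof (rule mult_left_mono)
      obtain s x where vv: "v = (s, x)" by (cases v)
      show "(\<Sum>a\<in>?W. tau p ?F v a * q ^ gd T (fst a) t) \<le> 32 * K * ?w"
        using weighted_row[OF p K _ t _ F, of s x] v unfolding vv by simp
    qed (use r in auto)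
    finally show ?thesis .
  qed
  finally have "real N * (1 / 4 * ?w) \<le> real \<Delta> * (?r * (32 * K * ?w))" by (simp add: mult_left_mono)
  then have "(real N / 4) * ?w \<le> (real \<Delta> * ?r * (32 * K)) * ?w" by (simp add: mult_ac)
  moreover have "0 < ?w" using q(1) by simp
  ultimately have "real N / 4 \<le> real \<Delta> * ?r * (32 * K)" by (rule mult_right_le_imp_le)
  then show False using N by simp
qed

text \<open>The numbers of edges and exits are bounded in terms of \<Delta> and \<open>N\<close>.
  Outer ends of exits lie within tree distance \<open>N\<close> of \<open>v\<close>, so their
  weights exceed the weight at \<open>v\<close> by at most the factor
  \<open>sqrt (real d) ^ N\<close>. The error is therefore relative to that weight, uniformly in
  \<open>v\<close> and \<open>t\<close>.\<close>

lemma wphi_Lipschitz: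
  assumes \<Delta>: "\<And>v. v \<in> verts H \<Longrightarrow> card (neighbours H v) \<le> \<Delta>"
    and p: "0 \<le> p" "p \<le> p'" "p' \<le> 1" and t: "t \<in> verts T" and v: "v \<in> verts H" and l: "l < N"
  shows "wphi p' l v t \<le> wphi p l v t
    + real ((1 + \<Delta>) ^ N * \<Delta>) * ((real ((1 + \<Delta>) ^ N * (1 + \<Delta>) ^ N) + 1) * (p' - p)) * (sqrt (real d) ^ N * q ^ gd T (fst v) t)"
proof -
  let ?X = "exits (edges H) (H.cball v l)" and ?F = "H.ball_edges v l" and ?r = "sqrt (real d)"
  let ?M = "real ((1 + \<Delta>) ^ N * (1 + \<Delta>) ^ N)" and ?w = "q ^ gd T (fst v) t"
  have B: "finite (H.cball v l)" "H.cball v l \<subseteq> verts H" using H.finite_cball[OF lf_H v] by (auto simp: H.cball_def)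
  have pl: "(1 + \<Delta>) ^ l \<le> (1 + \<Delta>) ^ N" using l by (intro power_increasing) auto
  have cB: "card (H.cball v l) \<le> (1 + \<Delta>) ^ N" using card_H_cball[OF \<Delta> v, of l] pl by simp
  have F: "finite ?F" by (rule H.finite_ball_edges[OF v])
  have cF: "real (card ?F) \<le> ?M"
  proof -
    have "?F \<subseteq> (\<lambda>(a, b). {a, b}) ` (H.cball v l \<times> H.cball v l)"
    proof
      fix e assume e: "e \<in> ?F"
      then obtain a b where ab: "e = {a, b}" by (auto simp: H.ball_edges_def elim: H.edgeE)
      then have "a \<in> H.cball v l" "b \<in> H.cball v l" using e by (auto simp: H.ball_edges_def inner_def)
      then show "e \<in> (\<lambda>(a, b). {a, b}) ` (H.cball v l \<times> H.cball v l)" using ab by auto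
    qed
    then have "card ?F \<le> card (H.cball v l \<times> H.cball v l)"
      using B(1) by (meson card_image_le card_mono finite_SigmaI finite_imageI order_trans)
    also have "\<dots> \<le> (1 + \<Delta>) ^ N * (1 + \<Delta>) ^ N" unfolding card_cartesian_product using cB by (intro mult_mono) auto
    finally show ?thesis by (rule of_nat_mono)
  qed
  have cX: "card ?X \<le> (1 + \<Delta>) ^ N * \<Delta>"
  proof -
    have "?X = ?X \<inter> H.cball v l \<times> UNIV" by (auto simp: exits_def)
    then have "card ?X = card (?X \<inter> H.cball v l \<times> UNIV)" by (rule arg_cong)
    also have "\<dots> \<le> card (H.cball v l) * \<Delta>" by (rule card_exits_le[OF \<Delta> B])
    also have "\<dots> \<le> (1 + \<Delta>) ^ N * \<Delta>" using cB by (intro mult_right_mono) auto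
    finally show ?thesis .
  qed
  have r: "0 < ?r" "?r * q = 1" using d by auto
  have tm: "tau p' ?F v a * p' * q ^ gd T (fst b) t
      \<le> tau p ?F v a * p * q ^ gd T (fst b) t + ((?M + 1) * (p' - p)) * (?r ^ N * ?w)" if ab: "(a, b) \<in> ?X" for a b
  proof -
    note e = exits_cball[OF v ab]
    have V: "a \<in> verts H" "b \<in> verts H" using H.adjD[OF e(1)] by auto
    have "gd T (fst v) (fst b) \<le> gd H v b" using v V by (intro gd_T_le_gd_H) auto
    also have "\<dots> \<le> N" using e(3) l by (simp add: H.cball_def)
    finally have "gd T (fst v) t \<le> N + gd T (fst b) t"
      using gd_triangle[of "fst v" "fst b" t] v V t by (cases v; cases b) auto
    then have "q ^ (N + gd T (fst b) t) \<le> ?w" using q by (intro power_decreasing) auto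
    then have "?r ^ N * q ^ (N + gd T (fst b) t) \<le> ?r ^ N * ?w" using r by (intro mult_left_mono) auto
    moreover have "?r ^ N * q ^ (N + gd T (fst b) t) = (?r * q) ^ N * q ^ gd T (fst b) t"
      by (simp only: power_add power_mult_distrib mult.assoc)
    ultimately have w: "q ^ gd T (fst b) t \<le> ?r ^ N * ?w" unfolding r(2) by simp
    have "\<bar>tau p' ?F v a - tau p ?F v a\<bar> \<le> card ?F * (p' - p)"
      unfolding tau_def Pr_def using F p by (intro Exp_Lipschitz) auto
    also have "\<dots> \<le> ?M * (p' - p)" using cF p by (intro mult_right_mono) auto
    finally have d1: "tau p' ?F v a - tau p ?F v a \<le> ?M * (p' - p)" by simp
    have "tau p' ?F v a * p' - tau p ?F v a * p = (tau p' ?F v a - tau p ?F v a) * p' + tau p ?F v a * (p' - p)"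
      by (simp add: algebra_simps)
    also have "\<dots> \<le> (?M * (p' - p)) * 1 + 1 * (p' - p)"
    proof (rule add_mono)
      have "(tau p' ?F v a - tau p ?F v a) * p' \<le> (?M * (p' - p)) * p'" using d1 p by (intro mult_right_mono) auto
      also have "\<dots> \<le> (?M * (p' - p)) * 1" using p by (intro mult_left_mono) auto
      finally show "(tau p' ?F v a - tau p ?F v a) * p' \<le> (?M * (p' - p)) * 1" .
      show "tau p ?F v a * (p' - p) \<le> 1 * (p' - p)" using p F by (intro mult_right_mono tau_le_1) auto
    qed
    finally have d2: "tau p' ?F v a * p' - tau p ?F v a * p \<le> (?M + 1) * (p' - p)" by (simp add: algebra_simps)
    have "(tau p' ?F v a * p' - tau p ?F v a * p) * q ^ gd T (fst b) t \<le> ((?M + 1) * (p' - p)) * q ^ gd T (fst b) t"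
      using d2 q(1) by (intro mult_right_mono) auto
    also have "\<dots> \<le> ((?M + 1) * (p' - p)) * (?r ^ N * ?w)" using w p by (intro mult_left_mono) auto
    finally show ?thesis by (simp add: left_diff_distrib)
  qed
  have "wphi p' l v t \<le> (\<Sum>(a, b)\<in>?X. tau p ?F v a * p * q ^ gd T (fst b) t + ((?M + 1) * (p' - p)) * (?r ^ N * ?w))"
    unfolding wphi_def using tm by (intro sum_mono) auto
  also have "\<dots> = wphi p l v t + real (card ?X) * (((?M + 1) * (p' - p)) * (?r ^ N * ?w))"
    unfolding wphi_def case_prod_unfold sum.distrib by simp
  also have "real (card ?X) * (((?M + 1) * (p' - p)) * (?r ^ N * ?w))
      \<le> real ((1 + \<Delta>) ^ N * \<Delta>) * (((?M + 1) * (p' - p)) * (?r ^ N * ?w))"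
    using cX p q(1) r(1) by (intro mult_right_mono of_nat_mono mult_nonneg_nonneg) auto
  finally show ?thesis by (simp only: mult.assoc)
qed

text \<open>A maximum principle for \<open>tau p1 F v (t, y)\<close> times
  \<open>sqrt (real d)\<close> to the tree distance from \<open>v\<close> to \<open>t\<close>. If
  the largest value occurs farther than \<open>N\<close> from \<open>t\<close>, Simon's inequality
  on a ball with small \<open>wphi\<close> bounds it by half of itself, so it vanishes; otherwise it
  is at most \<open>sqrt (real d) ^ N\<close>.\<close>

lemma supercritical_decay:
  "\<exists>p1 C. p_chi \<le> p1 \<and> p1 \<le> 1 \<and> (p_chi < 1 \<longrightarrow> p_chi < p1) \<and>
    (\<forall>F s t x y. finite F \<longrightarrow> F \<subseteq> edges H \<longrightarrow> s \<in> verts T \<longrightarrow> t \<in> verts T \<longrightarrow> x \<in> verts G \<longrightarrow> y \<in> verts G \<longrightarrow>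
      tau p1 F (s, x) (t, y) \<le> C * q ^ gd T s t)"
proof -
  obtain K where K: "1 \<le> K" "\<And>p n. sb p \<Longrightarrow> Bbd p n (K * \<delta> ^ n)" using uniform_decay by blast
  have crit: "Bbd p_chi n (K * \<delta> ^ n)" for n by (rule critical_decay[OF K(2)])
  have pc: "0 \<le> p_chi" "p_chi \<le> 1" using p_chi(1,2) by auto
  obtain \<Delta> where \<Delta>: "\<And>v. v \<in> verts H \<Longrightarrow> card (neighbours H v) \<le> \<Delta>" using degree_bound by blast
  let ?r = "sqrt (real d)"
  obtain N where N: "4 * (real \<Delta> * ?r * (32 * K)) < real N" using reals_Archimedean2 by blast
  define A where "A = real ((1 + \<Delta>) ^ N * \<Delta>) * (real ((1 + \<Delta>) ^ N * (1 + \<Delta>) ^ N) + 1) * ?r ^ N"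
  have A: "0 \<le> A" unfolding A_def by (intro mult_nonneg_nonneg) auto
  \<comment> \<open>Then \<open>A * \<epsilon> \<le> 1 / 4\<close>, which raises the factor 1/4 at
    \<open>p_chi\<close> to at most 1/2 at \<open>p1\<close>.\<close>
  define \<epsilon> where "\<epsilon> = 1 / (4 * (A + 1))"
  have \<epsilon>: "0 < \<epsilon>" "A * \<epsilon> \<le> 1 / 4" unfolding \<epsilon>_def using A by (auto simp: field_simps)
  \<comment> \<open>Capped at 1, because \<open>p_chi = 1\<close> is not yet excluded; hence the
    conditional strict inequality in the conclusion.\<close>
  define p1 where "p1 = min 1 (p_chi + \<epsilon>)"
  have p1: "p_chi \<le> p1" "p1 \<le> 1" "p1 - p_chi \<le> \<epsilon>" "p_chi < 1 \<longrightarrow> p_chi < p1"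
    unfolding p1_def using pc \<epsilon> by auto
  have p1': "0 \<le> p1" using p1 pc by simp
  have small: "\<exists>l<N. wphi p1 l v t \<le> 1 / 2 * q ^ gd T (fst v) t" if v: "v \<in> verts H" and t: "t \<in> verts T" for v t
  proof -
    obtain l where l: "l < N" "wphi p_chi l v t \<le> 1 / 4 * q ^ gd T (fst v) t"
      using wphi_small[OF \<Delta> pc K(1) crit t v N] by auto
    have "wphi p1 l v t \<le> wphi p_chi l v t
       + real ((1 + \<Delta>) ^ N * \<Delta>) * ((real ((1 + \<Delta>) ^ N * (1 + \<Delta>) ^ N) + 1) * (p1 - p_chi)) * (?r ^ N * q ^ gd T (fst v) t)"
      by (rule wphi_Lipschitz[OF \<Delta> pc(1) p1(1,2) t v l(1)])
    also have "real ((1 + \<Delta>) ^ N * \<Delta>) * ((real ((1 + \<Delta>) ^ N * (1 + \<Delta>) ^ N) + 1) * (p1 - p_chi)) * (?r ^ N * q ^ gd T (fst v) t)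
       = (A * (p1 - p_chi)) * q ^ gd T (fst v) t"
      unfolding A_def by (simp only: mult.assoc mult.commute mult.left_commute)
    also have "\<dots> \<le> 1 / 4 * q ^ gd T (fst v) t"
    proof (rule mult_right_mono)
      have "A * (p1 - p_chi) \<le> A * \<epsilon>" using A p1(3) by (intro mult_left_mono) auto
      then show "A * (p1 - p_chi) \<le> 1 / 4" using \<epsilon> by simp
    qed (use q(1) in auto)
    finally show ?thesis using l by (intro exI[of _ l]) auto
  qed
  have dec: "tau p1 F (s, x) (t, y) \<le> ?r ^ N * q ^ gd T s t"
    if F: "finite F" "F \<subseteq> edges H" and st: "s \<in> verts T" "t \<in> verts T" and xy: "x \<in> verts G" "y \<in> verts G" for F s t x y
  proof -
    let ?y = "(t, y)"
    let ?W = "insert (s, x) (\<Union>F)"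
    have r: "1 \<le> ?r" "0 < ?r" "?r * q = 1" using d by auto
    let ?f = "\<lambda>v. tau p1 F v ?y * ?r ^ gd T (fst v) t"
    have W: "finite ?W" "?W \<subseteq> verts H" using H.fin_edges[OF F] H.Union_edges[OF F(2)] st xy by (auto simp: fin_edges_def)
    define m where "m = Max (?f ` ?W)"
    have m: "?f v \<le> m" if "v \<in> ?W" for v unfolding m_def using W that by (intro Max_ge) auto
    have "m \<in> ?f ` ?W" unfolding m_def using W by (intro Max_in) auto
    then obtain v where v': "m = ?f v" "v \<in> ?W" by (rule imageE)
    note v = v'(2,1)
    have vH: "v \<in> verts H" using v W by auto
    have m0: "0 \<le> m" unfolding v(2) using p1' p1 r by (intro mult_nonneg_nonneg) auto
    have "m \<le> ?r ^ N"
    proof (cases "gd T (fst v) t \<le> N")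
      case True
      have "m \<le> 1 * ?r ^ N"
        unfolding v(2) using True r p1 p1' F by (intro mult_mono tau_le_1 power_increasing) auto
      then show ?thesis by simp
    next
      case False
      obtain l where l: "l < N" "wphi p1 l v t \<le> 1 / 2 * q ^ gd T (fst v) t" using small[OF vH st(2)] by auto
      let ?S = "H.cball v l"
      have vS: "v \<in> ?S" using vH by (simp add: H.cball_def)
      have yS: "?y \<notin> ?S"
      proof
        assume "?y \<in> ?S"
        then have "gd H v ?y \<le> l" by (simp add: H.cball_def)
        moreover have "gd T (fst v) t \<le> gd H v ?y" using gd_T_le_gd_H[OF vH, of ?y] st xy by simp
        ultimately show False using False l by simp
      qed
      have fS: "finite ?S" "?S \<subseteq> verts H" using H.finite_cball[OF lf_H vH] by (auto simp: H.cball_def)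
      have "tau p1 F v ?y \<le> (\<Sum>(a, b)\<in>exits F ?S. tau p1 (F \<inter> inner ?S) v a * p1 * tau p1 F b ?y)"
        by (rule Simon[OF F(1) p1' p1(2) vS yS])
      also have "\<dots> \<le> (\<Sum>(a, b)\<in>exits F ?S. tau p1 (H.ball_edges v l) v a * p1 * (m * q ^ gd T (fst b) t))"
      proof (rule sum_mono, clarify)
        fix a b assume ab: "(a, b) \<in> exits F ?S"
        then have "b \<in> ?W" by (auto simp: exits_def)
        then have "?f b * q ^ gd T (fst b) t \<le> m * q ^ gd T (fst b) t" using m q(1) by (intro mult_right_mono) auto
        moreover have "?f b * q ^ gd T (fst b) t = tau p1 F b ?y * (?r * q) ^ gd T (fst b) t"
          by (simp only: power_mult_distrib mult.assoc)
        ultimately have 1: "tau p1 F b ?y \<le> m * q ^ gd T (fst b) t" unfolding r(3) by simp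
        have 2: "tau p1 (F \<inter> inner ?S) v a \<le> tau p1 (H.ball_edges v l) v a"
          using F(2) p1 p1' by (intro tau_mono H.finite_ball_edges[OF vH]) (auto simp: H.ball_edges_def)
        show "tau p1 (F \<inter> inner ?S) v a * p1 * tau p1 F b ?y \<le> tau p1 (H.ball_edges v l) v a * p1 * (m * q ^ gd T (fst b) t)"
          using 1 2 p1 p1' by (intro mult_mono mult_right_mono mult_nonneg_nonneg) auto
      qed
      also have "\<dots> \<le> (\<Sum>(a, b)\<in>exits (edges H) ?S. tau p1 (H.ball_edges v l) v a * p1 * (m * q ^ gd T (fst b) t))"
        using F(2) m0 p1 p1' q(1) by (intro sum_mono2 H.finite_exits_edges[OF fS]) (auto simp: exits_def split: prod.splits)
      also have "\<dots> = m * wphi p1 l v t"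
        unfolding wphi_def sum_distrib_left case_prod_unfold by (intro sum.cong refl) (simp only: mult.assoc mult.left_commute)
      also have "\<dots> \<le> m * (1 / 2 * q ^ gd T (fst v) t)" using l(2) m0 by (rule mult_left_mono)
      finally have "m \<le> m * (1 / 2 * q ^ gd T (fst v) t) * ?r ^ gd T (fst v) t"
        unfolding v(2) using r by (intro mult_right_mono) auto
      also have "\<dots> = m * (1 / 2) * (?r * q) ^ gd T (fst v) t"
        by (simp only: power_mult_distrib mult.assoc mult.commute mult.left_commute)
      finally have "m \<le> m / 2" unfolding r(3) by simp
      then have "m \<le> 0" by simp
      then show ?thesis using r(2) by (meson less_le order_trans zero_less_power)
    qed
    then have "?f (s, x) \<le> ?r ^ N" using m[of "(s, x)"] by simp
    then have "?f (s, x) * q ^ gd T s t \<le> ?r ^ N * q ^ gd T s t" using q(1) by (intro mult_right_mono) auto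
    moreover have "?f (s, x) * q ^ gd T s t = tau p1 F (s, x) ?y * (?r * q) ^ gd T s t"
      unfolding fst_conv by (simp only: power_mult_distrib mult.assoc)
    ultimately show ?thesis by (simp only: r(3) power_one mult_1_right)
  qed
  show ?thesis
    using p1 dec by (intro exI[of _ p1] exI[of _ "?r ^ N"]) auto
qed

end

section \<open>Infinite clusters\<close>

definition opn :: "('e \<Rightarrow> bool) \<Rightarrow> 'e set \<Rightarrow> 'e set" where
  "opn \<omega> F = {e \<in> F. \<omega> e}"

lemma opn_subset: "opn \<omega> F \<subseteq> F"
  by (auto simp: opn_def)

lemma finite_pedges: "finite (pedges xs)"
  by (induction xs rule: pedges.induct) auto

lemma conn_finite:
  assumes "conn W x y"
  shows "\<exists>F. finite F \<and> F \<subseteq> W \<and> conn F x y"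
proof -
  obtain xs where xs: "spath W x xs y" using conn_spath[OF assms] by (rule exE)
  then have "conn (pedges xs) x y" using conn_pedges[of xs] by (auto simp: spath_def)
  then show ?thesis using xs finite_pedges by (auto simp: spath_def)
qed

text \<open>Whenever the walk uses \<open>e\<close>, it is restarted at the endpoint of
  \<open>e\<close> at which it then stands.\<close>

lemma conn_remove:
  assumes "conn W x y"
  shows "conn (W - {e}) x y \<or> (\<exists>z\<in>e. conn (W - {e}) z y)"
proof -
  have "(\<lambda>a b. {a, b} \<in> W)\<^sup>*\<^sup>* x y" using assms by (simp add: conn_def)
  then show ?thesis
  proof (induction rule: rtranclp_induct)
    case (step y z)
    show ?case
    proof (cases "{y, z} = e")
      case True
      then show ?thesis by (intro disjI2 bexI[of _ z]) auto
    next
      case False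
      then have "conn (W - {e}) y z" using step(2) by (intro conn_edge) auto
      then have "conn (W - {e}) w z" if "conn (W - {e}) w y" for w using that by (rule conn_trans[rotated])
      then show ?thesis using step(3) by auto
    qed
  qed simp
qed

text \<open>A connection needs only finitely many edges, and \<open>E\<close> has countably many
  finite subsets. The measure is arbitrary because the lemma serves both the percolation measure and
  the sigma-algebras generated by all but finitely many edges.\<close>

lemma conn_event_sets:
  assumes "countable E" "\<And>e. e \<in> E \<Longrightarrow> {\<omega> \<in> space N. \<omega> e} \<in> sets N"
  shows "{\<omega> \<in> space N. conn (opn \<omega> E) x y} \<in> sets N"
proof -
  let ?FF = "{F. finite F \<and> F \<subseteq> E \<and> conn F x y}"
  have "countable ?FF"
    by (rule countable_subset[OF _ countable_Collect_finite_subset[OF assms(1)]]) auto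
  moreover have "{\<omega> \<in> space N. \<forall>e\<in>F. \<omega> e} \<in> sets N" if "F \<in> ?FF" for F
    using that assms(2) by (intro sets.sets_Collect_finite_All) auto
  moreover have "{\<omega> \<in> space N. conn (opn \<omega> E) x y} = (\<Union>F\<in>?FF. {\<omega> \<in> space N. \<forall>e\<in>F. \<omega> e})"
  proof (intro set_eqI iffI)
    fix \<omega> assume w: "\<omega> \<in> {\<omega> \<in> space N. conn (opn \<omega> E) x y}"
    then have "\<exists>F. finite F \<and> F \<subseteq> opn \<omega> E \<and> conn F x y" by (intro conn_finite) simp
    then show "\<omega> \<in> (\<Union>F\<in>?FF. {\<omega> \<in> space N. \<forall>e\<in>F. \<omega> e})" using w by (auto simp: opn_def)
  next
    fix \<omega> assume "\<omega> \<in> (\<Union>F\<in>?FF. {\<omega> \<in> space N. \<forall>e\<in>F. \<omega> e})"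
    then obtain F where F: "F \<subseteq> E" "conn F x y" "\<forall>e\<in>F. \<omega> e" "\<omega> \<in> space N" by auto
    then have "F \<subseteq> opn \<omega> E" by (auto simp: opn_def)
    then show "\<omega> \<in> {\<omega> \<in> space N. conn (opn \<omega> E) x y}" using F(4) conn_mono[OF F(2)] by simp
  qed
  ultimately show ?thesis by (simp only: sets.countable_UN'')
qed

section \<open>Infinite clusters as unbounded components\<close>

context lfgraph
begin

lemma countable_verts: "countable (verts G)"
proof -
  obtain x where x: "x \<in> verts G" using connected unfolding connected_graph_def by auto
  have "verts G \<subseteq> (\<Union>n. cball x n)" unfolding cball_def by auto
  moreover have "countable (\<Union>n. cball x n)" using countable_finite[OF finite_cball[OF lf x]] by (intro countable_UN) auto
  ultimately show ?thesis by (rule countable_subset)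
qed

lemma countable_edges: "countable (edges G)"
proof -
  have "edges G \<subseteq> (\<lambda>(a, b). {a, b}) ` (verts G \<times> verts G)"
  proof
    fix e assume "e \<in> edges G"
    then obtain a b where "e = {a, b}" "adj G a b" by (rule edgeE)
    then show "e \<in> (\<lambda>(a, b). {a, b}) ` (verts G \<times> verts G)" using adjD by force
  qed
  then show ?thesis using countable_verts by (meson countable_SIGMA countable_image countable_subset)
qed

text \<open>Infiniteness of the cluster of \<open>x\<close>, in a form obtained from connection
  events by countable operations.\<close>

definition far :: "'a set set \<Rightarrow> 'a \<Rightarrow> bool" where
  "far W x \<longleftrightarrow> (\<forall>n. \<exists>y\<in>verts G. n \<le> gd G x y \<and> conn W x y)"

lemma far_iff_infinite:
  assumes "W \<subseteq> edges G" "x \<in> verts G"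
  shows "far W x \<longleftrightarrow> infinite {y. conn W x y}"
proof
  assume f: "far W x"
  show "infinite {y. conn W x y}"
  proof
    assume fin: "finite {y. conn W x y}"
    obtain y where "conn W x y" "Suc (Max (gd G x ` {y. conn W x y})) \<le> gd G x y" using f unfolding far_def by blast
    moreover from this have "gd G x y \<le> Max (gd G x ` {y. conn W x y})" using fin by (intro Max_ge) auto
    ultimately show False by simp
  qed
next
  assume i: "infinite {y. conn W x y}"
  show "far W x"
    unfolding far_def
  proof
    fix n
    have "\<not> {y. conn W x y} \<subseteq> cball x n" using i finite_cball[OF lf assms(2)] finite_subset by blast
    then obtain y where "conn W x y" "y \<notin> cball x n" by auto
    then show "\<exists>y\<in>verts G. n \<le> gd G x y \<and> conn W x y"
      using conn_gd_bound[OF _ assms] by (intro bexI[of _ y]) (auto simp: cball_def)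
  qed
qed

text \<open>When an edge is removed, an infinite component is covered by the new components of
  \<open>z\<close> and of the two ends of the edge, so one of these is infinite. Existence of an
  infinite cluster is thus insensitive to finitely many edges.\<close>

lemma far_remove:
  assumes W: "W \<subseteq> edges G" and x: "x \<in> verts G" "far W x" and K: "finite K"
  shows "\<exists>z\<in>verts G. far (W - K) z"
  using K
proof (induction K rule: finite_induct)
  case empty
  then show ?case using x by auto
next
  case (insert e K)
  then obtain z where z: "z \<in> verts G" "far (W - K) z" by auto
  let ?W = "W - K" and ?W' = "W - K - {e}"
  have sub: "?W \<subseteq> edges G" "?W' \<subseteq> edges G" using W by auto
  have inf: "infinite {y. conn ?W z y}" using far_iff_infinite[OF sub(1) z(1)] z(2) by simp
  have "\<exists>v\<in>verts G. infinite {y. conn ?W' v y}"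
  proof (cases "e \<in> ?W")
    case True
    then have e: "finite e" "e \<subseteq> verts G" using finite_edge Union_edges[of "{e}"] sub(1) by auto
    have "{y. conn ?W z y} \<subseteq> {y. conn ?W' z y} \<union> (\<Union>v\<in>e. {y. conn ?W' v y})"
      using conn_remove[of ?W z _ e] by blast
    then have "infinite ({y. conn ?W' z y} \<union> (\<Union>v\<in>e. {y. conn ?W' v y}))" using inf finite_subset by blast
    then show ?thesis using e z(1) by auto
  next
    case False
    then have "?W' = ?W" by auto
    then show ?thesis using inf z(1) by auto
  qed
  then obtain v where v: "v \<in> verts G" "infinite {y. conn ?W' v y}" by auto
  have "far ?W' v" using far_iff_infinite[OF sub(2) v(1)] v(2) by simp
  moreover have "?W' = W - insert e K" by auto
  ultimately show ?case using v(1) by auto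
qed

text \<open>A path that gets to distance at least \<open>N\<close> is followed until it first
  reaches distance \<open>N\<close>; up to there it stays in the ball.\<close>

lemma reach_of_conn:
  assumes x: "x \<in> verts G" and W: "W \<subseteq> edges G" and c: "conn W x y" and N: "N \<le> gd G x y"
  shows "reach N x (W \<inter> ball_edges x N)"
proof (cases "N = 0")
  case True
  then show ?thesis using x unfolding reach_def by (intro bexI[of _ x]) auto
next
  case False
  let ?S = "{v. gd G x v < N}"
  obtain xs where xs: "spath W x xs y" using conn_spath[OF c] by (rule exE)
  obtain as a b bs where s: "xs = as @ a # b # bs" "set (as @ [a]) \<subseteq> ?S" "b \<notin> ?S"
    using path_exit[OF xs, of ?S] False N by auto
  note parts = spath_parts[OF xs[unfolded s(1)]]
  have ab: "adj G a b" using parts(3) W by (auto simp: adj_def)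
  have V: "a \<in> verts G" "b \<in> verts G" using adjD[OF ab] by auto
  have "gd G x b \<le> Suc (gd G x a)" using gd_adj_le[of b a x] ab adj_sym[of G a b] x by (simp add: gd_sym)
  then have gb: "gd G x b = N" using s(2,3) by auto
  let ?P = "insert {a, b} (pedges (as @ [a]))"
  have PW: "?P \<subseteq> W" using parts by auto
  have "e \<subseteq> cball x N" if "e \<in> ?P" for e
  proof
    fix v assume v: "v \<in> e"
    have "e \<in> edges G" using that PW W by auto
    then have "v \<in> verts G" using Union_edges[of "{e}"] v by auto
    moreover have "v = b \<or> v \<in> set (as @ [a])" using that v pedges_subset[of e "as @ [a]"] by auto
    then have "gd G x v \<le> N" using gb s(2) by auto
    ultimately show "v \<in> cball x N" by (simp add: cball_def)
  qed
  then have P: "?P \<subseteq> W \<inter> ball_edges x N" using PW W by (auto simp: ball_edges_def inner_def)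
  then have "conn (W \<inter> ball_edges x N) x a" "conn (W \<inter> ball_edges x N) a b"
    using conn_mono[OF parts(1)] conn_edge[of a b] by blast+
  then have "conn (W \<inter> ball_edges x N) x b" by (rule conn_trans)
  then show ?thesis using gb V unfolding reach_def by auto
qed

lemma far_iff_reach:
  assumes x: "x \<in> verts G" and W: "W \<subseteq> edges G"
  shows "far W x \<longleftrightarrow> (\<forall>N. reach N x (W \<inter> ball_edges x N))"
proof
  assume "far W x"
  then show "\<forall>N. reach N x (W \<inter> ball_edges x N)"
    using reach_of_conn[OF x W] unfolding far_def by blast
next
  assume h: "\<forall>N. reach N x (W \<inter> ball_edges x N)"
  show "far W x"
    unfolding far_def
  proof
    fix n
    obtain y where "y \<in> verts G" "gd G x y = n" "conn (W \<inter> ball_edges x n) x y" using h unfolding reach_def by blast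
    then show "\<exists>y\<in>verts G. n \<le> gd G x y \<and> conn W x y"
      using conn_mono[of "W \<inter> ball_edges x n" x y W] by auto
  qed
qed

lemma component_retained: "component_of (retained_subgraph G \<omega>) x = {y. conn (opn \<omega> (edges G)) x y}"
  unfolding component_of_def retained_subgraph_def adj_def conn_def opn_def by simp

lemma infinite_cluster_iff:
  "(\<exists>C. C \<in> infinite_clusters G \<omega>) \<longleftrightarrow> (\<exists>x\<in>verts G. far (opn \<omega> (edges G)) x)"
proof -
  have "(\<exists>C. C \<in> infinite_clusters G \<omega>) \<longleftrightarrow> (\<exists>x\<in>verts G. infinite {y. conn (opn \<omega> (edges G)) x y})"
    unfolding infinite_clusters_def graph_components_def component_retained
    by (auto simp: retained_subgraph_def)
  then show ?thesis using far_iff_infinite[OF opn_subset] by auto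
qed

lemma unique_cluster_conn:
  assumes u: "\<exists>!C. C \<in> infinite_clusters G \<omega>" and x: "x \<in> verts G" "far (opn \<omega> (edges G)) x"
    and y: "y \<in> verts G" "far (opn \<omega> (edges G)) y"
  shows "conn (opn \<omega> (edges G)) x y"
proof -
  let ?C = "\<lambda>x. {y. conn (opn \<omega> (edges G)) x y}"
  have "?C z \<in> infinite_clusters G \<omega>" if "z \<in> verts G" "far (opn \<omega> (edges G)) z" for z
    using that far_iff_infinite[OF opn_subset that(1)]
    unfolding infinite_clusters_def graph_components_def component_retained[symmetric]
    by (auto simp: retained_subgraph_def)
  then have "?C x = ?C y" using u x y by blast
  moreover have "y \<in> ?C y" by simp
  ultimately have "y \<in> ?C x" by simp
  then show ?thesis by simp
qed

section \<open>Percolation events and the zero-one law\<close>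

context
  fixes p :: real
  assumes p: "0 \<le> p" "p \<le> 1"
begin

abbreviation M :: "('a set \<Rightarrow> bool) measure" where
  "M \<equiv> percolation G p"

interpretation B: product_prob_space "\<lambda>_. measure_pmf (bernoulli_pmf p)" "edges G"
  by unfold_locales

interpretation M: prob_space M
  unfolding percolation_def by (rule B.prob_space_axioms)

abbreviation far_event :: "'a \<Rightarrow> ('a set \<Rightarrow> bool) set" where
  "far_event x \<equiv> {\<omega> \<in> space M. far (opn \<omega> (edges G)) x}"

lemma edge_event: "e \<in> edges G \<Longrightarrow> {\<omega> \<in> space M. \<omega> e} \<in> sets M"
  unfolding percolation_def by (intro sets_Collect_single') auto

text \<open>The bridge from the product measure to the finite sums \<open>Pr\<close>: the event is a
  disjoint union of cylinders, one for each configuration of \<open>F\<close>.\<close>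

lemma cylinder:
  assumes F: "finite F" "F \<subseteq> edges G"
  shows "{\<omega> \<in> space M. A (opn \<omega> F)} \<in> sets M" "measure M {\<omega> \<in> space M. A (opn \<omega> F)} = Pr p F A"
proof -
  define C where "C U = {\<omega> \<in> space M. opn \<omega> F = U}" for U
  have Cemb: "C U = B.emb (edges G) F (Pi\<^sub>E F (\<lambda>e. {e \<in> U}))" if "U \<subseteq> F" for U
  proof -
    have "(opn \<omega> F = U) \<longleftrightarrow> (\<forall>e\<in>F. \<omega> e = (e \<in> U))" for \<omega> using that by (auto simp: opn_def)
    then show ?thesis
      unfolding C_def percolation_def prod_emb_def by (auto simp: space_PiM PiE_iff extensional_def)
  qed
  have Cs: "C U \<in> sets M" if "U \<subseteq> F" for U
    unfolding Cemb[OF that] percolation_def using F by (intro sets_PiM_I) auto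
  have Cm: "measure M (C U) = p ^ card U * (1 - p) ^ card (F - U)" if U: "U \<subseteq> F" for U
  proof -
    have "measure M (C U) = (\<Prod>e\<in>F. measure (measure_pmf (bernoulli_pmf p)) {e \<in> U})"
      unfolding Cemb[OF U] percolation_def using F by (intro B.measure_PiM_emb) auto
    also have "\<dots> = (\<Prod>e\<in>F. if e \<in> U then p else 1 - p)"
      using p by (intro prod.cong) (auto simp: measure_pmf_single)
    also have "\<dots> = p ^ card U * (1 - p) ^ card (F - U)"
      using F(1) U by (simp add: prod.If_cases Int_absorb1 Diff_eq)
    finally show ?thesis .
  qed
  let ?I = "{U \<in> Pow F. A U}"
  have I: "finite ?I" using F(1) by auto
  have eq: "{\<omega> \<in> space M. A (opn \<omega> F)} = (\<Union>U\<in>?I. C U)"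
    unfolding C_def using opn_subset[of _ F] by auto
  show "{\<omega> \<in> space M. A (opn \<omega> F)} \<in> sets M" unfolding eq using I Cs by (intro sets.finite_UN) auto
  have "measure M {\<omega> \<in> space M. A (opn \<omega> F)} = (\<Sum>U\<in>?I. measure M (C U))"
    unfolding eq
    using I Cs by (intro M.finite_measure_finite_Union) (auto simp: disjoint_family_on_def C_def)
  also have "\<dots> = (\<Sum>U\<in>?I. p ^ card U * (1 - p) ^ card (F - U))" using Cm by (intro sum.cong) auto
  also have "\<dots> = Pr p F A"
    unfolding Pr_def Exp_def using F(1) by (intro sum.mono_neutral_cong_left) auto
  finally show "measure M {\<omega> \<in> space M. A (opn \<omega> F)} = Pr p F A" .
qed

lemma conn_sets: "{\<omega> \<in> space M. conn (opn \<omega> (edges G)) x y} \<in> sets M"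
  by (intro conn_event_sets countable_edges edge_event)

lemma far_sets: "far_event x \<in> sets M"
  unfolding far_def
  by (intro sets.sets_Collect_countable_All sets.sets_Collect_countable_Ex' countable_verts
      sets.sets_Collect_conj sets.sets_Collect_const conn_sets)

lemma prob_conn_le:
  assumes c: "\<And>F. finite F \<Longrightarrow> F \<subseteq> edges G \<Longrightarrow> tau p F x y \<le> c"
  shows "measure M {\<omega> \<in> space M. conn (opn \<omega> (edges G)) x y} \<le> c"
proof -
  let ?F = "\<lambda>n. {e \<in> edges G. to_nat_on (edges G) e < n}"
  have fin: "finite (?F n)" for n
  proof (rule finite_imageD[of "to_nat_on (edges G)"])
    show "finite (to_nat_on (edges G) ` ?F n)" by (rule finite_subset[of _ "{..<n}"]) auto
    show "inj_on (to_nat_on (edges G)) (?F n)"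
      using inj_on_to_nat_on[OF countable_edges] by (rule inj_on_subset) auto
  qed
  let ?A = "\<lambda>n. {\<omega> \<in> space M. conn (opn \<omega> (?F n)) x y}"
  have "incseq ?A"
  proof (rule incseq_SucI, clarify)
    fix n \<omega> assume "conn (opn \<omega> (?F n)) x y"
    then show "conn (opn \<omega> (?F (Suc n))) x y" by (rule conn_mono) (auto simp: opn_def)
  qed
  moreover have "?A n \<in> sets M" for n using cylinder(1)[OF fin[of n], of "\<lambda>U. conn U x y"] by auto
  ultimately have "(\<lambda>n. measure M (?A n)) \<longlonglongrightarrow> measure M (\<Union>n. ?A n)"
    by (intro M.finite_Lim_measure_incseq) auto
  moreover have "measure M (?A n) \<le> c" for n
    using cylinder(2)[OF fin[of n], of "\<lambda>U. conn U x y"] c[OF fin[of n]] by (auto simp: tau_def)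
  ultimately have "measure M (\<Union>n. ?A n) \<le> c" by (intro LIMSEQ_le_const2) auto
  moreover have "{\<omega> \<in> space M. conn (opn \<omega> (edges G)) x y} \<subseteq> (\<Union>n. ?A n)"
  proof clarify
    fix \<omega> assume w: "\<omega> \<in> space M" "conn (opn \<omega> (edges G)) x y"
    obtain F where F: "finite F" "F \<subseteq> opn \<omega> (edges G)" "conn F x y" using conn_finite[OF w(2)] by blast
    let ?n = "Suc (Max (insert 0 (to_nat_on (edges G) ` F)))"
    have "to_nat_on (edges G) e < ?n" if "e \<in> F" for e
      using F(1) that by (intro le_imp_less_Suc Max_ge) auto
    then have "F \<subseteq> opn \<omega> (?F ?n)" using F(2) by (auto simp: opn_def)
    then have "conn (opn \<omega> (?F ?n)) x y" by (rule conn_mono[OF F(3)])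
    then show "\<omega> \<in> (\<Union>n. ?A n)" using w(1) by blast
  qed
  moreover have "(\<Union>n. ?A n) \<in> sets M" using \<open>\<And>n. ?A n \<in> sets M\<close> by auto
  ultimately show ?thesis using M.finite_measure_mono by (meson order_trans)
qed

definition reach_event :: "nat \<Rightarrow> 'a \<Rightarrow> ('a set \<Rightarrow> bool) set" where
  "reach_event N x = {\<omega> \<in> space M. reach N x (opn \<omega> (ball_edges x N))}"

lemma reach_event:
  assumes x: "x \<in> verts G"
  shows "reach_event N x \<in> sets M" "measure M (reach_event N x) = Pr p (ball_edges x N) (reach N x)"
    "decseq (\<lambda>N. reach_event N x)" "far_event x = (\<Inter>N. reach_event N x)"
proof -
  have B: "ball_edges x N \<subseteq> edges G" for N by (auto simp: ball_edges_def)
  show "reach_event N x \<in> sets M" "measure M (reach_event N x) = Pr p (ball_edges x N) (reach N x)"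
    unfolding reach_event_def using cylinder[OF finite_ball_edges[OF x, of N] B] by auto
  have "reach N x (opn \<omega> (ball_edges x N))" if r: "reach (Suc N) x (opn \<omega> (ball_edges x (Suc N)))" for N \<omega>
  proof -
    obtain y where y: "y \<in> verts G" "gd G x y = Suc N" "conn (opn \<omega> (ball_edges x (Suc N))) x y"
      using r unfolding reach_def by auto
    have "reach N x (opn \<omega> (ball_edges x (Suc N)) \<inter> ball_edges x N)"
      using y(2) by (intro reach_of_conn[OF x _ y(3)] order_trans[OF opn_subset B]) auto
    moreover have "opn \<omega> (ball_edges x (Suc N)) \<inter> ball_edges x N \<subseteq> opn \<omega> (ball_edges x N)" by (auto simp: opn_def)
    ultimately show ?thesis using mono_predD[OF mono_reach] by blast
  qed
  then show "decseq (\<lambda>N. reach_event N x)" unfolding reach_event_def by (intro decseq_SucI) auto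
  have "opn \<omega> (edges G) \<inter> ball_edges x N = opn \<omega> (ball_edges x N)" for \<omega> N using B[of N] by (auto simp: opn_def)
  then show "far_event x = (\<Inter>N. reach_event N x)"
    using far_iff_reach[OF x opn_subset] by (auto simp: reach_event_def)
qed

lemma prob_far_ge:
  assumes x: "x \<in> verts G" and \<theta>: "\<And>N. 0 < N \<Longrightarrow> \<theta> \<le> Pr p (ball_edges x N) (reach N x)"
  shows "\<theta> \<le> measure M (far_event x)"
proof -
  have "(\<lambda>N. measure M (reach_event N x)) \<longlonglongrightarrow> measure M (\<Inter>N. reach_event N x)"
    using reach_event[OF x] by (intro M.finite_Lim_measure_decseq) auto
  moreover have "\<forall>N\<ge>1. \<theta> \<le> measure M (reach_event N x)" using reach_event(2)[OF x] \<theta> by auto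
  ultimately show ?thesis unfolding reach_event(4)[OF x] by (intro LIMSEQ_le_const) auto
qed

lemma prob_far_le:
  assumes x: "x \<in> verts G"
  shows "measure M (far_event x) \<le> Pr p (ball_edges x N) (reach N x)"
  unfolding reach_event(2)[OF x, symmetric]
  by (rule M.finite_measure_mono) (use reach_event[OF x] in auto)

text \<open>Harris' inequality for the increasing events of reaching distance \<open>N\<close> from
  \<open>x\<close> and from \<open>y\<close>, which decrease to the \<open>far\<close>
  events.\<close>

lemma prob_far_both:
  assumes x: "x \<in> verts G" and y: "y \<in> verts G"
  shows "measure M (far_event x) * measure M (far_event y)
    \<le> measure M (far_event x \<inter> far_event y)"
    (is "?a * ?b \<le> _")
proof -
  let ?A = "\<lambda>N. reach_event N x \<inter> reach_event N y"
  have "(\<lambda>N. measure M (?A N)) \<longlonglongrightarrow> measure M (\<Inter>N. ?A N)"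
  proof (rule M.finite_Lim_measure_decseq)
    show "range ?A \<subseteq> sets M" using reach_event(1)[OF x] reach_event(1)[OF y] by auto
    show "decseq ?A"
      using reach_event(3)[OF x] reach_event(3)[OF y] unfolding decseq_def by (meson Int_mono)
  qed
  moreover have "?a * ?b \<le> measure M (?A N)" for N
  proof -
    let ?X = "ball_edges x N" and ?Y = "ball_edges y N"
    let ?F = "?X \<union> ?Y"
    have F: "finite ?F" "?F \<subseteq> edges G" using finite_ball_edges x y by (auto simp: ball_edges_def)
    have m: "mono (\<lambda>U. reach N z (U \<inter> B))" for z B
      by (intro monoI le_boolI) (erule mono_predD[OF mono_reach], auto)
    have "opn \<omega> ?F \<inter> ?X = opn \<omega> ?X" "opn \<omega> ?F \<inter> ?Y = opn \<omega> ?Y" for \<omega> by (auto simp: opn_def)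
    then have "?A N = {\<omega> \<in> space M. reach N x (opn \<omega> ?F \<inter> ?X) \<and> reach N y (opn \<omega> ?F \<inter> ?Y)}"
      by (auto simp: reach_event_def)
    then have "measure M (?A N) = Pr p ?F (\<lambda>U. reach N x (U \<inter> ?X) \<and> reach N y (U \<inter> ?Y))"
      using cylinder(2)[OF F, of "\<lambda>U. reach N x (U \<inter> ?X) \<and> reach N y (U \<inter> ?Y)"] by simp
    moreover have "Pr p ?F (\<lambda>U. reach N x (U \<inter> ?X)) * Pr p ?F (\<lambda>U. reach N y (U \<inter> ?Y))
        \<le> Pr p ?F (\<lambda>U. reach N x (U \<inter> ?X) \<and> reach N y (U \<inter> ?Y))"
      using F(1) p by (intro Pr_Harris m) auto
    moreover have "Pr p ?F (\<lambda>U. reach N x (U \<inter> ?X)) = Pr p ?X (reach N x)"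
      "Pr p ?F (\<lambda>U. reach N y (U \<inter> ?Y)) = Pr p ?Y (reach N y)"
      using F(1) by (auto intro!: Pr_restrict)
    moreover have "?a * ?b \<le> Pr p ?X (reach N x) * Pr p ?Y (reach N y)"
      using p by (intro mult_mono prob_far_le x y) auto
    ultimately show ?thesis by simp
  qed
  ultimately have "?a * ?b \<le> measure M (\<Inter>N. ?A N)" by (intro LIMSEQ_le_const) auto
  moreover have "(\<Inter>N. ?A N) = far_event x \<inter> far_event y"
    unfolding reach_event(4)[OF x] reach_event(4)[OF y] by auto
  ultimately show ?thesis by simp
qed

text \<open>Kolmogorov's law for the independent edge states, enumerated by \<open>e\<close>. By
  \<open>far_remove\<close> the event is unchanged when the first \<open>n\<close> edges are
  deleted, so it is determined by the remaining ones for every \<open>n\<close>.\<close>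

lemma zero_one:
  assumes inf: "infinite (edges G)"
  shows "M.prob {\<omega> \<in> space M. \<exists>x\<in>verts G. far (opn \<omega> (edges G)) x} = 0
    \<or> M.prob {\<omega> \<in> space M. \<exists>x\<in>verts G. far (opn \<omega> (edges G)) x} = 1" (is "M.prob ?X = 0 \<or> _")
proof -
  define e where "e = from_nat_into (edges G)"
  have e: "bij_betw e UNIV (edges G)" unfolding e_def using countable_edges inf by (rule bij_betw_from_nat_into)
  have eG: "e i \<in> edges G" for i using e unfolding bij_betw_def by auto
  define F where "F i = {\<omega> \<in> space M. \<omega> (e i)}" for i
  have Fs: "F i \<in> sets M" for i unfolding F_def using eG by (rule edge_event)
  have Fsub: "{F i} \<subseteq> Pow (space M)" for i by (auto simp: F_def)
  show ?thesis
  proof (rule M.kolmogorov_0_1_law[of "\<lambda>i. sigma_sets (space M) {F i}"])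
    show "sigma_algebra (space M) (sigma_sets (space M) {F i})" for i
      by (rule sigma_algebra_sigma_sets[OF Fsub])
    show "M.indep_sets (\<lambda>i. sigma_sets (space M) {F i}) UNIV"
    proof (rule M.indep_sets_sigma)
      show "M.indep_sets (\<lambda>i. {F i}) UNIV"
      proof (rule M.indep_setsI)
        fix A and J :: "nat set" assume J: "J \<noteq> {}" "finite J" and A: "\<forall>j\<in>J. A j \<in> {F j}"
        have inj: "inj_on e J" using e unfolding bij_betw_def by (auto intro: inj_on_subset)
        have one: "M.prob (F j) = p" for j
        proof -
          have "F j = {\<omega> \<in> space M. e j \<in> opn \<omega> {e j}}" by (auto simp: F_def opn_def)
          then have "M.prob (F j) = Pr p {e j} (\<lambda>U. e j \<in> U)"
            using cylinder(2)[of "{e j}" "\<lambda>U. e j \<in> U"] eG by simp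
          also have "\<dots> = p" by (rule Pr_edge) auto
          finally show ?thesis .
        qed
        have AF: "A j = F j" if "j \<in> J" for j using A that by auto
        have "(\<Inter>j\<in>J. A j) = (\<Inter>j\<in>J. F j)" using AF by auto
        also have "\<dots> = {\<omega> \<in> space M. e ` J \<subseteq> opn \<omega> (e ` J)}" using J(1) by (auto simp: F_def opn_def)
        also have "M.prob \<dots> = Pr p (e ` J) (\<lambda>U. e ` J \<subseteq> U)" using J(2) eG by (intro cylinder(2)) auto
        also have "\<dots> = p ^ card (e ` J)" using J(2) by (intro Pr_subset) auto
        also have "\<dots> = (\<Prod>j\<in>J. M.prob (A j))" using AF one card_image[OF inj] by simp
        finally show "M.prob (\<Inter>j\<in>J. A j) = (\<Prod>j\<in>J. M.prob (A j))" .
      qed (use Fs in auto)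
      show "Int_stable {F i}" for i by (auto simp: Int_stable_def)
    qed
    show "?X \<in> M.tail_events (\<lambda>i. sigma_sets (space M) {F i})"
      unfolding M.tail_events_def
    proof
      fix n
      let ?S = "\<Union> ((\<lambda>i. sigma_sets (space M) {F i}) ` {n..})"
      let ?N = "sigma (space M) ?S"
      let ?E = "edges G - e ` {..<n}"
      have Spow: "?S \<subseteq> Pow (space M)" using sigma_sets_into_sp[OF Fsub] by auto
      have N: "space ?N = space M" "sets ?N = sigma_sets (space M) ?S"
        using Spow by (auto simp: space_measure_of_conv sets_measure_of)
      have ev: "{\<omega> \<in> space ?N. \<omega> c} \<in> sets ?N" if c: "c \<in> ?E" for c
      proof -
        have "c \<in> e ` UNIV" using c e unfolding bij_betw_def by auto
        then obtain i where i: "c = e i" by auto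
        then have "n \<le> i" using c by (meson DiffE imageI lessThan_iff not_le)
        then have "F i \<in> ?S" by (intro UN_I[of i]) (auto intro: sigma_sets.Basic)
        then have "F i \<in> sets ?N" unfolding N by (rule sigma_sets.Basic)
        moreover have "{\<omega> \<in> space ?N. \<omega> c} = F i" unfolding N(1) unfolding F_def i by (rule refl)
        ultimately show ?thesis by (simp only:)
      qed
      have cE: "countable ?E" using countable_edges by (rule countable_subset[rotated]) auto
      have "{\<omega> \<in> space ?N. \<exists>x\<in>verts G. far (opn \<omega> ?E) x} \<in> sets ?N"
        unfolding far_def
        by (intro sets.sets_Collect_countable_All sets.sets_Collect_countable_Ex' countable_verts
            sets.sets_Collect_conj sets.sets_Collect_const conn_event_sets cE ev)
      moreover have "(\<exists>x\<in>verts G. far (opn \<omega> ?E) x) \<longleftrightarrow> (\<exists>x\<in>verts G. far (opn \<omega> (edges G)) x)" for \<omega>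
      proof
        assume "\<exists>x\<in>verts G. far (opn \<omega> ?E) x"
        moreover have "opn \<omega> ?E \<subseteq> opn \<omega> (edges G)" by (auto simp: opn_def)
        ultimately show "\<exists>x\<in>verts G. far (opn \<omega> (edges G)) x" unfolding far_def using conn_mono by meson
      next
        assume "\<exists>x\<in>verts G. far (opn \<omega> (edges G)) x"
        then obtain x where x: "x \<in> verts G" "far (opn \<omega> (edges G)) x" by auto
        have "opn \<omega> (edges G) - e ` {..<n} = opn \<omega> ?E" by (auto simp: opn_def)
        then show "\<exists>x\<in>verts G. far (opn \<omega> ?E) x" using far_remove[OF opn_subset x, of "e ` {..<n}"] by simp
      qed
      ultimately show "?X \<in> sigma_sets (space M) ?S" by (simp only: N)
    qed
  qed
qed

lemma AE_infinite_cluster: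
  assumes inf: "infinite (edges G)" and x: "x \<in> verts G" and \<theta>: "0 < \<theta>"
    and r: "\<And>N. 0 < N \<Longrightarrow> \<theta> \<le> Pr p (ball_edges x N) (reach N x)"
  shows "AE \<omega> in M. \<exists>C. C \<in> infinite_clusters G \<omega>"
proof -
  let ?X = "{\<omega> \<in> space M. \<exists>x\<in>verts G. far (opn \<omega> (edges G)) x}"
  have Xs: "?X \<in> sets M"
    by (intro sets.sets_Collect_countable_Ex' countable_verts far_sets)
  have "\<theta> \<le> M.prob (far_event x)" using x r by (rule prob_far_ge)
  also have "\<dots> \<le> M.prob ?X" using x Xs by (intro M.finite_measure_mono) auto
  finally have "M.prob ?X = 1" using zero_one[OF inf] \<theta> by auto
  then have "AE \<omega> in M. \<omega> \<in> ?X" using Xs by (simp add: M.prob_eq_1)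
  then show ?thesis
    by (rule AE_mp) (auto simp: infinite_cluster_iff)
qed

text \<open>There are countably many vertices; if each of them were \<open>far\<close> with
  probability 0, there would almost surely be no infinite cluster.\<close>

lemma unique_imp_far:
  assumes "AE \<omega> in M. \<exists>C. C \<in> infinite_clusters G \<omega>"
  shows "\<exists>x\<in>verts G. 0 < M.prob (far_event x)"
proof (rule ccontr)
  assume "\<not> ?thesis"
  then have z: "M.prob (far_event x) = 0" if "x \<in> verts G" for x
    using that measure_nonneg[of M] by (fastforce simp: not_less intro: antisym)
  have "AE \<omega> in M. \<not> far (opn \<omega> (edges G)) x" if x: "x \<in> verts G" for x
    using M.prob_Collect_eq_0[OF far_sets[of x]] z[OF x] by simp
  then have "AE \<omega> in M. \<forall>x\<in>verts G. \<not> far (opn \<omega> (edges G)) x"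
    using countable_verts by (simp add: AE_ball_countable)
  with assms have "AE \<omega> in M. False"
    by eventually_elim (auto simp: infinite_cluster_iff)
  then show False by simp
qed

text \<open>Almost surely two \<open>far\<close> vertices share the unique infinite cluster, so
  their joint event, bounded below by Harris' inequality, is contained in the connection
  event.\<close>

lemma unique_imp_conn:
  assumes "AE \<omega> in M. \<exists>!C. C \<in> infinite_clusters G \<omega>" and x: "x \<in> verts G" and y: "y \<in> verts G"
    and c: "\<And>F. finite F \<Longrightarrow> F \<subseteq> edges G \<Longrightarrow> tau p F x y \<le> c"
  shows "M.prob (far_event x) * M.prob (far_event y) \<le> c"
proof -
  let ?A = "far_event x \<inter> far_event y"
  have "M.prob ?A \<le> M.prob {\<omega> \<in> space M. conn (opn \<omega> (edges G)) x y}"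
  proof (rule M.finite_measure_mono_AE)
    show "AE \<omega> in M. \<omega> \<in> ?A \<longrightarrow> \<omega> \<in> {\<omega> \<in> space M. conn (opn \<omega> (edges G)) x y}"
      using assms(1) by eventually_elim (auto intro: unique_cluster_conn x y)
  qed (rule conn_sets)
  then show ?thesis using prob_far_both[OF x y] prob_conn_le[OF c] by linarith
qed

lemma AE_all_open:
  assumes "p = 1"
  shows "AE \<omega> in M. \<forall>e\<in>edges G. \<omega> e"
proof -
  have "AE \<omega> in M. \<omega> e" if e: "e \<in> edges G" for e
  proof -
    have "{\<omega> \<in> space M. \<omega> e} = {\<omega> \<in> space M. e \<in> opn \<omega> {e}}" by (auto simp: opn_def)
    then have "M.prob {\<omega> \<in> space M. \<omega> e} = Pr p {e} (\<lambda>U. e \<in> U)" using cylinder(2)[of "{e}" "\<lambda>U. e \<in> U"] e by simp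
    also have "\<dots> = 1" using assms by (subst Pr_edge) auto
    finally show ?thesis using M.prob_Collect_eq_1[OF edge_event[OF e]] by simp
  qed
  then show ?thesis using countable_edges by (simp add: AE_ball_countable)
qed

text \<open>Shows that the sets defining both thresholds contain 1, and later excludes decay of the
  two-point function at \<open>p = 1\<close>.\<close>

lemma unique_at_one:
  assumes "p = 1" "infinite (verts G)"
  shows "AE \<omega> in M. \<exists>!C. C \<in> infinite_clusters G \<omega>"
  using AE_all_open[OF assms(1)]
proof eventually_elim
  case (elim \<omega>)
  have W: "opn \<omega> (edges G) = edges G" using elim by (auto simp: opn_def)
  have c: "component_of (retained_subgraph G \<omega>) x = verts G" if x: "x \<in> verts G" for x
  proof -
    have "y \<in> verts G" if "conn (edges G) x y" for y using that order_refl x by (rule conn_gd_bound)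
    moreover have "conn (edges G) x y" if "y \<in> verts G" for y
      using connected x that unfolding connected_graph_def conn_edges by blast
    ultimately show ?thesis unfolding component_retained W by (intro set_eqI iffI) simp_all
  qed
  have "graph_components (retained_subgraph G \<omega>) = component_of (retained_subgraph G \<omega>) ` verts G"
    unfolding graph_components_def by (simp add: retained_subgraph_def)
  also have "\<dots> = (\<lambda>x. verts G) ` verts G" using c by (intro image_cong) auto
  also have "\<dots> = {verts G}" using connected unfolding connected_graph_def by (simp add: image_constant_conv)
  finally have "infinite_clusters G \<omega> = {verts G}"
    unfolding infinite_clusters_def using assms(2) by auto
  then show ?case by auto
qed

end

end

lemma (in lfgraph) automorphism_reach:
  assumes \<phi>: "is_automorphism G \<phi>" and x: "x \<in> verts G" and p: "0 \<le> p" "p \<le> 1"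
  shows "Pr p (ball_edges x N) (reach N x) \<le> Pr p (ball_edges (\<phi> x) N) (reach N (\<phi> x))"
proof -
  let ?B = "ball_edges x N" and ?I = "(`) \<phi> ` ball_edges x N"
  have x': "\<phi> x \<in> verts G" using \<phi> x by (rule automorphism_verts)
  have B: "finite ?B" "?B \<subseteq> edges G" using finite_ball_edges[OF x] by (auto simp: ball_edges_def)
  have inj: "inj_on ((`) \<phi>) ?B" by (rule inj_image_edges[OF automorphism_inj[OF \<phi>] Union_edges[OF B(2)]])
  have I: "?I \<subseteq> ball_edges (\<phi> x) N"
  proof clarify
    fix e assume e: "e \<in> ?B"
    have "\<phi> ` e \<in> edges G" using automorphism_edges[OF \<phi> B(2)] e by auto
    moreover have "\<phi> ` e \<subseteq> cball (\<phi> x) N"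
      using e automorphism_gd[OF \<phi> x] automorphism_verts[OF \<phi>] by (auto simp: ball_edges_def inner_def cball_def)
    ultimately show "\<phi> ` e \<in> ball_edges (\<phi> x) N" by (simp add: ball_edges_def inner_def)
  qed
  have "reach N (\<phi> x) ((`) \<phi> ` U)" if r: "reach N x U" for U
  proof -
    obtain y where y: "y \<in> verts G" "gd G x y = N" "conn U x y" using r unfolding reach_def by auto
    then show ?thesis
      using automorphism_gd[OF \<phi> x y(1)] automorphism_verts[OF \<phi> y(1)] conn_image[OF y(3), of \<phi>]
      unfolding reach_def by auto
  qed
  then have "Pr p ?B (reach N x) \<le> Pr p ?B (\<lambda>U. reach N (\<phi> x) ((`) \<phi> ` U))" using p by (intro Pr_mono) auto
  also have "\<dots> = Pr p ?I (reach N (\<phi> x))" by (rule Pr_image[OF B(1) inj, symmetric])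
  also have "\<dots> \<le> Pr p (ball_edges (\<phi> x) N) (reach N (\<phi> x))"
    using p by (intro Pr_mono_set finite_ball_edges x' I mono_reach) auto
  finally show ?thesis .
qed

section \<open>Comparison of the two thresholds\<close>

context tprod
begin

lemma infinite_H: "infinite (verts H)" "infinite (edges H)"
proof -
  obtain s where s: "s \<in> verts T" using connected unfolding connected_graph_def by auto
  obtain x where x: "x \<in> verts G" using G.connected unfolding connected_graph_def by auto
  obtain u where u: "line u" using line_exists[OF s s] by auto
  have "inj (\<lambda>i. (u i, x))" using line_inj[OF u] by (auto intro: injI)
  then have "infinite (range (\<lambda>i. (u i, x)))" using range_inj_infinite[of "\<lambda>i. (u i, x)"] finite_imageD infinite_UNIV_int by blast
  moreover have "range (\<lambda>i. (u i, x)) \<subseteq> verts H" using u x by auto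
  ultimately show 1: "infinite (verts H)" using finite_subset by blast
  show "infinite (edges H)"
  proof
    assume fin: "finite (edges H)"
    have "finite (\<Union>(edges H))" using fin H.finite_edge by (intro finite_Union) auto
    moreover have "verts H \<subseteq> insert (s, x) (\<Union>(edges H))"
    proof
      fix v assume "v \<in> verts H"
      then have "conn (edges H) (s, x) v" using H.connected s x unfolding connected_graph_def H.conn_edges by auto
      then show "v \<in> insert (s, x) (\<Union>(edges H))" using conn_verts[of "edges H" "(s, x)" v] by auto
    qed
    ultimately show False using 1 finite_subset by blast
  qed
qed

lemma p_c_le_p_chi: "p_c H \<le> p_chi"
proof (rule dense_ge)
  fix p assume h: "p_chi < p"
  have bdd: "bdd_below {p \<in> {0..1}. AE \<omega> in percolation H p. \<exists>C. C \<in> infinite_clusters H \<omega>}"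
    by (rule bdd_belowI[of _ 0]) auto
  show "p_c H \<le> p"
  proof (cases "p < 1")
    case True
    \<comment> \<open>A parameter strictly between: the susceptibility is infinite at
      \<open>?p\<close>, and integrating the differential inequality from \<open>?p\<close> to
      \<open>p\<close> gives a positive reach probability at \<open>p\<close>.\<close>
    let ?p = "(p_chi + p) / 2"
    have p: "0 < ?p" "?p < p" "?p \<le> 1" "p_chi < ?p" using h True p_chi(1) by auto
    have "\<not> sub_at ?p" using p p_chi(4)[of ?p] by (auto simp: sb_def)
    then obtain v where v: "v \<in> verts H"
        "\<And>N. 0 < N \<Longrightarrow> 1 - exp (?p - p) \<le> Pr p (H.ball_edges v N) (H.reach N v)"
      using not_sub_at_reach[OF p(1,2) True] by blast
    have "AE \<omega> in percolation H p. \<exists>C. C \<in> infinite_clusters H \<omega>"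
      by (rule H.AE_infinite_cluster[OF _ _ infinite_H(2) v(1) _ v(2)]) (use p True in auto)
    then show ?thesis unfolding p_c_def using p True by (intro cInf_lower bdd) auto
  next
    case False
    have "AE \<omega> in percolation H 1. \<exists>!C. C \<in> infinite_clusters H \<omega>"
      using infinite_H by (intro H.unique_at_one) auto
    then have "AE \<omega> in percolation H 1. \<exists>C. C \<in> infinite_clusters H \<omega>" by (rule AE_mp) auto
    then have "p_c H \<le> 1" unfolding p_c_def by (intro cInf_lower bdd) auto
    then show ?thesis using False by simp
  qed
qed

text \<open>Translations along a line carry \<open>v\<close> to vertices over \<open>w n\<close>
  that are \<open>far\<close> with at least the same probability. Uniqueness would bound the square
  of this positive probability by \<open>C * q ^ n\<close> for every \<open>n\<close>.\<close>

lemma no_unique_cluster: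
  assumes p: "0 \<le> p" "p \<le> 1"
    and dec: "\<And>F s t x y. finite F \<Longrightarrow> F \<subseteq> edges H \<Longrightarrow> s \<in> verts T \<Longrightarrow> t \<in> verts T \<Longrightarrow> x \<in> verts G \<Longrightarrow> y \<in> verts G \<Longrightarrow>
      tau p F (s, x) (t, y) \<le> C * q ^ gd T s t"
  shows "\<not> (AE \<omega> in percolation H p. \<exists>!C. C \<in> infinite_clusters H \<omega>)"
proof
  assume u: "AE \<omega> in percolation H p. \<exists>!C. C \<in> infinite_clusters H \<omega>"
  then have "AE \<omega> in percolation H p. \<exists>C. C \<in> infinite_clusters H \<omega>" by (rule AE_mp) auto
  let ?m = "\<lambda>v. measure (percolation H p) (H.far_event p v)"
  obtain v where v: "v \<in> verts H" "0 < ?m v"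
    using H.unique_imp_far[OF p \<open>AE \<omega> in percolation H p. \<exists>C. C \<in> infinite_clusters H \<omega>\<close>] by blast
  obtain s x where sx: "v = (s, x)" "s \<in> verts T" "x \<in> verts G" using v by (cases v) auto
  obtain w where w: "line w" "w 0 = s" using line_exists[OF sx(2) sx(2)] by auto
  have le: "?m v * ?m v \<le> C * q ^ n" for n
  proof -
    let ?v = "(w (int n), x)"
    have t: "w (int n) \<in> verts T" using w by auto
    have w': "line (\<lambda>i. w (i + int n))" using w(1) unfolding line_def by (metis add.assoc add.commute)
    obtain \<phi> where \<phi>: "is_automorphism T \<phi>" "\<And>i. \<phi> (w i) = w (i + int n)"
      using line_homogeneous[OF w(1) w'] by auto
    note a = box_automorphism[OF \<phi>(1) is_automorphism_id]
    have av: "map_prod \<phi> (\<lambda>x. x) v = ?v" using \<phi>(2)[of 0] w(2) sx by simp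
    have "?m v \<le> ?m ?v"
    proof (rule H.prob_far_ge[OF p])
      show "?v \<in> verts H" using t sx by simp
      show "?m v \<le> Pr p (H.ball_edges ?v N) (H.reach N ?v)" for N
        using H.prob_far_le[OF p v(1), of N] H.automorphism_reach[OF a v(1) p, of N] unfolding av by (rule order_trans)
    qed
    then have "?m v * ?m v \<le> ?m v * ?m ?v" using v(2) by (intro mult_left_mono) auto
    also have "\<dots> \<le> C * q ^ n"
    proof (rule H.unique_imp_conn[OF p u v(1)])
      show "?v \<in> verts H" using t sx by simp
      have "gd T s (w (int n)) = n" using line_gd[OF w(1), of 0 "int n"] w(2) by simp
      then show "tau p F v ?v \<le> C * q ^ n" if "finite F" "F \<subseteq> edges H" for F
        using dec[OF that sx(2) t sx(3) sx(3)] sx(1) by simp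
    qed
    finally show ?thesis .
  qed
  have "(\<lambda>n. C * q ^ n) \<longlonglongrightarrow> C * 0" using d by (intro tendsto_mult_left LIMSEQ_realpow_zero) auto
  then have "?m v * ?m v \<le> C * 0" using le by (intro LIMSEQ_le_const) auto
  then show False using mult_pos_pos[OF v(2) v(2)] by simp
qed

lemma p_c_less_p_u: "p_c H < p_u H"
proof -
  obtain p1 C where p1: "p_chi \<le> p1" "p1 \<le> 1" "p_chi < 1 \<Longrightarrow> p_chi < p1"
    and dec: "\<And>F s t x y. finite F \<Longrightarrow> F \<subseteq> edges H \<Longrightarrow> s \<in> verts T \<Longrightarrow> t \<in> verts T \<Longrightarrow> x \<in> verts G \<Longrightarrow> y \<in> verts G \<Longrightarrow>
      tau p1 F (s, x) (t, y) \<le> C * q ^ gd T s t"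
    using supercritical_decay by blast
  let ?S = "{p \<in> {0..1}. AE \<omega> in percolation H p. \<exists>!C. C \<in> infinite_clusters H \<omega>}"
  have S: "p1 < p" if "p \<in> ?S" for p
  proof (rule ccontr)
    assume h: "\<not> p1 < p"
    have p: "0 \<le> p" "p \<le> 1" using that by auto
    have "tau p F (s, x) (t, y) \<le> C * q ^ gd T s t"
      if "finite F" "F \<subseteq> edges H" "s \<in> verts T" "t \<in> verts T" "x \<in> verts G" "y \<in> verts G" for F s t x y
      using dec[OF that] tau_mono_p[OF that(1) p(1), of p1 "(s, x)" "(t, y)"] h p1(2) by simp
    then show False using no_unique_cluster[OF p, of C] that by blast
  qed
  \<comment> \<open>The infinite cluster is unique at \<open>p = 1\<close>, so the decay estimate
    cannot hold there; this excludes \<open>p1 = 1\<close> and with it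
    \<open>p_chi = 1\<close>.\<close>
  have one: "1 \<in> ?S" using H.unique_at_one[of 1] infinite_H(1) by auto
  then have "p1 < 1" by (rule S)
  then have "p_chi < p1" using p1 by simp
  moreover have "p1 \<le> p_u H"
    unfolding p_u_def using one S by (intro cInf_greatest) (auto intro: less_imp_le)
  ultimately show ?thesis using p_c_le_p_chi by simp
qed

end

theorem corollary1p3:
  fixes T :: "'a graph" and G :: "'b graph" and k :: nat
  assumes "k \<ge> 3"
    and "is_regular_tree k T"
    and "simple_graph G"
    and "connected_graph G"
    and "locally_finite G"
    and "quasi_transitive G"
  shows "p_c (box_product T G) < p_u (box_product T G)"
proof -
  obtain d where d: "k = Suc d" "2 \<le> d" using assms(1) by (cases k) auto
  interpret tprod T d G using assms d by unfold_locales auto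
  show ?thesis by (rule p_c_less_p_u)
qed

end
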